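(* For $m=0,\dots,n$ and $\mu\in\Lambda$, $$R_{(1^m)}(z)R_\mu(z)=\sum_{s=0}^m\ \sum_{|I|=s}R_{(1^{m-s})}(\rho+\mu\,|\,I')\ [\psi'_{\lambda/\mu}]_{\rm even}\ R_\lambda(z).$$ Here $\lambda=\mu+\epsilon_I$, and $I$ runs through those elements of $P_{\rm odd}$ if $m$ is odd, respectively of $P_{\rm even}$ if $m$ is even, for which $|I|=s$ and $\lambda\in\Lambda$.
   Context: Let $k$ be a field of characteristic zero, and $r\in k$ not a negative rational number. For $n\ge 0$ let $W=W_n\subseteq S_n$ be the group of permutations $\pi$ with $\pi(i)\equiv i \bmod 2$ for all $i$, acting on $k[z_1,\dots,z_n]$ by permuting variables; $W$-invariant polynomials are called semisymmetric. $\Lambda=\Lambda_n$ is the set of integer tuples $\lambda=(\lambda_1\ge\dots\ge\lambda_n\ge 0)$, $|\lambda|_{\rm odd}=\sum_{i\text{ odd}}\lambda_i$, $\rho=\rho_n=((n-1)r,(n-2)r,\dots,r,0)$, and $[\lambda]_m=\lambda_m-\lambda_{m+1}+\dots+(-1)^{n-m}\lambda_n$. For $\lambda\in\Lambda_n$, $R_\lambda(z)=R_\lambda(z_1,\dots,z_n;r)$ is the unique $W_n$-invariant polynomial of degree $|\lambda|_{\rm odd}$ which satisfies $R_\lambda(\rho_n+\mu)=0$ for all $\mu\in\Lambda_n$ with $|\mu|_{\rm odd}\le|\lambda|_{\rm odd}$, $\mu\ne\lambda$, and in which the monomial $z^{[\lambda]}$ has coefficient $1$ (it is known that this exists and is unique).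 $R_{(1^0)}=1$ (in any number of variables). Fix $n\ge1$. For $I\subseteq\{1,\dots,n\}$, $\epsilon_I\in\mathbb Z^n$ is the indicator vector. $P_{\rm odd}$ is the set of those $I$ whose number of odd members is equal to, or one more than, its number of even members; $P_{\rm even}\subseteq P_{\rm odd}$ is the set of those $I$ for which these numbers are equal. For $I\in P_{\rm odd}$ with $s=|I|$ and $f$ a semisymmetric polynomial in $n-s$ variables, $f(z|I'):=f(z_{k_{s+1}},\dots,z_{k_n})$, where $i\mapsto k_i$ is any parity preserving bijection from $\{s+1,\dots,n\}$ to $\{1,\dots,n\}\setminus I$ (the result is independent of the choice). In the theorem, the polynomial $R_{(1^{m-s})}$ in $R_{(1^{m-s})}(\rho+\mu|I')$ is the one in $n-s$ variables (with the same $r$), evaluated with $z=\rho+\mu$, $\rho=\rho_n$. For $\lambda=\mu+\epsilon_I\in\Lambda$, $$[\psi'_{\lambda/\mu}]_{\rm even}=\frac{\prod_{i\notin I,\,j\in I,\ i<j,\ j-i\text{ odd}}\big(\mu_i-\mu_j+(j-i-1)r\big)\big(\lambda_i-\lambda_j+(j-i+1)r\big)}{\prod_{i\notin I,\,j\in I,\ i<j,\ j-i\text{ even}}\big(\mu_i-\mu_j+(j-i)r\big)\big(\lambda_i-\lambda_j+(j-i)r\big)},\qquad i,j\in\{1,\dots,n\}.$$ For $r=0$ this is understood as the limit $r\to0$, i.e. the value at $0$ of this expression viewed as a rational function of $r$. *)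

theory Defs
  imports
    "HOL-Library.Poly_Mapping"
    "HOL-Combinatorics.Permutations"
    "HOL-Computational_Algebra.Polynomial"
    "HOL-Computational_Algebra.Fraction_Field"
begin

subsection \<open>Polynomials in variables indexed by natural numbers\<close>

type_synonym 'a mpol = "(nat \<Rightarrow>\<^sub>0 nat) \<Rightarrow>\<^sub>0 'a"

definition in_vars :: "nat set \<Rightarrow> 'a::zero mpol \<Rightarrow> bool" where
  "in_vars V p \<longleftrightarrow> (\<forall>e \<in> Poly_Mapping.keys p. Poly_Mapping.keys e \<subseteq> V)"

definition total_degree :: "'a::zero mpol \<Rightarrow> nat" where
  "total_degree p =
     Max (insert 0 ((\<lambda>e. \<Sum>i\<in>Poly_Mapping.keys e. Poly_Mapping.lookup e i) ` Poly_Mapping.keys p))"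

definition const_pol :: "'a::zero \<Rightarrow> 'a mpol" where
  "const_pol c = Poly_Mapping.single 0 c"

definition var_pol :: "nat \<Rightarrow> 'a::zero_neq_one mpol" where
  "var_pol i = Poly_Mapping.single (Poly_Mapping.single i 1) 1"

text \<open>Substitution of \<^term>\<open>f i\<close> for the variable \<^term>\<open>i\<close>, the coefficients being mapped by \<^term>\<open>h\<close>.\<close>

definition subst_pol :: "('a::zero \<Rightarrow> 'b::comm_semiring_1) \<Rightarrow> (nat \<Rightarrow> 'b) \<Rightarrow> 'a mpol \<Rightarrow> 'b" where
  "subst_pol h f p =
     (\<Sum>e\<in>Poly_Mapping.keys p. h (Poly_Mapping.lookup p e) *
        (\<Prod>i\<in>Poly_Mapping.keys e. f i ^ Poly_Mapping.lookup e i))"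

definition eval_pol :: "'a::comm_semiring_1 mpol \<Rightarrow> (nat \<Rightarrow> 'a) \<Rightarrow> 'a" where
  "eval_pol p z = subst_pol (\<lambda>c. c) z p"

definition permute_vars :: "(nat \<Rightarrow> nat) \<Rightarrow> 'a::comm_semiring_1 mpol \<Rightarrow> 'a mpol" where
  "permute_vars \<pi> p = subst_pol const_pol (\<lambda>i. var_pol (\<pi> i)) p"


subsection \<open>Semisymmetric polynomials and the polynomials \<open>R\<^sub>\<nu>\<close>\<close>

definition W_group :: "nat \<Rightarrow> (nat \<Rightarrow> nat) set" where
  "W_group n = {\<pi>. \<pi> permutes {1..n} \<and> (\<forall>i\<in>{1..n}. \<pi> i mod 2 = i mod 2)}"

definition semisymmetric :: "nat \<Rightarrow> 'a::comm_semiring_1 mpol \<Rightarrow> bool" where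
  "semisymmetric n p \<longleftrightarrow> in_vars {1..n} p \<and> (\<forall>\<pi>\<in>W_group n. permute_vars \<pi> p = p)"

text \<open>An integer \<open>n\<close>-tuple is a function on the natural numbers that vanishes outside \<open>{1..n}\<close>, so that
  distinct functions represent distinct tuples.\<close>

definition Lam :: "nat \<Rightarrow> (nat \<Rightarrow> int) set" where
  "Lam n = {\<nu>. (\<forall>i\<in>{1..n}. 0 \<le> \<nu> i) \<and> (\<forall>i\<in>{1..<n}. \<nu> (Suc i) \<le> \<nu> i) \<and>
                (\<forall>i. i \<notin> {1..n} \<longrightarrow> \<nu> i = 0)}"

definition odd_size :: "nat \<Rightarrow> (nat \<Rightarrow> int) \<Rightarrow> int" where
  "odd_size n \<nu> = (\<Sum>i | i \<in> {1..n} \<and> odd i. \<nu> i)"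

definition bracket :: "nat \<Rightarrow> (nat \<Rightarrow> int) \<Rightarrow> nat \<Rightarrow> int" where
  "bracket n \<nu> m = (\<Sum>j=m..n. (- 1) ^ (j - m) * \<nu> j)"

text \<open>The exponent of the monomial \<open>z\<^sup>[\<^sup>\<nu>\<^sup>]\<close>; for \<^term>\<open>\<nu> \<in> Lam n\<close> all the integers
  \<^term>\<open>bracket n \<nu> m\<close> are nonnegative.\<close>

definition bracket_exponent :: "nat \<Rightarrow> (nat \<Rightarrow> int) \<Rightarrow> nat \<Rightarrow>\<^sub>0 nat" where
  "bracket_exponent n \<nu> = (\<Sum>m\<in>{1..n}. Poly_Mapping.single m (nat (bracket n \<nu> m)))"

definition rho :: "nat \<Rightarrow> 'a::comm_ring_1 \<Rightarrow> nat \<Rightarrow> 'a" where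
  "rho n r i = of_nat (n - i) * r"

definition rho_plus :: "nat \<Rightarrow> 'a::comm_ring_1 \<Rightarrow> (nat \<Rightarrow> int) \<Rightarrow> nat \<Rightarrow> 'a" where
  "rho_plus n r \<mu> i = rho n r i + of_int (\<mu> i)"

definition is_R :: "nat \<Rightarrow> 'a::field_char_0 \<Rightarrow> (nat \<Rightarrow> int) \<Rightarrow> 'a mpol \<Rightarrow> bool" where
  "is_R n r \<nu> p \<longleftrightarrow>
     semisymmetric n p \<and>
     int (total_degree p) = odd_size n \<nu> \<and>
     (\<forall>\<mu>\<in>Lam n. odd_size n \<mu> \<le> odd_size n \<nu> \<and> \<mu> \<noteq> \<nu> \<longrightarrow> eval_pol p (rho_plus n r \<mu>) = 0) \<and>
     Poly_Mapping.lookup p (bracket_exponent n \<nu>) = 1"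

definition R_pol :: "nat \<Rightarrow> 'a::field_char_0 \<Rightarrow> (nat \<Rightarrow> int) \<Rightarrow> 'a mpol" where
  "R_pol n r \<nu> = (THE p. is_R n r \<nu> p)"

definition one_col :: "nat \<Rightarrow> nat \<Rightarrow> int" where
  "one_col m i = (if i \<in> {1..m} then 1 else 0)"


subsection \<open>The ingredients of the Pieri formula\<close>

definition add_indicator :: "(nat \<Rightarrow> int) \<Rightarrow> nat set \<Rightarrow> nat \<Rightarrow> int" where
  "add_indicator \<mu> I i = \<mu> i + (if i \<in> I then 1 else 0)"

definition P_odd :: "nat \<Rightarrow> nat set set" where
  "P_odd n = {I. I \<subseteq> {1..n} \<and>
     (card {i\<in>I. odd i} = card {i\<in>I. even i} \<or> card {i\<in>I. odd i} = card {i\<in>I. even i} + 1)}"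

definition P_even :: "nat \<Rightarrow> nat set set" where
  "P_even n = {I. I \<subseteq> {1..n} \<and> card {i\<in>I. odd i} = card {i\<in>I. even i}}"

text \<open>\<open>f(z | I')\<close>: for \<^term>\<open>I \<in> P_odd n\<close> a bijection \<open>k\<close> as below exists, and for semisymmetric \<open>f\<close> the
  value does not depend on which one is chosen.  The variables of \<open>f\<close> are \<open>1, \<dots>, n - s\<close>, so that
  its variable \<open>p\<close> is evaluated at the coordinate \<open>k (s + p)\<close>.\<close>

definition compl_enum :: "nat \<Rightarrow> nat set \<Rightarrow> nat \<Rightarrow> nat" where
  "compl_enum n I = (SOME k. bij_betw k {card I + 1..n} ({1..n} - I) \<and>
                             (\<forall>i\<in>{card I + 1..n}. k i mod 2 = i mod 2))"

definition eval_compl :: "nat \<Rightarrow> nat set \<Rightarrow> 'a::comm_semiring_1 mpol \<Rightarrow> (nat \<Rightarrow> 'a) \<Rightarrow> 'a" where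
  "eval_compl n I f z = eval_pol f (\<lambda>p. z (compl_enum n I (card I + p)))"

text \<open>Polymorphic, so that it can be instantiated both with \<open>r\<close> in the ground field and with \<open>r\<close> the
  indeterminate of the field of rational functions.\<close>

definition psi_expr :: "nat \<Rightarrow> nat set \<Rightarrow> (nat \<Rightarrow> int) \<Rightarrow> 'b::field \<Rightarrow> 'b" where
  "psi_expr n I \<mu> r =
     (let \<nu> = add_indicator \<mu> I;
          Q = {(i, j). i \<in> {1..n} \<and> j \<in> {1..n} \<and> i \<notin> I \<and> j \<in> I \<and> i < j}
      in (\<Prod>(i, j) \<in> {(i, j) \<in> Q. odd (j - i)}.
            (of_int (\<mu> i - \<mu> j) + of_nat (j - i - 1) * r) *
            (of_int (\<nu> i - \<nu> j) + of_nat (j - i + 1) * r)) /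
         (\<Prod>(i, j) \<in> {(i, j) \<in> Q. even (j - i)}.
            (of_int (\<mu> i - \<mu> j) + of_nat (j - i) * r) *
            (of_int (\<nu> i - \<nu> j) + of_nat (j - i) * r)))"

text \<open>The value at \<open>a\<close> of a rational function in one variable that is regular at \<open>a\<close>.\<close>

definition ratfun_value :: "'a::field poly fract \<Rightarrow> 'a \<Rightarrow> 'a" where
  "ratfun_value q a =
     (THE v. \<exists>f g. q = Fract f g \<and> poly g a \<noteq> 0 \<and> v = poly f a / poly g a)"

text \<open>For \<open>r = 0\<close> the denominator can vanish (when \<open>\<mu>\<^sub>i = \<mu>\<^sub>j + 1\<close>), so that the rational function has
  to be formed first.\<close>

definition psi_even :: "nat \<Rightarrow> nat set \<Rightarrow> (nat \<Rightarrow> int) \<Rightarrow> 'a::field_char_0 \<Rightarrow> 'a" where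
  "psi_even n I \<mu> r =
     (if r = 0 then ratfun_value (psi_expr n I \<mu> (Fract [:0, 1:] 1)) 0 else psi_expr n I \<mu> r)"

end

theory Submission
  imports Defs
begin

text \<open>For a parity \<open>A\<close> and a scalar \<open>t\<close>, consider the operator on functions \<open>g\<close> on \<open>\<Lambda>\<close> that sends \<open>g\<close> to
  \<open>\<mu> \<mapsto> \<Sum>\<^sub>I \<plusminus> (\<Prod>\<^sub>i (t - (\<rho> + \<mu>)\<^sub>i)) \<psi>'\<^sub>I g(\<mu> + \<epsilon>\<^sub>I)\<close>, where \<open>I\<close> runs through \<open>P\<^sub>o\<^sub>d\<^sub>d\<close> or
  \<open>P\<^sub>e\<^sub>v\<^sub>e\<^sub>n\<close> and \<open>i\<close> through the elements outside \<open>I\<close> of the parity \<open>A\<close>.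
  Collecting the terms of equal total shift turns the commutation of two such operators into an identity of
  rational functions, which is proved by induction on the number of variables, comparing the poles and the
  polynomial parts in one variable or in one variable common to an odd and an even index.
  The operators raise \<open>|\<mu>|\<^sub>o\<^sub>d\<^sub>d\<close>, up to the diagonal terms \<open>\<Prod>\<^sub>i (t - (\<rho> + \<mu>)\<^sub>i)\<close>, and these separate \<open>\<Lambda>\<close>
  since \<open>r\<close> is not a negative rational. So for each \<open>\<nu>\<close> there is a common eigenfunction \<open>\<chi>\<^sub>\<nu>\<close>
  with \<open>\<chi>\<^sub>\<nu>(\<nu>) = 1\<close> that vanishes at all other \<open>\<mu>\<close> with \<open>|\<nu>|\<^sub>o\<^sub>d\<^sub>d \<le> |\<mu>|\<^sub>o\<^sub>d\<^sub>d\<close>.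
  A Newton coefficient in \<open>t\<close> of the eigenvalue equation is a Pieri-type recursion for \<open>\<chi>\<^sub>\<nu>\<close> with eigenvalue
  \<open>e\<^sub>m(\<rho> + \<nu>)\<close> for an explicit semisymmetric polynomial \<open>e\<^sub>m\<close>. Solving it column by column gives
  \<open>\<chi>\<^sub>\<nu>(\<mu>) = f\<^sub>\<mu>(\<rho> + \<nu>) \<chi>\<^sub>\<nu>(0)\<close> with \<open>f\<^sub>\<mu>\<close> semisymmetric of leading monomial \<open>z\<^sup>[\<^sup>\<mu>\<^sup>]\<close>. The vanishing
  of \<open>\<chi>\<^sub>\<nu>\<close> identifies \<open>f\<^sub>\<mu>\<close> with \<open>R\<^sub>\<mu>\<close>, and \<open>e\<^sub>m = f\<^sub>\<mu>\<close> for the column \<open>\<mu> = (1\<^sup>m)\<close>, so that the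
  recursion is the Pieri formula.\<close>

subsection \<open>Partial fractions and quotients of monic polynomials\<close>

text \<open>The construction of chi_nu is guided by what it must be: chi_nu(mu) = R_mu(rho + nu) /
  R_nu(rho + nu). A Pieri formula for R, evaluated at rho + nu, is a difference equation in mu for
  chi_nu. Here the equations come first, and existence and uniqueness of R come out of them. The
  splitting identity rests on two features of the pair factors. In D = z_i - z_j they are D(D + 1) +
  r(1 - r) for opposite parities and 1 / (D(D + 1)) for equal ones. Both are invariant under D -> -1
  - D, which makes residues factor through smaller index sets; and up to inversion they differ by a
  constant only, which controls the polynomial parts. Deleting indices changes how many odd and even
  members each half may have, so the induction has to treat every offset a of these numbers. For a =
  0 with both parities present, one variable alone shows only that the difference of the two sides
  is constant along a line; the constant is found where an odd and an even variable
  coincide.\<close>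

lemma monic_prod_linear:
  fixes Z :: "'a::idom set"
  assumes "finite Z"
  shows "degree (\<Prod>q\<in>Z. [:-q, 1:]) = card Z" "lead_coeff (\<Prod>q\<in>Z. [:-q, 1:]) = 1"
proof -
  show "degree (\<Prod>q\<in>Z. [:-q, 1:]) = card Z"
    by (subst degree_prod_sum_eq) auto
  show "lead_coeff (\<Prod>q\<in>Z. [:-q, 1:]) = 1"
    by (subst lead_coeff_prod) auto
qed

lemma poly_eq_0_of_roots:
  fixes p :: "'a::idom poly"
  assumes "finite Z" "\<And>x. x \<in> Z \<Longrightarrow> poly p x = 0" "degree p < card Z"
  shows "p = 0"
proof (rule ccontr)
  assume "p \<noteq> 0"
  then have "card {x. poly p x = 0} \<le> degree p" "finite {x. poly p x = 0}"
    by (auto simp: card_poly_roots_bound poly_roots_finite)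
  moreover have "Z \<subseteq> {x. poly p x = 0}" using assms by auto
  ultimately show False using assms(3) card_mono[of "{x. poly p x = 0}" Z] by linarith
qed

text \<open>Lagrange interpolation: the remainder of \<open>N\<close> and the interpolation sum have
  degree below \<open>card Z\<close> and agree on \<open>Z\<close>. The quotient carries the
  polynomial part, so \<open>N\<close> may have any degree.\<close>

lemma partial_fraction:
  fixes N :: "'a::field poly"
  assumes Z: "finite Z" and w: "w \<notin> Z"
  shows "poly N w / (\<Prod>q\<in>Z. w - q) = poly (N div (\<Prod>q\<in>Z. [:-q, 1:])) w
    + (\<Sum>p\<in>Z. poly N p / (\<Prod>q\<in>Z - {p}. p - q) / (w - p))"
proof (cases "Z = {}")
  case True
  then show ?thesis by simp
next
  case False
  define P where "P = (\<Prod>q\<in>Z. [:-q, 1:])"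
  define R where "R = N mod P"
  define c where "c p = poly N p / (\<Prod>q\<in>Z - {p}. p - q)" for p
  define L where "L = (\<Sum>p\<in>Z. smult (c p) (\<Prod>q\<in>Z - {p}. [:-q, 1:]))"
  have degP: "degree P = card Z" unfolding P_def using monic_prod_linear[OF Z] by simp
  have cZ: "card Z > 0" using False Z by (simp add: card_gt_0_iff)
  have P0: "P \<noteq> 0" using degP cZ by auto
  have polyP: "poly P x = (\<Prod>q\<in>Z. x - q)" for x unfolding P_def by (simp add: poly_prod)
  have N: "N = N div P * P + R" unfolding R_def by simp
  have degR: "degree R < card Z"
    using degree_mod_less[OF P0, of N] degP cZ unfolding R_def by auto
  have degL: "degree L \<le> card Z - 1"
    unfolding L_def
  proof (rule degree_sum_le[OF Z])
    fix p assume "p \<in> Z"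
    then show "degree (smult (c p) (\<Prod>q\<in>Z - {p}. [:-q, 1:])) \<le> card Z - 1"
      using monic_prod_linear(1)[of "Z - {p}"] Z
      by (metis card_Diff_singleton degree_smult_le finite_Diff)
  qed
  have "R - L = 0"
  proof (rule poly_eq_0_of_roots[OF Z])
    fix x assume x: "x \<in> Z"
    have nz: "(\<Prod>q\<in>Z - {x}. x - q) \<noteq> 0" using Z by (auto simp: prod_zero_iff)
    have "poly L x = (\<Sum>p\<in>Z. if p = x then c x * (\<Prod>q\<in>Z - {x}. x - q) else 0)"
      unfolding L_def poly_sum
    proof (rule sum.cong[OF refl])
      fix p assume p: "p \<in> Z"
      show "poly (smult (c p) (\<Prod>q\<in>Z - {p}. [:-q, 1:])) x
        = (if p = x then c x * (\<Prod>q\<in>Z - {x}. x - q) else 0)"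
      proof (cases "p = x")
        case False
        then have "(\<Prod>q\<in>Z - {p}. x - q) = 0" using x Z by (intro prod_zero) auto
        then show ?thesis using False by (simp add: poly_prod)
      qed (simp add: poly_prod)
    qed
    also have "\<dots> = poly N x" using x Z nz by (simp add: c_def)
    also have "\<dots> = poly R x"
    proof -
      have "poly P x = 0" using x Z by (simp add: polyP)
      then show ?thesis by (subst N) simp
    qed
    finally show "poly (R - L) x = 0" by simp
  next
    show "degree (R - L) < card Z" using degR degL cZ degree_diff_le_max[of R L] by linarith
  qed
  then have RL: "R = L" by simp
  have Pw: "poly P w \<noteq> 0" using w Z by (auto simp: polyP prod_zero_iff)
  have "poly N w = poly (N div P) w * poly P w + poly R w"
    by (metis N poly_add poly_mult)
  then have "poly N w / poly P w = poly (N div P) w + poly L w / poly P w"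
    using Pw RL by (simp add: field_simps)
  also have "poly L w / poly P w = (\<Sum>p\<in>Z. c p / (w - p))"
    unfolding L_def poly_sum sum_divide_distrib
  proof (rule sum.cong[OF refl])
    fix p assume p: "p \<in> Z"
    have "poly P w = (w - p) * (\<Prod>q\<in>Z - {p}. w - q)"
      unfolding polyP using p Z by (simp add: prod.remove)
    moreover have "w - p \<noteq> 0" "(\<Prod>q\<in>Z - {p}. w - q) \<noteq> 0"
      using w p Z by (auto simp: prod_zero_iff)
    ultimately show "poly (smult (c p) (\<Prod>q\<in>Z - {p}. [:-q, 1:])) w / poly P w = c p / (w - p)"
      by (simp add: poly_prod)
  qed
  finally show ?thesis unfolding polyP P_def[symmetric] c_def .
qed

lemma monic_degree_0:
  fixes P :: "'a::comm_semiring_1 poly"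
  assumes "lead_coeff P = 1" "degree P = 0"
  shows "P = 1"
  using assms by (metis degree_eq_zeroE lead_coeff_pCons(2) one_pCons)

lemma degree_diff_monic_less:
  fixes P Q :: "'a::field poly"
  assumes "lead_coeff P = 1" "lead_coeff Q = 1" "degree P = degree Q" "degree P > 0"
  shows "degree (Q - P) < degree P"
proof -
  have "coeff (Q - P) (degree P) = 0" using assms by simp
  moreover have "degree (Q - P) \<le> degree P" using assms degree_diff_le_max[of Q P] by simp
  ultimately show ?thesis using assms(4)
    by (metis coeff_0 degree_0 le_neq_implies_less leading_coeff_0_iff)
qed

lemma div_monic_mult_add:
  fixes P R W :: "'a::field poly"
  assumes "P \<noteq> 0"
  shows "(W * P + R) div P = W + R div P"
  using assms by (simp add: poly_div_add_left)

lemma div_monic_same: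
  fixes P Q :: "'a::field poly"
  assumes "lead_coeff P = 1" "lead_coeff Q = 1" "degree P = degree Q"
  shows "smult b Q div P = [:b:]"
proof (cases "degree P = 0")
  case True
  then have "P = 1" "Q = 1" using assms by (auto intro!: monic_degree_0)
  then show ?thesis by simp
next
  case False
  have P0: "P \<noteq> 0" using assms by auto
  have "degree (smult b (Q - P)) < degree P"
    using degree_diff_monic_less[OF assms] False degree_smult_le[of b "Q - P"] by linarith
  moreover have "smult b Q = [:b:] * P + smult b (Q - P)"
    by (simp add: smult_diff_right)
  ultimately show ?thesis
    using div_monic_mult_add[OF P0, of "[:b:]" "smult b (Q - P)"] by (metis add_0_right div_poly_less)
qed

text \<open>Replacing \<open>Q\<close> by \<open>P\<close> changes the numerator by a polynomial of
  degree at most that of \<open>P\<close>, hence the quotient by a constant only. The linear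
  coefficient survives, the constant term stays unspecified.\<close>

lemma div_monic_same_linear:
  fixes P Q :: "'a::field poly"
  assumes "lead_coeff P = 1" "lead_coeff Q = 1" "degree P = degree Q"
  shows "degree (smult b ([:s, -1:] * Q) div P) \<le> 1" "coeff (smult b ([:s, -1:] * Q) div P) 1 = - b"
proof -
  have "\<exists>c. smult b ([:s, -1:] * Q) div P = smult b [:s, -1:] + [:c:]"
  proof (cases "degree P = 0")
    case True
    then have "P = 1" "Q = 1" using assms by (auto intro!: monic_degree_0)
    then show ?thesis by (intro exI[of _ 0]) simp
  next
    case False
    have P0: "P \<noteq> 0" using assms by auto
    define R where "R = smult b ([:s, -1:] * (Q - P))"
    have "degree R \<le> degree P"
      using degree_diff_monic_less[OF assms] False degree_smult_le[of b "[:s, -1:] * (Q - P)"]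
        degree_mult_le[of "[:s, -1:]" "Q - P"] unfolding R_def by simp
    moreover have "degree R = degree (R div P) + degree P" if "R div P \<noteq> 0"
    proof -
      have "degree (R div P * P + R mod P) = degree (R div P * P)"
        using degree_mod_less[OF P0, of R] that P0 degree_mult_eq[OF that P0] False
        by (intro degree_add_eq_left) auto
      then show ?thesis using degree_mult_eq[OF that P0] by simp
    qed
    ultimately have "degree (R div P) = 0" by (cases "R div P = 0") auto
    then obtain c where "R div P = [:c:]" by (metis degree_eq_zeroE)
    moreover have "smult b ([:s, -1:] * Q) = smult b [:s, -1:] * P + R"
      unfolding R_def mult_smult_left smult_add_right[symmetric] distrib_left[symmetric] by simp
    ultimately have "smult b ([:s, -1:] * Q) div P = smult b [:s, -1:] + [:c:]"
      by (metis div_monic_mult_add[OF P0])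
    then show ?thesis by blast
  qed
  then obtain c where c: "smult b ([:s, -1:] * Q) div P = smult b [:s, -1:] + [:c:]" by blast
  show "degree (smult b ([:s, -1:] * Q) div P) \<le> 1" unfolding c by simp
  show "coeff (smult b ([:s, -1:] * Q) div P) 1 = - b" unfolding c by simp
qed

subsection \<open>The splitting identity\<close>

definition parity_sign :: "nat \<Rightarrow> int" where
  "parity_sign i = (if odd i then 1 else - 1)"

text \<open>Number of odd members minus number of even members. \<open>P_even\<close> asks for
  excess 0, \<open>P_odd\<close> for excess 0 or 1.\<close>

definition excess :: "nat set \<Rightarrow> int" where
  "excess I = sum parity_sign I"

text \<open>With \<^term>\<open>a = 0\<close>, the flag \<open>A\<close> distinguishes \<^const>\<open>P_odd\<close> from \<^const>\<open>P_even\<close>.\<close>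

definition admissible :: "int \<Rightarrow> bool \<Rightarrow> int \<Rightarrow> bool" where
  "admissible a A k \<longleftrightarrow> k = a \<or> A \<and> k = a + 1"

text \<open>The interaction of an index i raised by the first operator with an index j raised by the
  second one, as a function of D = z_i - z_j. By \<open>om_gfac\<close> it is the same whether i < j
  or j < i.\<close>

definition om :: "'f::field \<Rightarrow> bool \<Rightarrow> 'f \<Rightarrow> 'f" where
  "om r same D = (if same then 1 / (D * (D + 1)) else (D + r) * (D + 1 - r))"

definition wt :: "bool \<Rightarrow> nat set \<Rightarrow> 'f::comm_ring_1 \<Rightarrow> (nat \<Rightarrow> 'f) \<Rightarrow> 'f" where
  "wt A T t z = (\<Prod>i | i \<in> T \<and> odd i = A. t - z i)"

definition cross :: "'f::field \<Rightarrow> nat set \<Rightarrow> nat set \<Rightarrow> (nat \<Rightarrow> 'f) \<Rightarrow> 'f" where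
  "cross r I J z = (\<Prod>(i, j)\<in>I \<times> J. om r (odd i = odd j) (z i - z j))"

text \<open>The second weight is taken after the first shift, when the indices in \<open>I\<close>
  have been raised by one; hence \<open>u - 1\<close>.\<close>

definition split_term ::
  "'f::field \<Rightarrow> bool \<Rightarrow> bool \<Rightarrow> 'f \<Rightarrow> 'f \<Rightarrow> nat set \<Rightarrow> (nat \<Rightarrow> 'f) \<Rightarrow> nat set \<Rightarrow> 'f" where
  "split_term r A B t u C z I = wt A (C - I) t z * wt B I (u - 1) z * cross r I (C - I) z"

definition splits :: "int \<Rightarrow> bool \<Rightarrow> bool \<Rightarrow> nat set \<Rightarrow> nat set set" where
  "splits a A B C = {I. I \<subseteq> C \<and> admissible a A (excess I) \<and> admissible a B (excess (C - I))}"

text \<open>The coefficient of the total shift by \<open>C\<close> in a product of two operators: \<open>I\<close> is added by the first one, \<open>C - I\<close> by the second.\<close>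

definition split_sum ::
  "'f::field \<Rightarrow> int \<Rightarrow> bool \<Rightarrow> bool \<Rightarrow> 'f \<Rightarrow> 'f \<Rightarrow> nat set \<Rightarrow> (nat \<Rightarrow> 'f) \<Rightarrow> 'f" where
  "split_sum r a A B t u C z = (\<Sum>I\<in>splits a A B C. split_term r A B t u C z I)"

text \<open>All poles below lie at a variable or at distance 1 from it, so non-integral differences
  keep the poles of different indices apart.\<close>

definition generic :: "nat set \<Rightarrow> (nat \<Rightarrow> 'f::ring_1) \<Rightarrow> bool" where
  "generic C z \<longleftrightarrow> (\<forall>i\<in>C. \<forall>j\<in>C. i \<noteq> j \<longrightarrow> z i - z j \<notin> \<int>)"

text \<open>If y_j = y_i + 1, this identifies the factor of i inside \<open>I\<close> against l
  outside with the factor that l inside \<open>I\<close> would have against j outside; see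
  \<open>sep_term_shifted\<close>.\<close>

lemma om_reflect: "om r s (- 1 - D) = om r s (D :: 'f::field)"
proof -
  have "(- 1 - D) * (- 1 - D + 1) = D * (D + 1)"
    "(- 1 - D + r) * (- 1 - D + 1 - r) = (D + r) * (D + 1 - r)" by algebra+
  then show ?thesis by (simp add: om_def)
qed

lemma excess_insert [simp]: "finite I \<Longrightarrow> i \<notin> I \<Longrightarrow> excess (insert i I) = parity_sign i + excess I"
  by (simp add: excess_def)

lemma excess_empty [simp]: "excess {} = 0"
  by (simp add: excess_def)

text \<open>The variables indexed by \<open>M\<close> are set equal to one variable \<open>w\<close>, in which partial fractions are taken. \<open>M\<close> contains at most one index of each parity (\<open>transversal\<close> below), since two variables of equal parity must stay distinct in \<^const>\<open>om\<close>.\<close>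

definition merge :: "nat set \<Rightarrow> (nat \<Rightarrow> 'f) \<Rightarrow> 'f \<Rightarrow> nat \<Rightarrow> 'f" where
  "merge M z w i = (if i \<in> M then w else z i)"

section \<open>Split terms as rational functions of the merged variable\<close>

definition pnum :: "nat set \<Rightarrow> (nat \<Rightarrow> 'f::field) \<Rightarrow> 'f \<Rightarrow> nat \<times> nat \<Rightarrow> 'f poly" where
  "pnum M z r = (\<lambda>(i, j).
     if i \<in> M \<and> j \<in> M then [:om r (odd i = odd j) 0:]
     else if i \<in> M then (if odd i = odd j then 1 else [:r - z j, 1:] * [:1 - r - z j, 1:])
     else if j \<in> M then (if odd i = odd j then 1 else [:z i + r, - 1:] * [:z i + 1 - r, - 1:])
     else [:om r (odd i = odd j) (z i - z j):])"

text \<open>The two poles of a pair of equal parity are distinct and simple, so a set records them.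
  Pairs of opposite parity have none.\<close>

definition pden :: "nat set \<Rightarrow> (nat \<Rightarrow> 'f::field) \<Rightarrow> nat \<times> nat \<Rightarrow> 'f set" where
  "pden M z = (\<lambda>(i, j).
     if odd i \<noteq> odd j then {}
     else if i \<in> M \<and> j \<notin> M then {z j, z j - 1}
     else if i \<notin> M \<and> j \<in> M then {z i, z i + 1}
     else {})"

lemma finite_pden [simp]: "finite (pden M z x)"
  by (cases x) (simp add: pden_def)

lemma om_line:
  fixes z :: "nat \<Rightarrow> 'f::field"
  assumes "w \<notin> pden M z (i, j)"
  shows "om r (odd i = odd j) (merge M z w i - merge M z w j)
    = poly (pnum M z r (i, j)) w / (\<Prod>q\<in>pden M z (i, j). w - q)"
proof -
  have 1: "z k \<noteq> z k - 1" "z k \<noteq> z k + 1" for k by simp_all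
  consider "i \<in> M" "j \<in> M" | "i \<in> M" "j \<notin> M" | "i \<notin> M" "j \<in> M" | "i \<notin> M" "j \<notin> M" by blast
  then show ?thesis
  proof cases
    case 2
    then show ?thesis using 1
      by (auto simp: om_def merge_def pnum_def pden_def algebra_simps)
  next
    case 3
    then have m: "merge M z w i = z i" "merge M z w j = w" by (simp_all add: merge_def)
    have e: "(z i - w) * (z i - w + 1) = (w - z i) * (w - (z i + 1))" by algebra
    show ?thesis
    proof (cases "odd i = odd j")
      case True
      then show ?thesis using 3 1[of i] by (simp add: om_def pnum_def pden_def m e)
    next
      case False
      moreover have "(z i - w + r) * (z i - w + 1 - r) = poly ([:z i + r, - 1:] * [:z i + 1 - r, - 1:]) w"
        by (simp add: algebra_simps)
      ultimately show ?thesis using 3 by (simp add: om_def pnum_def pden_def m)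
    qed
  qed (auto simp: om_def merge_def pnum_def pden_def)
qed

definition line_poles :: "nat set \<Rightarrow> nat set \<Rightarrow> (nat \<Rightarrow> 'f::field) \<Rightarrow> nat set \<Rightarrow> 'f set" where
  "line_poles C M z I = (\<Union>x\<in>I \<times> (C - I). pden M z x)"

text \<open>A superset of the poles that does not depend on \<open>I\<close>, so that the partial
  fractions of all split terms can be added pole by pole.\<close>

definition all_poles :: "nat set \<Rightarrow> nat set \<Rightarrow> (nat \<Rightarrow> 'f::field) \<Rightarrow> 'f set" where
  "all_poles C M z = (\<Union>k\<in>{k \<in> C - M. \<exists>c\<in>M. odd c = odd k}. {z k - 1, z k, z k + 1})"

definition line_wt :: "bool \<Rightarrow> nat set \<Rightarrow> nat set \<Rightarrow> 'f::field \<Rightarrow> (nat \<Rightarrow> 'f) \<Rightarrow> 'f poly" where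
  "line_wt A M T t z = (\<Prod>i | i \<in> T \<and> odd i = A. if i \<in> M then [:t, - 1:] else [:t - z i:])"

definition line_num ::
  "'f::field \<Rightarrow> bool \<Rightarrow> bool \<Rightarrow> 'f \<Rightarrow> 'f \<Rightarrow> nat set \<Rightarrow> nat set \<Rightarrow> (nat \<Rightarrow> 'f) \<Rightarrow> nat set \<Rightarrow> 'f poly" where
  "line_num r A B t u C M z I = line_wt A M (C - I) t z * line_wt B M I (u - 1) z *
     (\<Prod>x\<in>I \<times> (C - I). pnum M z r x)"

lemma poly_line_wt: "poly (line_wt A M T t z) w = wt A T t (merge M z w)"
  unfolding line_wt_def wt_def poly_prod by (intro prod.cong) (auto simp: merge_def)

lemma line_poles_subset: "I \<subseteq> C \<Longrightarrow> line_poles C M z I \<subseteq> all_poles C M z"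
proof
  fix q assume I: "I \<subseteq> C" and "q \<in> line_poles C M z I"
  then obtain i j where ij: "i \<in> I" "j \<in> C - I" and q: "q \<in> pden M z (i, j)"
    unfolding line_poles_def by blast
  show "q \<in> all_poles C M z"
  proof (cases "i \<in> M")
    case True
    then have "j \<in> C - M" "odd i = odd j" "q \<in> {z j - 1, z j, z j + 1}"
      using q ij unfolding pden_def by (auto split: if_splits)
    then show ?thesis using True unfolding all_poles_def by blast
  next
    case False
    then have "i \<in> C - M" "j \<in> M" "odd j = odd i" "q \<in> {z i - 1, z i, z i + 1}"
      using q ij I unfolding pden_def by (auto split: if_splits)
    then show ?thesis unfolding all_poles_def by blast
  qed
qed

lemma finite_all_poles: "finite C \<Longrightarrow> finite (all_poles C M z)"
  unfolding all_poles_def by auto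

lemma finite_line_poles: "finite C \<Longrightarrow> I \<subseteq> C \<Longrightarrow> finite (line_poles C M z I)"
  using line_poles_subset finite_all_poles finite_subset by metis

lemma generic_eqD:
  assumes "generic C z" "i \<in> C" "j \<in> C" "z i - z j \<in> \<int>"
  shows "i = j"
  using assms unfolding generic_def by blast

definition transversal :: "nat set \<Rightarrow> bool" where
  "transversal M \<longleftrightarrow> (\<forall>c\<in>M. \<forall>d\<in>M. odd c = odd d \<longrightarrow> c = d)"

text \<open>A pole differs by an integer from z_k for its unmerged index k. Genericity recovers k
  from the pole, and transversality recovers the merged index from the parity of k. Hence the
  product over all pairs has simple poles only.\<close>

lemma pden_disjoint:
  assumes g: "generic (C - M) z" and M: "transversal M" and I: "I \<subseteq> C"
    and x: "x \<in> I \<times> (C - I)" and y: "y \<in> I \<times> (C - I)"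
    and q: "q \<in> pden M z x" "q \<in> pden M z y"
  shows "x = y"
proof -
  obtain i j where xx: "x = (i, j)" by (cases x)
  obtain i' j' where yy: "y = (i', j')" by (cases y)
  define k where "k = (if i \<in> M then j else i)"
  define c where "c = (if i \<in> M then i else j)"
  define k' where "k' = (if i' \<in> M then j' else i')"
  define c' where "c' = (if i' \<in> M then i' else j')"
  have int: "q - z l \<in> \<int>" if "q = z l \<or> q = z l - 1 \<or> q = z l + 1" for l
    using that by auto
  have qz: "q - z k \<in> \<int>" "q - z k' \<in> \<int>"
    using q unfolding xx yy pden_def k_def k'_def by (intro int; force split: if_splits)+
  have "z k - z k' = (q - z k') - (q - z k)" by simp
  then have "z k - z k' \<in> \<int>" using qz by (metis Ints_diff)
  moreover have kk: "k \<in> C - M" "k' \<in> C - M" "c \<in> M" "c' \<in> M" "odd c = odd k" "odd c' = odd k'"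
    using q x y I unfolding xx yy pden_def k_def k'_def c_def c'_def by (auto split: if_splits)
  ultimately have "k = k'" using generic_eqD[OF g] by blast
  then have "c = c'" using kk M unfolding transversal_def by metis
  show ?thesis using \<open>k = k'\<close> \<open>c = c'\<close> x y I kk unfolding xx yy k_def k'_def c_def c'_def
    by (auto split: if_splits)
qed

lemma pden_inter:
  assumes "generic (C - M) z" "transversal M" "I \<subseteq> C"
  shows "\<forall>x\<in>I \<times> (C - I). \<forall>y\<in>I \<times> (C - I). x \<noteq> y \<longrightarrow> pden M z x \<inter> pden M z y = {}"
proof (intro ballI impI equals0I)
  fix x y q
  assume "x \<in> I \<times> (C - I)" "y \<in> I \<times> (C - I)" "x \<noteq> y" "q \<in> pden M z x \<inter> pden M z y"
  then show False using pden_disjoint[OF assms, of x y q] by (simp only: IntE) blast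
qed

lemma prod_line_poles:
  assumes "finite C" "generic (C - M) z" "transversal M" "I \<subseteq> C"
  shows "(\<Prod>q\<in>line_poles C M z I. f q) = (\<Prod>x\<in>I \<times> (C - I). \<Prod>q\<in>pden M z x. f q)"
  unfolding line_poles_def
proof (rule prod.UNION_disjoint)
  show "finite (I \<times> (C - I))" using assms finite_subset by auto
  show "\<forall>x\<in>I \<times> (C - I). \<forall>y\<in>I \<times> (C - I). x \<noteq> y \<longrightarrow> pden M z x \<inter> pden M z y = {}"
    by (rule pden_inter[OF assms(2-4)])
qed auto

lemma split_term_line:
  assumes "finite C" "generic (C - M) z" "transversal M" "I \<subseteq> C" "w \<notin> line_poles C M z I"
  shows "split_term r A B t u C (merge M z w) I
    = poly (line_num r A B t u C M z I) w / (\<Prod>q\<in>line_poles C M z I. w - q)"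
proof -
  have "cross r I (C - I) (merge M z w)
    = (\<Prod>x\<in>I \<times> (C - I). poly (pnum M z r x) w / (\<Prod>q\<in>pden M z x. w - q))"
    unfolding cross_def
  proof (rule prod.cong[OF refl])
    fix x assume x: "x \<in> I \<times> (C - I)"
    obtain i j where xx: "x = (i, j)" by (cases x)
    have "w \<notin> pden M z (i, j)" using assms(5) x unfolding line_poles_def xx by blast
    then show "(case x of (i, j) \<Rightarrow> om r (odd i = odd j) (merge M z w i - merge M z w j))
      = poly (pnum M z r x) w / (\<Prod>q\<in>pden M z x. w - q)"
      unfolding xx using om_line by simp
  qed
  then show ?thesis
    unfolding split_term_def line_num_def poly_mult poly_line_wt prod_line_poles[OF assms(1-4)]
      poly_prod prod_dividef by simp
qed

section \<open>Residues of a split term\<close>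

definition line_res ::
  "'f::field \<Rightarrow> bool \<Rightarrow> bool \<Rightarrow> 'f \<Rightarrow> 'f \<Rightarrow> nat set \<Rightarrow> nat set \<Rightarrow> (nat \<Rightarrow> 'f) \<Rightarrow> nat set \<Rightarrow> 'f \<Rightarrow> 'f" where
  "line_res r A B t u C M z I p =
     poly (line_num r A B t u C M z I) p / (\<Prod>q\<in>line_poles C M z I - {p}. p - q)"

text \<open>Only the pair (i, j) is singular at \<open>p\<close>; every other pair factor can be
  evaluated there, so the residue is again a product over pairs.\<close>

lemma line_res_eq:
  assumes C: "finite C" "generic (C - M) z" "transversal M" "I \<subseteq> C"
    and x: "i \<in> I" "j \<in> C - I" "p \<in> pden M z (i, j)"
  shows "line_res r A B t u C M z I p =
    wt A (C - I) t (merge M z p) * wt B I (u - 1) (merge M z p) *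
    (1 / (\<Prod>q\<in>pden M z (i, j) - {p}. p - q)) *
    (\<Prod>(k, l)\<in>I \<times> (C - I) - {(i, j)}. om r (odd k = odd l) (merge M z p k - merge M z p l))"
proof -
  let ?X = "I \<times> (C - I)"
  have finX: "finite ?X" using C finite_subset by auto
  have xX: "(i, j) \<in> ?X" using x by simp
  have other: "p \<notin> pden M z y" if "y \<in> ?X" "y \<noteq> (i, j)" for y
    using pden_disjoint[OF C(2-4) that(1) xX _ x(3)] that(2) by metis
  have "line_poles C M z I - {p} = (\<Union>y\<in>?X. pden M z y - {p})"
    unfolding line_poles_def by blast
  moreover have "\<forall>x\<in>?X. \<forall>y\<in>?X. x \<noteq> y \<longrightarrow> (pden M z x - {p}) \<inter> (pden M z y - {p}) = {}"
  proof (intro ballI impI)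
    fix x y assume "x \<in> ?X" "y \<in> ?X" "x \<noteq> y"
    then have "pden M z x \<inter> pden M z y = {}" by (rule pden_inter[OF C(2-4), rule_format])
    then show "(pden M z x - {p}) \<inter> (pden M z y - {p}) = {}" by blast
  qed
  ultimately have "(\<Prod>q\<in>line_poles C M z I - {p}. p - q) = (\<Prod>y\<in>?X. \<Prod>q\<in>pden M z y - {p}. p - q)"
    using prod.UNION_disjoint[OF finX, of "\<lambda>y. pden M z y - {p}" "\<lambda>q. p - q"] by simp
  also have "\<dots> = (\<Prod>q\<in>pden M z (i, j) - {p}. p - q) * (\<Prod>y\<in>?X - {(i, j)}. \<Prod>q\<in>pden M z y - {p}. p - q)"
    by (rule prod.remove[OF finX xX])
  also have "(\<Prod>y\<in>?X - {(i, j)}. \<Prod>q\<in>pden M z y - {p}. p - q)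
      = (\<Prod>y\<in>?X - {(i, j)}. \<Prod>q\<in>pden M z y. p - q)"
    using other by (intro prod.cong refl) (metis Diff_empty Diff_iff Diff_insert0 insertI1)
  finally have den: "(\<Prod>q\<in>line_poles C M z I - {p}. p - q)
    = (\<Prod>q\<in>pden M z (i, j) - {p}. p - q) * (\<Prod>y\<in>?X - {(i, j)}. \<Prod>q\<in>pden M z y. p - q)" .
  have "pnum M z r (i, j) = 1"
    using x(3) by (auto simp: pden_def pnum_def split: if_splits)
  then have num: "(\<Prod>y\<in>?X. poly (pnum M z r y) p) = (\<Prod>y\<in>?X - {(i, j)}. poly (pnum M z r y) p)"
    using prod.remove[OF finX xX, of "\<lambda>y. poly (pnum M z r y) p"] by simp
  have rat: "(\<Prod>y\<in>?X - {(i, j)}. poly (pnum M z r y) p) / (\<Prod>y\<in>?X - {(i, j)}. \<Prod>q\<in>pden M z y. p - q)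
    = (\<Prod>(k, l)\<in>?X - {(i, j)}. om r (odd k = odd l) (merge M z p k - merge M z p l))"
    unfolding prod_dividef[symmetric]
  proof (rule prod.cong[OF refl])
    fix y assume y: "y \<in> ?X - {(i, j)}"
    obtain k l where yy: "y = (k, l)" by (cases y)
    show "poly (pnum M z r y) p / (\<Prod>q\<in>pden M z y. p - q)
      = (case y of (k, l) \<Rightarrow> om r (odd k = odd l) (merge M z p k - merge M z p l))"
      using om_line[of p M z k l r] other[of y] y unfolding yy by simp
  qed
  show ?thesis
    unfolding line_res_def line_num_def poly_mult poly_line_wt poly_prod den num rat[symmetric]
    by simp
qed

text \<open>Genericity forces the singular pair at \<open>p\<close> to consist of \<open>k\<close>
  and its partner in \<open>M\<close>. Which of the two lies in \<open>I\<close> decides between z_k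
  - 1 and z_k + 1, while z_k itself can arise both ways.\<close>

lemma line_pole_cases:
  assumes g: "generic (C - M) z" and M: "transversal M" and I: "I \<subseteq> C"
    and k: "k \<in> C - M" and p: "p - z k \<in> \<int>" and c: "c \<in> M \<Longrightarrow> odd c = odd k"
    and mem: "p \<in> line_poles C M z I"
  obtains c where "c \<in> M" "odd c = odd k" "c \<in> I" "k \<notin> I" "p \<in> {z k, z k - 1}"
  | c where "c \<in> M" "odd c = odd k" "c \<notin> I" "k \<in> I" "p \<in> {z k, z k + 1}"
proof -
  obtain i j where ij: "i \<in> I" "j \<in> C - I" and q: "p \<in> pden M z (i, j)"
    using mem unfolding line_poles_def by blast
  have int: "z l - z k \<in> \<int>" if "p = z l \<or> p = z l - 1 \<or> p = z l + 1" for l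
  proof -
    have "p - z l \<in> \<int>" using that by auto
    then have "(p - z k) - (p - z l) \<in> \<int>" using p by (rule Ints_diff[rotated])
    then show ?thesis by simp
  qed
  show ?thesis
  proof (cases "i \<in> M")
    case True
    then have "odd i = odd j" "j \<notin> M" "p \<in> {z j, z j - 1}"
      using q by (auto simp: pden_def split: if_splits)
    moreover have "j = k" using generic_eqD[OF g, of j k] int[of j] calculation ij k by blast
    ultimately show ?thesis using that(1)[of i] True ij by simp
  next
    case False
    then have "odd i = odd j" "j \<in> M" "p \<in> {z i, z i + 1}"
      using q by (auto simp: pden_def split: if_splits)
    moreover have "i = k" using generic_eqD[OF g, of i k] int[of i] calculation ij k False I by blast
    ultimately show ?thesis using that(2)[of j] ij by simp
  qed
qed

lemma cross_insert_insert:
  assumes fin: "finite C" and d: "i \<notin> C" "j \<notin> C" "i \<noteq> j" and I: "I \<subseteq> C"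
    and C': "C' = insert i (insert j C)" and I': "I' = insert i I"
  shows "wt A (C' - I') t y * wt B I' s y *
      (\<Prod>(k, l)\<in>I' \<times> (C' - I') - {(i, j)}. om r (odd k = odd l) (y k - y l))
    = (if odd j = A then t - y j else 1) * (if odd i = B then s - y i else 1) *
      (\<Prod>l\<in>C - I. om r (odd i = odd l) (y i - y l)) * (\<Prod>k\<in>I. om r (odd k = odd j) (y k - y j)) *
      (wt A (C - I) t y * wt B I s y * cross r I (C - I) y)"
proof -
  have J: "C' - I' = insert j (C - I)" unfolding C' I' using d I by auto
  have fI: "finite I" using fin I finite_subset by auto
  have dI: "i \<notin> I" "j \<notin> C - I" using d I by auto
  have w1: "wt A (insert j (C - I)) t y = (if odd j = A then t - y j else 1) * wt A (C - I) t y"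
  proof -
    have "{k. k \<in> insert j (C - I) \<and> odd k = A} =
        (if odd j = A then insert j {k. k \<in> C - I \<and> odd k = A} else {k. k \<in> C - I \<and> odd k = A})"
      by auto
    then show ?thesis unfolding wt_def using dI fin by simp
  qed
  have w2: "wt B (insert i I) s y = (if odd i = B then s - y i else 1) * wt B I s y"
  proof -
    have "{k. k \<in> insert i I \<and> odd k = B} =
        (if odd i = B then insert i {k. k \<in> I \<and> odd k = B} else {k. k \<in> I \<and> odd k = B})"
      by auto
    then show ?thesis unfolding wt_def using dI fI by simp
  qed
  let ?f = "\<lambda>(k, l). om r (odd k = odd l) (y k - y l)"
  have "insert i I \<times> insert j (C - I) - {(i, j)} = ({i} \<times> (C - I) \<union> I \<times> {j}) \<union> I \<times> (C - I)"
    using dI by auto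
  then have "prod ?f (insert i I \<times> insert j (C - I) - {(i, j)})
    = prod ?f (({i} \<times> (C - I) \<union> I \<times> {j}) \<union> I \<times> (C - I))" by simp
  also have "\<dots> = prod ?f ({i} \<times> (C - I) \<union> I \<times> {j}) * prod ?f (I \<times> (C - I))"
    using fin fI dI by (intro prod.union_disjoint) auto
  also have "prod ?f ({i} \<times> (C - I) \<union> I \<times> {j}) = prod ?f ({i} \<times> (C - I)) * prod ?f (I \<times> {j})"
    using fin fI dI by (intro prod.union_disjoint) auto
  also have "prod ?f ({i} \<times> (C - I)) = (\<Prod>l\<in>C - I. om r (odd i = odd l) (y i - y l))"
    by (rule prod.reindex_bij_witness[of _ "\<lambda>l. (i, l)" snd]) auto
  also have "prod ?f (I \<times> {j}) = (\<Prod>k\<in>I. om r (odd k = odd j) (y k - y j))"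
    by (rule prod.reindex_bij_witness[of _ "\<lambda>l. (l, j)" fst]) auto
  finally have P: "prod ?f (insert i I \<times> insert j (C - I) - {(i, j)})
    = (\<Prod>l\<in>C - I. om r (odd i = odd l) (y i - y l)) *
      (\<Prod>k\<in>I. om r (odd k = odd j) (y k - y j)) * prod ?f (I \<times> (C - I))" .
  show ?thesis unfolding J unfolding I' w1 w2 cross_def P by (simp only: mult_ac)
qed

definition pole_res ::
  "'f::field \<Rightarrow> int \<Rightarrow> bool \<Rightarrow> bool \<Rightarrow> 'f \<Rightarrow> 'f \<Rightarrow> nat set \<Rightarrow> nat set \<Rightarrow> (nat \<Rightarrow> 'f) \<Rightarrow> 'f \<Rightarrow> 'f" where
  "pole_res r a A B t u C M z p =
     (\<Sum>I | I \<in> splits a A B C \<and> p \<in> line_poles C M z I. line_res r A B t u C M z I p)"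

definition line_quot ::
  "'f::field \<Rightarrow> bool \<Rightarrow> bool \<Rightarrow> 'f \<Rightarrow> 'f \<Rightarrow> nat set \<Rightarrow> nat set \<Rightarrow> (nat \<Rightarrow> 'f) \<Rightarrow> nat set \<Rightarrow> 'f poly" where
  "line_quot r A B t u C M z I =
     line_num r A B t u C M z I div (\<Prod>q\<in>line_poles C M z I. [:-q, 1:])"

lemma finite_splits [simp]: "finite C \<Longrightarrow> finite (splits a A B C)"
  unfolding splits_def by auto

lemma splits_subset: "I \<in> splits a A B C \<Longrightarrow> I \<subseteq> C"
  unfolding splits_def by auto

lemma split_sum_line:
  assumes C: "finite C" "generic (C - M) z" "transversal M" and w: "w \<notin> all_poles C M z"
  shows "split_sum r a A B t u C (merge M z w) =
    poly (\<Sum>I\<in>splits a A B C. line_quot r A B t u C M z I) w +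
    (\<Sum>p\<in>all_poles C M z. pole_res r a A B t u C M z p / (w - p))"
proof -
  have "split_sum r a A B t u C (merge M z w) = (\<Sum>I\<in>splits a A B C.
      poly (line_quot r A B t u C M z I) w +
      (\<Sum>p\<in>all_poles C M z. if p \<in> line_poles C M z I then line_res r A B t u C M z I p / (w - p) else 0))"
    unfolding split_sum_def
  proof (rule sum.cong[OF refl])
    fix I assume "I \<in> splits a A B C"
    then have I: "I \<subseteq> C" by (rule splits_subset)
    have w': "w \<notin> line_poles C M z I" using w line_poles_subset[OF I] by blast
    have "(\<Sum>p\<in>line_poles C M z I. line_res r A B t u C M z I p / (w - p)) =
      (\<Sum>p\<in>all_poles C M z. if p \<in> line_poles C M z I then line_res r A B t u C M z I p / (w - p) else 0)"
      using line_poles_subset[OF I, of M z] finite_all_poles[OF C(1), of M z]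
      by (intro sum.mono_neutral_cong_left) auto
    then show "split_term r A B t u C (merge M z w) I = poly (line_quot r A B t u C M z I) w +
      (\<Sum>p\<in>all_poles C M z. if p \<in> line_poles C M z I then line_res r A B t u C M z I p / (w - p) else 0)"
      unfolding split_term_line[OF C I w'] partial_fraction[OF finite_line_poles[OF C(1) I] w']
        line_quot_def line_res_def by simp
  qed
  also have "\<dots> = poly (\<Sum>I\<in>splits a A B C. line_quot r A B t u C M z I) w +
    (\<Sum>p\<in>all_poles C M z. \<Sum>I\<in>splits a A B C.
       if p \<in> line_poles C M z I then line_res r A B t u C M z I p / (w - p) else 0)"
    unfolding sum.distrib poly_sum by (subst (2) sum.swap) (rule refl)
  also have "(\<Sum>p\<in>all_poles C M z. \<Sum>I\<in>splits a A B C.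
       if p \<in> line_poles C M z I then line_res r A B t u C M z I p / (w - p) else 0)
    = (\<Sum>p\<in>all_poles C M z. pole_res r a A B t u C M z p / (w - p))"
    unfolding pole_res_def sum_divide_distrib
    using C(1) by (intro sum.cong[OF refl] sum.mono_neutral_cong_right) auto
  finally show ?thesis .
qed

section \<open>Symmetry of the residues\<close>

definition sep_term ::
  "'f::field \<Rightarrow> bool \<Rightarrow> bool \<Rightarrow> 'f \<Rightarrow> 'f \<Rightarrow> nat set \<Rightarrow> (nat \<Rightarrow> 'f) \<Rightarrow> nat \<Rightarrow> nat \<Rightarrow> nat set \<Rightarrow> 'f" where
  "sep_term r A B t u C y i j I =
     (if odd j = A then t - y j else 1) * (if odd i = B then u - 1 - y i else 1) *
     (\<Prod>l\<in>C - I. om r (odd i = odd l) (y i - y l)) * (\<Prod>k\<in>I. om r (odd k = odd j) (y k - y j)) *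
     split_term r A B t u C y I"

lemma excess_Diff: "finite C \<Longrightarrow> I \<subseteq> C \<Longrightarrow> excess (C - I) = excess C - excess I"
  unfolding excess_def by (rule sum_diff)

text \<open>Sets containing \<open>i\<close> but not \<open>j\<close> correspond to subsets of
  \<open>C - {i, j}\<close>. As \<open>i\<close> and \<open>j\<close> have equal parity, both halves
  lose the same sign, so the offset drops by \<open>parity_sign i\<close> for both.\<close>

lemma sum_separated:
  assumes C: "finite C" "generic (C - M) z" "transversal M"
    and ij: "i \<in> C" "j \<in> C" "i \<noteq> j" "odd i = odd j" and p: "p \<in> pden M z (i, j)"
  shows "(\<Sum>I | I \<in> splits a A B C \<and> i \<in> I \<and> j \<notin> I. line_res r A B t u C M z I p) =
    (\<Sum>I\<in>splits (a - parity_sign i) A B (C - {i, j}).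
      sep_term r A B t u (C - {i, j}) (merge M z p) i j I / (\<Prod>q\<in>pden M z (i, j) - {p}. p - q))"
proof (rule sum.reindex_bij_witness[of _ "insert i" "\<lambda>I. I - {i}"])
  fix I assume I: "I \<in> {I. I \<in> splits a A B C \<and> i \<in> I \<and> j \<notin> I}"
  then have IC: "I \<subseteq> C" by (auto dest: splits_subset)
  have fI: "finite I" using IC C(1) finite_subset by blast
  have e: "excess I = parity_sign i + excess (I - {i})"
    using I fI excess_insert[of "I - {i}" i] by (simp add: insert_absorb)
  have "C - I = insert j (C - {i, j} - (I - {i}))" using ij I by auto
  moreover have "excess (insert j (C - {i, j} - (I - {i}))) = parity_sign j + excess (C - {i, j} - (I - {i}))"
    using C(1) by (intro excess_insert) auto
  ultimately have e': "excess (C - I) = parity_sign i + excess (C - {i, j} - (I - {i}))"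
    using ij(4) by (simp add: parity_sign_def)
  show "insert i (I - {i}) = I" using I by auto
  show "I - {i} \<in> splits (a - parity_sign i) A B (C - {i, j})"
    using I e e' unfolding splits_def admissible_def by auto
  have C': "C = insert i (insert j (C - {i, j}))" using ij by auto
  have x: "i \<in> I" "j \<in> C - I" using I ij by auto
  have "line_res r A B t u C M z I p =
      (wt A (C - I) t (merge M z p) * wt B I (u - 1) (merge M z p) *
      (\<Prod>(k, l)\<in>I \<times> (C - I) - {(i, j)}. om r (odd k = odd l) (merge M z p k - merge M z p l))) *
      (1 / (\<Prod>q\<in>pden M z (i, j) - {p}. p - q))"
    using line_res_eq[OF C IC x p, of r A B t u] by simp
  also have "wt A (C - I) t (merge M z p) * wt B I (u - 1) (merge M z p) *
      (\<Prod>(k, l)\<in>I \<times> (C - I) - {(i, j)}. om r (odd k = odd l) (merge M z p k - merge M z p l))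
    = sep_term r A B t u (C - {i, j}) (merge M z p) i j (I - {i})"
    unfolding sep_term_def split_term_def
    by (rule cross_insert_insert[OF _ _ _ ij(3) _ C']) (use C(1) IC I x in auto)
  finally show "sep_term r A B t u (C - {i, j}) (merge M z p) i j (I - {i}) /
      (\<Prod>q\<in>pden M z (i, j) - {p}. p - q) = line_res r A B t u C M z I p" by simp
next
  fix I assume I: "I \<in> splits (a - parity_sign i) A B (C - {i, j})"
  then have IC: "I \<subseteq> C - {i, j}" by (rule splits_subset)
  have fI: "finite I" using IC C(1) finite_subset by blast
  have e: "excess (insert i I) = parity_sign i + excess I"
    using IC fI by (intro excess_insert) auto
  have "C - insert i I = insert j (C - {i, j} - I)" using ij IC by auto
  moreover have "excess (insert j (C - {i, j} - I)) = parity_sign j + excess (C - {i, j} - I)"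
    using C(1) by (intro excess_insert) auto
  ultimately have e': "excess (C - insert i I) = parity_sign i + excess (C - {i, j} - I)"
    using ij(4) by (simp add: parity_sign_def)
  show "insert i I - {i} = I" using IC by auto
  show "insert i I \<in> {I. I \<in> splits a A B C \<and> i \<in> I \<and> j \<notin> I}"
    using I IC e e' ij unfolding splits_def admissible_def by auto
qed

text \<open>By \<open>om_reflect\<close> the factors of \<open>i\<close> against
  \<open>C - I\<close> and those of \<open>I\<close> against \<open>j\<close> merge into one product
  over all of \<open>C\<close>. The prefactor then depends no longer on \<open>I\<close> and is
  symmetric in (A, t) and (B, u).\<close>

lemma sep_term_shifted:
  assumes "finite C" "I \<subseteq> C" "odd i = odd j" "y j = y i + 1"
  shows "sep_term r A B t u C y i j I =
    ((if odd j = A then t - y j else 1) * (if odd j = B then u - y j else 1) *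
     (\<Prod>l\<in>C. om r (odd l = odd j) (y l - y j))) * split_term r A B t u C y I"
proof -
  have "om r (odd i = odd l) (y i - y l) = om r (odd l = odd j) (y l - y j)" for l
  proof -
    have "y i - y l = - 1 - (y l - y j)" using assms(4) by simp
    moreover have "(odd i = odd l) = (odd l = odd j)" using assms(3) by blast
    ultimately show ?thesis by (simp only: om_reflect)
  qed
  then have P: "(\<Prod>l\<in>C. om r (odd l = odd j) (y l - y j)) =
      (\<Prod>l\<in>C - I. om r (odd i = odd l) (y i - y l)) * (\<Prod>k\<in>I. om r (odd k = odd j) (y k - y j))"
    using prod.subset_diff[OF assms(2,1), of "\<lambda>l. om r (odd l = odd j) (y l - y j)"] by simp
  have u: "u - 1 - y i = u - y j" using assms(4) by simp
  show ?thesis unfolding sep_term_def P u assms(3) by (simp only: mult.assoc)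
qed

lemma generic_subset: "generic C z \<Longrightarrow> D \<subseteq> C \<Longrightarrow> generic D z"
  unfolding generic_def by blast

lemma transversalD: "transversal M \<Longrightarrow> c \<in> M \<Longrightarrow> d \<in> M \<Longrightarrow> odd c = odd d \<Longrightarrow> c = d"
  unfolding transversal_def by blast

text \<open>At the pole the merged value is an integer away from z_k, hence not from any other
  variable. So the variables left after removing \<open>c\<close> and \<open>k\<close> are generic
  and the induction hypothesis applies to them.\<close>

lemma generic_merge:
  assumes g: "generic (C - M) z" and M: "transversal M" and k: "k \<in> C - M" and c: "c \<in> M"
    and p: "p - z k \<in> \<int>"
  shows "generic (C - {c, k}) (merge M z p)"
proof -
  have pz: "p - z l \<notin> \<int>" if "l \<in> C - M" "l \<noteq> k" for l
  proof
    assume "p - z l \<in> \<int>"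
    then have "(p - z l) - (p - z k) \<in> \<int>" using p by (rule Ints_diff)
    then have "z k - z l \<in> \<int>" by simp
    then have "k = l" using generic_eqD[OF g k that(1)] by simp
    then show False using that(2) by simp
  qed
  then have zp: "z l - p \<notin> \<int>" if "l \<in> C - M" "l \<noteq> k" for l
    using pz[OF that] Ints_minus[of "z l - p"] by (metis minus_diff_eq)
  have M1: "i = j" if "i \<in> M - {c}" "j \<in> M - {c}" for i j
  proof -
    have ne: "odd l \<noteq> odd c" if "l \<in> M" "l \<noteq> c" for l
      using transversalD[OF M that(1) c] that(2) by iprover
    have "odd i \<noteq> odd c" "odd j \<noteq> odd c"
      using ne[of i] ne[of j] that by simp_all
    then have "odd i = odd j" by argo
    with that show ?thesis by (intro transversalD[OF M, of i j]) simp_all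
  qed
  show ?thesis
    unfolding generic_def
  proof (intro ballI impI)
    fix i j assume ij: "i \<in> C - {c, k}" "j \<in> C - {c, k}" "i \<noteq> j"
    consider "i \<in> M" "j \<in> M" | "i \<in> M" "j \<notin> M" | "i \<notin> M" "j \<in> M" | "i \<notin> M" "j \<notin> M" by blast
    then show "merge M z p i - merge M z p j \<notin> \<int>"
    proof cases
      case 1 then show ?thesis using M1[of i j] ij by blast
    next
      case 2 then show ?thesis using pz[of j] ij by (simp add: merge_def)
    next
      case 3 then show ?thesis using zp[of i] ij by (simp add: merge_def)
    next
      case 4 then show ?thesis using generic_eqD[OF g, of i j] ij by (auto simp: merge_def)
    qed
  qed
qed

text \<open>At z_k - 1 and at z_k + 1 only one orientation of the pair c, k is singular, and the
  residue is a symmetric factor times a split sum over \<open>C - {c, k}\<close>, which is symmetric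
  by induction. At z_k both orientations occur and cancel.\<close>

lemma pole_res_sym:
  fixes z :: "nat \<Rightarrow> 'f::field_char_0"
  assumes C: "finite C" "generic (C - M) z" "transversal M" and MC: "M \<subseteq> C"
    and IH: "\<And>D b y. D \<subset> C \<Longrightarrow> generic D y \<Longrightarrow> split_sum r b A B t u D y = split_sum r b B A u t D y"
    and p: "p \<in> all_poles C M z"
  shows "pole_res r a A B t u C M z p = pole_res r a B A u t C M z p"
proof -
  obtain k c where k: "k \<in> C - M" and pk: "p \<in> {z k - 1, z k, z k + 1}"
    and c: "c \<in> M" "odd c = odd k"
    using p unfolding all_poles_def by blast
  have pz: "p - z k \<in> \<int>" using pk by auto
  show ?thesis
  proof -
    have uniq: "d = c" if "d \<in> M" "odd d = odd k" for d
      using transversalD[OF C(3), of d c] that c by auto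
    have ck: "c \<in> C" "k \<in> C" "c \<noteq> k" "c \<notin> C - M" using c k MC by auto
    have yc: "merge M z p c = p" and yk: "merge M z p k = z k" using c k by (auto simp: merge_def)
    have pd: "pden M z (c, k) = {z k, z k - 1}" "pden M z (k, c) = {z k, z k + 1}"
      using c k by (auto simp: pden_def)
    have ne: "z k \<noteq> z k - 1" "z k \<noteq> z k + 1" "z k - 1 \<noteq> z k + 1" by (simp_all add: eq_diff_eq)
    have in1: "p \<in> line_poles C M z I" if "I \<subseteq> C" "c \<in> I" "k \<notin> I" "p \<in> {z k, z k - 1}" for I
      using that pd ck unfolding line_poles_def by (intro UN_I[of "(c, k)"]) auto
    have in2: "p \<in> line_poles C M z I" if "I \<subseteq> C" "k \<in> I" "c \<notin> I" "p \<in> {z k, z k + 1}" for I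
      using that pd ck unfolding line_poles_def by (intro UN_I[of "(k, c)"]) auto
    have iff: "p \<in> line_poles C M z I \<longleftrightarrow>
        (c \<in> I \<and> k \<notin> I \<and> p \<in> {z k, z k - 1}) \<or> (k \<in> I \<and> c \<notin> I \<and> p \<in> {z k, z k + 1})"
      if I: "I \<subseteq> C" for I
    proof
      assume "p \<in> line_poles C M z I"
      then show "(c \<in> I \<and> k \<notin> I \<and> p \<in> {z k, z k - 1}) \<or> (k \<in> I \<and> c \<notin> I \<and> p \<in> {z k, z k + 1})"
        by (rule line_pole_cases[OF C(2,3) I k pz, rotated]) (use uniq c in blast)+
    qed (use in1[OF I] in2[OF I] in blast)
    have gen: "generic (C - {c, k}) (merge M z p)" by (rule generic_merge[OF C(2,3) k c(1) pz])
    have sub: "C - {c, k} \<subset> C" using ck by blast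
    have shifted: "pole_res r a A' B' t' u' C M z p =
        (\<Sum>I\<in>splits (a - parity_sign i) A' B' (C - {i, j}).
           sep_term r A' B' t' u' (C - {i, j}) (merge M z p) i j I / d)"
      if ij: "(i, j) = (c, k) \<or> (i, j) = (k, c)" and pij: "p \<in> pden M z (i, j)" and pn: "p \<notin> pden M z (j, i)"
        and d: "d = (\<Prod>q\<in>pden M z (i, j) - {p}. p - q)" for i j d A' B' t' u'
    proof -
      have "{I. I \<in> splits a A' B' C \<and> p \<in> line_poles C M z I} = {I. I \<in> splits a A' B' C \<and> i \<in> I \<and> j \<notin> I}"
        using iff[OF splits_subset] ij pij pn pd by auto
      then show ?thesis
        unfolding pole_res_def d using sum_separated[OF C _ _ _ _ pij, where a = a and A = A' and B = B' and r = r and t = t' and u = u'] ij ck c by auto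
    qed
    have main: ?thesis
      if ij: "(i, j) = (c, k) \<or> (i, j) = (k, c)" and pij: "p \<in> pden M z (i, j)" and pn: "p \<notin> pden M z (j, i)"
        and y: "merge M z p j = merge M z p i + 1" for i j
    proof -
      define y where "y = merge M z p"
      define d where "d = (\<Prod>q\<in>pden M z (i, j) - {p}. p - q)"
      have o: "odd i = odd j" using ij c by auto
      have Cij: "C - {i, j} = C - {c, k}" using ij by auto
      have fin: "finite (C - {c, k})" using C(1) by simp
      let ?K = "\<lambda>A B t u. (if odd j = A then t - y j else 1) * (if odd j = B then u - y j else 1) *
        (\<Prod>l\<in>C - {c, k}. om r (odd l = odd j) (y l - y j))"
      have P: "pole_res r a A' B' t' u' C M z p
        = ?K A' B' t' u' / d * split_sum r (a - parity_sign i) A' B' t' u' (C - {c, k}) y" for A' B' t' u'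
      proof -
        have "pole_res r a A' B' t' u' C M z p = (\<Sum>I\<in>splits (a - parity_sign i) A' B' (C - {c, k}).
           sep_term r A' B' t' u' (C - {c, k}) y i j I / d)"
          using shifted[OF ij pij pn d_def] unfolding Cij y_def .
        also have "\<dots> = (\<Sum>I\<in>splits (a - parity_sign i) A' B' (C - {c, k}).
           ?K A' B' t' u' / d * split_term r A' B' t' u' (C - {c, k}) y I)"
        proof (rule sum.cong[OF refl])
          fix I assume "I \<in> splits (a - parity_sign i) A' B' (C - {c, k})"
          then have "I \<subseteq> C - {c, k}" by (rule splits_subset)
          then have "sep_term r A' B' t' u' (C - {c, k}) y i j I
            = ?K A' B' t' u' * split_term r A' B' t' u' (C - {c, k}) y I"
            by (rule sep_term_shifted[where y = y, OF fin _ o]) (use y in \<open>simp add: y_def\<close>)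
          then show "sep_term r A' B' t' u' (C - {c, k}) y i j I / d
            = ?K A' B' t' u' / d * split_term r A' B' t' u' (C - {c, k}) y I" by simp
        qed
        finally show ?thesis unfolding split_sum_def sum_distrib_left .
      qed
      have K: "?K A B t u = ?K B A u t" by (simp only: mult_ac)
      show ?thesis unfolding P K IH[OF sub gen[folded y_def]] ..
    qed
    consider "p = z k - 1" | "p = z k" | "p = z k + 1" using pk by blast
    then show ?thesis
    proof cases
      case 1
      show ?thesis
        by (rule main[of c k]) (use 1 ne pd yc yk in auto)
    next
      case 3
      show ?thesis
        by (rule main[of k c]) (use 3 ne pd yc yk in auto)
    next
      case 2
      \<comment> \<open>The remaining pole of the pair lies below or above z_k according to the
        orientation, which gives the two residues opposite signs.\<close>
      have d1: "(\<Prod>q\<in>pden M z (c, k) - {p}. p - q) = 1" unfolding pd 2 using ne by simp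
      have d2: "(\<Prod>q\<in>pden M z (k, c) - {p}. p - q) = - 1" unfolding pd 2 using ne by simp
      have zero: "pole_res r a A' B' t' u' C M z p = 0" for A' B' t' u'
      proof -
        let ?S = "\<lambda>i j. {I. I \<in> splits a A' B' C \<and> i \<in> I \<and> j \<notin> I}"
        have "{I. I \<in> splits a A' B' C \<and> p \<in> line_poles C M z I} = ?S c k \<union> ?S k c"
          using iff[OF splits_subset] 2 by auto
        then have "pole_res r a A' B' t' u' C M z p =
          (\<Sum>I\<in>?S c k. line_res r A' B' t' u' C M z I p) + (\<Sum>I\<in>?S k c. line_res r A' B' t' u' C M z I p)"
          unfolding pole_res_def using C(1)
          by (simp only:) (rule sum.union_disjoint, auto)
        also have "(\<Sum>I\<in>?S c k. line_res r A' B' t' u' C M z I p) =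
          (\<Sum>I\<in>splits (a - parity_sign c) A' B' (C - {c, k}). sep_term r A' B' t' u' (C - {c, k}) (merge M z p) c k I)"
          using sum_separated[OF C ck(1,2,3) c(2), where p = p and a = a and A = A' and B = B' and r = r and t = t' and u = u'] unfolding d1 by (simp add: pd 2)
        also have "(\<Sum>I\<in>?S k c. line_res r A' B' t' u' C M z I p) =
          - (\<Sum>I\<in>splits (a - parity_sign k) A' B' (C - {k, c}). sep_term r A' B' t' u' (C - {k, c}) (merge M z p) k c I)"
          using sum_separated[OF C ck(2,1) ck(3)[symmetric] c(2)[symmetric], where p = p and a = a and A = A' and B = B' and r = r and t = t' and u = u'] unfolding d2
          by (simp add: pd 2 sum_negf)
        also have "parity_sign k = parity_sign c" using c(2) by (simp add: parity_sign_def)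
        also have "C - {k, c} = C - {c, k}" by auto
        \<comment> \<open>At p = z_k the variables of \<open>c\<close> and \<open>k\<close>
          coincide, so the two may be exchanged.\<close>
        also have "sep_term r A' B' t' u' (C - {c, k}) (merge M z p) k c
          = sep_term r A' B' t' u' (C - {c, k}) (merge M z p) c k"
          unfolding sep_term_def using yc yk 2 c(2) by auto
        finally show ?thesis by simp
      qed
      show ?thesis unfolding zero ..
    qed
  qed
qed

section \<open>Degrees of numerators and denominators along the line\<close>

definition qnum :: "'f::field \<Rightarrow> (nat \<Rightarrow> 'f) \<Rightarrow> bool \<Rightarrow> nat \<Rightarrow> 'f poly" where
  "qnum r z side l = (if side then [:r - z l, 1:] * [:1 - r - z l, 1:]
     else [:z l + r, - 1:] * [:z l + 1 - r, - 1:])"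

text \<open>\<open>side\<close> holds if the merged index lies in \<open>I\<close> and
  \<open>l\<close> outside, and fails in the opposite case. This is the denominator for equal
  parities, \<open>qnum\<close> the numerator for opposite ones.\<close>

definition qden :: "(nat \<Rightarrow> 'f::field) \<Rightarrow> bool \<Rightarrow> nat \<Rightarrow> 'f poly" where
  "qden z side l = (if side then [:- z l, 1:] * [:- (z l - 1), 1:] else [:- z l, 1:] * [:- (z l + 1), 1:])"

text \<open>This is (D + r)(D + 1 - r) = D(D + 1) + r(1 - r): the difference is two degrees below
  the leading term.\<close>

lemma qnum_eq: "qnum r z side l = qden z side l + [:r * (1 - r):]"
  unfolding qnum_def qden_def by (simp add: algebra_simps)

lemma monic_qden: "degree (qden z side l) = 2" "lead_coeff (qden z side l) = 1"
  unfolding qden_def by simp_all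

lemma monic_qnum: "degree (qnum r z side l) = 2" "lead_coeff (qnum r z side l) = 1"
  unfolding qnum_def by simp_all

lemma monic_prod:
  fixes f :: "nat \<Rightarrow> 'f::field poly"
  assumes "finite L" "\<And>l. l \<in> L \<Longrightarrow> degree (f l) = 2 \<and> lead_coeff (f l) = 1"
  shows "degree (prod f L) = 2 * card L" "lead_coeff (prod f L) = 1"
proof -
  have "\<forall>l\<in>L. f l \<noteq> 0" using assms(2) by fastforce
  then have "degree (prod f L) = (\<Sum>l\<in>L. degree (f l))" by (intro degree_prod_sum_eq) simp
  then show "degree (prod f L) = 2 * card L" using assms(2) by simp
  show "lead_coeff (prod f L) = 1" unfolding lead_coeff_prod
    by (rule prod.neutral) (use assms(2) in blast)
qed

text \<open>Every term of the expanded difference has a quadratic factor replaced by a constant, so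
  two degrees are lost. The zero polynomial needs its own alternative because its
  \<open>degree\<close> is 0.\<close>

lemma degree_prod_shift:
  fixes f :: "nat \<Rightarrow> 'f::field poly"
  assumes "finite L" "\<And>l. l \<in> L \<Longrightarrow> degree (f l) = 2 \<and> lead_coeff (f l) = 1"
  shows "(\<Prod>l\<in>L. f l + [:k:]) - prod f L = 0 \<or>
    degree ((\<Prod>l\<in>L. f l + [:k:]) - prod f L) + 2 \<le> 2 * card L"
  using assms
proof (induction L rule: finite_induct)
  case (insert m L)
  let ?X = "\<Prod>l\<in>L. f l + [:k:]" and ?Y = "prod f L"
  have eq: "(\<Prod>l\<in>insert m L. f l + [:k:]) - prod f (insert m L)
    = (f m + [:k:]) * (?X - ?Y) + smult k ?Y"
    using insert(1,2) by (simp add: algebra_simps)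
  have Y: "degree (smult k ?Y) \<le> 2 * card L"
    using monic_prod(1)[OF insert(1), of f] insert(4) degree_smult_le[of k ?Y] by (metis insertCI)
  have m: "degree (f m + [:k:]) \<le> 2"
    using insert(4)[of m] by (intro degree_add_le) auto
  have "degree ((f m + [:k:]) * (?X - ?Y)) \<le> 2 * card L"
  proof (cases "?X - ?Y = 0")
    case False
    then have "degree (?X - ?Y) + 2 \<le> 2 * card L" using insert by blast
    then show ?thesis using degree_mult_le[of "f m + [:k:]" "?X - ?Y"] m by linarith
  qed simp
  then have "degree ((f m + [:k:]) * (?X - ?Y) + smult k ?Y) \<le> 2 * card L"
    using Y by (rule degree_add_le)
  then show ?case unfolding eq using insert(1,2) by simp
qed simp

lemma prod_pnum_fixed:
  assumes "finite I" "finite J" "I \<inter> M = {}" "J \<inter> M = {}"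
  shows "(\<Prod>x\<in>I \<times> J. pnum M z r x) = [:cross r I J z:]"
proof -
  have "(\<Prod>x\<in>I \<times> J. pnum M z r x) = (\<Prod>x\<in>I \<times> J. [:case x of (i, j) \<Rightarrow> om r (odd i = odd j) (z i - z j):])"
    by (rule prod.cong[OF refl]) (use assms in \<open>auto simp: pnum_def\<close>)
  then show ?thesis unfolding cross_def by (simp add: prod_to_poly)
qed

lemma prod_pnum_left:
  assumes "c \<in> M" "J \<inter> M = {}" "finite J"
  shows "(\<Prod>l\<in>J. pnum M z r (c, l)) = (\<Prod>l | l \<in> J \<and> odd l \<noteq> odd c. qnum r z True l)"
proof -
  have "(\<Prod>l\<in>J. pnum M z r (c, l)) = (\<Prod>l\<in>J. if odd l \<noteq> odd c then qnum r z True l else 1)"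
    by (rule prod.cong[OF refl]) (use assms in \<open>auto simp: pnum_def qnum_def\<close>)
  then show ?thesis using assms(3) by (simp add: prod.inter_filter)
qed

lemma prod_pnum_right:
  assumes "c \<in> M" "I \<inter> M = {}" "finite I"
  shows "(\<Prod>l\<in>I. pnum M z r (l, c)) = (\<Prod>l | l \<in> I \<and> odd l \<noteq> odd c. qnum r z False l)"
proof -
  have "(\<Prod>l\<in>I. pnum M z r (l, c)) = (\<Prod>l\<in>I. if odd l \<noteq> odd c then qnum r z False l else 1)"
    by (rule prod.cong[OF refl]) (use assms in \<open>auto simp: pnum_def qnum_def\<close>)
  then show ?thesis using assms(3) by (simp add: prod.inter_filter)
qed

lemma prod_pden_left:
  assumes "c \<in> M" "J \<inter> M = {}" "finite J"
  shows "(\<Prod>l\<in>J. \<Prod>q\<in>pden M z (c, l). [:-q, 1:]) = (\<Prod>l | l \<in> J \<and> odd l = odd c. qden z True l)"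
proof -
  have "(\<Prod>l\<in>J. \<Prod>q\<in>pden M z (c, l). [:-q, 1:]) = (\<Prod>l\<in>J. if odd l = odd c then qden z True l else 1)"
  proof (rule prod.cong[OF refl])
    fix l assume l: "l \<in> J"
    have "z l \<noteq> z l - 1" by simp
    then show "(\<Prod>q\<in>pden M z (c, l). [:-q, 1:]) = (if odd l = odd c then qden z True l else 1)"
      using assms l by (auto simp: pden_def qden_def)
  qed
  then show ?thesis using assms(3) by (simp add: prod.inter_filter)
qed

lemma prod_pden_right:
  assumes "c \<in> M" "I \<inter> M = {}" "finite I"
  shows "(\<Prod>l\<in>I. \<Prod>q\<in>pden M z (l, c). [:-q, 1:]) = (\<Prod>l | l \<in> I \<and> odd l = odd c. qden z False l)"
proof -
  have "(\<Prod>l\<in>I. \<Prod>q\<in>pden M z (l, c). [:-q, 1:]) = (\<Prod>l\<in>I. if odd l = odd c then qden z False l else 1)"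
  proof (rule prod.cong[OF refl])
    fix l assume l: "l \<in> I"
    have "z l \<noteq> z l + 1" by simp
    then show "(\<Prod>q\<in>pden M z (l, c). [:-q, 1:]) = (if odd l = odd c then qden z False l else 1)"
      using assms l by (auto simp: pden_def qden_def)
  qed
  then show ?thesis using assms(3) by (simp add: prod.inter_filter)
qed

lemma line_wt_split:
  assumes "finite T"
  shows "line_wt A M T t z = [:wt A (T - M) t z:] * (\<Prod>c | c \<in> T \<inter> M \<and> odd c = A. [:t, - 1:])"
proof -
  have "{i \<in> T. odd i = A} = {i. i \<in> T - M \<and> odd i = A} \<union> {c. c \<in> T \<inter> M \<and> odd c = A}" by auto
  then have "line_wt A M T t z
    = (\<Prod>i \<in> {i. i \<in> T - M \<and> odd i = A} \<union> {c. c \<in> T \<inter> M \<and> odd c = A}. if i \<in> M then [:t, - 1:] else [:t - z i:])"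
    unfolding line_wt_def by simp
  also have "\<dots> = (\<Prod>i | i \<in> T - M \<and> odd i = A. if i \<in> M then [:t, - 1:] else [:t - z i:]) *
     (\<Prod>i | i \<in> T \<inter> M \<and> odd i = A. if i \<in> M then [:t, - 1:] else [:t - z i:])"
    using assms by (intro prod.union_disjoint) auto
  also have "(\<Prod>i | i \<in> T - M \<and> odd i = A. if i \<in> M then [:t, - 1:] else [:t - z i:])
    = (\<Prod>i | i \<in> T - M \<and> odd i = A. [:t - z i:])"
    by (rule prod.cong) auto
  also have "\<dots> = [:wt A (T - M) t z:]" unfolding wt_def by (rule prod_to_poly)
  also have "(\<Prod>i | i \<in> T \<inter> M \<and> odd i = A. if i \<in> M then [:t, - 1:] else [:t - z i:])
    = (\<Prod>c | c \<in> T \<inter> M \<and> odd c = A. [:t, - 1:])"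
    by (rule prod.cong) auto
  finally show ?thesis .
qed

lemma prod_times_split:
  fixes f :: "nat \<times> nat \<Rightarrow> 'c::comm_monoid_mult"
  assumes "finite I" "finite J"
  shows "(\<Prod>x\<in>I \<times> J. f x) = (\<Prod>x\<in>(I - M) \<times> (J - M). f x) * (\<Prod>c\<in>I \<inter> M. \<Prod>l\<in>J - M. f (c, l)) *
    (\<Prod>c\<in>J \<inter> M. \<Prod>l\<in>I - M. f (l, c)) * (\<Prod>x\<in>(I \<inter> M) \<times> (J \<inter> M). f x)"
proof -
  have I: "(\<Prod>i\<in>I. g i) = (\<Prod>i\<in>I - M. g i) * (\<Prod>i\<in>I \<inter> M. g i)" for g :: "nat \<Rightarrow> 'c"
    using prod.Int_Diff[OF assms(1), of g M] by (simp add: mult.commute)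
  have J: "(\<Prod>i\<in>J. g i) = (\<Prod>i\<in>J - M. g i) * (\<Prod>i\<in>J \<inter> M. g i)" for g :: "nat \<Rightarrow> 'c"
    using prod.Int_Diff[OF assms(2), of g M] by (simp add: mult.commute)
  have c: "(\<Prod>x\<in>X \<times> Y. f x) = (\<Prod>i\<in>X. \<Prod>j\<in>Y. f (i, j))" for X Y
    by (simp add: prod.cartesian_product)
  show ?thesis
    unfolding c I J prod.distrib prod.swap[of _ "I - M" "J \<inter> M"] by (simp only: mult_ac)
qed

lemma line_num_split:
  assumes C: "finite C" and I: "I \<subseteq> C"
  shows "line_num r A B t u C M z I = smult (split_term r A B t u (C - M) z (I - M))
    ((\<Prod>c | c \<in> (C - I) \<inter> M \<and> odd c = A. [:t, - 1:]) * (\<Prod>c | c \<in> I \<inter> M \<and> odd c = B. [:u - 1, - 1:]) *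
     (\<Prod>x\<in>(I \<inter> M) \<times> ((C - I) \<inter> M). pnum M z r x) *
     (\<Prod>c\<in>I \<inter> M. \<Prod>l | l \<in> C - I - M \<and> odd l \<noteq> odd c. qnum r z True l) *
     (\<Prod>c\<in>(C - I) \<inter> M. \<Prod>l | l \<in> I - M \<and> odd l \<noteq> odd c. qnum r z False l))"
proof -
  have fin: "finite I" "finite (C - I)" using C I finite_subset by auto
  have L: "(\<Prod>c\<in>I \<inter> M. \<Prod>l\<in>C - I - M. pnum M z r (c, l))
    = (\<Prod>c\<in>I \<inter> M. \<Prod>l | l \<in> C - I - M \<and> odd l \<noteq> odd c. qnum r z True l)"
    by (intro prod.cong refl prod_pnum_left) (use fin in auto)
  have R: "(\<Prod>c\<in>(C - I) \<inter> M. \<Prod>l\<in>I - M. pnum M z r (l, c))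
    = (\<Prod>c\<in>(C - I) \<inter> M. \<Prod>l | l \<in> I - M \<and> odd l \<noteq> odd c. qnum r z False l)"
    by (intro prod.cong refl prod_pnum_right) (use fin in auto)
  have F: "(\<Prod>x\<in>(I - M) \<times> (C - I - M). pnum M z r x) = [:cross r (I - M) (C - I - M) z:]"
    by (rule prod_pnum_fixed) (use fin in auto)
  have D: "C - M - (I - M) = C - I - M" by auto
  show ?thesis
    unfolding line_num_def line_wt_split[OF fin(1)] line_wt_split[OF fin(2)]
      prod_times_split[OF fin, of "pnum M z r" M] L R F split_term_def D
    by (simp add: mult_ac)
qed

lemma line_den_split:
  assumes C: "finite C" "generic (C - M) z" "transversal M" and I: "I \<subseteq> C"
  shows "(\<Prod>q\<in>line_poles C M z I. [:-q, 1:]) =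
     (\<Prod>c\<in>I \<inter> M. \<Prod>l | l \<in> C - I - M \<and> odd l = odd c. qden z True l) *
     (\<Prod>c\<in>(C - I) \<inter> M. \<Prod>l | l \<in> I - M \<and> odd l = odd c. qden z False l)"
proof -
  have fin: "finite I" "finite (C - I)" using C I finite_subset by auto
  let ?f = "\<lambda>x. \<Prod>q\<in>pden M z x. [:-q, 1:]"
  have L: "(\<Prod>c\<in>I \<inter> M. \<Prod>l\<in>C - I - M. ?f (c, l))
    = (\<Prod>c\<in>I \<inter> M. \<Prod>l | l \<in> C - I - M \<and> odd l = odd c. qden z True l)"
    by (intro prod.cong refl prod_pden_left) (use fin in auto)
  have R: "(\<Prod>c\<in>(C - I) \<inter> M. \<Prod>l\<in>I - M. ?f (l, c))
    = (\<Prod>c\<in>(C - I) \<inter> M. \<Prod>l | l \<in> I - M \<and> odd l = odd c. qden z False l)"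
    by (intro prod.cong refl prod_pden_right) (use fin in auto)
  have F: "(\<Prod>x\<in>(I - M) \<times> (C - I - M). ?f x) = 1"
    by (rule prod.neutral) (auto simp: pden_def)
  have G: "(\<Prod>x\<in>(I \<inter> M) \<times> ((C - I) \<inter> M). ?f x) = 1"
    by (rule prod.neutral) (auto simp: pden_def)
  show ?thesis
    unfolding prod_line_poles[OF C I] prod_times_split[OF fin, of ?f M] L R F G by simp
qed

text \<open>For a merged \<open>c\<close> against \<open>L\<close>, equal parities give quadratic
  denominators and opposite parities quadratic numerators. The left side is thus half the amount by
  which the degree of the denominator exceeds that of the numerator.\<close>

lemma parity_excess:
  assumes "finite L"
  shows "parity_sign c * excess L = int (card {l\<in>L. odd l = odd c}) - int (card {l\<in>L. odd l \<noteq> odd c})"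
  using assms
proof (induction L rule: finite_induct)
  case (insert m L)
  have e: "parity_sign c * excess (insert m L) = parity_sign c * parity_sign m + parity_sign c * excess L"
    using insert(1,2) by (simp add: distrib_left)
  show ?case
  proof (cases "odd m = odd c")
    case True
    then have "{l\<in>insert m L. odd l = odd c} = insert m {l\<in>L. odd l = odd c}"
      "{l\<in>insert m L. odd l \<noteq> odd c} = {l\<in>L. odd l \<noteq> odd c}" by blast+
    moreover have "parity_sign c * parity_sign m = 1" using True by (simp add: parity_sign_def)
    ultimately show ?thesis using insert(1,2,3) e by simp
  next
    case False
    then have "{l\<in>insert m L. odd l = odd c} = {l\<in>L. odd l = odd c}"
      "{l\<in>insert m L. odd l \<noteq> odd c} = insert m {l\<in>L. odd l \<noteq> odd c}" by blast+
    moreover have "parity_sign c * parity_sign m = - 1" using False by (simp add: parity_sign_def)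
    ultimately show ?thesis using insert(1,2,3) e by simp
  qed
qed simp

text \<open>A weight raises the degree of the numerator by at most one, while \<open>e\<close>
  counts degrees in steps of two. So \<open>e \<ge> 1\<close> leaves no quotient, and
  \<open>e = 0\<close> leaves a constant or a linear polynomial with known leading
  coefficient.\<close>

lemma quot_monic_cases:
  fixes P X :: "'f::field poly"
  assumes P: "degree P = 2 * m" "lead_coeff P = 1" and X: "degree X = 2 * k" "lead_coeff X = 1"
    and N: "N = smult b ((if lin then [:s, - 1:] else 1) * X)"
    and e: "e = int m - int k"
  shows "e \<ge> 1 \<Longrightarrow> N div P = 0"
    "e = 0 \<Longrightarrow> \<not> lin \<Longrightarrow> N div P = [:b:]"
    "e = 0 \<Longrightarrow> lin \<Longrightarrow> degree (N div P) \<le> 1 \<and> coeff (N div P) 1 = - b"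
proof -
  assume "e \<ge> 1"
  have "degree N \<le> degree ((if lin then [:s, - 1:] else 1) * X)" unfolding N by (rule degree_smult_le)
  also have "\<dots> \<le> degree (if lin then [:s, - 1:] else 1) + degree X" by (rule degree_mult_le)
  also have "\<dots> \<le> 1 + 2 * k" unfolding X(1) by simp
  also have "\<dots> < degree P" using \<open>e \<ge> 1\<close> e P(1) by simp
  finally show "N div P = 0" by (rule div_poly_less)
next
  assume "e = 0" "\<not> lin"
  then show "N div P = [:b:]" unfolding N using div_monic_same[OF P(2) X(2)] P(1) X(1) e by simp
next
  assume "e = 0" "lin"
  then show "degree (N div P) \<le> 1 \<and> coeff (N div P) 1 = - b" unfolding N
    using div_monic_same_linear[OF P(2) X(2), of b s] P(1) X(1) e by simp
qed

lemma monic_prod_qden: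
  assumes "finite L"
  shows "degree (\<Prod>l | l \<in> L \<and> Q l. qden z side l) = 2 * card {l \<in> L. Q l}"
    "lead_coeff (\<Prod>l | l \<in> L \<and> Q l. qden z side l) = 1"
  by (rule monic_prod; use assms monic_qden in \<open>simp; fail | blast\<close>)+

lemma monic_prod_qnum:
  assumes "finite L"
  shows "degree (\<Prod>l | l \<in> L \<and> Q l. qnum r z side l) = 2 * card {l \<in> L. Q l}"
    "lead_coeff (\<Prod>l | l \<in> L \<and> Q l. qnum r z side l) = 1"
  by (rule monic_prod; use assms monic_qnum in \<open>simp; fail | blast\<close>)+

lemma transversal_singleton [simp]: "transversal {c}"
  unfolding transversal_def by simp

lemma single_quot_in:
  assumes C: "finite C" "generic (C - {c}) z" and I: "I \<subseteq> C" "c \<in> I"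
    and b: "b = split_term r A B t u (C - {c}) z (I - {c})"
  shows "parity_sign c * excess (C - I) \<ge> 1 \<Longrightarrow> line_quot r A B t u C {c} z I = 0"
    "excess (C - I) = 0 \<Longrightarrow> odd c \<noteq> B \<Longrightarrow> line_quot r A B t u C {c} z I = [:b:]"
    "excess (C - I) = 0 \<Longrightarrow> odd c = B \<Longrightarrow> degree (line_quot r A B t u C {c} z I) \<le> 1 \<and>
        coeff (line_quot r A B t u C {c} z I) 1 = - b"
proof -
  define L where "L = C - I"
  have L: "finite L" using C(1) unfolding L_def by simp
  have s: "I \<inter> {c} = {c}" "(C - I) \<inter> {c} = {}" "C - I - {c} = L" using I unfolding L_def by auto
  have w: "{c'. c' \<in> {c} \<and> odd c' = B} = (if odd c = B then {c} else {})" by auto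
  have N: "line_num r A B t u C {c} z I = smult b ((if odd c = B then [:u - 1, - 1:] else 1) *
      (\<Prod>l | l \<in> L \<and> odd l \<noteq> odd c. qnum r z True l))"
    unfolding line_num_split[OF C(1) I(1)] b s w by simp
  have P: "(\<Prod>q\<in>line_poles C {c} z I. [:-q, 1:]) = (\<Prod>l | l \<in> L \<and> odd l = odd c. qden z True l)"
    unfolding line_den_split[OF C transversal_singleton I(1)] s by simp
  note q = quot_monic_cases[OF monic_prod_qden[OF L] monic_prod_qnum[OF L] N parity_excess[OF L],
      of z True, folded P, folded line_quot_def]
  show "parity_sign c * excess (C - I) \<ge> 1 \<Longrightarrow> line_quot r A B t u C {c} z I = 0"
    using q(1) unfolding L_def .
  show "excess (C - I) = 0 \<Longrightarrow> odd c \<noteq> B \<Longrightarrow> line_quot r A B t u C {c} z I = [:b:]"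
    using q(2) unfolding L_def by simp
  show "excess (C - I) = 0 \<Longrightarrow> odd c = B \<Longrightarrow> degree (line_quot r A B t u C {c} z I) \<le> 1 \<and>
        coeff (line_quot r A B t u C {c} z I) 1 = - b"
    using q(3) unfolding L_def by simp
qed

lemma single_quot_out:
  assumes C: "finite C" "generic (C - {c}) z" and I: "I \<subseteq> C" "c \<in> C - I"
    and b: "b = split_term r A B t u (C - {c}) z I"
  shows "parity_sign c * excess I \<ge> 1 \<Longrightarrow> line_quot r A B t u C {c} z I = 0"
    "excess I = 0 \<Longrightarrow> odd c \<noteq> A \<Longrightarrow> line_quot r A B t u C {c} z I = [:b:]"
    "excess I = 0 \<Longrightarrow> odd c = A \<Longrightarrow> degree (line_quot r A B t u C {c} z I) \<le> 1 \<and>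
        coeff (line_quot r A B t u C {c} z I) 1 = - b"
proof -
  have L: "finite I" using C(1) I finite_subset by blast
  have s: "I \<inter> {c} = {}" "(C - I) \<inter> {c} = {c}" "I - {c} = I" using I by auto
  have w: "{c'. c' \<in> {c} \<and> odd c' = A} = (if odd c = A then {c} else {})" by auto
  have N: "line_num r A B t u C {c} z I = smult b ((if odd c = A then [:t, - 1:] else 1) *
      (\<Prod>l | l \<in> I \<and> odd l \<noteq> odd c. qnum r z False l))"
    unfolding line_num_split[OF C(1) I(1)] b s w by simp
  have P: "(\<Prod>q\<in>line_poles C {c} z I. [:-q, 1:]) = (\<Prod>l | l \<in> I \<and> odd l = odd c. qden z False l)"
    unfolding line_den_split[OF C transversal_singleton I(1)] s by simp
  note q = quot_monic_cases[OF monic_prod_qden[OF L] monic_prod_qnum[OF L] N parity_excess[OF L],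
      of z False, folded P, folded line_quot_def]
  show "parity_sign c * excess I \<ge> 1 \<Longrightarrow> line_quot r A B t u C {c} z I = 0"
    using q(1) .
  show "excess I = 0 \<Longrightarrow> odd c \<noteq> A \<Longrightarrow> line_quot r A B t u C {c} z I = [:b:]"
    using q(2) by simp
  show "excess I = 0 \<Longrightarrow> odd c = A \<Longrightarrow> degree (line_quot r A B t u C {c} z I) \<le> 1 \<and>
        coeff (line_quot r A B t u C {c} z I) 1 = - b"
    using q(3) by simp
qed

section \<open>The polynomial part with one merged variable\<close>

definition boundary_weight :: "bool \<Rightarrow> bool \<Rightarrow> nat set \<Rightarrow> nat set \<Rightarrow> 'f::field" where
  "boundary_weight A B C I = of_bool (B \<and> excess (C - I) = 0) + of_bool (A \<and> excess I = 0)"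

text \<open>Each half has excess \<open>a\<close> or \<open>a + 1\<close>, the latter only with its
  flag. For a = 0 and a = -1 the total excess therefore determines how many flagged halves have
  excess 0, and symmetrically in \<open>A\<close> and \<open>B\<close>.\<close>

lemma boundary_weight_const:
  assumes "finite C" "a = 0 \<or> a = - 1"
  obtains \<kappa> :: "'f::field" where
    "\<And>I. I \<in> splits a A B C \<Longrightarrow> boundary_weight A B C I = \<kappa>"
    "\<And>I. I \<in> splits a B A C \<Longrightarrow> boundary_weight B A C I = \<kappa>"
proof -
  \<comment> \<open>With both flags, total excess 2a + 1 means that exactly one half has excess 0.
    With one flag, the other half has excess \<open>a\<close>, so the total is \<open>a\<close>
    exactly when the flagged half has excess 0.\<close>
  define \<kappa> where "\<kappa> A B = (if A \<and> B then (if excess C = 0 then 2 else of_bool (excess C = 2 * a + 1))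
    else of_bool ((A \<or> B) \<and> excess C = a) :: 'f)" for A B
  have weight: "of_bool (B \<and> j = 0) + of_bool (A \<and> i = 0) = \<kappa> A B"
    if "admissible a A i" "admissible a B j" "excess C = i + j" for i j A B
  proof -
    have "i = a \<or> A \<and> i = a + 1" "j = a \<or> B \<and> j = a + 1" using that unfolding admissible_def by auto
    then show ?thesis using assms(2) that(3) unfolding \<kappa>_def
      by (elim disjE conjE; cases A; cases B; simp)
  qed
  have "boundary_weight A' B' C I = \<kappa> A' B'" if "I \<in> splits a A' B' C" for I A' B'
    unfolding boundary_weight_def
  proof (rule weight)
    show "admissible a A' (excess I)" "admissible a B' (excess (C - I))"
      using that unfolding splits_def by auto
    show "excess C = excess I + excess (C - I)"
      using excess_Diff[OF assms(1) splits_subset[OF that]] by simp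
  qed
  moreover have "\<kappa> B A = \<kappa> A B" unfolding \<kappa>_def by (simp add: conj_commute disj_commute)
  ultimately show ?thesis using that[of "\<kappa> A B"] by metis
qed

text \<open>The residues of the two sums agree by \<open>pole_res_sym\<close>, so in their
  difference only the polynomial parts remain.\<close>

lemma split_diff_line:
  fixes z :: "nat \<Rightarrow> 'f::field_char_0"
  assumes C: "finite C" "generic (C - M) z" "transversal M" and MC: "M \<subseteq> C"
    and IH: "\<And>D b y. D \<subset> C \<Longrightarrow> generic D y \<Longrightarrow> split_sum r b A B t u D y = split_sum r b B A u t D y"
    and w: "w \<notin> all_poles C M z"
  shows "split_sum r a A B t u C (merge M z w) - split_sum r a B A u t C (merge M z w) =
    poly ((\<Sum>I\<in>splits a A B C. line_quot r A B t u C M z I) -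
      (\<Sum>I\<in>splits a B A C. line_quot r B A u t C M z I)) w"
proof -
  have "(\<Sum>p\<in>all_poles C M z. pole_res r a A B t u C M z p / (w - p))
    = (\<Sum>p\<in>all_poles C M z. pole_res r a B A u t C M z p / (w - p))"
    by (rule sum.cong[OF refl]) (simp add: pole_res_sym[OF C MC IH])
  then show ?thesis
    unfolding split_sum_line[OF C w] by simp
qed

lemma merge_self: "merge {c} z (z c) = z"
  by (auto simp: merge_def fun_eq_iff)

lemma notin_all_poles:
  assumes "generic C z" "c \<in> C" "M \<subseteq> C" "\<And>k. k \<in> C - M \<Longrightarrow> \<exists>d\<in>M. odd d = odd k \<Longrightarrow> k \<noteq> c"
  shows "z c \<notin> all_poles C M z"
proof
  assume "z c \<in> all_poles C M z"
  then obtain k where k: "k \<in> C - M" "\<exists>d\<in>M. odd d = odd k" "z c \<in> {z k - 1, z k, z k + 1}"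
    unfolding all_poles_def by blast
  then have "z c - z k \<in> \<int>" by auto
  then have "c = k" using generic_eqD[OF assms(1,2), of k] k by auto
  then show False using assms(4) k by blast
qed

text \<open>The positivity makes every quotient vanish, so the sums agree along the line, in
  particular at \<open>w = z c\<close>, where the line passes through the given point.\<close>

lemma split_diff_zero:
  fixes z :: "nat \<Rightarrow> 'f::field_char_0"
  assumes C: "finite C" "generic C z" "c \<in> C"
    and IH: "\<And>D b y. D \<subset> C \<Longrightarrow> generic D y \<Longrightarrow> split_sum r b A B t u D y = split_sum r b B A u t D y"
    and pos: "\<And>I A' B'. (A', B') = (A, B) \<or> (A', B') = (B, A) \<Longrightarrow> I \<in> splits a A' B' C \<Longrightarrow>
      (if c \<in> I then parity_sign c * excess (C - I) \<ge> 1 else parity_sign c * excess I \<ge> 1)"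
  shows "split_sum r a A B t u C z = split_sum r a B A u t C z"
proof -
  have g: "generic (C - {c}) z" using C(2) by (rule generic_subset) auto
  have q: "line_quot r A' B' t' u' C {c} z I = 0"
    if "I \<in> splits a A' B' C" "(A', B') = (A, B) \<or> (A', B') = (B, A)" for I A' B' t' u'
    using pos[OF that(2,1)] single_quot_in(1)[OF C(1) g splits_subset[OF that(1)] _ refl]
      single_quot_out(1)[OF C(1) g splits_subset[OF that(1)] _ refl] C(3) by (auto split: if_splits)
  have w: "z c \<notin> all_poles C {c} z"
    by (rule notin_all_poles[OF C(2,3)]) (use C(3) in auto)
  have s: "(\<Sum>I\<in>splits a A B C. line_quot r A B t u C {c} z I) = 0"
    "(\<Sum>I\<in>splits a B A C. line_quot r B A u t C {c} z I) = 0"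
    using q by auto
  show ?thesis
    using split_diff_line[OF C(1) g transversal_singleton _ IH w, of a] C(3) unfolding merge_self s by simp
qed

text \<open>The coefficient that the split term of \<open>I\<close> leaves in the quotient: it is
  nonzero only if the half without \<open>c\<close> has its flag set and excess 0.\<close>

definition boundary_term ::
  "'f::field \<Rightarrow> bool \<Rightarrow> bool \<Rightarrow> 'f \<Rightarrow> 'f \<Rightarrow> nat set \<Rightarrow> nat \<Rightarrow> (nat \<Rightarrow> 'f) \<Rightarrow> nat set \<Rightarrow> 'f" where
  "boundary_term r A B t u C c z I = (if c \<in> I
     then of_bool (B \<and> excess (C - I) = 0) * split_term r A B t u (C - {c}) z (I - {c})
     else of_bool (A \<and> excess I = 0) * split_term r A B t u (C - {c}) z I)"

text \<open>A subset of \<open>C - {c}\<close> can arise with \<open>c\<close> added to either half,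
  and each origin counts when the other half has its flag set and excess 0. Adding up both origins
  gives \<open>boundary_weight\<close>.\<close>

lemma sum_boundary_term:
  assumes C: "finite C" "c \<in> C" and a: "a = 0 \<or> a = - 1" and a': "a' = a - parity_sign c" "a' = 0 \<or> a' = - 1"
  shows "(\<Sum>I\<in>splits a A B C. boundary_term r A B t u C c z I) =
    (\<Sum>I\<in>splits a' A B (C - {c}). boundary_weight A B (C - {c}) I * split_term r A B t u (C - {c}) z I)"
proof -
  let ?C = "C - {c}"
  let ?f = "split_term r A B t u ?C z"
  have Cc: "C = insert c ?C" using C(2) by auto
  have fin: "finite (splits a A B C)" "finite (splits a' A B ?C)" using C(1) by auto
  have "(\<Sum>I\<in>splits a A B C. boundary_term r A B t u C c z I)
    = (\<Sum>I | I \<in> splits a A B C \<and> c \<in> I. boundary_term r A B t u C c z I)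
    + (\<Sum>I | I \<in> splits a A B C \<and> c \<notin> I. boundary_term r A B t u C c z I)"
    using fin(1) by (subst sum.union_disjoint[symmetric]) (auto intro!: sum.cong)
  also have "(\<Sum>I | I \<in> splits a A B C \<and> c \<in> I. boundary_term r A B t u C c z I)
    = (\<Sum>I | I \<in> splits a A B C \<and> c \<in> I \<and> B \<and> excess (C - I) = 0. ?f (I - {c}))"
    by (rule sum.mono_neutral_cong_right) (use fin in \<open>auto simp: boundary_term_def\<close>)
  also have "\<dots> = (\<Sum>I | I \<in> splits a' A B ?C \<and> B \<and> excess (?C - I) = 0. ?f I)"
  proof (rule sum.reindex_bij_witness[of _ "insert c" "\<lambda>I. I - {c}"])
    fix I assume I: "I \<in> {I. I \<in> splits a A B C \<and> c \<in> I \<and> B \<and> excess (C - I) = 0}"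
    then have IC: "I \<subseteq> C" by (auto dest: splits_subset)
    then have fI: "finite I" using C(1) finite_subset by blast
    have e: "excess I = parity_sign c + excess (I - {c})"
      using I fI excess_insert[of "I - {c}" c] by (simp add: insert_absorb)
    have d: "?C - (I - {c}) = C - I" using I by auto
    show "insert c (I - {c}) = I" using I by auto
    show "I - {c} \<in> {I. I \<in> splits a' A B ?C \<and> B \<and> excess (?C - I) = 0}"
      using I IC a' unfolding splits_def admissible_def mem_Collect_eq d e by auto
    show "?f (I - {c}) = ?f (I - {c})" ..
  next
    fix I assume I: "I \<in> {I. I \<in> splits a' A B ?C \<and> B \<and> excess (?C - I) = 0}"
    then have IC: "I \<subseteq> ?C" by (auto dest: splits_subset)
    then have fI: "finite I" using C(1) finite_subset by blast
    have e: "excess (insert c I) = parity_sign c + excess I" using IC fI by (intro excess_insert) auto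
    have d: "C - insert c I = ?C - I" by auto
    show "insert c I - {c} = I" using IC by auto
    show "insert c I \<in> {I. I \<in> splits a A B C \<and> c \<in> I \<and> B \<and> excess (C - I) = 0}"
      using I IC C a a' unfolding splits_def admissible_def mem_Collect_eq d e by auto
  qed
  also have "\<dots> = (\<Sum>I\<in>splits a' A B ?C. of_bool (B \<and> excess (?C - I) = 0) * ?f I)"
    by (rule sum.mono_neutral_cong_left) (use fin in auto)
  also have "(\<Sum>I | I \<in> splits a A B C \<and> c \<notin> I. boundary_term r A B t u C c z I)
    = (\<Sum>I | I \<in> splits a A B C \<and> c \<notin> I \<and> A \<and> excess I = 0. ?f I)"
    by (rule sum.mono_neutral_cong_right) (use fin in \<open>auto simp: boundary_term_def\<close>)
  also have "{I. I \<in> splits a A B C \<and> c \<notin> I \<and> A \<and> excess I = 0} = {I. I \<in> splits a' A B ?C \<and> A \<and> excess I = 0}"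
  proof -
    have e: "excess (C - I) = parity_sign c + excess (?C - I)" if "I \<subseteq> C" "c \<notin> I" for I
    proof -
      have "C - I = insert c (?C - I)" using that C(2) by auto
      then show ?thesis using excess_insert[of "?C - I" c] C(1) by simp
    qed
    have "I \<in> splits a A B C \<and> c \<notin> I \<and> A \<and> excess I = 0 \<longleftrightarrow> I \<in> splits a' A B ?C \<and> A \<and> excess I = 0" for I
    proof (cases "I \<subseteq> C \<and> c \<notin> I")
      case True
      then have "I \<subseteq> ?C" by auto
      then show ?thesis using True e[of I] a a' unfolding splits_def admissible_def by auto
    next
      case False
      then show ?thesis unfolding splits_def by auto
    qed
    then show ?thesis by blast
  qed
  also have "(\<Sum>I | I \<in> splits a' A B ?C \<and> A \<and> excess I = 0. ?f I)
    = (\<Sum>I\<in>splits a' A B ?C. of_bool (A \<and> excess I = 0) * ?f I)"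
    by (rule sum.mono_neutral_cong_left) (use fin in auto)
  finally show ?thesis
    unfolding boundary_weight_def by (simp only: distrib_right sum.distrib)
qed

lemma boundary_sum_sym:
  fixes z :: "nat \<Rightarrow> 'f::field_char_0"
  assumes C: "finite C" "c \<in> C" and a: "a = 0 \<or> a = - 1" and a': "a' = a - parity_sign c" "a' = 0 \<or> a' = - 1"
    and IH: "split_sum r a' A B t u (C - {c}) z = split_sum r a' B A u t (C - {c}) z"
  shows "(\<Sum>I\<in>splits a A B C. boundary_term r A B t u C c z I) =
    (\<Sum>I\<in>splits a B A C. boundary_term r B A u t C c z I)"
proof -
  obtain \<kappa> :: 'f where \<kappa>: "\<And>I. I \<in> splits a' A B (C - {c}) \<Longrightarrow> boundary_weight A B (C - {c}) I = \<kappa>"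
    "\<And>I. I \<in> splits a' B A (C - {c}) \<Longrightarrow> boundary_weight B A (C - {c}) I = \<kappa>"
    using boundary_weight_const[of "C - {c}" a' A B] C(1) a'(2) by blast
  have "(\<Sum>I\<in>splits a A B C. boundary_term r A B t u C c z I) = \<kappa> * split_sum r a' A B t u (C - {c}) z"
    unfolding sum_boundary_term[OF C a a'] split_sum_def sum_distrib_left
    by (rule sum.cong[OF refl]) (simp add: \<kappa>)
  moreover have "(\<Sum>I\<in>splits a B A C. boundary_term r B A u t C c z I) = \<kappa> * split_sum r a' B A u t (C - {c}) z"
    unfolding sum_boundary_term[OF C a a'] split_sum_def sum_distrib_left
    by (rule sum.cong[OF refl]) (simp add: \<kappa>)
  ultimately show ?thesis using IH by simp
qed

text \<open>For even \<open>c\<close>, opposite a half of excess -1 the quotient vanishes. Excess 0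
  requires the flag of that half, so the flag differs from the parity of \<open>c\<close> and no
  linear weight occurs: a constant remains.\<close>

lemma quot_step_neg:
  assumes C: "finite C" "generic (C - {c}) z" "c \<in> C" "even c" and I: "I \<in> splits (- 1) A B C"
  shows "line_quot r A B t u C {c} z I = [:boundary_term r A B t u C c z I:]"
proof -
  have IC: "I \<subseteq> C" using I by (rule splits_subset)
  have p: "parity_sign c = - 1" using C(4) by (simp add: parity_sign_def)
  show ?thesis
  proof (cases "c \<in> I")
    case True
    have "excess (C - I) = - 1 \<or> B \<and> excess (C - I) = 0" using I unfolding splits_def admissible_def by auto
    then show ?thesis
      using single_quot_in(1,2)[OF C(1,2) IC True refl, where A = A and B = B and r = r and t = t and u = u] True C(4) p
      by (auto simp: boundary_term_def)
  next
    case False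
    have "excess I = - 1 \<or> A \<and> excess I = 0" using I unfolding splits_def admissible_def by auto
    then show ?thesis
      using single_quot_out(1,2)[OF C(1,2) IC _ refl, where A = A and B = B and r = r and t = t and u = u] False C(3,4) p
      by (auto simp: boundary_term_def)
  qed
qed

text \<open>For odd \<open>c\<close>, opposite a half of excess 1 the quotient vanishes. Opposite a
  half of excess 0 it is linear if the flag of that half is set, which then matches the parity of
  \<open>c\<close>, and constant otherwise.\<close>

lemma quot_step_zero:
  assumes C: "finite C" "generic (C - {c}) z" "c \<in> C" "odd c" and I: "I \<in> splits 0 A B C"
  shows "degree (line_quot r A B t u C {c} z I) \<le> 1 \<and>
    coeff (line_quot r A B t u C {c} z I) 1 = - boundary_term r A B t u C c z I"
proof -
  have IC: "I \<subseteq> C" using I by (rule splits_subset)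
  have p: "parity_sign c = 1" using C(4) by (simp add: parity_sign_def)
  show ?thesis
  proof (cases "c \<in> I")
    case True
    have "excess (C - I) = 0 \<or> B \<and> excess (C - I) = 1" using I unfolding splits_def admissible_def by auto
    then show ?thesis
      using single_quot_in[OF C(1,2) IC True refl, where A = A and B = B and r = r and t = t and u = u] True C(4) p
      by (cases B) (auto simp: boundary_term_def)
  next
    case False
    have "excess I = 0 \<or> A \<and> excess I = 1" using I unfolding splits_def admissible_def by auto
    then show ?thesis
      using single_quot_out[OF C(1,2) IC _ refl, where A = A and B = B and r = r and t = t and u = u] False C(3,4) p
      by (cases A) (auto simp: boundary_term_def)
  qed
qed

section \<open>The polynomial part with a merged odd-even pair\<close>

definition pair_quot ::
  "'f::field \<Rightarrow> bool \<Rightarrow> bool \<Rightarrow> 'f \<Rightarrow> 'f \<Rightarrow> nat set \<Rightarrow> nat \<Rightarrow> nat \<Rightarrow> (nat \<Rightarrow> 'f) \<Rightarrow> nat set \<Rightarrow> 'f poly" where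
  "pair_quot r A B t u C x y z I =
     (if x \<in> I \<and> y \<in> I then smult (split_term r A B t u (C - {x, y}) z (I - {x, y})) [:u - 1, - 1:]
      else if x \<notin> I \<and> y \<notin> I then smult (split_term r A B t u (C - {x, y}) z I) [:t, - 1:]
      else 0)"

text \<open>The shift of the factors costs two degrees and the linear factor restores one, so the
  error stays below the degree of the divisor and the quotient is exactly the linear factor.\<close>

lemma div_shifted_prod:
  fixes d :: "nat \<Rightarrow> 'f::field poly"
  assumes "finite L" "\<And>l. l \<in> L \<Longrightarrow> degree (d l) = 2 \<and> lead_coeff (d l) = 1"
  shows "smult b ([:s, - 1:] * (\<Prod>l\<in>L. d l + [:k:])) div (prod d L) = smult b [:s, - 1:]"
proof -
  let ?P = "prod d L" and ?D = "(\<Prod>l\<in>L. d l + [:k:]) - prod d L"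
  have P: "degree ?P = 2 * card L" "lead_coeff ?P = 1" using monic_prod[OF assms] by auto
  then have P0: "?P \<noteq> 0" by auto
  have "smult b ([:s, - 1:] * ?D) div ?P = 0"
  proof (cases "?D = 0")
    case False
    then have "degree ?D + 2 \<le> 2 * card L" using degree_prod_shift[of L d k, OF assms] by blast
    moreover have "degree (smult b ([:s, - 1:] * ?D)) \<le> 1 + degree ?D"
      using degree_smult_le[of b "[:s, - 1:] * ?D"] degree_mult_le[of "[:s, - 1:]" ?D] by simp
    ultimately show ?thesis using P(1) by (intro div_poly_less) linarith
  qed simp
  moreover have "smult b ([:s, - 1:] * (\<Prod>l\<in>L. d l + [:k:])) = smult b [:s, - 1:] * ?P + smult b ([:s, - 1:] * ?D)"
    unfolding mult_smult_left smult_add_right[symmetric] distrib_left[symmetric] by simp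
  ultimately show ?thesis by (simp only: div_monic_mult_add[OF P0] add_0_right)
qed

lemma prod_both_parities:
  assumes "finite L" "odd x" "even y"
  shows "(\<Prod>l | l \<in> L \<and> odd l = odd x. f l) * (\<Prod>l | l \<in> L \<and> odd l = odd y. f l) = prod f L"
    "(\<Prod>l | l \<in> L \<and> odd l \<noteq> odd x. f l) * (\<Prod>l | l \<in> L \<and> odd l \<noteq> odd y. f l) = (prod f L :: 'c::comm_monoid_mult)"
proof -
  have "L = {l \<in> L. odd l} \<union> {l \<in> L. even l}" by auto
  then have "prod f L = prod f ({l \<in> L. odd l} \<union> {l \<in> L. even l})" by simp
  also have "\<dots> = prod f {l \<in> L. odd l} * prod f {l \<in> L. even l}"
    using assms(1) by (intro prod.union_disjoint) auto
  finally have *: "prod f L = prod f {l \<in> L. odd l} * prod f {l \<in> L. even l}" .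
  show "(\<Prod>l | l \<in> L \<and> odd l = odd x. f l) * (\<Prod>l | l \<in> L \<and> odd l = odd y. f l) = prod f L"
    using assms(2,3) * by simp
  show "(\<Prod>l | l \<in> L \<and> odd l \<noteq> odd x. f l) * (\<Prod>l | l \<in> L \<and> odd l \<noteq> odd y. f l) = prod f L"
    using assms(2,3) * by (simp add: mult.commute)
qed

text \<open>The factor of \<open>c\<close> against \<open>d\<close> is constant on the line, and
  \<open>less\<close> says that the weights cannot make up for the degree lost against all other
  indices. The 4 compensates for \<open>c\<close> and \<open>d\<close> being counted in the two
  excesses.\<close>

lemma line_quot_mixed:
  assumes C: "finite C" "generic (C - {c, d}) z" and cd: "odd c \<noteq> odd d" and IC: "I \<subseteq> C"
    and I: "c \<in> I" "d \<in> C - I"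
    and less: "of_bool (odd d = A) + of_bool (odd c = B) < 4 + 2 * (parity_sign c * (excess (C - I) - excess I))"
  shows "line_quot r A B t u C {c, d} z I = 0"
proof -
  have tr: "transversal {c, d}" using cd unfolding transversal_def by auto
  define J0 where "J0 = C - I - {c, d}"
  define I0 where "I0 = I - {c, d}"
  have fin: "finite I" "finite (C - I)" "finite J0" "finite I0"
    using C(1) IC finite_subset unfolding J0_def I0_def by auto
  have s: "I \<inter> {c, d} = {c}" "(C - I) \<inter> {c, d} = {d}" "C - I - {c, d} = J0" "I - {c, d} = I0"
    using I IC unfolding J0_def I0_def by auto
  have "C - I = insert d J0" "d \<notin> J0" "I = insert c I0" "c \<notin> I0" using I unfolding J0_def I0_def by auto
  then have e: "excess (C - I) = parity_sign d + excess J0" "excess I = parity_sign c + excess I0"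
    using excess_insert[OF fin(3), of d] excess_insert[OF fin(4), of c] by simp_all
  define X where "X = (\<Prod>l | l \<in> J0 \<and> odd l \<noteq> odd c. qnum r z True l)"
  define Y where "Y = (\<Prod>l | l \<in> I0 \<and> odd l \<noteq> odd d. qnum r z False l)"
  define X' where "X' = (\<Prod>l | l \<in> J0 \<and> odd l = odd c. qden z True l)"
  define Y' where "Y' = (\<Prod>l | l \<in> I0 \<and> odd l = odd d. qden z False l)"
  define W1 where "W1 = (\<Prod>c' | c' \<in> {d} \<and> odd c' = A. [:t, - 1:])"
  define W2 where "W2 = (\<Prod>c' | c' \<in> {c} \<and> odd c' = B. [:u - 1, - 1:])"
  have "{c'. c' \<in> {d} \<and> odd c' = A} = (if odd d = A then {d} else {})"
    "{c'. c' \<in> {c} \<and> odd c' = B} = (if odd c = B then {c} else {})" by auto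
  then have W: "degree W1 = of_bool (odd d = A)" "degree W2 = of_bool (odd c = B)"
    unfolding W1_def W2_def by simp_all
  have K: "degree (pnum {c, d} z r (c, d)) = 0" by (simp add: pnum_def)
  have deg: "degree X = 2 * card {l \<in> J0. odd l \<noteq> odd c}" "degree Y = 2 * card {l \<in> I0. odd l \<noteq> odd d}"
    "degree X' = 2 * card {l \<in> J0. odd l = odd c}" "degree Y' = 2 * card {l \<in> I0. odd l = odd d}"
    "lead_coeff X' = 1" "lead_coeff Y' = 1"
    unfolding X_def Y_def X'_def Y'_def
    by (rule monic_prod_qnum[OF fin(3)] monic_prod_qnum[OF fin(4)]
      monic_prod_qden[OF fin(3)] monic_prod_qden[OF fin(4)])+
  have N: "line_num r A B t u C {c, d} z I = smult (split_term r A B t u (C - {c, d}) z I0)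
     (W1 * W2 * pnum {c, d} z r (c, d) * X * Y)"
    unfolding line_num_split[OF C(1) IC] s W1_def W2_def X_def Y_def by simp
  have P: "(\<Prod>q\<in>line_poles C {c, d} z I. [:-q, 1:]) = X' * Y'"
    unfolding line_den_split[OF C tr IC] s X'_def Y'_def by simp
  have X'Y': "X' \<noteq> 0" "Y' \<noteq> 0" using deg by auto
  have "parity_sign d = - parity_sign c" using cd by (auto simp: parity_sign_def)
  moreover have "parity_sign c * parity_sign c = 1" by (simp add: parity_sign_def)
  ultimately have "parity_sign c * (excess (C - I) - excess I) =
    parity_sign c * excess J0 + parity_sign d * excess I0 - 2"
    unfolding e by (simp add: algebra_simps)
  then have "of_bool (odd d = A) + of_bool (odd c = B) <
    2 * (parity_sign c * excess J0 + parity_sign d * excess I0)" using less by simp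
  then have lt: "int (of_bool (odd d = A) + of_bool (odd c = B)) < int (degree (X' * Y')) - int (degree X + degree Y)"
    unfolding parity_excess[OF fin(3)] parity_excess[OF fin(4)] degree_mult_eq[OF X'Y'] deg by simp
  have "degree (line_num r A B t u C {c, d} z I) \<le> degree (W1 * W2 * pnum {c, d} z r (c, d) * X * Y)"
    unfolding N by (rule degree_smult_le)
  also have "\<dots> \<le> degree W1 + degree W2 + degree (pnum {c, d} z r (c, d)) + degree X + degree Y"
    by (intro order.trans[OF degree_mult_le] add_mono order.refl)
  also have "\<dots> < degree (X' * Y')" using lt unfolding W K by linarith
  finally show ?thesis unfolding line_quot_def P by (rule div_poly_less)
qed

text \<open>If the pair lies in one half, each index of the other half has equal parity with one
  member and opposite parity with the other. So it contributes one \<open>qden\<close> and one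
  \<open>qnum\<close>, which differ by a constant. If the pair is divided, the quotient is 0 for
  reasons of degree.\<close>

lemma line_quot_pair:
  assumes C: "finite C" "generic (C - {x, y}) z" and xy: "odd x" "even y" "x \<in> C" "y \<in> C"
    and I: "I \<in> splits a A B C"
  shows "line_quot r A B t u C {x, y} z I = pair_quot r A B t u C x y z I"
proof -
  have tr: "transversal {x, y}" using xy unfolding transversal_def by auto
  have IC: "I \<subseteq> C" using I by (rule splits_subset)
  have fin: "finite I" "finite (C - I)" using C(1) IC finite_subset by auto
  have ne: "x \<noteq> y" using xy by auto
  consider "x \<in> I" "y \<in> I" | "x \<notin> I" "y \<notin> I" | "x \<in> I" "y \<notin> I" | "x \<notin> I" "y \<in> I" by blast
  then show ?thesis
  proof cases
    case 1
    define L where "L = C - I"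
    have L: "finite L" unfolding L_def using fin by simp
    have s: "I \<inter> {x, y} = {x, y}" "(C - I) \<inter> {x, y} = {}" "C - I - {x, y} = L"
      using 1 unfolding L_def by auto
    have "{c. c \<in> {x, y} \<and> odd c = B} = (if B then {x} else {y})" using xy by auto
    then have w: "(\<Prod>c | c \<in> {x, y} \<and> odd c = B. [:u - 1, - 1:]) = [:u - 1, - 1:]" by simp
    have N: "line_num r A B t u C {x, y} z I = smult (split_term r A B t u (C - {x, y}) z (I - {x, y}))
      ([:u - 1, - 1:] * (\<Prod>l\<in>L. qden z True l + [:r * (1 - r):]))"
      unfolding line_num_split[OF C(1) IC] s w qnum_eq[symmetric]
      using ne prod_both_parities(2)[OF L xy(1,2), of "qnum r z True"] by simp
    have P: "(\<Prod>q\<in>line_poles C {x, y} z I. [:-q, 1:]) = prod (qden z True) L"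
      unfolding line_den_split[OF C tr IC] s
      using ne prod_both_parities(1)[OF L xy(1,2), of "qden z True"] by simp
    show ?thesis
      unfolding line_quot_def N P pair_quot_def
      using div_shifted_prod[OF L, of "qden z True"] monic_qden[of z True] 1 by simp
  next
    case 2
    have s: "I \<inter> {x, y} = {}" "(C - I) \<inter> {x, y} = {x, y}" "I - {x, y} = I"
      using 2 xy by auto
    have "{c. c \<in> {x, y} \<and> odd c = A} = (if A then {x} else {y})" using xy by auto
    then have w: "(\<Prod>c | c \<in> {x, y} \<and> odd c = A. [:t, - 1:]) = [:t, - 1:]" by simp
    have N: "line_num r A B t u C {x, y} z I = smult (split_term r A B t u (C - {x, y}) z I)
      ([:t, - 1:] * (\<Prod>l\<in>I. qden z False l + [:r * (1 - r):]))"
      unfolding line_num_split[OF C(1) IC] s w qnum_eq[symmetric]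
      using ne prod_both_parities(2)[OF fin(1) xy(1,2), of "qnum r z False"] by simp
    have P: "(\<Prod>q\<in>line_poles C {x, y} z I. [:-q, 1:]) = prod (qden z False) I"
      unfolding line_den_split[OF C tr IC] s
      using ne prod_both_parities(1)[OF fin(1) xy(1,2), of "qden z False"] by simp
    show ?thesis
      unfolding line_quot_def N P pair_quot_def
      using div_shifted_prod[OF fin(1), of "qden z False"] monic_qden[of z False] 2 by simp
  next
    case 3
    have e: "excess I = a \<or> A \<and> excess I = a + 1" "excess (C - I) = a \<or> B \<and> excess (C - I) = a + 1"
      using I unfolding splits_def admissible_def by auto
    have "line_quot r A B t u C {x, y} z I = 0"
    proof (rule line_quot_mixed[OF C(1) _ _ IC])
      show "of_bool (odd y = A) + of_bool (odd x = B) < 4 + 2 * (parity_sign x * (excess (C - I) - excess I))"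
        using e xy by (auto simp: parity_sign_def)
    qed (use C(2) xy 3 in auto)
    then show ?thesis using 3 by (simp add: pair_quot_def)
  next
    case 4
    have e: "excess I = a \<or> A \<and> excess I = a + 1" "excess (C - I) = a \<or> B \<and> excess (C - I) = a + 1"
      using I unfolding splits_def admissible_def by auto
    have "line_quot r A B t u C {y, x} z I = 0"
    proof (rule line_quot_mixed[OF C(1) _ _ IC])
      show "of_bool (odd x = A) + of_bool (odd y = B) < 4 + 2 * (parity_sign y * (excess (C - I) - excess I))"
        using e xy by (auto simp: parity_sign_def)
      show "generic (C - {y, x}) z" using C(2) by (simp add: insert_commute)
    qed (use xy 4 in auto)
    then show ?thesis using 4 by (simp add: pair_quot_def insert_commute)
  qed
qed

text \<open>The pair has excess 0, so the offset is unchanged. Each set of the smaller problem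
  occurs twice, with the pair in one half or in the other, whence the sum of the two linear
  weights.\<close>

lemma sum_pair_quot:
  assumes C: "finite C" and xy: "odd x" "even y" "x \<in> C" "y \<in> C"
  shows "(\<Sum>I\<in>splits a A B C. pair_quot r A B t u C x y z I) =
    smult (split_sum r a A B t u (C - {x, y}) z) ([:u - 1, - 1:] + [:t, - 1:])"
proof -
  let ?C = "C - {x, y}"
  let ?f = "split_term r A B t u ?C z"
  have ne: "x \<noteq> y" using xy by auto
  have fin: "finite (splits a A B C)" using C by simp
  have e2: "excess (insert x (insert y I)) = excess I" if "finite I" "x \<notin> I" "y \<notin> I" for I
    using that ne xy(1,2) by (simp add: parity_sign_def)
  have "(\<Sum>I\<in>splits a A B C. pair_quot r A B t u C x y z I) =
      (\<Sum>I | I \<in> splits a A B C \<and> x \<in> I \<and> y \<in> I. pair_quot r A B t u C x y z I)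
    + (\<Sum>I | I \<in> splits a A B C \<and> \<not> (x \<in> I \<and> y \<in> I). pair_quot r A B t u C x y z I)"
    using fin by (subst sum.union_disjoint[symmetric]) (auto intro!: sum.cong)
  also have "(\<Sum>I | I \<in> splits a A B C \<and> \<not> (x \<in> I \<and> y \<in> I). pair_quot r A B t u C x y z I)
    = (\<Sum>I | I \<in> splits a A B C \<and> x \<notin> I \<and> y \<notin> I. pair_quot r A B t u C x y z I)"
    by (rule sum.mono_neutral_right) (use fin in \<open>auto simp: pair_quot_def\<close>)
  also have "(\<Sum>I | I \<in> splits a A B C \<and> x \<notin> I \<and> y \<notin> I. pair_quot r A B t u C x y z I)
    = (\<Sum>I\<in>splits a A B ?C. smult (?f I) [:t, - 1:])"
  proof (rule sum.cong)
    show "{I. I \<in> splits a A B C \<and> x \<notin> I \<and> y \<notin> I} = splits a A B ?C"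
    proof -
      have "excess (C - I) = excess (?C - I)" if "I \<subseteq> ?C" for I
      proof -
        have "C - I = insert x (insert y (?C - I))" using that xy by auto
        then show ?thesis using e2[of "?C - I"] C by simp
      qed
      then have *: "I \<in> splits a A B C \<longleftrightarrow> I \<in> splits a A B ?C" if "I \<subseteq> ?C" for I
        using that unfolding splits_def by auto
      show ?thesis
      proof (intro set_eqI iffI)
        fix I assume I: "I \<in> {I. I \<in> splits a A B C \<and> x \<notin> I \<and> y \<notin> I}"
        then have "I \<subseteq> ?C" using splits_subset[of I a A B C] by auto
        then show "I \<in> splits a A B ?C" using *[of I] I by simp
      next
        fix I assume I: "I \<in> splits a A B ?C"
        then have "I \<subseteq> ?C" by (rule splits_subset)
        then show "I \<in> {I. I \<in> splits a A B C \<and> x \<notin> I \<and> y \<notin> I}" using *[of I] I by auto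
      qed
    qed
    fix I assume "I \<in> splits a A B ?C"
    then have "I \<subseteq> ?C" by (rule splits_subset)
    then show "pair_quot r A B t u C x y z I = smult (?f I) [:t, - 1:]" by (auto simp: pair_quot_def)
  qed
  also have "(\<Sum>I | I \<in> splits a A B C \<and> x \<in> I \<and> y \<in> I. pair_quot r A B t u C x y z I)
    = (\<Sum>I\<in>splits a A B ?C. smult (?f I) [:u - 1, - 1:])"
  proof (rule sum.reindex_bij_witness[of _ "\<lambda>I. insert x (insert y I)" "\<lambda>I. I - {x, y}"])
    fix I assume I: "I \<in> {I. I \<in> splits a A B C \<and> x \<in> I \<and> y \<in> I}"
    then have IC: "I \<subseteq> C" by (auto dest: splits_subset)
    then have fI: "finite I" using C finite_subset by blast
    have i: "insert x (insert y (I - {x, y})) = I" using I by auto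
    then show "insert x (insert y (I - {x, y})) = I" .
    have e: "excess I = excess (I - {x, y})" using e2[of "I - {x, y}"] fI i by simp
    have d: "?C - (I - {x, y}) = C - I" using I by auto
    show "I - {x, y} \<in> splits a A B ?C" using I IC e unfolding splits_def mem_Collect_eq d by auto
    show "smult (?f (I - {x, y})) [:u - 1, - 1:] = pair_quot r A B t u C x y z I"
      using I by (simp add: pair_quot_def)
  next
    fix I assume I: "I \<in> splits a A B ?C"
    then have IC: "I \<subseteq> ?C" by (rule splits_subset)
    then have fI: "finite I" using C finite_subset by blast
    show "insert x (insert y I) - {x, y} = I" using IC by auto
    have e: "excess (insert x (insert y I)) = excess I" using e2[of I] fI IC by auto
    have d: "C - insert x (insert y I) = ?C - I" by auto
    show "insert x (insert y I) \<in> {I. I \<in> splits a A B C \<and> x \<in> I \<and> y \<in> I}"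
      using I IC e xy unfolding splits_def mem_Collect_eq d by auto
  qed
  finally show ?thesis
    unfolding split_sum_def smult_sum[symmetric] by (simp only: smult_add_right)
qed

lemma split_diff_pair:
  fixes z :: "nat \<Rightarrow> 'f::field_char_0"
  assumes C: "finite C" "generic (C - {x, y}) z" and xy: "odd x" "even y" "x \<in> C" "y \<in> C"
    and IH: "\<And>D b y. D \<subset> C \<Longrightarrow> generic D y \<Longrightarrow> split_sum r b A B t u D y = split_sum r b B A u t D y"
    and w: "w \<notin> all_poles C {x, y} z"
  shows "split_sum r a A B t u C (merge {x, y} z w) = split_sum r a B A u t C (merge {x, y} z w)"
proof -
  have tr: "transversal {x, y}" using xy unfolding transversal_def by auto
  have q: "(\<Sum>I\<in>splits a A' B' C. line_quot r A' B' t' u' C {x, y} z I) =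
      smult (split_sum r a A' B' t' u' (C - {x, y}) z) ([:u' - 1, - 1:] + [:t', - 1:])" for A' B' t' u'
    unfolding sum_pair_quot[OF C(1) xy, symmetric] by (rule sum.cong[OF refl line_quot_pair[OF C xy]])
  \<comment> \<open>The shift by 1 belongs to the second operator, but only the sum t + u - 1 enters
    here.\<close>
  have "[:u - 1, - 1:] + [:t, - 1:] = [:t - 1, - 1:] + [:u, - 1:]" by simp
  moreover have "split_sum r a A B t u (C - {x, y}) z = split_sum r a B A u t (C - {x, y}) z"
    by (rule IH) (use C xy in auto)
  ultimately show ?thesis
    using split_diff_line[OF C tr _ IH w, of a] xy unfolding q by (simp add: algebra_simps)
qed

section \<open>Induction on the index set\<close>

lemma excess_parity:
  assumes "I \<subseteq> C"
  shows "\<forall>c\<in>C. odd c \<Longrightarrow> excess I = int (card I)" "\<forall>c\<in>C. even c \<Longrightarrow> excess I = - int (card I)"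
proof -
  assume "\<forall>c\<in>C. odd c"
  then have "excess I = (\<Sum>i\<in>I. 1)"
    unfolding excess_def using assms by (intro sum.cong) (auto simp: parity_sign_def)
  then show "excess I = int (card I)" by simp
next
  assume "\<forall>c\<in>C. even c"
  then have "excess I = (\<Sum>i\<in>I. - 1)"
    unfolding excess_def using assms by (intro sum.cong) (auto simp: parity_sign_def)
  then show "excess I = - int (card I)" by simp
qed

lemma splits_excess:
  "I \<in> splits a A B C \<Longrightarrow> (excess I = a \<or> A \<and> excess I = a + 1) \<and>
    (excess (C - I) = a \<or> B \<and> excess (C - I) = a + 1)"
  unfolding splits_def admissible_def by auto

lemma split_sum_empty_splits: "splits a A B C = {} \<Longrightarrow> split_sum r a A B t u C z = 0"
  unfolding split_sum_def by simp

text \<open>The offset decides which index is made variable. For a >= 1 an odd one and for a <= -2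
  an even one make all quotients vanish. For a = -1 an even one leaves constants that agree by
  induction. For a = 0 an odd one leaves linear polynomials whose linear coefficients agree by
  induction; if there is also an even index, the remaining constant is computed at the point where
  both variables coincide.\<close>

lemma split_sum_sym:
  fixes z :: "nat \<Rightarrow> 'f::field_char_0"
  assumes "finite C" "generic C z"
  shows "split_sum r a A B t u C z = split_sum r a B A u t C z"
  using assms
proof (induction C arbitrary: a z rule: finite_psubset_induct)
  case (psubset C)
  note C = psubset.hyps psubset.prems
  have IH: "split_sum r b A B t u D y = split_sum r b B A u t D y" if "D \<subset> C" "generic D y" for D b y
    using psubset.IH that by blast
  have g: "generic (C - M) z" for M using C(2) by (rule generic_subset) auto
  have IHc: "split_sum r b A B t u (C - {c}) z = split_sum r b B A u t (C - {c}) z" if "c \<in> C" for b c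
  proof (rule IH)
    show "C - {c} \<subset> C" using that by blast
  qed (rule g)
  have nonempty: ?case if empty: "\<And>A' B'. splits a A' B' C = {}"
    by (simp add: split_sum_empty_splits[OF empty])
  have fin: "finite I" "finite (C - I)" if "I \<in> splits a' A' B' C" for I A' B' a'
    using splits_subset[OF that] C(1) finite_subset by auto
  consider "C = {}" | "C \<noteq> {}" "a \<ge> 1" | "C \<noteq> {}" "a = 0" | "C \<noteq> {}" "a = - 1" | "a \<le> - 2" by linarith
  then show ?case
  proof cases
    case 1
    have "splits a A B {} = (if admissible a A 0 \<and> admissible a B 0 then {{}} else {})" for A B
      unfolding splits_def by auto
    then show ?thesis unfolding 1 split_sum_def by (auto simp: split_term_def wt_def cross_def)
  next
    case 2
    show ?thesis
    proof (cases "\<exists>c\<in>C. odd c")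
      case True
      then obtain c where c: "c \<in> C" "odd c" by blast
      show ?thesis
      proof (rule split_diff_zero[OF C c(1) IH])
        fix I A' B' assume I: "I \<in> splits a A' B' C"
        show "if c \<in> I then parity_sign c * excess (C - I) \<ge> 1 else parity_sign c * excess I \<ge> 1"
          using splits_excess[OF I] 2 c(2) by (auto simp: parity_sign_def)
      qed
    next
      case False
      have "I \<notin> splits a A' B' C" for I A' B'
      proof
        assume I: "I \<in> splits a A' B' C"
        have "excess I \<le> 0" using excess_parity(2)[OF splits_subset[OF I]] False by auto
        then show False using splits_excess[OF I] 2 by auto
      qed
      then show ?thesis by (intro nonempty) blast
    qed
  next
    case 5
    show ?thesis
    proof (cases "\<exists>c\<in>C. even c")
      case True
      then obtain c where c: "c \<in> C" "even c" by blast
      show ?thesis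
      proof (rule split_diff_zero[OF C c(1) IH])
        fix I A' B' assume I: "I \<in> splits a A' B' C"
        show "if c \<in> I then parity_sign c * excess (C - I) \<ge> 1 else parity_sign c * excess I \<ge> 1"
          using splits_excess[OF I] 5 c(2) by (auto simp: parity_sign_def)
      qed
    next
      case False
      have "I \<notin> splits a A' B' C" for I A' B'
      proof
        assume I: "I \<in> splits a A' B' C"
        have "excess I \<ge> 0" using excess_parity(1)[OF splits_subset[OF I]] False by auto
        then show False using splits_excess[OF I] 5 by auto
      qed
      then show ?thesis by (intro nonempty) blast
    qed
  next
    case 4
    show ?thesis
    proof (cases "\<exists>c\<in>C. even c")
      case True
      then obtain c where c: "c \<in> C" "even c" by blast
      have w: "z c \<notin> all_poles C {c} z" by (rule notin_all_poles[OF C(2) c(1)]) (use c in auto)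
      have q: "(\<Sum>I\<in>splits a A' B' C. line_quot r A' B' t' u' C {c} z I)
        = [:\<Sum>I\<in>splits a A' B' C. boundary_term r A' B' t' u' C c z I:]" for A' B' t' u'
        by (simp add: quot_step_neg[OF C(1) g c] 4(2) sum_to_poly)
      have "(\<Sum>I\<in>splits a A B C. boundary_term r A B t u C c z I) =
          (\<Sum>I\<in>splits a B A C. boundary_term r B A u t C c z I)"
        by (rule boundary_sum_sym[OF C(1) c(1) _ refl]) (use 4 c IHc in \<open>auto simp: parity_sign_def\<close>)
      then show ?thesis
        using split_diff_line[OF C(1) g transversal_singleton _ IH w, of a] c unfolding merge_self q by simp
    next
      case False
      have "I \<notin> splits a A' B' C" for I A' B'
      proof
        assume I: "I \<in> splits a A' B' C"
        have "excess I = int (card I)" "excess (C - I) = int (card (C - I))"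
          using excess_parity(1)[OF splits_subset[OF I]] excess_parity(1)[OF Diff_subset[of C I]] False by auto
        then have "card I = 0" "card (C - I) = 0" using splits_excess[OF I] 4 by auto
        then have "I = {}" "C - I = {}" using fin[OF I] by auto
        then show False using 4 by auto
      qed
      then show ?thesis by (intro nonempty) blast
    qed
  next
    case 3
    consider "\<forall>c\<in>C. even c" | c where "\<forall>c\<in>C. odd c" "C = {c}" | c d where "\<forall>c\<in>C. odd c" "c \<in> C" "d \<in> C" "c \<noteq> d"
      | x y where "odd x" "even y" "x \<in> C" "y \<in> C"
      using 3 by blast
    then show ?thesis
    proof cases
      case 1
      have "I \<notin> splits a A' B' C" for I A' B'
      proof
        assume I: "I \<in> splits a A' B' C"
        have "excess I = - int (card I)" "excess (C - I) = - int (card (C - I))"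
          using excess_parity(2)[OF splits_subset[OF I]] excess_parity(2)[OF Diff_subset[of C I]] 1 by auto
        then have "card I = 0" "card (C - I) = 0" using splits_excess[OF I] 3 by auto
        then have "I = {}" "C - I = {}" using fin[OF I] by auto
        then show False using 3 by auto
      qed
      then show ?thesis by (intro nonempty) blast
    next
      case 2
      then have c: "odd c" by auto
      \<comment> \<open>With both flags set this is t' + u' - 1 - 2 * z c, symmetric in t' and
        u'.\<close>
      have S: "split_sum r a A' B' t' u' C z =
        of_bool B' * (if A' then t' - z c else 1) + of_bool A' * (if B' then u' - 1 - z c else 1)" for A' B' t' u'
      proof -
        have e: "excess {c} = 1" using c by (simp add: excess_def parity_sign_def)
        have iff: "I \<in> splits a A' B' C \<longleftrightarrow> I = {} \<and> B' \<or> I = {c} \<and> A'" for I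
        proof -
          consider "I = {}" | "I = {c}" | "\<not> I \<subseteq> {c}" by blast
          then show ?thesis
            by cases (use 2(2) 3(2) e in \<open>auto simp: splits_def admissible_def\<close>)
        qed
        have "splits a A' B' C = (if B' then {{}} else {}) \<union> (if A' then {{c}} else {})"
          by (rule set_eqI) (simp add: iff)
        moreover have "wt X {c} s z = (if X then s - z c else 1)" for X s
        proof -
          have "{i. i \<in> {c} \<and> odd i = X} = (if X then {c} else {})" using c by auto
          then show ?thesis unfolding wt_def by simp
        qed
        moreover have "wt X {} s z = 1" for X s unfolding wt_def by simp
        ultimately show ?thesis
          unfolding split_sum_def 2(2) by (cases A'; cases B'; simp add: split_term_def cross_def)
      qed
      show ?thesis unfolding S by auto
    next
      case 3
      \<comment> \<open>At least two odd indices are shared out between halves of excess at most 1,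
        so each half receives exactly one.\<close>
      have le: "excess I = 1 \<and> excess (C - I) = 1" if I: "I \<in> splits a A' B' C" for I A' B'
      proof -
        have e: "excess I = int (card I)" "excess (C - I) = int (card (C - I))"
          using excess_parity(1)[OF splits_subset[OF I]] excess_parity(1)[OF Diff_subset[of C I]] 3 by auto
        have "card {c, d} \<le> card C" using 3 C(1) by (intro card_mono) auto
        then have "2 \<le> card C" using 3 by simp
        moreover have "card C = card I + card (C - I)"
          using card_Diff_subset[OF fin(1)[OF I] splits_subset[OF I]] card_mono[OF C(1) splits_subset[OF I]] by simp
        ultimately show ?thesis using splits_excess[OF I] e \<open>a = 0\<close> by auto
      qed
      show ?thesis
      proof (rule split_diff_zero[OF C 3(2) IH])
        fix I A' B' assume "I \<in> splits a A' B' C"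
        then show "if c \<in> I then parity_sign c * excess (C - I) \<ge> 1 else parity_sign c * excess I \<ge> 1"
          using le 3 by (simp add: parity_sign_def)
      qed
    next
      case 4
      have x: "x \<in> C" "odd x" using 4 by auto
      define H where "H w = split_sum r a A B t u C (merge {x} z w) - split_sum r a B A u t C (merge {x} z w)" for w
      define Q where "Q = (\<Sum>I\<in>splits a A B C. line_quot r A B t u C {x} z I) -
        (\<Sum>I\<in>splits a B A C. line_quot r B A u t C {x} z I)"
      have H: "H w = poly Q w" if "w \<notin> all_poles C {x} z" for w
        unfolding H_def Q_def
        by (rule split_diff_line[OF C(1) g transversal_singleton _ IH that]) (use x in auto)
      have q: "degree (\<Sum>I\<in>splits a A' B' C. line_quot r A' B' t' u' C {x} z I) \<le> 1"
        "coeff (\<Sum>I\<in>splits a A' B' C. line_quot r A' B' t' u' C {x} z I) 1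
        = - (\<Sum>I\<in>splits a A' B' C. boundary_term r A' B' t' u' C x z I)" for A' B' t' u'
      proof -
        have st: "degree (line_quot r A' B' t' u' C {x} z I) \<le> 1"
          "coeff (line_quot r A' B' t' u' C {x} z I) 1 = - boundary_term r A' B' t' u' C x z I"
          if "I \<in> splits a A' B' C" for I
          using quot_step_zero[OF C(1) g x, of I A' B'] that \<open>a = 0\<close> by blast+
        show "degree (\<Sum>I\<in>splits a A' B' C. line_quot r A' B' t' u' C {x} z I) \<le> 1"
          by (rule degree_sum_le[OF finite_splits[OF C(1)] st(1)])
        show "coeff (\<Sum>I\<in>splits a A' B' C. line_quot r A' B' t' u' C {x} z I) 1
          = - (\<Sum>I\<in>splits a A' B' C. boundary_term r A' B' t' u' C x z I)"
          unfolding coeff_sum sum_negf[symmetric] by (rule sum.cong[OF refl st(2)])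
      qed
      have b: "(\<Sum>I\<in>splits a A B C. boundary_term r A B t u C x z I) =
          (\<Sum>I\<in>splits a B A C. boundary_term r B A u t C x z I)"
        by (rule boundary_sum_sym[OF C(1) x(1) _ refl]) (use \<open>a = 0\<close> x IHc in \<open>auto simp: parity_sign_def\<close>)
      have "degree Q \<le> 1" unfolding Q_def using q(1) by (intro degree_diff_le) auto
      moreover have "coeff Q 1 = 0" unfolding Q_def coeff_diff q(2) b by simp
      ultimately have "degree Q = 0"
        by (metis One_nat_def le_Suc_eq le_zero_eq degree_0 leading_coeff_0_iff)
      then obtain k where Q: "Q = [:k:]" by (metis degree_eq_zeroE)
      have wx: "z x \<notin> all_poles C {x} z" by (rule notin_all_poles[OF C(2) x(1)]) (use x in auto)
      have wy: "z y \<notin> all_poles C {x} z" by (rule notin_all_poles[OF C(2) 4(4)]) (use 4 in auto)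
      have wxy: "z y \<notin> all_poles C {x, y} z" by (rule notin_all_poles[OF C(2) 4(4)]) (use 4 in auto)
      \<comment> \<open>Giving the odd variable the value \<open>z y\<close> leads to the line of
        the merged pair, where the difference vanishes. Since it is constant in the odd variable, it
        vanishes at \<open>z x\<close> too.\<close>
      have "merge {x} z (z y) = merge {x, y} z (z y)" by (auto simp: merge_def fun_eq_iff)
      then have "H (z y) = 0"
        unfolding H_def using split_diff_pair[OF C(1) g 4 IH wxy, of a] by simp
      then have "H (z x) = 0" using H[OF wx] H[OF wy] unfolding Q by simp
      then show ?thesis unfolding H_def merge_self by simp
    qed
  qed
qed

subsection \<open>Commuting Pieri operators\<close>

definition index_pairs :: "nat \<Rightarrow> (nat \<times> nat) set" where
  "index_pairs n = {(i, j). i \<in> {1..n} \<and> j \<in> {1..n} \<and> i < j}"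

text \<open>The factor of a pair i < j with i outside and j inside the raised set, in x = z_i - z_j.
  The second factor has x - 1 because j is raised.\<close>

definition gfac :: "'f::field \<Rightarrow> bool \<Rightarrow> 'f \<Rightarrow> 'f" where
  "gfac r same x = (if same then 1 / (x * (x - 1)) else (x - r) * (x - 1 + r))"

lemma finite_index_pairs [simp]: "finite (index_pairs n)"
  by (rule finite_subset[of _ "{1..n} \<times> {1..n}"]) (auto simp: index_pairs_def)

lemma rho_plus_diff:
  assumes "(i, j) \<in> index_pairs n"
  shows "rho_plus n r \<mu> i - rho_plus n r \<mu> j = of_int (\<mu> i - \<mu> j) + of_nat (j - i) * (r :: 'f::comm_ring_1)"
proof -
  have ij: "i < j" "j \<le> n" using assms by (auto simp: index_pairs_def)
  then have "n - i = (n - j) + (j - i)" by simp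
  then have "of_nat (n - i) = (of_nat (n - j) + of_nat (j - i) :: 'f)" by (metis of_nat_add)
  then show ?thesis by (simp add: rho_plus_def rho_def algebra_simps)
qed

lemma rho_plus_add_indicator:
  "rho_plus n r (add_indicator \<mu> I) i = rho_plus n r \<mu> i + (if i \<in> I then 1 else 0)"
  by (simp add: rho_plus_def add_indicator_def)

text \<open>The coordinates rho + mu absorb the multiples of r, and the parity of j - i turns into
  the comparison of the parities of i and j. Only in this form can the factors of two steps be
  combined.\<close>

lemma psi_expr_pairs:
  fixes r :: "'f::field"
  shows "psi_expr n I \<mu> r = (\<Prod>(i, j)\<in>index_pairs n.
    if i \<notin> I \<and> j \<in> I then gfac r (odd i = odd j) (rho_plus n r \<mu> i - rho_plus n r \<mu> j) else 1)"
proof -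
  define Q where "Q = {(i, j). i \<in> {1..n} \<and> j \<in> {1..n} \<and> i \<notin> I \<and> j \<in> I \<and> i < j}"
  let ?\<nu> = "add_indicator \<mu> I"
  let ?a = "\<lambda>(i, j). (of_int (\<mu> i - \<mu> j) + of_nat (j - i - 1) * r) * (of_int (?\<nu> i - ?\<nu> j) + of_nat (j - i + 1) * r)"
  let ?b = "\<lambda>(i, j). (of_int (\<mu> i - \<mu> j) + of_nat (j - i) * r) * (of_int (?\<nu> i - ?\<nu> j) + of_nat (j - i) * r)"
  let ?g = "\<lambda>(i, j). gfac r (odd i = odd j) (rho_plus n r \<mu> i - rho_plus n r \<mu> j)"
  have Qp: "Q = {x \<in> index_pairs n. fst x \<notin> I \<and> snd x \<in> I}"
    by (auto simp: Q_def index_pairs_def)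
  have finQ: "finite Q" unfolding Qp by simp
  have val: "?g (i, j) = (if odd (j - i) then ?a (i, j) else 1 / ?b (i, j))" if "(i, j) \<in> Q" for i j
  proof -
    have ij: "i < j" "i \<notin> I" "j \<in> I" "(i, j) \<in> index_pairs n" using that by (auto simp: Q_def index_pairs_def)
    define x where "x = rho_plus n r \<mu> i - rho_plus n r \<mu> j"
    have x: "x = of_int (\<mu> i - \<mu> j) + of_nat (j - i) * r" unfolding x_def using rho_plus_diff[OF ij(4)] .
    have "j - i = Suc (j - i - 1)" using ij by simp
    then have s: "of_nat (j - i) = (of_nat (j - i - 1) + 1 :: 'f)" by (metis of_nat_Suc add.commute)
    have o: "(odd i = odd j) = even (j - i)" using ij(1) by (auto simp: even_diff_nat)
    have n: "?\<nu> i - ?\<nu> j = \<mu> i - \<mu> j - 1" using ij by (simp add: add_indicator_def)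
    have 1: "of_int (\<mu> i - \<mu> j) + of_nat (j - i - 1) * r = x - r" unfolding x s by (simp add: algebra_simps)
    have 2: "of_int (?\<nu> i - ?\<nu> j) + of_nat (j - i + 1) * r = x - 1 + r" unfolding x n by (simp add: algebra_simps)
    have 3: "of_int (?\<nu> i - ?\<nu> j) + of_nat (j - i) * r = x - 1" unfolding x n by (simp add: algebra_simps)
    show ?thesis unfolding split x_def[symmetric] 1 2 3 x[symmetric] gfac_def o by simp
  qed
  have "(\<Prod>(i, j)\<in>index_pairs n. if i \<notin> I \<and> j \<in> I then ?g (i, j) else 1) = (\<Prod>x\<in>Q. ?g x)"
    unfolding Qp prod.inter_filter[OF finite_index_pairs] by (rule prod.cong) auto
  also have "\<dots> = (\<Prod>x\<in>Q. if odd (snd x - fst x) then ?a x else 1 / ?b x)"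
    by (rule prod.cong[OF refl]) (use val in force)
  also have "\<dots> = (\<Prod>x\<in>{x\<in>Q. odd (snd x - fst x)}. ?a x) * (\<Prod>x\<in>{x\<in>Q. \<not> odd (snd x - fst x)}. 1 / ?b x)"
    using prod.If_cases[OF finQ, of "\<lambda>x. odd (snd x - fst x)" ?a "\<lambda>x. 1 / ?b x"] by (simp add: Int_def Collect_neg_eq[symmetric])
  also have "\<dots> = (\<Prod>x\<in>{x\<in>Q. odd (snd x - fst x)}. ?a x) / (\<Prod>x\<in>{x\<in>Q. \<not> odd (snd x - fst x)}. ?b x)"
    by (simp add: prod_dividef)
  also have "{x\<in>Q. odd (snd x - fst x)} = {(i, j) \<in> Q. odd (j - i)}" by auto
  also have "{x\<in>Q. \<not> odd (snd x - fst x)} = {(i, j) \<in> Q. even (j - i)}" by auto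
  finally show ?thesis unfolding psi_expr_def Let_def Q_def[symmetric] by (simp only: split)
qed

section \<open>Products of two coefficients as split terms\<close>

definition family :: "nat \<Rightarrow> bool \<Rightarrow> nat set set" where
  "family n A = {I. I \<subseteq> {1..n} \<and> admissible 0 A (excess I)}"

lemma excess_card:
  assumes "finite I"
  shows "excess I = int (card {i\<in>I. odd i}) - int (card {i\<in>I. even i})"
  using parity_excess[OF assms, of 1] by (simp add: parity_sign_def)

lemma family_eq: "family n A = (if A then P_odd n else P_even n)"
proof -
  have "admissible 0 A (excess I) \<longleftrightarrow> card {i\<in>I. odd i} = card {i\<in>I. even i} \<or>
      A \<and> card {i\<in>I. odd i} = card {i\<in>I. even i} + 1" if "I \<subseteq> {1..n}" for I
    using excess_card[OF finite_subset[OF that]] by (auto simp: admissible_def)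
  then show ?thesis unfolding family_def P_odd_def P_even_def by auto
qed

text \<open>In a product of two steps this sign depends on the total shift only. Its purpose appears
  in \<open>eval_compl_col\<close>, where it matches the signs of \<open>col\<close> in different
  numbers of variables.\<close>

definition odd_sign :: "nat set \<Rightarrow> 'f::comm_ring_1" where
  "odd_sign I = (- 1) ^ card {i\<in>I. odd i}"

text \<open>For i < j, a pair divided between the two steps contributes in the second step, with i
  already raised, if i is raised first, and in the first step otherwise. Both times the factor is
  \<open>om\<close>, and the order of i and j disappears.\<close>

lemma om_gfac: "om r s x = gfac r s (x + 1)" "om r s (- x) = gfac r s (x :: 'f::field)"
proof -
  show "om r s x = gfac r s (x + 1)" by (simp add: om_def gfac_def algebra_simps)
  have "- x * (- x + 1) = x * (x - 1)" "(- x + r) * (- x + 1 - r) = (x - r) * (x - 1 + r)" by algebra+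
  then show "om r s (- x) = gfac r s x" unfolding om_def gfac_def by simp
qed

lemma gfac_reflect: "gfac r s (1 - x) = gfac r s (x :: 'f::field)"
proof -
  have "(1 - x) * (1 - x - 1) = x * (x - 1)" "(1 - x - r) * (1 - x - 1 + r) = (x - r) * (x - 1 + r)" by algebra+
  then show ?thesis unfolding gfac_def by simp
qed

text \<open>The part of a product of two coefficients that only depends on the set \<open>B\<close> of indices raised twice and the set \<open>C\<close> of indices raised once.\<close>

definition psi_common :: "nat \<Rightarrow> 'f::field \<Rightarrow> nat set \<Rightarrow> nat set \<Rightarrow> (nat \<Rightarrow> 'f) \<Rightarrow> 'f" where
  "psi_common n r B C z = (\<Prod>(i, j)\<in>index_pairs n.
     if i \<notin> B \<union> C \<and> j \<in> B then gfac r (odd i = odd j) (z i - z j) * gfac r (odd i = odd j) (z i - z j - 1)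
     else if i \<notin> B \<union> C \<and> j \<in> C \<or> i \<in> C \<and> j \<in> B then gfac r (odd i = odd j) (z i - z j)
     else 1)"

lemma cross_pairs:
  assumes "I \<subseteq> {1..n}" "J \<subseteq> {1..n}" "I \<inter> J = {}"
  shows "cross r I J z = (\<Prod>(i, j)\<in>index_pairs n.
    if i \<in> I \<and> j \<in> J then om r (odd i = odd j) (z i - z j)
    else if i \<in> J \<and> j \<in> I then om r (odd i = odd j) (z j - z i) else 1)"
proof -
  let ?f = "\<lambda>(i, j). om r (odd i = odd j) (z i - z j)"
  let ?g = "\<lambda>(i, j). om r (odd i = odd j) (z j - z i)"
  let ?P = "index_pairs n"
  have fin: "finite I" "finite J" using finite_subset[OF assms(1)] finite_subset[OF assms(2)] by simp_all
  have "I \<times> J = {x \<in> I \<times> J. fst x < snd x} \<union> {x \<in> I \<times> J. snd x < fst x}"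
    using assms(3) by (auto simp: not_less le_less)
  then have "prod ?f (I \<times> J) = prod ?f ({x \<in> I \<times> J. fst x < snd x} \<union> {x \<in> I \<times> J. snd x < fst x})" by simp
  also have "\<dots> = prod ?f {x \<in> I \<times> J. fst x < snd x} * prod ?f {x \<in> I \<times> J. snd x < fst x}"
    using fin by (intro prod.union_disjoint) auto
  also have "prod ?f {x \<in> I \<times> J. fst x < snd x} = prod ?f {x \<in> ?P. fst x \<in> I \<and> snd x \<in> J}"
    by (rule prod.cong) (use assms in \<open>auto simp: index_pairs_def\<close>)
  also have "prod ?f {x \<in> I \<times> J. snd x < fst x} = prod ?g {x \<in> ?P. fst x \<in> J \<and> snd x \<in> I}"
    by (rule prod.reindex_bij_witness[of _ prod.swap prod.swap])
      (use assms in \<open>auto simp: index_pairs_def intro: arg_cong2[where f = "om r"]\<close>)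
  also have "prod ?f {x \<in> ?P. fst x \<in> I \<and> snd x \<in> J} * prod ?g {x \<in> ?P. fst x \<in> J \<and> snd x \<in> I}
    = (\<Prod>x\<in>?P. (if fst x \<in> I \<and> snd x \<in> J then ?f x else 1) * (if fst x \<in> J \<and> snd x \<in> I then ?g x else 1))"
    unfolding prod.distrib prod.inter_filter[OF finite_index_pairs] ..
  also have "\<dots> = (\<Prod>(i, j)\<in>?P. if i \<in> I \<and> j \<in> J then om r (odd i = odd j) (z i - z j)
    else if i \<in> J \<and> j \<in> I then om r (odd i = odd j) (z j - z i) else 1)"
    by (rule prod.cong[OF refl]) (use assms(3) in auto)
  finally show ?thesis unfolding cross_def .
qed

text \<open>Only pairs with one member in \<open>I\<close> and the other in \<open>C - I\<close>
  have a factor that depends on \<open>I\<close>. For all other pairs the two steps together give a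
  factor determined by \<open>B\<close> and \<open>C\<close>.\<close>

lemma psi_expr_mult:
  fixes r :: "'f::field"
  assumes d: "B \<inter> C = {}" "I \<subseteq> C" "C \<subseteq> {1..n}"
  shows "psi_expr n (B \<union> I) \<mu> r * psi_expr n (B \<union> (C - I)) (add_indicator \<mu> (B \<union> I)) r =
    psi_common n r B C (rho_plus n r \<mu>) * cross r I (C - I) (rho_plus n r \<mu>)"
proof -
  define z where "z = rho_plus n r \<mu>"
  have cr: "cross r I (C - I) z = (\<Prod>(i, j)\<in>index_pairs n.
    if i \<in> I \<and> j \<in> C - I then om r (odd i = odd j) (z i - z j)
    else if i \<in> C - I \<and> j \<in> I then om r (odd i = odd j) (z j - z i) else 1)"
    by (rule cross_pairs) (use d in auto)
  show ?thesis
    unfolding psi_expr_pairs psi_common_def z_def[symmetric] cr prod.distrib[symmetric] rho_plus_add_indicator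
  proof (rule prod.cong[OF refl], clarify)
    fix i j assume "(i, j) \<in> index_pairs n"
    define x where "x = z i - z j"
    have x': "z j - z i = - x" unfolding x_def by simp
    have e: "x + 1 - 1 = x" by simp
    consider "i \<in> B" | "i \<in> I" | "i \<in> C - I" | "i \<notin> B \<union> C" using d by blast
    note ci = this
    consider "j \<in> B" | "j \<in> I" | "j \<in> C - I" | "j \<notin> B \<union> C" using d by blast
    note cj = this
    have 1: "z i + 1 - (z j + 1) = x" "z i + 1 - z j = x + 1" "z i - (z j + 1) = x - 1" "z i + 1 - (z j + 0) = x + 1"
       "z i + 0 - (z j + 1) = x - 1" "z i + 0 - (z j + 0) = x" "z i - z j = x"
      unfolding x_def by simp_all
    show "(if i \<notin> B \<union> I \<and> j \<in> B \<union> I then gfac r (odd i = odd j) (z i - z j) else 1) *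
      (if i \<notin> B \<union> (C - I) \<and> j \<in> B \<union> (C - I) then gfac r (odd i = odd j)
         (z i + (if i \<in> B \<union> I then 1 else 0) - (z j + (if j \<in> B \<union> I then 1 else 0))) else 1) =
      (if i \<notin> B \<union> C \<and> j \<in> B then gfac r (odd i = odd j) (z i - z j) * gfac r (odd i = odd j) (z i - z j - 1)
       else if i \<notin> B \<union> C \<and> j \<in> C \<or> i \<in> C \<and> j \<in> B then gfac r (odd i = odd j) (z i - z j) else 1) *
      (if i \<in> I \<and> j \<in> C - I then om r (odd i = odd j) (z i - z j)
       else if i \<in> C - I \<and> j \<in> I then om r (odd i = odd j) (z j - z i) else 1)"
      unfolding x' x_def[symmetric] om_gfac
      by (rule ci; rule cj) (use d in \<open>auto simp: 1 gfac_reflect\<close>)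
  qed
qed

definition coef :: "nat \<Rightarrow> bool \<Rightarrow> 'f::field \<Rightarrow> 'f \<Rightarrow> (nat \<Rightarrow> int) \<Rightarrow> nat set \<Rightarrow> 'f" where
  "coef n A r t \<mu> I = odd_sign I * wt A ({1..n} - I) t (rho_plus n r \<mu>) * psi_expr n I \<mu> r"

lemma wt_union:
  assumes "finite S" "finite T" "S \<inter> T = {}"
  shows "wt A (S \<union> T) t z = wt A S t z * wt A T t z"
proof -
  have "{i \<in> S \<union> T. odd i = A} = {i \<in> S. odd i = A} \<union> {i \<in> T. odd i = A}" by auto
  then show ?thesis unfolding wt_def using assms
    by (simp only:) (rule prod.union_disjoint, auto)
qed

lemma odd_sign_union:
  assumes "finite S" "finite T" "S \<inter> T = {}"
  shows "odd_sign (S \<union> T) = odd_sign S * odd_sign T"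
proof -
  have "{i \<in> S \<union> T. odd i} = {i \<in> S. odd i} \<union> {i \<in> T. odd i}" by auto
  then have "card {i \<in> S \<union> T. odd i} = card {i \<in> S. odd i} + card {i \<in> T. odd i}"
    using assms by (simp only:) (rule card_Un_disjoint, auto)
  then show ?thesis unfolding odd_sign_def by (simp add: power_add)
qed

lemma excess_union:
  assumes "finite S" "finite T" "S \<inter> T = {}"
  shows "excess (S \<union> T) = excess S + excess T"
  unfolding excess_def using assms by (rule sum.union_disjoint)

lemma coef_mult:
  fixes r :: "'f::field"
  assumes d: "B \<inter> C = {}" "I \<subseteq> C" "B \<subseteq> {1..n}" "C \<subseteq> {1..n}"
  shows "coef n A r t \<mu> (B \<union> I) * coef n A' r u (add_indicator \<mu> (B \<union> I)) (B \<union> (C - I)) =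
    odd_sign C * wt A ({1..n} - (B \<union> C)) t (rho_plus n r \<mu>) * wt A' ({1..n} - (B \<union> C)) u (rho_plus n r \<mu>) *
    psi_common n r B C (rho_plus n r \<mu>) * split_term r A A' t u C (rho_plus n r \<mu>) I"
proof -
  let ?z = "rho_plus n r \<mu>" and ?N = "{1..n} - (B \<union> C)"
  have fin: "finite B" "finite C" "finite I" "finite (C - I)" "finite ?N"
    using d finite_subset[of _ "{1..n}"] finite_subset[of I C] by auto
  have c1: "{1..n} - (B \<union> I) = ?N \<union> (C - I)" and c2: "{1..n} - (B \<union> (C - I)) = ?N \<union> I"
    using d by auto
  have w1: "wt A ({1..n} - (B \<union> I)) t ?z = wt A ?N t ?z * wt A (C - I) t ?z"
    unfolding c1 by (rule wt_union) (use fin in auto)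
  have "wt A' ({1..n} - (B \<union> (C - I))) u (rho_plus n r (add_indicator \<mu> (B \<union> I)))
    = wt A' ?N u (rho_plus n r (add_indicator \<mu> (B \<union> I))) * wt A' I u (rho_plus n r (add_indicator \<mu> (B \<union> I)))"
    unfolding c2 by (rule wt_union) (use fin d in auto)
  also have "wt A' ?N u (rho_plus n r (add_indicator \<mu> (B \<union> I))) = wt A' ?N u ?z"
    unfolding wt_def by (rule prod.cong) (use d in \<open>auto simp: rho_plus_add_indicator\<close>)
  also have "wt A' I u (rho_plus n r (add_indicator \<mu> (B \<union> I))) = wt A' I (u - 1) ?z"
    unfolding wt_def by (rule prod.cong) (auto simp: rho_plus_add_indicator)
  finally have w2: "wt A' ({1..n} - (B \<union> (C - I))) u (rho_plus n r (add_indicator \<mu> (B \<union> I)))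
    = wt A' ?N u ?z * wt A' I (u - 1) ?z" .
  have "odd_sign (B \<union> I) * odd_sign (B \<union> (C - I)) = odd_sign B * odd_sign B * (odd_sign I * odd_sign (C - I) :: 'f)"
  proof -
    have "B \<inter> I = {}" "B \<inter> (C - I) = {}" using d by auto
    then show ?thesis
      by (simp only: odd_sign_union[OF fin(1,3)] odd_sign_union[OF fin(1,4)] mult_ac)
  qed
  also have "odd_sign B * odd_sign B = (1 :: 'f)"
    unfolding odd_sign_def by (simp flip: power_mult_distrib)
  also have "odd_sign I * odd_sign (C - I) = (odd_sign C :: 'f)"
    using odd_sign_union[of I "C - I", where 'a = 'f] fin d by (auto simp: Un_absorb1)
  finally have s: "odd_sign (B \<union> I) * odd_sign (B \<union> (C - I)) = (odd_sign C :: 'f)" by simp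
  have "coef n A r t \<mu> (B \<union> I) * coef n A' r u (add_indicator \<mu> (B \<union> I)) (B \<union> (C - I)) =
    (odd_sign (B \<union> I) * odd_sign (B \<union> (C - I))) *
    (wt A ?N t ?z * wt A (C - I) t ?z) * (wt A' ?N u ?z * wt A' I (u - 1) ?z) *
    (psi_expr n (B \<union> I) \<mu> r * psi_expr n (B \<union> (C - I)) (add_indicator \<mu> (B \<union> I)) r)"
    unfolding coef_def w1 w2 by (simp only: mult_ac)
  also have "\<dots> = odd_sign C * wt A ?N t ?z * wt A' ?N u ?z * psi_common n r B C ?z * split_term r A A' t u C ?z I"
    unfolding s psi_expr_mult[OF d(1,2,4)] split_term_def by (simp only: mult_ac)
  finally show ?thesis .
qed

definition add2 :: "(nat \<Rightarrow> int) \<Rightarrow> nat set \<Rightarrow> nat set \<Rightarrow> nat \<Rightarrow> int" where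
  "add2 \<mu> B C = (\<lambda>i. \<mu> i + (if i \<in> B then 2 else 0) + (if i \<in> C then 1 else 0))"

lemma add_indicator_twice:
  assumes "B \<inter> C = {}" "I \<subseteq> C"
  shows "add_indicator (add_indicator \<mu> (B \<union> I)) (B \<union> (C - I)) = add2 \<mu> B C"
  using assms by (auto simp: add_indicator_def add2_def fun_eq_iff)

definition set_pairs :: "nat \<Rightarrow> (nat set \<times> nat set) set" where
  "set_pairs n = {(B, C). B \<subseteq> {1..n} \<and> C \<subseteq> {1..n} \<and> B \<inter> C = {}}"

lemma finite_set_pairs [simp]: "finite (set_pairs n)"
  by (rule finite_subset[of _ "Pow {1..n} \<times> Pow {1..n}"]) (auto simp: set_pairs_def)

lemma finite_family [simp]: "finite (family n A)"
  by (rule finite_subset[of _ "Pow {1..n}"]) (auto simp: family_def)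

text \<open>The bijection sends (I, J) to the intersection B, the symmetric difference C and I - J.
  Since \<open>excess I\<close> is the sum of \<open>excess B\<close> and
  \<open>excess (I - J)\<close>, the condition on I becomes one with offset
  \<open>- excess B\<close>, and likewise for J. This is the origin of the offset in
  \<open>splits\<close>.\<close>

lemma sum_family_pairs:
  "(\<Sum>(I, J)\<in>family n A \<times> family n A'. h I J) =
    (\<Sum>(B, C)\<in>set_pairs n. \<Sum>I\<in>splits (- excess B) A A' C. h (B \<union> I) (B \<union> (C - I)))"
proof -
  have fin: "finite X" if "X \<subseteq> {1..n}" for X using that finite_subset by blast
  have "(\<Sum>(I, J)\<in>family n A \<times> family n A'. h I J) =
    (\<Sum>(x, I)\<in>(SIGMA x:set_pairs n. splits (- excess (fst x)) A A' (snd x)). h (fst x \<union> I) (fst x \<union> (snd x - I)))"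
  proof (rule sum.reindex_bij_witness[of _ "\<lambda>(x, I). (fst x \<union> I, fst x \<union> (snd x - I))"
        "\<lambda>(I, J). ((I \<inter> J, (I - J) \<union> (J - I)), I - J)"])
    fix p assume p: "p \<in> family n A \<times> family n A'"
    obtain I J where pp: "p = (I, J)" by (cases p)
    have IJ: "I \<subseteq> {1..n}" "J \<subseteq> {1..n}" "admissible 0 A (excess I)" "admissible 0 A' (excess J)"
      using p pp by (auto simp: family_def)
    have f: "finite I" "finite J" using IJ fin by auto
    have "(I \<inter> J) \<union> (I - J) = I" "(I \<inter> J) \<union> (J - I) = J"
      "(I \<inter> J) \<inter> (I - J) = {}" "(I \<inter> J) \<inter> (J - I) = {}" by auto
    then have e: "excess I = excess (I \<inter> J) + excess (I - J)" "excess J = excess (I \<inter> J) + excess (J - I)"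
      using excess_union[of "I \<inter> J" "I - J"] excess_union[of "I \<inter> J" "J - I"] f by simp_all
    have d: "I - J \<union> (J - I) - (I - J) = J - I" by auto
    show "(\<lambda>(x, I). (fst x \<union> I, fst x \<union> (snd x - I))) ((\<lambda>(I, J). ((I \<inter> J, (I - J) \<union> (J - I)), I - J)) p) = p"
      unfolding pp by auto
    show "(\<lambda>(I, J). ((I \<inter> J, (I - J) \<union> (J - I)), I - J)) p \<in> (SIGMA x:set_pairs n. splits (- excess (fst x)) A A' (snd x))"
      unfolding pp using IJ e by (auto simp: set_pairs_def splits_def admissible_def d)
    show "(\<lambda>(x, I). h (fst x \<union> I) (fst x \<union> (snd x - I))) ((\<lambda>(I, J). ((I \<inter> J, (I - J) \<union> (J - I)), I - J)) p)
      = (\<lambda>(I, J). h I J) p"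
      unfolding pp by (auto intro!: arg_cong2[where f = h])
  next
    fix q assume q: "q \<in> (SIGMA x:set_pairs n. splits (- excess (fst x)) A A' (snd x))"
    obtain B C I where qq: "q = ((B, C), I)" by (metis surj_pair)
    have BC: "B \<subseteq> {1..n}" "C \<subseteq> {1..n}" "B \<inter> C = {}" "I \<subseteq> C"
      "admissible (- excess B) A (excess I)" "admissible (- excess B) A' (excess (C - I))"
      using q qq by (auto simp: set_pairs_def splits_def)
    have e: "excess (B \<union> I) = excess B + excess I" "excess (B \<union> (C - I)) = excess B + excess (C - I)"
      using BC fin finite_subset[OF BC(4)] by (auto intro!: excess_union)
    show "(\<lambda>(I, J). ((I \<inter> J, (I - J) \<union> (J - I)), I - J)) ((\<lambda>(x, I). (fst x \<union> I, fst x \<union> (snd x - I))) q) = q"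
      unfolding qq using BC by auto
    show "(\<lambda>(x, I). (fst x \<union> I, fst x \<union> (snd x - I))) q \<in> family n A \<times> family n A'"
      unfolding qq using BC e by (auto simp: family_def admissible_def)
  qed
  also have "\<dots> = (\<Sum>x\<in>set_pairs n. \<Sum>I\<in>splits (- excess (fst x)) A A' (snd x). h (fst x \<union> I) (fst x \<union> (snd x - I)))"
  proof (rule sum.Sigma[symmetric])
    show "\<forall>x\<in>set_pairs n. finite (splits (- excess (fst x)) A A' (snd x))"
      using fin by (auto simp: set_pairs_def)
  qed simp
  finally show ?thesis by (simp add: case_prod_unfold)
qed

lemma generic_commute:
  fixes r :: "'f::field_char_0"
  assumes g: "generic {1..n} (rho_plus n r \<mu>)"
  shows "(\<Sum>I\<in>family n A. \<Sum>J\<in>family n A'.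
      coef n A r t \<mu> I * coef n A' r u (add_indicator \<mu> I) J * h (add_indicator (add_indicator \<mu> I) J)) =
    (\<Sum>I\<in>family n A'. \<Sum>J\<in>family n A.
      coef n A' r u \<mu> I * coef n A r t (add_indicator \<mu> I) J * h (add_indicator (add_indicator \<mu> I) J))"
proof -
  let ?z = "rho_plus n r \<mu>"
  have eq: "(\<Sum>I\<in>family n A. \<Sum>J\<in>family n A'.
      coef n A r t \<mu> I * coef n A' r u (add_indicator \<mu> I) J * h (add_indicator (add_indicator \<mu> I) J)) =
    (\<Sum>(B, C)\<in>set_pairs n. odd_sign C * wt A ({1..n} - (B \<union> C)) t ?z * wt A' ({1..n} - (B \<union> C)) u ?z *
      psi_common n r B C ?z * h (add2 \<mu> B C) * split_sum r (- excess B) A A' t u C ?z)" for A A' t u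
  proof -
    have "(\<Sum>I\<in>family n A. \<Sum>J\<in>family n A'.
      coef n A r t \<mu> I * coef n A' r u (add_indicator \<mu> I) J * h (add_indicator (add_indicator \<mu> I) J)) =
      (\<Sum>(B, C)\<in>set_pairs n. \<Sum>I\<in>splits (- excess B) A A' C.
        coef n A r t \<mu> (B \<union> I) * coef n A' r u (add_indicator \<mu> (B \<union> I)) (B \<union> (C - I)) *
        h (add_indicator (add_indicator \<mu> (B \<union> I)) (B \<union> (C - I))))"
      unfolding sum.cartesian_product by (rule sum_family_pairs)
    also have "\<dots> = (\<Sum>(B, C)\<in>set_pairs n. odd_sign C * wt A ({1..n} - (B \<union> C)) t ?z * wt A' ({1..n} - (B \<union> C)) u ?z *
      psi_common n r B C ?z * h (add2 \<mu> B C) * split_sum r (- excess B) A A' t u C ?z)"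
    proof (rule sum.cong[OF refl], clarify)
      fix B C assume BC: "(B, C) \<in> set_pairs n"
      then have d: "B \<inter> C = {}" "B \<subseteq> {1..n}" "C \<subseteq> {1..n}" by (auto simp: set_pairs_def)
      show "(\<Sum>I\<in>splits (- excess B) A A' C.
        coef n A r t \<mu> (B \<union> I) * coef n A' r u (add_indicator \<mu> (B \<union> I)) (B \<union> (C - I)) *
        h (add_indicator (add_indicator \<mu> (B \<union> I)) (B \<union> (C - I)))) =
        odd_sign C * wt A ({1..n} - (B \<union> C)) t ?z * wt A' ({1..n} - (B \<union> C)) u ?z *
        psi_common n r B C ?z * h (add2 \<mu> B C) * split_sum r (- excess B) A A' t u C ?z"
        unfolding split_sum_def sum_distrib_left
      proof (rule sum.cong[OF refl])
        fix I assume "I \<in> splits (- excess B) A A' C"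
        then have I: "I \<subseteq> C" by (rule splits_subset)
        show "coef n A r t \<mu> (B \<union> I) * coef n A' r u (add_indicator \<mu> (B \<union> I)) (B \<union> (C - I)) *
          h (add_indicator (add_indicator \<mu> (B \<union> I)) (B \<union> (C - I))) =
          odd_sign C * wt A ({1..n} - (B \<union> C)) t ?z * wt A' ({1..n} - (B \<union> C)) u ?z *
          psi_common n r B C ?z * h (add2 \<mu> B C) * split_term r A A' t u C ?z I"
          unfolding coef_mult[OF d(1) I d(2,3)] add_indicator_twice[OF d(1) I] by (simp only: mult_ac)
      qed
    qed
    finally show ?thesis .
  qed
  show ?thesis unfolding eq
  proof (rule sum.cong[OF refl], clarify)
    fix B C assume "(B, C) \<in> set_pairs n"
    then have C: "C \<subseteq> {1..n}" by (auto simp: set_pairs_def)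
    have "split_sum r (- excess B) A A' t u C ?z = split_sum r (- excess B) A' A u t C ?z"
      by (rule split_sum_sym) (use C finite_subset generic_subset[OF g C] in blast)+
    then show "odd_sign C * wt A ({1..n} - (B \<union> C)) t ?z * wt A' ({1..n} - (B \<union> C)) u ?z *
        psi_common n r B C ?z * h (add2 \<mu> B C) * split_sum r (- excess B) A A' t u C ?z =
      odd_sign C * wt A' ({1..n} - (B \<union> C)) u ?z * wt A ({1..n} - (B \<union> C)) t ?z *
        psi_common n r B C ?z * h (add2 \<mu> B C) * split_sum r (- excess B) A' A u t C ?z"
      by (simp only: mult_ac)
  qed
qed

text \<open>With \<open>r\<close> an indeterminate, the points \<open>\<rho> + \<mu>\<close> are generic; special values of \<open>r\<close> are reached by specialization.\<close>

instance fract :: ("{idom, ring_char_0}") field_char_0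
proof
  show "inj (of_nat :: nat \<Rightarrow> 'a fract)"
    by (rule injI) (simp add: of_nat_fract eq_fract)
qed

section \<open>The generic point and the boundary of \<Lambda>\<close>

definition fract_of :: "'a::idom \<Rightarrow> 'a fract" where
  "fract_of p = Fract p 1"

lemma fract_of_simps:
  "fract_of 0 = 0" "fract_of 1 = 1" "fract_of (p + q) = fract_of p + fract_of q" "fract_of (p - q) = fract_of p - fract_of q"
  "fract_of (p * q) = fract_of p * fract_of q"
  by (simp_all add: fract_of_def Zero_fract_def One_fract_def)

lemma fract_of_eq_iff: "fract_of p = fract_of q \<longleftrightarrow> p = q"
  by (simp add: fract_of_def eq_fract)

lemma fract_of_eq_0_iff: "fract_of p = 0 \<longleftrightarrow> p = 0"
  using fract_of_eq_iff[of p 0] by (simp add: fract_of_simps)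

lemma fract_of_prod: "fract_of (\<Prod>x\<in>S. f x) = (\<Prod>x\<in>S. fract_of (f x))"
  by (induction S rule: infinite_finite_induct) (simp_all add: fract_of_simps)

lemma Fract_eq_divide: "q \<noteq> 0 \<Longrightarrow> Fract p q = fract_of p / fract_of q"
  by (simp add: fract_of_def)

lemma fract_of_nat: "fract_of (of_nat k) = of_nat k"
  by (simp add: fract_of_def of_nat_fract)

lemma fract_of_int: "fract_of (of_int k) = of_int k"
  by (cases k rule: int_cases2) (simp_all add: fract_of_nat fract_of_simps(4)[of 0, simplified fract_of_simps(1), simplified])

definition indet :: "'a::idom poly fract" where
  "indet = fract_of [:0, 1:]"

lemma rho_plus_indet: "rho_plus n indet \<mu> i = fract_of [:of_int (\<mu> i), of_nat (n - i):]"
proof -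
  have eq: "[:of_int (\<mu> i), of_nat (n - i):] = of_nat (n - i) * [:0, 1:] + of_int (\<mu> i)"
    by (simp add: of_nat_poly of_int_poly)
  show ?thesis
    unfolding eq fract_of_simps fract_of_nat fract_of_int rho_plus_def rho_def indet_def ..
qed

lemma generic_indet: "generic {1..n} (rho_plus n (indet :: 'a::{idom, ring_char_0} poly fract) \<mu>)"
  unfolding generic_def
proof (intro ballI impI notI)
  fix i j assume ij: "i \<in> {1..n}" "j \<in> {1..n}" "i \<noteq> j"
    and "rho_plus n (indet :: 'a poly fract) \<mu> i - rho_plus n indet \<mu> j \<in> \<int>"
  then obtain k where "rho_plus n (indet :: 'a poly fract) \<mu> i - rho_plus n indet \<mu> j = of_int k"
    by (auto elim: Ints_cases)
  then have "fract_of ([:of_int (\<mu> i), of_nat (n - i):] - [:of_int (\<mu> j), of_nat (n - j):]) = fract_of (of_int k :: 'a poly)"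
    unfolding rho_plus_indet fract_of_simps(4) fract_of_int .
  then have "[:of_int (\<mu> i), of_nat (n - i):] - [:of_int (\<mu> j), of_nat (n - j):] = [:of_int k :: 'a:]"
    unfolding fract_of_eq_iff by (simp add: of_int_poly)
  then have "(of_nat (n - i) :: 'a) = of_nat (n - j)" by simp
  then have "n - i = n - j" by simp
  then show False using ij unfolding atLeastAtMost_iff by presburger
qed

lemma LamD:
  assumes "\<mu> \<in> Lam n" "1 \<le> i" "i \<le> j" "j \<le> n"
  shows "\<mu> j \<le> \<mu> i"
  using assms(3,4)
proof (induction j rule: dec_induct)
  case (step m)
  then have "\<mu> (Suc m) \<le> \<mu> m" using assms(1,2) unfolding Lam_def by auto
  then show ?case using step by simp
qed simp

lemma Lam_nonneg: "\<mu> \<in> Lam n \<Longrightarrow> 0 \<le> \<mu> i"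
  unfolding Lam_def by (cases "i \<in> {1..n}") auto

text \<open>Leaving \<Lambda> means that \<mu> takes equal values at some i outside \<open>I\<close>
  and i + 1 inside. For this pair z_i - z_(i+1) = r, a zero of the factor.\<close>

lemma psi_expr_outside:
  fixes r :: "'f::field"
  assumes \<mu>: "\<mu> \<in> Lam n" and I: "I \<subseteq> {1..n}" and out: "add_indicator \<mu> I \<notin> Lam n"
  shows "psi_expr n I \<mu> r = 0"
proof -
  have "\<exists>i\<in>{1..<n}. add_indicator \<mu> I i < add_indicator \<mu> I (Suc i)"
  proof (rule ccontr)
    assume "\<not> ?thesis"
    then have "add_indicator \<mu> I \<in> Lam n"
      using \<mu> I unfolding Lam_def by (auto simp: add_indicator_def not_less)
    then show False using out by simp
  qed
  then obtain i where i: "i \<in> {1..<n}" "add_indicator \<mu> I i < add_indicator \<mu> I (Suc i)" by blast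
  have "\<mu> (Suc i) \<le> \<mu> i" using \<mu> i(1) unfolding Lam_def by auto
  then have *: "\<mu> (Suc i) = \<mu> i" "i \<notin> I" "Suc i \<in> I"
    using i(2) by (auto simp: add_indicator_def split: if_splits)
  have pr: "(i, Suc i) \<in> index_pairs n" using i(1) by (simp add: index_pairs_def)
  have "rho_plus n r \<mu> i - rho_plus n r \<mu> (Suc i) = r"
    using rho_plus_diff[OF pr, of r \<mu>] * by simp
  then show ?thesis
    unfolding psi_expr_pairs using pr * by (intro prod_zero) (auto simp: gfac_def intro!: bexI[OF _ pr])
qed

section \<open>Values of rational functions at regular points\<close>

definition regular_at :: "'a::field \<Rightarrow> 'a poly fract \<Rightarrow> bool" where
  "regular_at a q \<longleftrightarrow> (\<exists>f g. q = Fract f g \<and> poly g a \<noteq> 0)"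

lemma ratfun_value_Fract:
  assumes "poly g a \<noteq> 0"
  shows "ratfun_value (Fract f g) a = poly f a / poly g a"
  unfolding ratfun_value_def
proof (rule the_equality)
  show "\<exists>f' g'. Fract f g = Fract f' g' \<and> poly g' a \<noteq> 0 \<and> poly f a / poly g a = poly f' a / poly g' a"
    using assms by blast
next
  fix v assume "\<exists>f' g'. Fract f g = Fract f' g' \<and> poly g' a \<noteq> 0 \<and> v = poly f' a / poly g' a"
  then obtain f' g' where *: "Fract f g = Fract f' g'" "poly g' a \<noteq> 0" "v = poly f' a / poly g' a" by blast
  have "g \<noteq> 0" "g' \<noteq> 0" using assms *(2) by auto
  then have "f * g' = f' * g" using *(1) by (simp add: eq_fract)
  then have "poly f a * poly g' a = poly f' a * poly g a" by (metis poly_mult)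
  then show "v = poly f a / poly g a" using assms *(2,3) by (simp add: frac_eq_eq)
qed

lemma regular_fract_of: "regular_at a (fract_of p)" "ratfun_value (fract_of p) a = poly p a"
proof -
  show "regular_at a (fract_of p)"
    unfolding regular_at_def fract_of_def by (intro exI[of _ p] exI[of _ 1]) simp
  show "ratfun_value (fract_of p) a = poly p a"
    unfolding fract_of_def using ratfun_value_Fract[of 1 a p] by simp
qed

lemma regular_add:
  assumes "regular_at a p" "regular_at a q"
  shows "regular_at a (p + q)" "ratfun_value (p + q) a = ratfun_value p a + ratfun_value q a"
proof -
  obtain f g f' g' where *: "p = Fract f g" "poly g a \<noteq> 0" "q = Fract f' g'" "poly g' a \<noteq> 0"
    using assms unfolding regular_at_def by blast
  have "g \<noteq> 0" "g' \<noteq> 0" using * by auto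
  then have s: "p + q = Fract (f * g' + f' * g) (g * g')" using * by simp
  have n: "poly (g * g') a \<noteq> 0" using * by simp
  show "regular_at a (p + q)" unfolding s regular_at_def using n by blast
  show "ratfun_value (p + q) a = ratfun_value p a + ratfun_value q a"
    unfolding s ratfun_value_Fract[OF n] using * by (simp add: ratfun_value_Fract field_simps)
qed

lemma regular_mult:
  assumes "regular_at a p" "regular_at a q"
  shows "regular_at a (p * q)" "ratfun_value (p * q) a = ratfun_value p a * ratfun_value q a"
proof -
  obtain f g f' g' where *: "p = Fract f g" "poly g a \<noteq> 0" "q = Fract f' g'" "poly g' a \<noteq> 0"
    using assms unfolding regular_at_def by blast
  have s: "p * q = Fract (f * f') (g * g')" using * by simp
  have n: "poly (g * g') a \<noteq> 0" using * by simp
  show "regular_at a (p * q)" unfolding s regular_at_def using n by blast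
  show "ratfun_value (p * q) a = ratfun_value p a * ratfun_value q a"
    unfolding s ratfun_value_Fract[OF n] using * by (simp add: ratfun_value_Fract)
qed

lemma regular_zero: "regular_at a 0" "ratfun_value 0 a = 0"
  using regular_fract_of[where p = 0] by (simp_all add: fract_of_simps)

lemma regular_sum:
  assumes "\<And>x. x \<in> S \<Longrightarrow> regular_at a (f x)"
  shows "regular_at a (sum f S) \<and> ratfun_value (sum f S) a = (\<Sum>x\<in>S. ratfun_value (f x) a)"
  using assms
proof (induction S rule: infinite_finite_induct)
  case (insert x S)
  then show ?case using regular_add[of a "f x" "sum f S"] by simp
qed (simp_all add: regular_zero)

lemma regular_divide:
  assumes "poly q a \<noteq> 0"
  shows "regular_at a (fract_of p / fract_of q)" "ratfun_value (fract_of p / fract_of q) a = poly p a / poly q a"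
proof -
  have "q \<noteq> 0" using assms by auto
  then have *: "fract_of p / fract_of q = Fract p q" by (simp add: Fract_eq_divide)
  show "regular_at a (fract_of p / fract_of q)" unfolding * regular_at_def using assms by blast
  show "ratfun_value (fract_of p / fract_of q) a = poly p a / poly q a" unfolding * using ratfun_value_Fract[OF assms] .
qed

section \<open>Regularity of the coefficients\<close>

lemma excess_interval_left: "p \<le> q \<Longrightarrow> excess {p..<q} = 0 \<or> excess {p..<q} = - parity_sign q"
proof (induction q rule: dec_induct)
  case (step q)
  have "{p..<Suc q} = insert q {p..<q}" using step by auto
  then have "excess {p..<Suc q} = parity_sign q + excess {p..<q}" by simp
  then show ?case using step.IH by (auto simp: parity_sign_def)
qed simp

lemma excess_interval_right: "excess {q..s} = 0 \<or> excess {q..s} = parity_sign q"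
proof (cases "q \<le> s")
  case True
  then show ?thesis
  proof (induction q rule: inc_induct)
    case (step q)
    have "{q..s} = insert q {Suc q..s}" using step by auto
    then have "excess {q..s} = parity_sign q + excess {Suc q..s}" by simp
    then show ?case using step.IH by (auto simp: parity_sign_def)
  qed (simp add: excess_def)
qed (simp add: excess_def)

text \<open>The pairs whose second factors vanish at \<open>r = 0\<close>. Those of odd difference contribute zeros and those of even difference poles, so that \<open>card_tie_pairs\<close> makes \<^const>\<open>psi_expr\<close> regular there.\<close>

definition tie_pairs :: "nat \<Rightarrow> nat set \<Rightarrow> (nat \<Rightarrow> int) \<Rightarrow> (nat \<times> nat) set" where
  "tie_pairs n I \<mu> = {(i, j). (i, j) \<in> index_pairs n \<and> i \<notin> I \<and> j \<in> I \<and> add_indicator \<mu> I i = add_indicator \<mu> I j}"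

text \<open>Where the raised tuple has the value v, the indices outside \<open>I\<close> have \<mu>
  = v and precede those in \<open>I\<close>, where \<mu> = v - 1. They form adjacent intervals
  meeting at some q, with alternating sums in {0, -s} and {0, s} for s =
  \<open>parity_sign q\<close>.\<close>

lemma excess_tie_block:
  assumes \<mu>: "\<mu> \<in> Lam n" and I: "I \<subseteq> {1..n}" and \<nu>: "add_indicator \<mu> I \<in> Lam n"
  shows "excess {i\<in>{1..n}. i \<notin> I \<and> add_indicator \<mu> I i = v} * excess {j\<in>{1..n}. j \<in> I \<and> add_indicator \<mu> I j = v} \<le> 0"
proof -
  let ?\<nu> = "add_indicator \<mu> I"
  define U where "U = {i\<in>{1..n}. i \<notin> I \<and> ?\<nu> i = v}"
  define V where "V = {j\<in>{1..n}. j \<in> I \<and> ?\<nu> j = v}"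
  have fin: "finite U" "finite V" unfolding U_def V_def by auto
  show ?thesis
  proof (cases "U = {} \<or> V = {}")
    case True
    then show ?thesis unfolding U_def[symmetric] V_def[symmetric] by auto
  next
    case False
    define p where "p = Min U"
    define q where "q = Min V"
    define s where "s = Max V"
    have mem: "p \<in> U" "q \<in> V" "s \<in> V" using False fin unfolding p_def q_def s_def by auto
    have UV: "i < j" if "i \<in> U" "j \<in> V" for i j
    proof (rule ccontr)
      assume "\<not> i < j"
      then have "\<mu> i \<le> \<mu> j" using LamD[OF \<mu>, of j i] that unfolding U_def V_def by auto
      then show False using that unfolding U_def V_def by (auto simp: add_indicator_def)
    qed
    have block: "?\<nu> k = v" if "p \<le> k" "k \<le> s" for k
    proof -
      have b: "1 \<le> p" "s \<le> n" "?\<nu> p = v" "?\<nu> s = v" using mem unfolding U_def V_def by auto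
      then show ?thesis using LamD[OF \<nu>, of p k] LamD[OF \<nu>, of k s] that by auto
    qed
    have b: "1 \<le> p" "s \<le> n" "p < q" "q \<le> s"
      using mem UV fin unfolding U_def V_def q_def s_def by auto
    have "U = {p..<q}"
    proof (intro set_eqI iffI)
      fix i assume "i \<in> U" then show "i \<in> {p..<q}" using UV mem(2) fin(1) unfolding p_def by auto
    next
      fix i assume i: "i \<in> {p..<q}"
      then have "?\<nu> i = v" "i \<in> {1..n}" using block[of i] b by auto
      moreover have "i \<notin> V" using i fin(2) unfolding q_def by (auto simp: not_le[symmetric])
      ultimately show "i \<in> U" unfolding U_def V_def by auto
    qed
    moreover have "V = {q..s}"
    proof (intro set_eqI iffI)
      fix i assume "i \<in> V" then show "i \<in> {q..s}" using fin(2) unfolding q_def s_def by auto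
    next
      fix i assume i: "i \<in> {q..s}"
      then have "?\<nu> i = v" "i \<in> {1..n}" using block[of i] b by auto
      moreover have "i \<notin> U" using UV[of i q] mem(2) i by auto
      ultimately show "i \<in> V" unfolding U_def V_def by auto
    qed
    ultimately have "excess U = 0 \<or> excess U = - parity_sign q" "excess V = 0 \<or> excess V = parity_sign q"
      using excess_interval_left[of p q] excess_interval_right[of q s] b by auto
    then have "excess U * excess V \<le> 0" by (auto simp: parity_sign_def)
    then show ?thesis unfolding U_def V_def .
  qed
qed

text \<open>The product of the parity signs of a pair is 1 for even and -1 for odd difference. The
  signed count of pairs splits over the common values v into products of alternating sums, none of
  which is positive.\<close>

lemma card_tie_pairs:
  assumes \<mu>: "\<mu> \<in> Lam n" and I: "I \<subseteq> {1..n}" and \<nu>: "add_indicator \<mu> I \<in> Lam n"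
  shows "card {x \<in> tie_pairs n I \<mu>. even (snd x - fst x)} \<le> card {x \<in> tie_pairs n I \<mu>. odd (snd x - fst x)}"
proof -
  let ?\<nu> = "add_indicator \<mu> I" and ?E = "tie_pairs n I \<mu>"
  let ?U = "\<lambda>v. {i\<in>{1..n}. i \<notin> I \<and> ?\<nu> i = v}" and ?V = "\<lambda>v. {j\<in>{1..n}. j \<in> I \<and> ?\<nu> j = v}"
  have fin: "finite ?E" by (rule finite_subset[of _ "index_pairs n"]) (auto simp: tie_pairs_def)
  have sgn: "parity_sign (fst x) * parity_sign (snd x) = (if even (snd x - fst x) then 1 else - 1)" if "x \<in> ?E" for x
  proof -
    have "fst x < snd x" using that by (auto simp: tie_pairs_def index_pairs_def)
    then show ?thesis by (auto simp: parity_sign_def even_diff_nat)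
  qed
  have blk: "{x \<in> ?E. ?\<nu> (fst x) = v} = ?U v \<times> ?V v" for v
  proof (intro set_eqI iffI)
    fix x assume "x \<in> ?U v \<times> ?V v"
    then obtain i j where x: "x = (i, j)" "i \<in> {1..n}" "i \<notin> I" "?\<nu> i = v" "j \<in> {1..n}" "j \<in> I" "?\<nu> j = v" by auto
    have "i < j"
    proof (rule ccontr)
      assume "\<not> i < j"
      then have "\<mu> i \<le> \<mu> j" using LamD[OF \<mu>, of j i] x by auto
      then show False using x by (auto simp: add_indicator_def)
    qed
    then show "x \<in> {x \<in> ?E. ?\<nu> (fst x) = v}" using x by (auto simp: tie_pairs_def index_pairs_def)
  qed (auto simp: tie_pairs_def index_pairs_def)
  have "int (card {x \<in> ?E. even (snd x - fst x)}) - int (card {x \<in> ?E. odd (snd x - fst x)})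
    = (\<Sum>x\<in>?E. parity_sign (fst x) * parity_sign (snd x))"
  proof -
    have "(\<Sum>x\<in>?E. parity_sign (fst x) * parity_sign (snd x)) = (\<Sum>x\<in>?E. if even (snd x - fst x) then 1 else - 1)"
      by (rule sum.cong[OF refl sgn])
    also have "\<dots> = (\<Sum>x\<in>{x\<in>?E. even (snd x - fst x)}. 1) + (\<Sum>x\<in>{x\<in>?E. odd (snd x - fst x)}. - 1)"
      unfolding sum.If_cases[OF fin] by (intro arg_cong2[where f = "(+)"] sum.cong) auto
    finally show ?thesis by simp
  qed
  also have "\<dots> = (\<Sum>v\<in>?\<nu> ` {1..n}. \<Sum>x\<in>{x \<in> ?E. ?\<nu> (fst x) = v}. parity_sign (fst x) * parity_sign (snd x))"
    by (rule sum.group[symmetric]) (use fin in \<open>auto simp: tie_pairs_def index_pairs_def\<close>)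
  also have "\<dots> = (\<Sum>v\<in>?\<nu> ` {1..n}. excess (?U v) * excess (?V v))"
    unfolding blk excess_def sum_product sum.cartesian_product by (simp add: case_prod_unfold)
  also have "\<dots> \<le> 0" by (rule sum_nonpos) (rule excess_tie_block[OF assms])
  finally show ?thesis by simp
qed

lemma fract_of_linear: "of_int c + of_nat k * indet = fract_of [:of_int c, of_nat k:]"
proof -
  have eq: "[:of_int c, of_nat k:] = of_nat k * [:0, 1:] + of_int c"
    by (simp add: of_nat_poly of_int_poly)
  show ?thesis unfolding eq fract_of_simps fract_of_nat fract_of_int indet_def by simp
qed

text \<open>The form in which the assumption on r serves both for denominators and for separating
  eigenvalues.\<close>

lemma linear_nonzero:
  fixes r :: "'a::field_char_0"
  assumes r: "\<not> (\<exists>q::rat. q < 0 \<and> r = of_rat q)" "r \<noteq> 0" and c: "0 \<le> c" and k: "0 < k"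
  shows "of_int c + of_nat k * r \<noteq> 0"
proof
  assume "of_int c + of_nat k * r = 0"
  then have eq: "r = - (of_int c / of_nat k)" using k by (simp add: field_simps eq_neg_iff_add_eq_0)
  then have "r = of_rat (- (of_int c / of_nat k))" by (simp add: of_rat_minus of_rat_divide)
  moreover have "c \<noteq> 0" using eq r(2) by auto
  then have "- (of_int c / of_nat k) < (0 :: rat)" using c k by simp
  ultimately show False using r(1) by blast
qed

text \<open>For nonzero r no denominator vanishes. At r = 0 only factors of the raised tuple at ties
  vanish; each is a multiple of the indeterminate, and \<open>card_tie_pairs\<close> ensures that
  the numerator has at least as many of them.\<close>

lemma psi_even_regular:
  fixes r :: "'a::field_char_0"
  assumes r: "\<not> (\<exists>q::rat. q < 0 \<and> r = of_rat q)"
    and \<mu>: "\<mu> \<in> Lam n" and I: "I \<subseteq> {1..n}" and \<nu>: "add_indicator \<mu> I \<in> Lam n"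
  shows "regular_at r (psi_expr n I \<mu> indet)" "ratfun_value (psi_expr n I \<mu> indet) r = psi_even n I \<mu> r"
proof -
  let ?\<nu> = "add_indicator \<mu> I"
  define Q where "Q = {(i, j). i \<in> {1..n} \<and> j \<in> {1..n} \<and> i \<notin> I \<and> j \<in> I \<and> i < j}"
  define Qo where "Qo = {(i, j) \<in> Q. odd (j - i)}"
  define Qe where "Qe = {(i, j) \<in> Q. even (j - i)}"
  have finQ: "finite Qo" "finite Qe"
    unfolding Qo_def Qe_def Q_def by (rule finite_subset[of _ "{1..n} \<times> {1..n}"]; auto)+
  define lin where "lin c k = [:of_int c, of_nat k :: 'a:]" for c :: int and k :: nat
  have plin: "poly (lin c k) x = of_int c + of_nat k * x" for c k x
    by (simp add: lin_def mult.commute)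
  define NA where "NA = (\<Prod>(i, j)\<in>Qo. lin (\<mu> i - \<mu> j) (j - i - 1) * lin (?\<nu> i - ?\<nu> j) (j - i + 1))"
  define DB where "DB = (\<Prod>(i, j)\<in>Qe. lin (\<mu> i - \<mu> j) (j - i) * lin (?\<nu> i - ?\<nu> j) (j - i))"
  have psi: "psi_expr n I \<mu> indet = fract_of NA / fract_of DB"
    unfolding psi_expr_def Let_def Q_def[symmetric] Qo_def[symmetric] Qe_def[symmetric]
    unfolding NA_def DB_def fract_of_prod case_prod_unfold fract_of_simps lin_def fract_of_linear ..
  have pos: "0 \<le> ?\<nu> i - ?\<nu> j" "0 < \<mu> i - \<mu> j" "0 < j - i" if "(i, j) \<in> Q" for i j
  proof -
    have ij: "i \<in> {1..n}" "j \<in> {1..n}" "i \<notin> I" "j \<in> I" "i < j" using that by (auto simp: Q_def)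
    then show "0 \<le> ?\<nu> i - ?\<nu> j" using LamD[OF \<nu>, of i j] by auto
    then show "0 < \<mu> i - \<mu> j" using ij by (auto simp: add_indicator_def)
    show "0 < j - i" using ij by simp
  qed
  have "regular_at r (psi_expr n I \<mu> indet) \<and> ratfun_value (psi_expr n I \<mu> indet) r = psi_even n I \<mu> r"
  proof (cases "r = 0")
    case False
    have "poly DB r \<noteq> 0"
      unfolding DB_def poly_prod using finQ(2)
    proof (subst prod_zero_iff, assumption, clarsimp)
      fix i j assume "(i, j) \<in> Qe"
        and z: "poly (lin (\<mu> i - \<mu> j) (j - i)) r = 0 \<or> poly (lin (?\<nu> i - ?\<nu> j) (j - i)) r = 0"
      then have q: "(i, j) \<in> Q" by (simp add: Qe_def)
      show False
        using z linear_nonzero[OF r False _ pos(3)[OF q], of "\<mu> i - \<mu> j"]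
          linear_nonzero[OF r False _ pos(3)[OF q], of "?\<nu> i - ?\<nu> j"] pos(1,2)[OF q]
        by (auto simp: lin_def mult.commute)
    qed
    note reg = regular_divide[OF this, of NA]
    have "poly NA r / poly DB r = psi_expr n I \<mu> r"
      unfolding psi_expr_def Let_def Q_def[symmetric] Qo_def[symmetric] Qe_def[symmetric]
      unfolding NA_def DB_def poly_prod case_prod_unfold poly_mult plin ..
    then show ?thesis using reg False unfolding psi psi_even_def by simp
  next
    case True
    define tie where "tie x \<longleftrightarrow> ?\<nu> (fst x) = ?\<nu> (snd x)" for x
    \<comment> \<open>The second factor of a pair after the indeterminate has been split off at
      ties.\<close>
    define lin' where "lin' x k = (if tie x then [:of_nat k:] else lin (?\<nu> (fst x) - ?\<nu> (snd x)) k)" for x and k :: nat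
    have lin_tie: "lin (?\<nu> (fst x) - ?\<nu> (snd x)) k = (if tie x then [:0, 1:] else 1) * lin' x k" for x k
      by (simp add: lin'_def tie_def lin_def)
    define N' where "N' = (\<Prod>x\<in>Qo. lin (\<mu> (fst x) - \<mu> (snd x)) (snd x - fst x - 1) * lin' x (snd x - fst x + 1))"
    define D' where "D' = (\<Prod>x\<in>Qe. lin (\<mu> (fst x) - \<mu> (snd x)) (snd x - fst x) * lin' x (snd x - fst x))"
    have pw: "(\<Prod>x\<in>S. if tie x then [:0, 1:] else 1 :: 'a poly) = [:0, 1:] ^ card {x \<in> S. tie x}" if "finite S" for S
      using that by (simp add: prod.If_cases Int_def)
    have NA: "NA = [:0, 1:] ^ card {x \<in> Qo. tie x} * N'"
      unfolding NA_def N'_def case_prod_unfold lin_tie pw[OF finQ(1), symmetric] prod.distrib[symmetric]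
      by (simp only: mult_ac)
    have DB: "DB = [:0, 1:] ^ card {x \<in> Qe. tie x} * D'"
      unfolding DB_def D'_def case_prod_unfold lin_tie pw[OF finQ(2), symmetric] prod.distrib[symmetric]
      by (simp only: mult_ac)
    have "{x \<in> Qo. tie x} = {x \<in> tie_pairs n I \<mu>. odd (snd x - fst x)}"
      "{x \<in> Qe. tie x} = {x \<in> tie_pairs n I \<mu>. even (snd x - fst x)}"
      unfolding Qo_def Qe_def Q_def tie_def tie_pairs_def index_pairs_def by auto
    then have "card {x \<in> Qe. tie x} \<le> card {x \<in> Qo. tie x}" using card_tie_pairs[OF \<mu> I \<nu>] by simp
    then obtain d where d: "card {x \<in> Qo. tie x} = card {x \<in> Qe. tie x} + d" using le_Suc_ex by blast
    have NA': "NA = [:0, 1:] ^ card {x \<in> Qe. tie x} * ([:0, 1:] ^ d * N')"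
      unfolding NA d power_add by (simp only: mult.assoc)
    have x0: "fract_of ([:0, 1:] ^ card {x \<in> Qe. tie x}) \<noteq> (0 :: 'a poly fract)"
      unfolding fract_of_eq_0_iff by simp
    have "psi_expr n I \<mu> indet = fract_of ([:0, 1:] ^ d * N') / fract_of D'"
      unfolding psi NA' DB unfolding fract_of_simps(5)[of "[:0, 1:] ^ card {x \<in> Qe. tie x}"] using x0 by simp
    moreover have "poly (lin (\<mu> (fst x) - \<mu> (snd x)) (snd x - fst x) * lin' x (snd x - fst x)) r \<noteq> 0"
      if "x \<in> Qe" for x
    proof -
      have "(fst x, snd x) \<in> Q" using that by (auto simp: Qe_def)
      note pos[OF this]
      then show ?thesis using True by (auto simp: lin_def lin'_def tie_def)
    qed
    then have "poly D' r \<noteq> 0"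
      unfolding D'_def poly_prod using finQ(2) by (simp add: prod_zero_iff)
    ultimately have "regular_at r (psi_expr n I \<mu> indet)" using regular_divide(1) by metis
    then show ?thesis using True unfolding psi_even_def indet_def fract_of_def by simp
  qed
  then show "regular_at r (psi_expr n I \<mu> indet)" "ratfun_value (psi_expr n I \<mu> indet) r = psi_even n I \<mu> r"
    by auto
qed

section \<open>The operators over the ground field\<close>

definition coef_at :: "nat \<Rightarrow> bool \<Rightarrow> 'a::field_char_0 \<Rightarrow> 'a \<Rightarrow> (nat \<Rightarrow> int) \<Rightarrow> nat set \<Rightarrow> 'a" where
  "coef_at n A r t \<mu> I = odd_sign I * wt A ({1..n} - I) t (rho_plus n r \<mu>) * psi_even n I \<mu> r"

definition pieri_sets :: "nat \<Rightarrow> bool \<Rightarrow> (nat \<Rightarrow> int) \<Rightarrow> nat set set" where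
  "pieri_sets n A \<mu> = {I \<in> family n A. add_indicator \<mu> I \<in> Lam n}"

definition pieri_op ::
  "nat \<Rightarrow> 'a::field_char_0 \<Rightarrow> bool \<Rightarrow> 'a \<Rightarrow> ((nat \<Rightarrow> int) \<Rightarrow> 'a) \<Rightarrow> (nat \<Rightarrow> int) \<Rightarrow> 'a" where
  "pieri_op n r A t g \<mu> = (\<Sum>I\<in>pieri_sets n A \<mu>. coef_at n A r t \<mu> I * g (add_indicator \<mu> I))"

lemma finite_pieri_sets [simp]: "finite (pieri_sets n A \<mu>)"
  unfolding pieri_sets_def by simp

lemma odd_sign_fract: "(odd_sign I :: 'a::field poly fract) = fract_of [:odd_sign I:]"
proof -
  have "fract_of [:- 1 :: 'a:] = - 1"
  proof -
    have "fract_of [:1 :: 'a:] = 1" by (metis fract_of_simps(2) one_pCons)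
    then show ?thesis using fract_of_simps(4)[of 0 "[:1 :: 'a:]"] by (simp add: fract_of_simps(1))
  qed
  then show ?thesis unfolding odd_sign_def
    by (cases "even (card {i \<in> I. odd i})") (simp_all add: fract_of_simps(2) flip: one_pCons)
qed

lemma coef_regular:
  fixes r :: "'a::field_char_0"
  assumes r: "\<not> (\<exists>q::rat. q < 0 \<and> r = of_rat q)" and \<mu>: "\<mu> \<in> Lam n" and I: "I \<in> pieri_sets n A \<mu>"
  shows "regular_at r (coef n A indet (fract_of [:t:]) \<mu> I)"
    "ratfun_value (coef n A indet (fract_of [:t:]) \<mu> I) r = coef_at n A r t \<mu> I"
proof -
  let ?p = "\<Prod>i | i \<in> {1..n} - I \<and> odd i = A. [:t:] - [:of_int (\<mu> i), of_nat (n - i):]"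
  have I': "I \<subseteq> {1..n}" "add_indicator \<mu> I \<in> Lam n" using I by (auto simp: pieri_sets_def family_def)
  have w: "wt A ({1..n} - I) (fract_of [:t:]) (rho_plus n indet \<mu>) = fract_of ?p"
    unfolding wt_def rho_plus_indet fract_of_prod fract_of_simps ..
  have p: "poly ?p r = wt A ({1..n} - I) t (rho_plus n r \<mu>)"
    unfolding wt_def poly_prod by (rule prod.cong) (simp_all add: rho_plus_def rho_def algebra_simps)
  note psi = psi_even_regular[OF r \<mu> I']
  note 1 = regular_mult[OF regular_fract_of(1)[of r "[:odd_sign I:]"] regular_fract_of(1)[of r ?p]]
  note 2 = regular_mult[OF 1(1) psi(1)]
  show "regular_at r (coef n A indet (fract_of [:t:]) \<mu> I)"
    unfolding coef_def w odd_sign_fract by (rule 2(1))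
  show "ratfun_value (coef n A indet (fract_of [:t:]) \<mu> I) r = coef_at n A r t \<mu> I"
    unfolding coef_def w odd_sign_fract 2(2) 1(2) regular_fract_of(2) psi(2) coef_at_def p by simp
qed

text \<open>The generic identity sums over the whole of \<open>family\<close>. Sets leaving
  \<Lambda> in the first step have generic coefficient 0; those leaving it in the second step are
  suppressed by the value 0 of the test function. All other terms are regular at r.\<close>

lemma pieri_op_twice:
  fixes r :: "'a::field_char_0"
  assumes r: "\<not> (\<exists>q::rat. q < 0 \<and> r = of_rat q)" and \<mu>: "\<mu> \<in> Lam n"
  shows "pieri_op n r A t (pieri_op n r A' u g) \<mu> =
    ratfun_value (\<Sum>I\<in>family n A. \<Sum>J\<in>family n A'.
      coef n A indet (fract_of [:t:]) \<mu> I * coef n A' indet (fract_of [:u:]) (add_indicator \<mu> I) J *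
      (if add_indicator (add_indicator \<mu> I) J \<in> Lam n
       then fract_of [:g (add_indicator (add_indicator \<mu> I) J):] else 0)) r"
proof -
  let ?h = "\<lambda>\<kappa>. if \<kappa> \<in> Lam n then fract_of [:g \<kappa>:] else 0"
  let ?t = "\<lambda>I J. coef n A indet (fract_of [:t:]) \<mu> I * coef n A' indet (fract_of [:u:]) (add_indicator \<mu> I) J *
      ?h (add_indicator (add_indicator \<mu> I) J)"
  have "(\<Sum>I\<in>family n A. \<Sum>J\<in>family n A'. ?t I J)
    = (\<Sum>I\<in>pieri_sets n A \<mu>. \<Sum>J\<in>family n A'. ?t I J)"
  proof (rule sum.mono_neutral_right)
    show "\<forall>I\<in>family n A - pieri_sets n A \<mu>. (\<Sum>J\<in>family n A'. ?t I J) = 0"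
    proof
      fix I assume "I \<in> family n A - pieri_sets n A \<mu>"
      then have "psi_expr n I \<mu> (indet :: 'a poly fract) = 0"
        by (intro psi_expr_outside[OF \<mu>]) (auto simp: pieri_sets_def family_def)
      then show "(\<Sum>J\<in>family n A'. ?t I J) = 0" by (simp add: coef_def)
    qed
  qed (auto simp: pieri_sets_def)
  also have "\<dots> = (\<Sum>I\<in>pieri_sets n A \<mu>. \<Sum>J\<in>pieri_sets n A' (add_indicator \<mu> I). ?t I J)"
    by (intro sum.cong[OF refl] sum.mono_neutral_right) (auto simp: pieri_sets_def)
  finally have eq: "(\<Sum>I\<in>family n A. \<Sum>J\<in>family n A'. ?t I J)
    = (\<Sum>I\<in>pieri_sets n A \<mu>. \<Sum>J\<in>pieri_sets n A' (add_indicator \<mu> I). ?t I J)" .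
  have trm: "regular_at r (?t I J) \<and> ratfun_value (?t I J) r =
      coef_at n A r t \<mu> I * (coef_at n A' r u (add_indicator \<mu> I) J * g (add_indicator (add_indicator \<mu> I) J))"
    if I: "I \<in> pieri_sets n A \<mu>" and J: "J \<in> pieri_sets n A' (add_indicator \<mu> I)" for I J
  proof -
    have L: "add_indicator \<mu> I \<in> Lam n" "add_indicator (add_indicator \<mu> I) J \<in> Lam n"
      using I J by (auto simp: pieri_sets_def)
    note c1 = coef_regular[OF r \<mu> I, of t]
    note c2 = coef_regular[OF r L(1) J, of u]
    note m1 = regular_mult[OF c1(1) c2(1)]
    note m2 = regular_mult[OF m1(1) regular_fract_of(1)[of r "[:g (add_indicator (add_indicator \<mu> I) J):]"]]
    show ?thesis using m2 L(2) unfolding m1(2) c1(2) c2(2) regular_fract_of(2) by (simp add: mult.assoc)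
  qed
  note inner = regular_sum[of "pieri_sets n A' (add_indicator \<mu> I)" r "?t I" for I]
  show ?thesis unfolding eq pieri_op_def sum_distrib_left
    using regular_sum[of "pieri_sets n A \<mu>" r "\<lambda>I. \<Sum>J\<in>pieri_sets n A' (add_indicator \<mu> I). ?t I J"]
      inner trm by simp
qed

lemma pieri_op_commute:
  fixes r :: "'a::field_char_0"
  assumes r: "\<not> (\<exists>q::rat. q < 0 \<and> r = of_rat q)" and \<mu>: "\<mu> \<in> Lam n"
  shows "pieri_op n r A t (pieri_op n r A' u g) \<mu> = pieri_op n r A' u (pieri_op n r A t g) \<mu>"
  unfolding pieri_op_twice[OF assms]
  using generic_commute[OF generic_indet, where n = n and \<mu> = \<mu> and A = A and A' = A'
    and t = "fract_of [:t:]" and u = "fract_of [:u:]" and h = "\<lambda>\<kappa>. if \<kappa> \<in> Lam n then fract_of [:g \<kappa>:] else 0"] by simp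

subsection \<open>Joint eigenfunctionals\<close>

text \<open>The diagonal coefficient (the term of the empty set) of the operator, as a polynomial in
  its parameter.\<close>

definition class_poly :: "nat \<Rightarrow> 'a::field_char_0 \<Rightarrow> bool \<Rightarrow> (nat \<Rightarrow> int) \<Rightarrow> 'a poly" where
  "class_poly n r A \<mu> = (\<Prod>i | i \<in> {1..n} \<and> odd i = A. [:- rho_plus n r \<mu> i, 1:])"

lemma poly_class_poly: "poly (class_poly n r A \<mu>) t = wt A {1..n} t (rho_plus n r \<mu>)"
  unfolding class_poly_def wt_def poly_prod by (rule prod.cong) simp_all

lemma degree_class_poly: "degree (class_poly n r A \<mu>) \<le> n"
proof -
  have "degree (class_poly n r A \<mu>) = card {i. i \<in> {1..n} \<and> odd i = A}"
    unfolding class_poly_def by (subst degree_prod_sum_eq) auto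
  also have "\<dots> \<le> card {1..n}" by (rule card_mono) auto
  finally show ?thesis by simp
qed

text \<open>After cancelling the common earlier factors, the root (rho + mu)_i equals some (rho +
  nu)_j with j >= i. If mu_i > nu_i, then j > i and (j - i) r = nu_j - mu_i < 0, because nu_j <=
  nu_i; so r would be a negative rational.\<close>

lemma class_poly_eq_imp_le:
  fixes r :: "'a::field_char_0"
  assumes r: "\<not> (\<exists>q::rat. q < 0 \<and> r = of_rat q)"
    and L: "\<mu> \<in> Lam n" "\<nu> \<in> Lam n" and eq: "class_poly n r A \<mu> = class_poly n r A \<nu>"
    and i: "i \<in> {1..n}" "odd i = A" and min: "\<And>j. j \<in> {1..n} \<Longrightarrow> odd j = A \<Longrightarrow> j < i \<Longrightarrow> \<mu> j = \<nu> j"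
  shows "\<mu> i \<le> \<nu> i"
proof (rule ccontr)
  assume gt: "\<not> \<mu> i \<le> \<nu> i"
  let ?L = "{j. j \<in> {1..n} \<and> odd j = A \<and> j < i}" and ?H = "{j. j \<in> {1..n} \<and> odd j = A \<and> i \<le> j}"
  have split: "class_poly n r A \<kappa> = (\<Prod>j\<in>?L. [:- rho_plus n r \<kappa> j, 1:]) * (\<Prod>j\<in>?H. [:- rho_plus n r \<kappa> j, 1:])" for \<kappa>
  proof -
    have "{i. i \<in> {1..n} \<and> odd i = A} = ?L \<union> ?H" by auto
    moreover have "?L \<inter> ?H = {}" by (rule Int_emptyI) (simp only: mem_Collect_eq, linarith)
    ultimately show ?thesis unfolding class_poly_def
      using prod.union_disjoint[of ?L ?H "\<lambda>j. [:- rho_plus n r \<kappa> j, 1:]"] by simp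
  qed
  have "(\<Prod>j\<in>?L. [:- rho_plus n r \<mu> j, 1:]) = (\<Prod>j\<in>?L. [:- rho_plus n r \<nu> j, 1:])"
    by (rule prod.cong) (auto simp: rho_plus_def min)
  moreover have "(\<Prod>j\<in>?L. [:- rho_plus n r \<nu> j, 1:]) \<noteq> 0" by (simp add: prod_zero_iff)
  ultimately have "(\<Prod>j\<in>?H. [:- rho_plus n r \<mu> j, 1:]) = (\<Prod>j\<in>?H. [:- rho_plus n r \<nu> j, 1:])"
    using eq unfolding split by simp
  then have "poly (\<Prod>j\<in>?H. [:- rho_plus n r \<nu> j, 1:]) (rho_plus n r \<mu> i) = poly (\<Prod>j\<in>?H. [:- rho_plus n r \<mu> j, 1:]) (rho_plus n r \<mu> i)"
    by simp
  also have "\<dots> = 0" unfolding poly_prod using i by (intro prod_zero) auto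
  finally obtain j where j: "j \<in> {1..n}" "i \<le> j" "rho_plus n r \<mu> i = rho_plus n r \<nu> j"
    unfolding poly_prod by (auto simp: prod_zero_iff)
  have "j \<noteq> i" using j(3) gt by (auto simp: rho_plus_def)
  then have ij: "i < j" using j(2) by simp
  have "\<nu> j \<le> \<nu> i" using LamD[OF L(2), of i j] i j by auto
  then have neg: "0 < \<mu> i - \<nu> j" using gt by linarith
  have "n - i = (n - j) + (j - i)" using ij j(1) by auto
  then have "of_nat (n - i) = (of_nat (n - j) + of_nat (j - i) :: 'a)" by (metis of_nat_add)
  then have "of_nat (j - i) * r = - of_int (\<mu> i - \<nu> j)"
    using j(3) unfolding rho_plus_def rho_def by (simp add: algebra_simps)
  then have z: "of_int (\<mu> i - \<nu> j) + of_nat (j - i) * r = 0" by simp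
  have "r \<noteq> 0" using z neg by auto
  then show False using linear_nonzero[OF r, of "\<mu> i - \<nu> j" "j - i"] z neg ij by auto
qed

lemma class_poly_inj:
  fixes r :: "'a::field_char_0"
  assumes r: "\<not> (\<exists>q::rat. q < 0 \<and> r = of_rat q)"
    and L: "\<mu> \<in> Lam n" "\<nu> \<in> Lam n" and eq: "\<And>A. class_poly n r A \<mu> = class_poly n r A \<nu>"
  shows "\<mu> = \<nu>"
proof -
  have "\<mu> i = \<nu> i" if "i \<in> {1..n}" for i
    using that
  proof (induction i rule: less_induct)
    case (less i)
    then have "\<mu> j = \<nu> j" if "j \<in> {1..n}" "j < i" for j using that by blast
    then show ?case
      by (intro order_antisym class_poly_eq_imp_le[OF r L eq less.prems refl]
          class_poly_eq_imp_le[OF r L(2,1) eq[symmetric] less.prems refl]) simp_all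
  qed
  moreover have "\<mu> i = \<nu> i" if "i \<notin> {1..n}" for i using that L unfolding Lam_def by simp
  ultimately show ?thesis by (metis ext)
qed

text \<open>Both eigenvalues in one polynomial: the first has degree at most \<open>n\<close>, so their coefficients do not interfere.\<close>

definition joint_poly :: "nat \<Rightarrow> 'a::field_char_0 \<Rightarrow> (nat \<Rightarrow> int) \<Rightarrow> 'a poly" where
  "joint_poly n r \<mu> = class_poly n r False \<mu> + monom 1 (n + 1) * class_poly n r True \<mu>"

lemma joint_poly_inj:
  fixes r :: "'a::field_char_0"
  assumes r: "\<not> (\<exists>q::rat. q < 0 \<and> r = of_rat q)"
    and L: "\<mu> \<in> Lam n" "\<nu> \<in> Lam n" and eq: "joint_poly n r \<mu> = joint_poly n r \<nu>"
  shows "\<mu> = \<nu>"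
proof -
  have low: "coeff (class_poly n r A \<kappa>) k = 0" if "k > n" for k A \<kappa>
    using degree_class_poly[of n r A \<kappa>] that by (intro coeff_eq_0) simp
  have c: "coeff (joint_poly n r \<kappa>) k = (if k \<le> n then coeff (class_poly n r False \<kappa>) k else coeff (class_poly n r True \<kappa>) (k - (n + 1)))" for k \<kappa>
    unfolding joint_poly_def by (simp add: coeff_monom_mult low)
  have "class_poly n r False \<mu> = class_poly n r False \<nu>"
  proof (rule poly_eqI)
    fix k show "coeff (class_poly n r False \<mu>) k = coeff (class_poly n r False \<nu>) k"
      using c[of \<mu> k] c[of \<nu> k] eq low[of k False] by (cases "k \<le> n") auto
  qed
  moreover have "class_poly n r True \<mu> = class_poly n r True \<nu>"
  proof (rule poly_eqI)
    fix k show "coeff (class_poly n r True \<mu>) k = coeff (class_poly n r True \<nu>) k"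
      using c[of \<mu> "k + (n + 1)"] c[of \<nu> "k + (n + 1)"] eq by simp
  qed
  ultimately show ?thesis using class_poly_inj[OF r L] by (metis (full_types))
qed

lemma odd_size_nonneg: "\<mu> \<in> Lam n \<Longrightarrow> 0 \<le> odd_size n \<mu>"
  unfolding odd_size_def by (intro sum_nonneg Lam_nonneg)

lemma Lam_le_odd_size:
  assumes "\<mu> \<in> Lam n" "i \<in> {1..n}"
  shows "\<mu> i \<le> odd_size n \<mu>"
proof -
  have "\<mu> i \<le> \<mu> 1" using LamD[OF assms(1), of 1 i] assms(2) by auto
  also have "\<dots> \<le> odd_size n \<mu>"
    unfolding odd_size_def by (rule member_le_sum) (use assms Lam_nonneg in auto)
  finally show ?thesis .
qed

lemma finite_Lam_bounded: "finite {\<mu> \<in> Lam n. odd_size n \<mu> \<le> d}"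
proof (rule finite_subset)
  show "{\<mu> \<in> Lam n. odd_size n \<mu> \<le> d} \<subseteq> {f. \<forall>i. (i \<in> {1..n} \<longrightarrow> f i \<in> {0..d}) \<and> (i \<notin> {1..n} \<longrightarrow> f i = 0)}"
  proof clarify
    fix \<mu> i assume m: "\<mu> \<in> Lam n" "odd_size n \<mu> \<le> d"
    show "(i \<in> {1..n} \<longrightarrow> \<mu> i \<in> {0..d}) \<and> (i \<notin> {1..n} \<longrightarrow> \<mu> i = 0)"
      using Lam_nonneg[OF m(1), of i] Lam_le_odd_size[OF m(1), of i] m unfolding Lam_def by auto
  qed
  show "finite {f. \<forall>i. (i \<in> {1..n} \<longrightarrow> f i \<in> {0..d}) \<and> (i \<notin> {1..n} \<longrightarrow> f i = 0)}"
    by (rule finite_set_of_finite_funs) auto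
qed

lemma odd_size_add_indicator:
  assumes "I \<subseteq> {1..n}"
  shows "odd_size n (add_indicator \<mu> I) = odd_size n \<mu> + int (card {i\<in>I. odd i})"
proof -
  have "odd_size n (add_indicator \<mu> I) = odd_size n \<mu> + (\<Sum>i | i \<in> {1..n} \<and> odd i. if i \<in> I then 1 else 0)"
    unfolding odd_size_def add_indicator_def by (rule sum.distrib)
  also have "(\<Sum>i | i \<in> {1..n} \<and> odd i. if i \<in> I then 1 else 0) = (\<Sum>i\<in>{i\<in>I. odd i}. 1 :: int)"
    by (rule sum.mono_neutral_cong_right) (use assms in auto)
  finally show ?thesis by simp
qed

lemma family_card:
  assumes "I \<in> family n A"
  shows "I \<subseteq> {1..n}" "card {i\<in>I. even i} \<le> card {i\<in>I. odd i}" "card {i\<in>I. odd i} \<le> card {i\<in>I. even i} + 1"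
    "I \<noteq> {} \<Longrightarrow> 0 < card {i\<in>I. odd i}"
proof -
  show sub: "I \<subseteq> {1..n}" using assms by (simp add: family_def)
  have fin: "finite I" using finite_subset[OF sub] by simp
  show *: "card {i\<in>I. even i} \<le> card {i\<in>I. odd i}" "card {i\<in>I. odd i} \<le> card {i\<in>I. even i} + 1"
    using assms excess_card[OF fin] by (auto simp: family_def admissible_def)
  show "0 < card {i\<in>I. odd i}" if "I \<noteq> {}"
  proof (rule ccontr)
    assume "\<not> ?thesis"
    then have "card {i\<in>I. odd i} = 0" "card {i\<in>I. even i} = 0" using * by auto
    then have "{i\<in>I. odd i} = {}" "{i\<in>I. even i} = {}" using fin by auto
    then show False using that by blast
  qed
qed

text \<open>In a member of the family the even elements do not outnumber the odd ones, so a nonempty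
  member has an odd element. This makes the operators triangular.\<close>

lemma odd_size_pieri:
  assumes "I \<in> pieri_sets n A \<mu>" "I \<noteq> {}"
  shows "odd_size n \<mu> < odd_size n (add_indicator \<mu> I)"
  using assms family_card[of I n A] odd_size_add_indicator[of I n \<mu>] by (auto simp: pieri_sets_def)

lemma add_indicator_empty [simp]: "add_indicator \<mu> {} = \<mu>"
  by (auto simp: add_indicator_def)

lemma coef_at_empty: "coef_at n A r t \<mu> {} = poly (class_poly n r A \<mu>) t"
proof -
  have e: "psi_expr n {} \<mu> x = 1" for x :: "'b::field" unfolding psi_expr_pairs by simp
  have "ratfun_value (1 :: 'a poly fract) 0 = 1"
    using regular_fract_of(2)[of "1 :: 'a poly" 0] by (simp add: fract_of_simps)
  then have "psi_even n {} \<mu> r = 1" unfolding psi_even_def e by simp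
  then show ?thesis unfolding coef_at_def poly_class_poly by (simp add: odd_sign_def)
qed

definition pieri_up ::
  "nat \<Rightarrow> 'a::field_char_0 \<Rightarrow> bool \<Rightarrow> 'a \<Rightarrow> ((nat \<Rightarrow> int) \<Rightarrow> 'a) \<Rightarrow> (nat \<Rightarrow> int) \<Rightarrow> 'a" where
  "pieri_up n r A t g \<mu> = (\<Sum>I\<in>pieri_sets n A \<mu> - {{}}. coef_at n A r t \<mu> I * g (add_indicator \<mu> I))"

lemma pieri_op_split:
  assumes "\<mu> \<in> Lam n"
  shows "pieri_op n r A t g \<mu> = poly (class_poly n r A \<mu>) t * g \<mu> + pieri_up n r A t g \<mu>"
proof -
  have "{} \<in> pieri_sets n A \<mu>" using assms by (simp add: pieri_sets_def family_def admissible_def)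
  then show ?thesis
    unfolding pieri_op_def pieri_up_def by (subst sum.remove[of _ "{}"]) (simp_all add: coef_at_empty)
qed

lemma pieri_up_cong:
  assumes "\<And>\<kappa>. \<kappa> \<in> Lam n \<Longrightarrow> odd_size n \<mu> < odd_size n \<kappa> \<Longrightarrow> g \<kappa> = h \<kappa>"
  shows "pieri_up n r A t g \<mu> = pieri_up n r A t h \<mu>"
  unfolding pieri_up_def
proof (rule sum.cong[OF refl])
  fix I assume "I \<in> pieri_sets n A \<mu> - {{}}"
  then show "coef_at n A r t \<mu> I * g (add_indicator \<mu> I) = coef_at n A r t \<mu> I * h (add_indicator \<mu> I)"
    using assms[of "add_indicator \<mu> I"] odd_size_pieri[of I n A \<mu>] by (auto simp: pieri_sets_def)
qed

lemma pieri_op_cong: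
  assumes "\<And>\<kappa>. \<kappa> \<in> Lam n \<Longrightarrow> g \<kappa> = h \<kappa>"
  shows "pieri_op n r A t g \<mu> = pieri_op n r A t h \<mu>"
  unfolding pieri_op_def by (rule sum.cong[OF refl]) (use assms in \<open>auto simp: pieri_sets_def\<close>)

lemma pieri_op_linear:
  "pieri_op n r A t (\<lambda>\<kappa>. g \<kappa> + c * h \<kappa>) \<mu> = pieri_op n r A t g \<mu> + c * pieri_op n r A t h \<mu>"
  unfolding pieri_op_def sum_distrib_left sum.distrib[symmetric]
  by (rule sum.cong[OF refl]) (simp add: algebra_simps)

section \<open>Eigenvectors of one operator combining both parities\<close>

definition joint_op ::
  "nat \<Rightarrow> 'a::field_char_0 \<Rightarrow> 'a \<Rightarrow> ((nat \<Rightarrow> int) \<Rightarrow> 'a) \<Rightarrow> (nat \<Rightarrow> int) \<Rightarrow> 'a" where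
  "joint_op n r t g \<mu> = pieri_op n r False t g \<mu> + t ^ (n + 1) * pieri_op n r True t g \<mu>"

definition joint_up ::
  "nat \<Rightarrow> 'a::field_char_0 \<Rightarrow> 'a \<Rightarrow> ((nat \<Rightarrow> int) \<Rightarrow> 'a) \<Rightarrow> (nat \<Rightarrow> int) \<Rightarrow> 'a" where
  "joint_up n r t g \<mu> = pieri_up n r False t g \<mu> + t ^ (n + 1) * pieri_up n r True t g \<mu>"

lemma joint_op_split:
  assumes "\<mu> \<in> Lam n"
  shows "joint_op n r t g \<mu> = poly (joint_poly n r \<mu>) t * g \<mu> + joint_up n r t g \<mu>"
  unfolding joint_op_def joint_up_def joint_poly_def pieri_op_split[OF assms]
  by (simp add: poly_monom algebra_simps)

lemma joint_up_cong:
  assumes "\<And>\<kappa>. \<kappa> \<in> Lam n \<Longrightarrow> odd_size n \<mu> < odd_size n \<kappa> \<Longrightarrow> g \<kappa> = h \<kappa>"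
  shows "joint_up n r t g \<mu> = joint_up n r t h \<mu>"
  unfolding joint_up_def using pieri_up_cong[OF assms, where r = r and t = t] by simp

lemma joint_up_zero: "joint_up n r t (\<lambda>_. 0) \<mu> = 0"
  by (simp add: joint_up_def pieri_up_def)

text \<open>Only finitely many tuples must be told apart from \<nu>, so finitely many roots are to
  be avoided in an infinite field. The point may depend on \<nu>.\<close>

lemma ex_separating_point:
  fixes r :: "'a::field_char_0"
  assumes r: "\<not> (\<exists>q::rat. q < 0 \<and> r = of_rat q)" and \<nu>: "\<nu> \<in> Lam n"
  obtains t where "\<And>\<mu>. \<mu> \<in> Lam n \<Longrightarrow> odd_size n \<mu> \<le> odd_size n \<nu> \<Longrightarrow> \<mu> \<noteq> \<nu> \<Longrightarrow>
    poly (joint_poly n r \<mu>) t \<noteq> poly (joint_poly n r \<nu>) t"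
proof -
  let ?S = "{\<mu> \<in> Lam n. odd_size n \<mu> \<le> odd_size n \<nu>} - {\<nu>}"
  have "finite (\<Union>\<mu>\<in>?S. {t. poly (joint_poly n r \<mu> - joint_poly n r \<nu>) t = 0})"
  proof (rule finite_UN_I)
    show "finite ?S" using finite_Lam_bounded by blast
    fix \<mu> assume "\<mu> \<in> ?S"
    then have "joint_poly n r \<mu> - joint_poly n r \<nu> \<noteq> 0" using joint_poly_inj[OF r _ \<nu>] by auto
    then show "finite {t. poly (joint_poly n r \<mu> - joint_poly n r \<nu>) t = 0}" by (rule poly_roots_finite)
  qed
  then obtain t where "t \<notin> (\<Union>\<mu>\<in>?S. {t. poly (joint_poly n r \<mu> - joint_poly n r \<nu>) t = 0})"
    using ex_new_if_finite[OF infinite_UNIV_char_0] by blast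
  then show ?thesis by (intro that[of t]) auto
qed

text \<open>Descending induction on \<open>odd_size\<close>: the strictly raising part meets only
  values already known to be 0, so a nonzero value would force the diagonal entry to equal
  \<open>x\<close>.\<close>

lemma joint_eigenvector_unique:
  assumes sep: "\<And>\<mu>. \<mu> \<in> Lam n \<Longrightarrow> odd_size n \<mu> \<le> d \<Longrightarrow> \<mu> \<noteq> \<nu> \<Longrightarrow> poly (joint_poly n r \<mu>) t \<noteq> x"
    and top: "\<And>\<mu>. \<mu> \<in> Lam n \<Longrightarrow> d \<le> odd_size n \<mu> \<or> \<mu> = \<nu> \<Longrightarrow> g \<mu> = 0"
    and eig: "\<And>\<mu>. \<mu> \<in> Lam n \<Longrightarrow> joint_op n r t g \<mu> = x * g \<mu>"
    and \<mu>: "\<mu> \<in> Lam n"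
  shows "g \<mu> = 0"
proof -
  have "\<mu> \<in> Lam n \<Longrightarrow> d - int k \<le> odd_size n \<mu> \<Longrightarrow> g \<mu> = 0" for k \<mu>
  proof (induction k arbitrary: \<mu> rule: less_induct)
    case (less k)
    show ?case
    proof (cases "d \<le> odd_size n \<mu> \<or> \<mu> = \<nu>")
      case False
      then have k: "0 < k" using less.prems by (cases k) auto
      have "joint_up n r t g \<mu> = joint_up n r t (\<lambda>_. 0) \<mu>"
      proof (rule joint_up_cong)
        fix \<kappa> assume "\<kappa> \<in> Lam n" "odd_size n \<mu> < odd_size n \<kappa>"
        then show "g \<kappa> = 0" using less.IH[of "k - 1" \<kappa>] less.prems k by auto
      qed
      then have "poly (joint_poly n r \<mu>) t * g \<mu> = x * g \<mu>"
        using eig[OF less.prems(1)] joint_op_split[OF less.prems(1), of r t g] by (simp add: joint_up_zero)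
      then show ?thesis using sep[OF less.prems(1)] False by auto
    qed (use top less.prems in auto)
  qed
  from this[OF \<mu>, of "nat (d - odd_size n \<mu>)"] show ?thesis by simp
qed

text \<open>The eigenvalue equation is solved level by level downwards from \<nu>; each new value is
  the raising part divided by a difference of diagonal entries. The induction counts the levels
  below \<nu> on which the equation already holds.\<close>

lemma ex_joint_eigenvector:
  assumes \<nu>: "\<nu> \<in> Lam n"
    and sep: "\<And>\<mu>. \<mu> \<in> Lam n \<Longrightarrow> odd_size n \<mu> \<le> odd_size n \<nu> \<Longrightarrow> \<mu> \<noteq> \<nu> \<Longrightarrow>
      poly (joint_poly n r \<mu>) t \<noteq> poly (joint_poly n r \<nu>) t"
  obtains g where "g \<nu> = 1" "\<And>\<mu>. \<mu> \<in> Lam n \<Longrightarrow> odd_size n \<nu> \<le> odd_size n \<mu> \<Longrightarrow> \<mu> \<noteq> \<nu> \<Longrightarrow> g \<mu> = 0"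
    "\<And>\<mu>. \<mu> \<in> Lam n \<Longrightarrow> joint_op n r t g \<mu> = poly (joint_poly n r \<nu>) t * g \<mu>"
proof -
  let ?d = "odd_size n \<nu>" and ?x = "\<lambda>\<mu>. poly (joint_poly n r \<mu>) t"
  have "\<exists>g. g \<nu> = 1 \<and> (\<forall>\<mu>\<in>Lam n. ?d \<le> odd_size n \<mu> \<and> \<mu> \<noteq> \<nu> \<longrightarrow> g \<mu> = 0) \<and>
    (\<forall>\<mu>\<in>Lam n. ?d - int k \<le> odd_size n \<mu> \<longrightarrow> joint_op n r t g \<mu> = ?x \<nu> * g \<mu>)" for k
  proof (induction k)
    case 0
    define g where "g \<mu> = (if \<mu> = \<nu> then 1 else 0 :: 'a)" for \<mu>
    have "joint_op n r t g \<mu> = ?x \<nu> * g \<mu>" if "\<mu> \<in> Lam n" "?d \<le> odd_size n \<mu>" for \<mu>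
    proof -
      have "joint_up n r t g \<mu> = joint_up n r t (\<lambda>_. 0) \<mu>"
        by (rule joint_up_cong) (use that in \<open>auto simp: g_def\<close>)
      then show ?thesis using joint_op_split[OF that(1), of r t g] by (simp add: g_def joint_up_zero)
    qed
    moreover have "g \<nu> = 1" "\<And>\<mu>. \<mu> \<noteq> \<nu> \<Longrightarrow> g \<mu> = 0" by (simp_all add: g_def)
    ultimately show ?case by (intro exI[of _ g]) simp
  next
    case (Suc k)
    then obtain g where g: "g \<nu> = 1" "\<And>\<mu>. \<mu> \<in> Lam n \<Longrightarrow> ?d \<le> odd_size n \<mu> \<Longrightarrow> \<mu> \<noteq> \<nu> \<Longrightarrow> g \<mu> = 0"
      "\<And>\<mu>. \<mu> \<in> Lam n \<Longrightarrow> ?d - int k \<le> odd_size n \<mu> \<Longrightarrow> joint_op n r t g \<mu> = ?x \<nu> * g \<mu>" by blast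
    define h where "h \<mu> = (if odd_size n \<mu> = ?d - int (Suc k) then joint_up n r t g \<mu> / (?x \<nu> - ?x \<mu>) else g \<mu>)" for \<mu>
    have up: "joint_up n r t h \<mu> = joint_up n r t g \<mu>" if "?d - int (Suc k) \<le> odd_size n \<mu>" for \<mu>
      by (rule joint_up_cong) (use that in \<open>auto simp: h_def\<close>)
    have "joint_op n r t h \<mu> = ?x \<nu> * h \<mu>" if \<mu>: "\<mu> \<in> Lam n" "?d - int (Suc k) \<le> odd_size n \<mu>" for \<mu>
    proof (cases "odd_size n \<mu> = ?d - int (Suc k)")
      case True
      then have "?x \<mu> \<noteq> ?x \<nu>" by (intro sep \<mu>(1)) auto
      then have "(?x \<nu> - ?x \<mu>) * h \<mu> = joint_up n r t g \<mu>" using True by (simp add: h_def)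
      then show ?thesis unfolding joint_op_split[OF \<mu>(1)] up[OF \<mu>(2)] by (simp add: algebra_simps)
    next
      case False
      then have "joint_op n r t g \<mu> = ?x \<nu> * g \<mu>" using g(3)[of \<mu>] \<mu> by auto
      then show ?thesis using False unfolding joint_op_split[OF \<mu>(1)] up[OF \<mu>(2)] by (simp add: h_def)
    qed
    moreover have "h \<nu> = 1" using g(1) by (simp add: h_def)
    moreover have "h \<mu> = 0" if "\<mu> \<in> Lam n" "?d \<le> odd_size n \<mu>" "\<mu> \<noteq> \<nu>" for \<mu>
      using g(2)[OF that] that by (simp add: h_def)
    ultimately show ?case by blast
  qed
  from this[of "nat ?d"] obtain g where g: "g \<nu> = 1" "\<And>\<mu>. \<mu> \<in> Lam n \<Longrightarrow> ?d \<le> odd_size n \<mu> \<Longrightarrow> \<mu> \<noteq> \<nu> \<Longrightarrow> g \<mu> = 0"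
      "\<And>\<mu>. \<mu> \<in> Lam n \<Longrightarrow> ?d - int (nat ?d) \<le> odd_size n \<mu> \<Longrightarrow> joint_op n r t g \<mu> = ?x \<nu> * g \<mu>" by blast
  show ?thesis
    by (rule that[of g]) (use g odd_size_nonneg[OF \<nu>] odd_size_nonneg in simp_all)
qed

text \<open>For any operator D of the family with diagonal entry y at \<nu>, commutation makes D g -
  y g an eigenvector of the joint operator with the same eigenvalue as g. It vanishes at \<nu> and
  at all other tuples of at least the size of \<nu>, hence everywhere.\<close>

lemma ex_eigenfunctional:
  fixes r :: "'a::field_char_0"
  assumes r: "\<not> (\<exists>q::rat. q < 0 \<and> r = of_rat q)" and \<nu>: "\<nu> \<in> Lam n"
  obtains g where "g \<nu> = 1" "\<And>\<mu>. \<mu> \<in> Lam n \<Longrightarrow> odd_size n \<nu> \<le> odd_size n \<mu> \<Longrightarrow> \<mu> \<noteq> \<nu> \<Longrightarrow> g \<mu> = 0"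
    "\<And>\<mu> A u. \<mu> \<in> Lam n \<Longrightarrow> pieri_op n r A u g \<mu> = poly (class_poly n r A \<nu>) u * g \<mu>"
proof -
  obtain t where t: "\<And>\<mu>. \<mu> \<in> Lam n \<Longrightarrow> odd_size n \<mu> \<le> odd_size n \<nu> \<Longrightarrow> \<mu> \<noteq> \<nu> \<Longrightarrow>
      poly (joint_poly n r \<mu>) t \<noteq> poly (joint_poly n r \<nu>) t"
    using ex_separating_point[OF r \<nu>] by metis
  obtain g where g: "g \<nu> = 1" "\<And>\<mu>. \<mu> \<in> Lam n \<Longrightarrow> odd_size n \<nu> \<le> odd_size n \<mu> \<Longrightarrow> \<mu> \<noteq> \<nu> \<Longrightarrow> g \<mu> = 0"
    "\<And>\<mu>. \<mu> \<in> Lam n \<Longrightarrow> joint_op n r t g \<mu> = poly (joint_poly n r \<nu>) t * g \<mu>"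
    by (rule ex_joint_eigenvector[OF \<nu>, of r t]) (use t in blast)+
  have "pieri_op n r A u g \<mu> = poly (class_poly n r A \<nu>) u * g \<mu>" if \<mu>: "\<mu> \<in> Lam n" for \<mu> A u
  proof -
    define y where "y = poly (class_poly n r A \<nu>) u"
    define h where "h \<kappa> = pieri_op n r A u g \<kappa> + (- y) * g \<kappa>" for \<kappa>
    have op_h: "pieri_op n r B s h \<kappa> = pieri_op n r A u (pieri_op n r B s g) \<kappa> + (- y) * pieri_op n r B s g \<kappa>"
      if "\<kappa> \<in> Lam n" for B s \<kappa>
      unfolding h_def pieri_op_linear pieri_op_commute[OF r that, of B s A u g] ..
    have "h \<mu> = 0"
    proof (rule joint_eigenvector_unique[where d = "odd_size n \<nu>" and \<nu> = \<nu>, OF t _ _ \<mu>])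
      fix \<kappa> assume \<kappa>: "\<kappa> \<in> Lam n"
      have "pieri_op n r A u (joint_op n r t g) \<kappa> = pieri_op n r A u (\<lambda>\<kappa>. 0 + poly (joint_poly n r \<nu>) t * g \<kappa>) \<kappa>"
        by (rule pieri_op_cong) (use g(3) in simp)
      also have "\<dots> = poly (joint_poly n r \<nu>) t * pieri_op n r A u g \<kappa>"
        unfolding pieri_op_linear by (simp add: pieri_op_def)
      finally have "pieri_op n r A u (joint_op n r t g) \<kappa> = poly (joint_poly n r \<nu>) t * pieri_op n r A u g \<kappa>" .
      moreover have "pieri_op n r A u (joint_op n r t g) \<kappa> =
          pieri_op n r A u (pieri_op n r False t g) \<kappa> + t ^ (n + 1) * pieri_op n r A u (pieri_op n r True t g) \<kappa>"
        unfolding joint_op_def pieri_op_linear ..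
      ultimately have e: "pieri_op n r A u (pieri_op n r False t g) \<kappa> +
          t ^ (n + 1) * pieri_op n r A u (pieri_op n r True t g) \<kappa> =
          poly (joint_poly n r \<nu>) t * pieri_op n r A u g \<kappa>" by simp
      have "joint_op n r t h \<kappa> = (pieri_op n r A u (pieri_op n r False t g) \<kappa> +
          t ^ (n + 1) * pieri_op n r A u (pieri_op n r True t g) \<kappa>) + (- y) * joint_op n r t g \<kappa>"
        unfolding joint_op_def op_h[OF \<kappa>] distrib_left by (simp only: ac_simps)
      then show "joint_op n r t h \<kappa> = poly (joint_poly n r \<nu>) t * h \<kappa>"
        unfolding e g(3)[OF \<kappa>] h_def distrib_left by (simp only: ac_simps)
      assume top: "odd_size n \<nu> \<le> odd_size n \<kappa> \<or> \<kappa> = \<nu>"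
      have "pieri_up n r A u g \<kappa> = pieri_up n r A u (\<lambda>_. 0) \<kappa>"
      proof (rule pieri_up_cong)
        fix \<kappa>' assume "\<kappa>' \<in> Lam n" "odd_size n \<kappa> < odd_size n \<kappa>'"
        then show "g \<kappa>' = 0" by (intro g(2)) (use top in auto)
      qed
      then have "pieri_op n r A u g \<kappa> = poly (class_poly n r A \<kappa>) u * g \<kappa>"
        unfolding pieri_op_split[OF \<kappa>] by (simp add: pieri_up_def)
      then show "h \<kappa> = 0" using g(2)[OF \<kappa>] top unfolding h_def y_def by (cases "\<kappa> = \<nu>") auto
    qed
    then show ?thesis unfolding h_def y_def by simp
  qed
  then show ?thesis using that[of g] g(1,2) by blast
qed

subsection \<open>Semisymmetric polynomials and their leading exponents\<close>

lemma mpol_decompose: "p = (\<Sum>e\<in>Poly_Mapping.keys p. Poly_Mapping.single e (Poly_Mapping.lookup p e))"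
proof (rule poly_mapping_eqI)
  fix k
  have "(\<Sum>e\<in>Poly_Mapping.keys p. Poly_Mapping.lookup (Poly_Mapping.single e (Poly_Mapping.lookup p e)) k)
    = (\<Sum>e\<in>Poly_Mapping.keys p. if e = k then Poly_Mapping.lookup p k else 0)"
    by (rule sum.cong[OF refl]) (auto simp: lookup_single when_def)
  also have "\<dots> = Poly_Mapping.lookup p k" by (auto simp: in_keys_iff)
  finally show "Poly_Mapping.lookup p k = Poly_Mapping.lookup
      (\<Sum>e\<in>Poly_Mapping.keys p. Poly_Mapping.single e (Poly_Mapping.lookup p e)) k"
    by (simp add: lookup_sum)
qed

lemma mpol_induct [case_names zero single add]:
  fixes p :: "'k \<Rightarrow>\<^sub>0 'c::comm_monoid_add"
  assumes "P 0" "\<And>e c. P (Poly_Mapping.single e c)" "\<And>p q. P p \<Longrightarrow> P q \<Longrightarrow> P (p + q)"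
  shows "P p"
proof -
  have "P (\<Sum>e\<in>E. Poly_Mapping.single e (Poly_Mapping.lookup p e))" for E
    by (induction E rule: infinite_finite_induct) (auto intro: assms)
  then show ?thesis using mpol_decompose[of p] by metis
qed

definition mon :: "(nat \<Rightarrow> 'b::comm_semiring_1) \<Rightarrow> (nat \<Rightarrow>\<^sub>0 nat) \<Rightarrow> 'b" where
  "mon f e = (\<Prod>i\<in>Poly_Mapping.keys e. f i ^ Poly_Mapping.lookup e i)"

lemma mon_superset:
  assumes "finite S" "Poly_Mapping.keys e \<subseteq> S"
  shows "mon f e = (\<Prod>i\<in>S. f i ^ Poly_Mapping.lookup e i)"
  unfolding mon_def by (rule prod.mono_neutral_left) (use assms in \<open>auto simp: in_keys_iff\<close>)

lemma mon_zero [simp]: "mon f 0 = 1"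
  by (simp add: mon_def)

lemma mon_single [simp]: "mon f (Poly_Mapping.single i k) = f i ^ k"
  by (simp add: mon_def)

lemma mon_add: "mon f (d + e) = mon f d * mon f e"
proof -
  let ?S = "Poly_Mapping.keys d \<union> Poly_Mapping.keys e"
  have "mon f (d + e) = (\<Prod>i\<in>?S. f i ^ Poly_Mapping.lookup (d + e) i)"
    by (rule mon_superset) (simp_all add: Poly_Mapping.keys_add)
  also have "\<dots> = (\<Prod>i\<in>?S. f i ^ Poly_Mapping.lookup d i) * (\<Prod>i\<in>?S. f i ^ Poly_Mapping.lookup e i)"
    by (simp add: lookup_add power_add prod.distrib)
  also have "(\<Prod>i\<in>?S. f i ^ Poly_Mapping.lookup d i) = mon f d" by (rule mon_superset[symmetric]) auto
  also have "(\<Prod>i\<in>?S. f i ^ Poly_Mapping.lookup e i) = mon f e" by (rule mon_superset[symmetric]) auto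
  finally show ?thesis .
qed

lemma subst_pol_superset:
  assumes "finite S" "Poly_Mapping.keys p \<subseteq> S" "h 0 = 0"
  shows "subst_pol h f p = (\<Sum>e\<in>S. h (Poly_Mapping.lookup p e) * mon f e)"
  unfolding subst_pol_def mon_def[symmetric]
  by (rule sum.mono_neutral_left) (use assms in \<open>auto simp: in_keys_iff\<close>)

text \<open>Covers both evaluation at a point, with identical coefficients, and permutation of
  variables, with \<open>const_pol\<close> as the coefficient map.\<close>

locale coeff_hom =
  fixes h :: "'a::comm_ring_1 \<Rightarrow> 'b::comm_ring_1"
  assumes h_zero: "h 0 = 0" and h_one: "h 1 = 1"
    and h_add: "h (a + b) = h a + h b" and h_mult: "h (a * b) = h a * h b"
begin

lemma subst_zero: "subst_pol h f 0 = 0"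
  by (simp add: subst_pol_def)

lemma subst_single: "subst_pol h f (Poly_Mapping.single e c) = h c * mon f e"
  by (cases "c = 0") (simp_all add: subst_pol_def mon_def h_zero)

lemma subst_add: "subst_pol h f (p + q) = subst_pol h f p + subst_pol h f q"
proof -
  let ?S = "Poly_Mapping.keys p \<union> Poly_Mapping.keys q"
  have "subst_pol h f (p + q) = (\<Sum>e\<in>?S. h (Poly_Mapping.lookup (p + q) e) * mon f e)"
    by (rule subst_pol_superset) (simp_all add: Poly_Mapping.keys_add h_zero)
  also have "\<dots> = (\<Sum>e\<in>?S. h (Poly_Mapping.lookup p e) * mon f e) + (\<Sum>e\<in>?S. h (Poly_Mapping.lookup q e) * mon f e)"
    by (simp add: lookup_add h_add distrib_right sum.distrib)
  also have "(\<Sum>e\<in>?S. h (Poly_Mapping.lookup p e) * mon f e) = subst_pol h f p"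
    by (rule subst_pol_superset[symmetric]) (auto simp: h_zero)
  also have "(\<Sum>e\<in>?S. h (Poly_Mapping.lookup q e) * mon f e) = subst_pol h f q"
    by (rule subst_pol_superset[symmetric]) (auto simp: h_zero)
  finally show ?thesis .
qed

lemma subst_mult: "subst_pol h f (p * q) = subst_pol h f p * subst_pol h f q"
proof (induction p rule: mpol_induct)
  case (single e c)
  show ?case
  proof (induction q rule: mpol_induct)
    case (single e' c')
    then show ?case by (simp add: mult_single h_mult mon_add subst_single ac_simps)
  qed (simp_all add: distrib_left subst_add subst_zero)
qed (simp_all add: distrib_right subst_add subst_zero)

lemma subst_const: "subst_pol h f (const_pol c) = h c"
  by (simp add: const_pol_def subst_single)

lemma subst_var: "subst_pol h f (var_pol i) = f i"
  by (simp add: var_pol_def subst_single h_one)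

lemma subst_sum: "subst_pol h f (\<Sum>x\<in>S. g x) = (\<Sum>x\<in>S. subst_pol h f (g x))"
  by (induction S rule: infinite_finite_induct) (simp_all add: subst_add subst_zero)

end

lemma const_pol_simps: "const_pol 0 = 0" "const_pol 1 = 1"
  "const_pol (a + b) = const_pol a + const_pol b" "const_pol (a * b) = const_pol a * const_pol (b :: 'a::comm_ring_1)"
  by (simp_all add: const_pol_def single_add mult_single flip: single_one)

interpretation eval_hom: coeff_hom "\<lambda>c. c"
  by standard simp_all

interpretation const_hom: coeff_hom const_pol
  by standard (simp_all add: const_pol_simps)

lemmas eval_pol_simps = eval_hom.subst_add[folded eval_pol_def] eval_hom.subst_mult[folded eval_pol_def]
  eval_hom.subst_const[folded eval_pol_def] eval_hom.subst_var[folded eval_pol_def]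
  eval_hom.subst_zero[folded eval_pol_def] eval_hom.subst_single[folded eval_pol_def]
  eval_hom.subst_sum[folded eval_pol_def]

lemmas permute_vars_simps = const_hom.subst_add[where f = "\<lambda>i. var_pol (\<pi> i)" for \<pi>, folded permute_vars_def]
  const_hom.subst_mult[where f = "\<lambda>i. var_pol (\<pi> i)" for \<pi>, folded permute_vars_def]
  const_hom.subst_const[where f = "\<lambda>i. var_pol (\<pi> i)" for \<pi>, folded permute_vars_def]
  const_hom.subst_zero[where f = "\<lambda>i. var_pol (\<pi> i)" for \<pi>, folded permute_vars_def]
  const_hom.subst_single[where f = "\<lambda>i. var_pol (\<pi> i)" for \<pi>, folded permute_vars_def]
  const_hom.subst_sum[where f = "\<lambda>i. var_pol (\<pi> i)" for \<pi>, folded permute_vars_def]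

lemma in_vars_simps:
  fixes p q :: "'a::comm_ring_1 mpol"
  shows "in_vars V (0 :: 'a mpol)" "in_vars V (const_pol c :: 'a mpol)"
  "in_vars V p \<Longrightarrow> in_vars V q \<Longrightarrow> in_vars V (p + q)"
  "in_vars V p \<Longrightarrow> in_vars V q \<Longrightarrow> in_vars V (p * q)"
proof -
  show "in_vars V 0" "in_vars V (const_pol c)" by (auto simp: in_vars_def const_pol_def)
  show "in_vars V (p + q)" if "in_vars V p" "in_vars V q"
    using that Poly_Mapping.keys_add[of p q] unfolding in_vars_def by blast
  show "in_vars V (p * q)" if pq: "in_vars V p" "in_vars V q"
    unfolding in_vars_def
  proof
    fix e assume "e \<in> Poly_Mapping.keys (p * q)"
    then obtain a b where "e = a + b" "a \<in> Poly_Mapping.keys p" "b \<in> Poly_Mapping.keys q"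
      using keys_mult[of p q] by blast
    then show "Poly_Mapping.keys e \<subseteq> V"
      using pq Poly_Mapping.keys_add[of a b] unfolding in_vars_def by blast
  qed
qed

lemma semisymmetric_simps:
  "semisymmetric n (0 :: 'a::comm_ring_1 mpol)" "semisymmetric n (const_pol (c :: 'a::comm_ring_1))"
  "semisymmetric n p \<Longrightarrow> semisymmetric n q \<Longrightarrow> semisymmetric n (p + q)"
  "semisymmetric n p \<Longrightarrow> semisymmetric n q \<Longrightarrow> semisymmetric n (p * q :: 'a::comm_ring_1 mpol)"
  by (auto simp: semisymmetric_def in_vars_simps permute_vars_simps)

lemma semisymmetric_sum:
  assumes "\<And>x. x \<in> S \<Longrightarrow> semisymmetric n (f x)"
  shows "semisymmetric n (\<Sum>x\<in>S. f x :: 'a::comm_ring_1 mpol)"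
  using assms by (induction S rule: infinite_finite_induct) (auto intro: semisymmetric_simps)

lemma uminus_const: "- p = const_pol (- 1) * (p :: 'a::comm_ring_1 mpol)"
  using const_pol_simps(3)[of "- 1 :: 'a" 1] by (simp add: const_pol_simps(1,2) eq_neg_iff_add_eq_0[symmetric])

lemma eval_pol_uminus: "eval_pol (- p) z = - eval_pol p (z :: nat \<Rightarrow> 'a::comm_ring_1)"
  by (subst uminus_const) (simp add: eval_pol_simps)

lemma eval_pol_diff: "eval_pol (p - q) z = eval_pol p z - eval_pol q (z :: nat \<Rightarrow> 'a::comm_ring_1)"
  using eval_pol_simps(1)[of p "- q" z] by (simp add: eval_pol_uminus)

lemma semisymmetric_diff:
  "semisymmetric n p \<Longrightarrow> semisymmetric n q \<Longrightarrow> semisymmetric n (p - q :: 'a::comm_ring_1 mpol)"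
  using semisymmetric_simps(3)[of n p "- q"] semisymmetric_simps(4)[OF semisymmetric_simps(2), of n q "- 1"]
  by (simp flip: uminus_const)

section \<open>Degrees and bracket exponents\<close>

definition exp_deg :: "(nat \<Rightarrow>\<^sub>0 nat) \<Rightarrow> nat" where
  "exp_deg e = (\<Sum>i\<in>Poly_Mapping.keys e. Poly_Mapping.lookup e i)"

lemma exp_deg_superset:
  assumes "finite S" "Poly_Mapping.keys e \<subseteq> S"
  shows "exp_deg e = (\<Sum>i\<in>S. Poly_Mapping.lookup e i)"
  unfolding exp_deg_def by (rule sum.mono_neutral_left) (use assms in \<open>auto simp: in_keys_iff\<close>)

lemma exp_deg_add: "exp_deg (d + e) = exp_deg d + exp_deg e"
proof -
  let ?S = "Poly_Mapping.keys d \<union> Poly_Mapping.keys e"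
  have "exp_deg (d + e) = (\<Sum>i\<in>?S. Poly_Mapping.lookup (d + e) i)"
    by (rule exp_deg_superset) (simp_all add: Poly_Mapping.keys_add)
  also have "\<dots> = (\<Sum>i\<in>?S. Poly_Mapping.lookup d i) + (\<Sum>i\<in>?S. Poly_Mapping.lookup e i)"
    by (simp add: lookup_add sum.distrib)
  also have "(\<Sum>i\<in>?S. Poly_Mapping.lookup d i) = exp_deg d" by (rule exp_deg_superset[symmetric]) auto
  also have "(\<Sum>i\<in>?S. Poly_Mapping.lookup e i) = exp_deg e" by (rule exp_deg_superset[symmetric]) auto
  finally show ?thesis .
qed

lemma exp_deg_zero [simp]: "exp_deg 0 = 0"
  by (simp add: exp_deg_def)

definition deg_le :: "nat \<Rightarrow> 'a::zero mpol \<Rightarrow> bool" where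
  "deg_le d p \<longleftrightarrow> (\<forall>e\<in>Poly_Mapping.keys p. exp_deg e \<le> d)"

lemma total_degree_le_iff: "total_degree p \<le> d \<longleftrightarrow> deg_le d p"
  unfolding total_degree_def deg_le_def exp_deg_def by auto

lemma deg_le_total_degree: "deg_le (total_degree p) p"
  using total_degree_le_iff by blast

lemma deg_le_add: "deg_le d p \<Longrightarrow> deg_le d q \<Longrightarrow> deg_le d (p + q)"
  using Poly_Mapping.keys_add[of p q] unfolding deg_le_def by blast

lemma deg_le_mult: "deg_le d p \<Longrightarrow> deg_le d' q \<Longrightarrow> deg_le (d + d') (p * q :: 'a::comm_ring_1 mpol)"
  using keys_mult[of p q] unfolding deg_le_def by (fastforce simp: exp_deg_add intro: add_mono)

lemma deg_le_const: "deg_le d (const_pol c)"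
  unfolding deg_le_def const_pol_def by simp

lemma deg_le_zero: "deg_le d 0"
  unfolding deg_le_def by simp

lemma deg_le_const_mult: "deg_le d p \<Longrightarrow> deg_le d (const_pol c * p :: 'a::comm_ring_1 mpol)"
  using deg_le_mult[OF deg_le_const[of 0 c], of d p] by simp

lemma lookup_const_mult: "Poly_Mapping.lookup (const_pol c * p) e = c * Poly_Mapping.lookup (p :: 'a::comm_ring_1 mpol) e"
proof (induction p rule: mpol_induct)
  case (single e' c')
  show ?case by (simp add: const_pol_def mult_single lookup_single when_def)
qed (simp_all add: distrib_left lookup_add)

lemma bracket_beyond: "n < m \<Longrightarrow> bracket n \<nu> m = 0"
  by (simp add: bracket_def)

lemma bracket_rec:
  assumes "m \<le> n"
  shows "bracket n \<nu> m = \<nu> m - bracket n \<nu> (Suc m)"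
proof -
  have "bracket n \<nu> m = \<nu> m + (\<Sum>j=Suc m..n. (- 1) ^ (j - m) * \<nu> j)"
    unfolding bracket_def using assms by (subst sum.atLeast_Suc_atMost) auto
  also have "(\<Sum>j=Suc m..n. (- 1) ^ (j - m) * \<nu> j) = (\<Sum>j=Suc m..n. - ((- 1) ^ (j - Suc m) * \<nu> j))"
  proof (rule sum.cong[OF refl])
    fix j assume "j \<in> {Suc m..n}"
    then have "j - m = Suc (j - Suc m)" by auto
    then show "(- 1) ^ (j - m) * \<nu> j = - ((- 1) ^ (j - Suc m) * \<nu> j)" by simp
  qed
  finally show ?thesis by (simp add: sum_negf bracket_def)
qed

text \<open>Descending induction with [nu]_m = nu_m - [nu]_(m+1). Nonnegativity ensures that
  \<open>nat\<close> in \<open>bracket_exponent\<close> loses nothing.\<close>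

lemma bracket_bounds:
  assumes "\<nu> \<in> Lam n" "1 \<le> m"
  shows "0 \<le> bracket n \<nu> m \<and> bracket n \<nu> m \<le> \<nu> m"
proof (cases "m \<le> n")
  case True
  then show ?thesis using assms(2)
  proof (induction m rule: inc_induct)
    case base
    then show ?case using Lam_nonneg[OF assms(1)] by (simp add: bracket_rec bracket_beyond)
  next
    case (step m)
    then have "\<nu> (Suc m) \<le> \<nu> m" using LamD[OF assms(1), of m "Suc m"] by auto
    then show ?case using step bracket_rec[of m n \<nu>] by auto
  qed
next
  case False
  then show ?thesis using bracket_beyond[of n m] Lam_nonneg[OF assms(1)] by simp
qed

lemma lookup_bracket_exponent:
  "Poly_Mapping.lookup (bracket_exponent n \<nu>) m = (if m \<in> {1..n} then nat (bracket n \<nu> m) else 0)"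
proof -
  have "Poly_Mapping.lookup (bracket_exponent n \<nu>) m = (\<Sum>k\<in>{1..n}. if k = m then nat (bracket n \<nu> m) else 0)"
    unfolding bracket_exponent_def lookup_sum by (rule sum.cong[OF refl]) (auto simp: lookup_single when_def)
  then show ?thesis by simp
qed

text \<open>Two consecutive brackets add up to one part, [nu]_k + [nu]_(k+1) = nu_k, so every second
  part remains. For k = 1 this says that the leading monomial has degree
  \<open>odd_size\<close>.\<close>

lemma sum_bracket: "(\<Sum>m=k..n. bracket n \<nu> m) = (\<Sum>i | i \<in> {k..n} \<and> even (i - k). \<nu> i)"
proof (induction "Suc n - k" arbitrary: k rule: less_induct)
  case less
  show ?case
  proof (cases "k \<le> n")
    case True
    have 1: "(\<Sum>m=k..n. bracket n \<nu> m) = bracket n \<nu> k + (\<Sum>m=Suc k..n. bracket n \<nu> m)"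
      using True by (rule sum.atLeast_Suc_atMost)
    have 2: "(\<Sum>m=Suc k..n. bracket n \<nu> m) = bracket n \<nu> (Suc k) + (\<Sum>m=Suc (Suc k)..n. bracket n \<nu> m)"
      by (cases "Suc k \<le> n") (simp_all add: sum.atLeast_Suc_atMost bracket_beyond)
    have IH: "(\<Sum>m=Suc (Suc k)..n. bracket n \<nu> m) = (\<Sum>i | i \<in> {Suc (Suc k)..n} \<and> even (i - Suc (Suc k)). \<nu> i)"
      by (rule less) (use True in auto)
    have "{i. i \<in> {k..n} \<and> even (i - k)} = insert k {i. i \<in> {Suc (Suc k)..n} \<and> even (i - Suc (Suc k))}"
    proof (intro set_eqI iffI)
      fix i assume i: "i \<in> {i. i \<in> {k..n} \<and> even (i - k)}"
      then have "i \<noteq> Suc k" by auto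
      then show "i \<in> insert k {i. i \<in> {Suc (Suc k)..n} \<and> even (i - Suc (Suc k))}" using i by (auto simp: even_diff_nat)
    qed (use True in \<open>auto simp: even_diff_nat\<close>)
    then have "(\<Sum>i | i \<in> {k..n} \<and> even (i - k). \<nu> i) = \<nu> k + (\<Sum>i | i \<in> {Suc (Suc k)..n} \<and> even (i - Suc (Suc k)). \<nu> i)"
      by simp
    then show ?thesis unfolding 1 2 IH using bracket_rec[OF True, of \<nu>] by simp
  qed simp
qed

lemma exp_deg_bracket_exponent:
  assumes "\<nu> \<in> Lam n"
  shows "int (exp_deg (bracket_exponent n \<nu>)) = odd_size n \<nu>"
proof -
  have "exp_deg (bracket_exponent n \<nu>) = (\<Sum>m\<in>{1..n}. Poly_Mapping.lookup (bracket_exponent n \<nu>) m)"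
    by (rule exp_deg_superset) (auto simp: in_keys_iff lookup_bracket_exponent split: if_splits)
  then have "int (exp_deg (bracket_exponent n \<nu>)) = (\<Sum>m=1..n. bracket n \<nu> m)"
    using bracket_bounds[OF assms] by (simp add: lookup_bracket_exponent)
  also have "\<dots> = odd_size n \<nu>"
    unfolding sum_bracket odd_size_def by (rule sum.cong) (auto simp: even_diff_nat)
  finally show ?thesis .
qed

text \<open>The library order on exponents is decided at the least index where they differ: it is
  lexicographic, with variable 1 counting most.\<close>

lemma bracket_exponent_less:
  assumes L: "\<kappa> \<in> Lam n" "\<mu> \<in> Lam n" and q: "q \<in> {1..n}" "bracket n \<kappa> q < bracket n \<mu> q"
    and eq: "\<And>j. 1 \<le> j \<Longrightarrow> j < q \<Longrightarrow> bracket n \<kappa> j = bracket n \<mu> j"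
  shows "bracket_exponent n \<kappa> < bracket_exponent n \<mu>"
proof -
  have "less_fun (Poly_Mapping.lookup (bracket_exponent n \<kappa>)) (Poly_Mapping.lookup (bracket_exponent n \<mu>))"
    unfolding less_fun_def
  proof (intro exI[of _ q] conjI allI impI)
    show "Poly_Mapping.lookup (bracket_exponent n \<kappa>) q < Poly_Mapping.lookup (bracket_exponent n \<mu>) q"
      using q bracket_bounds[OF L(1), of q] by (simp add: lookup_bracket_exponent)
    fix j assume "j < q"
    then show "Poly_Mapping.lookup (bracket_exponent n \<kappa>) j = Poly_Mapping.lookup (bracket_exponent n \<mu>) j"
      using eq[of j] by (simp add: lookup_bracket_exponent)
  qed
  then show ?thesis by (simp add: less_poly_mapping.rep_eq)
qed

lemma bracket_add_indicator: "bracket n (add_indicator \<mu> I) m = bracket n \<mu> m + bracket n (add_indicator (\<lambda>_. 0) I) m"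
  unfolding bracket_def add_indicator_def by (simp add: distrib_left sum.distrib)

lemma bracket_one_indicator:
  assumes "I \<subseteq> {1..n}"
  shows "bracket n (add_indicator (\<lambda>_. 0) I) 1 = excess I"
proof -
  have "bracket n (add_indicator (\<lambda>_. 0) I) 1 = (\<Sum>j=1..n. if j \<in> I then parity_sign j else 0)"
    unfolding bracket_def
  proof (rule sum.cong[OF refl])
    fix j assume "j \<in> {1..n}"
    then obtain k where k: "j = Suc k" by (cases j) auto
    show "(- 1) ^ (j - 1) * add_indicator (\<lambda>_. 0) I j = (if j \<in> I then parity_sign j else 0)"
      unfolding k by (simp add: add_indicator_def parity_sign_def)
  qed
  also have "\<dots> = excess I" unfolding excess_def
    by (rule sum.mono_neutral_cong_right) (use assms in auto)
  finally show ?thesis .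
qed

text \<open>The first brackets agree because they are the excesses. By the recursion [e]_(j+1) = e_j
  - [e]_j they keep agreeing up to the least p in {1..m} that is missing from \<open>I\<close>, and
  at p + 1 the bracket of \<open>I\<close> is smaller by 1.\<close>

lemma lex_less_column:
  assumes L: "add_indicator \<mu> I \<in> Lam n" "add_indicator \<mu> {1..m} \<in> Lam n" and m: "m \<le> n"
    and I: "I \<subseteq> {1..n}" "I \<noteq> {1..m}" "card I = m" "excess I = excess {1..m}"
  shows "bracket_exponent n (add_indicator \<mu> I) < bracket_exponent n (add_indicator \<mu> {1..m})"
proof -
  let ?b = "\<lambda>I. bracket n (add_indicator (\<lambda>_. 0) I)"
  have fin: "finite I" using finite_subset[OF I(1)] by simp
  have "\<not> {1..m} \<subseteq> I" using card_subset_eq[OF fin, of "{1..m}"] I(2,3) by auto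
  then obtain p0 where p0: "p0 \<in> {1..m}" "p0 \<notin> I" by blast
  define p where "p = (LEAST p. p \<in> {1..m} \<and> p \<notin> I)"
  have p: "p \<in> {1..m}" "p \<notin> I" using LeastI[of "\<lambda>p. p \<in> {1..m} \<and> p \<notin> I" p0] p0 unfolding p_def by auto
  have low: "j \<in> I \<longleftrightarrow> j \<in> {1..m}" if "1 \<le> j" "j < p" for j
  proof -
    have "j \<in> {1..m}" using that p by auto
    moreover have "j \<in> I" using not_less_Least[of j "\<lambda>p. p \<in> {1..m} \<and> p \<notin> I"] that calculation unfolding p_def by blast
    ultimately show ?thesis by simp
  qed
  have eq: "?b I j = ?b {1..m} j" if "1 \<le> j" "j \<le> p" for j
    using that
  proof (induction j rule: dec_induct)
    case base
    show ?case using bracket_one_indicator[OF I(1)] bracket_one_indicator[of "{1..m}" n] I(4) m by auto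
  next
    case (step j)
    have "j \<le> n" using step p m by auto
    then have r: "?b X (Suc j) = add_indicator (\<lambda>_. 0) X j - ?b X j" for X using bracket_rec[of j n "add_indicator (\<lambda>_. 0) X"] by simp
    have "add_indicator (\<lambda>_. 0) I j = add_indicator (\<lambda>_. 0) {1..m} j"
      using low[of j] step by (simp add: add_indicator_def)
    moreover have "?b I j = ?b {1..m} j" using step by simp
    ultimately show ?case unfolding r by simp
  qed
  have pn: "p \<le> n" using p m by auto
  have rec: "?b X (Suc p) = add_indicator (\<lambda>_. 0) X p - ?b X p" for X
    using bracket_rec[OF pn, of "add_indicator (\<lambda>_. 0) X"] by simp
  have lt: "?b I (Suc p) < ?b {1..m} (Suc p)"
    unfolding rec using eq[of p] p by (auto simp: add_indicator_def)
  have "Suc p \<le> n"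
  proof (rule ccontr)
    assume "\<not> ?thesis"
    then have "?b I (Suc p) = 0" "?b {1..m} (Suc p) = 0" using bracket_beyond by auto
    then show False using lt by simp
  qed
  then show ?thesis
    by (intro bracket_exponent_less[OF L, of "Suc p"])
      (use lt eq in \<open>auto simp: bracket_add_indicator[of n \<mu>]\<close>)
qed

section \<open>Leading exponents of semisymmetric polynomials\<close>

lemma mon_permute:
  assumes \<pi>: "bij \<pi>"
  shows "mon (\<lambda>i. var_pol (\<pi> i)) e = (Poly_Mapping.single (Poly_Mapping.map_key (inv \<pi>) e) 1 :: 'a::comm_ring_1 mpol)"
proof -
  have inj: "inj (inv \<pi>)" using \<pi> by (simp add: bij_imp_bij_inv bij_is_inj)
  have pw: "(var_pol i :: 'a mpol) ^ k = Poly_Mapping.single (Poly_Mapping.single i k) 1" for i k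
  proof (induction k)
    case (Suc k)
    have "Poly_Mapping.single i (Suc k) = Poly_Mapping.single i 1 + Poly_Mapping.single i k"
      by (simp flip: single_add)
    then show ?case using Suc by (simp add: var_pol_def mult_single)
  qed (simp flip: single_one)
  have pr: "(\<Prod>i\<in>S. Poly_Mapping.single (f i) (1 :: 'a)) = Poly_Mapping.single (\<Sum>i\<in>S. f i) 1" for S and f :: "nat \<Rightarrow> nat \<Rightarrow>\<^sub>0 nat"
    by (induction S rule: infinite_finite_induct) (simp_all add: mult_single)
  have "(\<Sum>i\<in>Poly_Mapping.keys e. Poly_Mapping.single (\<pi> i) (Poly_Mapping.lookup e i)) = Poly_Mapping.map_key (inv \<pi>) e"
  proof (rule poly_mapping_eqI)
    fix j
    have "Poly_Mapping.lookup (\<Sum>i\<in>Poly_Mapping.keys e. Poly_Mapping.single (\<pi> i) (Poly_Mapping.lookup e i)) j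
      = (\<Sum>i\<in>Poly_Mapping.keys e. if i = inv \<pi> j then Poly_Mapping.lookup e (inv \<pi> j) else 0)"
      unfolding lookup_sum
      by (rule sum.cong[OF refl]) (use \<pi> in \<open>auto simp: lookup_single when_def bij_inv_eq_iff bij_is_inj inv_f_f\<close>)
    also have "\<dots> = Poly_Mapping.lookup e (inv \<pi> j)" by (auto simp: in_keys_iff)
    also have "\<dots> = Poly_Mapping.lookup (Poly_Mapping.map_key (inv \<pi>) e) j"
      using inj by (simp add: map_key.rep_eq)
    finally show "Poly_Mapping.lookup (\<Sum>i\<in>Poly_Mapping.keys e. Poly_Mapping.single (\<pi> i) (Poly_Mapping.lookup e i)) j =
      Poly_Mapping.lookup (Poly_Mapping.map_key (inv \<pi>) e) j" .
  qed
  then show ?thesis unfolding mon_def pw pr by simp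
qed

lemma lookup_permute_vars:
  assumes \<pi>: "bij \<pi>"
  shows "Poly_Mapping.lookup (permute_vars \<pi> (p :: 'a::comm_ring_1 mpol)) (Poly_Mapping.map_key (inv \<pi>) e) = Poly_Mapping.lookup p e"
proof (induction p rule: mpol_induct)
  case (single d c)
  have inj: "inj (inv \<pi>)" using \<pi> by (simp add: bij_imp_bij_inv bij_is_inj)
  have "Poly_Mapping.map_key (inv \<pi>) d = Poly_Mapping.map_key (inv \<pi>) e \<longleftrightarrow> d = e"
  proof
    assume eq: "Poly_Mapping.map_key (inv \<pi>) d = Poly_Mapping.map_key (inv \<pi>) e"
    show "d = e"
    proof (rule poly_mapping_eqI)
      fix k
      have "Poly_Mapping.lookup (Poly_Mapping.map_key (inv \<pi>) d) (\<pi> k) = Poly_Mapping.lookup (Poly_Mapping.map_key (inv \<pi>) e) (\<pi> k)"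
        using eq by simp
      then show "Poly_Mapping.lookup d k = Poly_Mapping.lookup e k"
        using inj \<pi> by (simp add: map_key.rep_eq bij_is_inj inv_f_f)
    qed
  qed simp
  then show ?case
    by (simp add: permute_vars_simps mon_permute[OF \<pi>] const_pol_def mult_single lookup_single when_def)
qed (simp_all add: permute_vars_simps lookup_add)

lemma semisymmetric_swap:
  assumes p: "semisymmetric n (p :: 'a::comm_ring_1 mpol)" and i: "1 \<le> i" "i + 2 \<le> n"
  shows "Poly_Mapping.lookup p (Poly_Mapping.map_key (transpose i (i + 2)) e) = Poly_Mapping.lookup p e"
proof -
  let ?t = "transpose i (i + 2)"
  have "?t \<in> W_group n"
    unfolding W_group_def
  proof (intro CollectI conjI ballI)
    show "?t permutes {1..n}" using i by (intro permutes_swap_id) auto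
    fix j show "?t j mod 2 = j mod 2" by (auto simp: transpose_def)
  qed
  then have "permute_vars ?t p = p" using p by (simp add: semisymmetric_def)
  moreover have "inv ?t = ?t" by (rule inv_transpose_eq)
  ultimately show ?thesis using lookup_permute_vars[of ?t p e] by simp
qed

definition top_exp :: "'a::zero mpol \<Rightarrow> nat \<Rightarrow>\<^sub>0 nat" where
  "top_exp p = Max {e \<in> Poly_Mapping.keys p. exp_deg e = total_degree p}"

lemma top_exp:
  assumes "p \<noteq> 0"
  shows "top_exp p \<in> Poly_Mapping.keys p" "exp_deg (top_exp p) = total_degree p"
    "\<And>e. e \<in> Poly_Mapping.keys p \<Longrightarrow> exp_deg e = total_degree p \<Longrightarrow> e \<le> top_exp p"
proof -
  let ?E = "{e \<in> Poly_Mapping.keys p. exp_deg e = total_degree p}"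
  have fin: "finite ?E" by simp
  have K: "Poly_Mapping.keys p \<noteq> {}" using assms by simp
  have "Max (insert 0 (exp_deg ` Poly_Mapping.keys p)) \<in> insert 0 (exp_deg ` Poly_Mapping.keys p)"
    by (rule Max_in) auto
  then have "total_degree p = 0 \<or> total_degree p \<in> exp_deg ` Poly_Mapping.keys p"
    unfolding total_degree_def exp_deg_def by auto
  moreover obtain e where e: "e \<in> Poly_Mapping.keys p" using K by blast
  moreover have "exp_deg e \<le> total_degree p" using deg_le_total_degree[of p] e by (simp add: deg_le_def)
  ultimately have ne: "?E \<noteq> {}" by auto
  show "top_exp p \<in> Poly_Mapping.keys p" "exp_deg (top_exp p) = total_degree p"
    using Max_in[OF fin ne] by (auto simp: top_exp_def)
  show "e \<le> top_exp p" if "e \<in> Poly_Mapping.keys p" "exp_deg e = total_degree p" for e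
    unfolding top_exp_def using fin that by (intro Max_ge) auto
qed

text \<open>Exchanging i and i + 2 lies in W, so the lexicographically largest exponent e of top
  degree satisfies e_(i+2) <= e_i. Then nu_i = e_i + e_(i+1) is weakly decreasing and its brackets
  are e.\<close>

lemma top_exp_bracket:
  assumes p: "semisymmetric n (p :: 'a::comm_ring_1 mpol)" "p \<noteq> 0"
  obtains \<nu> where "\<nu> \<in> Lam n" "bracket_exponent n \<nu> = top_exp p" "odd_size n \<nu> = int (total_degree p)"
proof -
  let ?e = "top_exp p"
  note top = top_exp[OF p(2)]
  have keys: "Poly_Mapping.keys ?e \<subseteq> {1..n}" using p(1) top(1) by (auto simp: semisymmetric_def in_vars_def)
  have zero: "Poly_Mapping.lookup ?e i = 0" if "i \<notin> {1..n}" for i using keys that by (auto simp: in_keys_iff)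
  have sorted: "Poly_Mapping.lookup ?e (i + 2) \<le> Poly_Mapping.lookup ?e i" if i: "1 \<le> i" for i
  proof (cases "i + 2 \<le> n")
    case True
    let ?t = "transpose i (i + 2)"
    let ?f = "Poly_Mapping.map_key ?t ?e"
    have lf: "Poly_Mapping.lookup ?f j = Poly_Mapping.lookup ?e (?t j)" for j by (simp add: map_key.rep_eq)
    have perm: "?t permutes {1..n}" using i True by (intro permutes_swap_id) auto
    have fkeys: "Poly_Mapping.keys ?f \<subseteq> {1..n}"
    proof
      fix j assume "j \<in> Poly_Mapping.keys ?f"
      then have "?t j \<in> Poly_Mapping.keys ?e" using lf[of j] by (simp add: in_keys_iff)
      then have "?t j \<in> {1..n}" using keys by blast
      then show "j \<in> {1..n}" using permutes_in_image[OF perm, of j] by simp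
    qed
    have "exp_deg ?f = (\<Sum>j\<in>{1..n}. Poly_Mapping.lookup ?e (?t j))"
      unfolding exp_deg_superset[OF finite_atLeastAtMost fkeys] lf ..
    also have "\<dots> = (\<Sum>j\<in>{1..n}. Poly_Mapping.lookup ?e j)"
      by (rule sum.permute[OF perm, symmetric, unfolded comp_def])
    also have "\<dots> = exp_deg ?e" using exp_deg_superset[OF _ keys] by simp
    finally have fd: "exp_deg ?f = total_degree p" using top(2) by simp
    have "?f \<in> Poly_Mapping.keys p" using semisymmetric_swap[OF p(1) i True, of ?e] top(1) by (simp add: in_keys_iff)
    then have le: "?f \<le> ?e" using top(3) fd by blast
    show ?thesis
    proof (rule ccontr)
      assume lt: "\<not> ?thesis"
      have "less_fun (Poly_Mapping.lookup ?e) (Poly_Mapping.lookup ?f)"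
        unfolding less_fun_def lf by (intro exI[of _ i] conjI allI impI) (use lt in \<open>auto simp: transpose_def\<close>)
      then have "?e < ?f" by (simp add: less_poly_mapping.rep_eq)
      then show False using le by simp
    qed
  qed (use zero in auto)
  define \<nu> where "\<nu> i = (if i \<in> {1..n} then int (Poly_Mapping.lookup ?e i + Poly_Mapping.lookup ?e (Suc i)) else 0)" for i
  have \<nu>: "\<nu> i = int (Poly_Mapping.lookup ?e i) + int (Poly_Mapping.lookup ?e (Suc i))" if "1 \<le> i" "i \<le> n" for i
    using that by (simp add: \<nu>_def)
  have L: "\<nu> \<in> Lam n"
    unfolding Lam_def
  proof (intro CollectI conjI ballI allI impI)
    fix i assume "i \<in> {1..<n}"
    then show "\<nu> (Suc i) \<le> \<nu> i" using sorted[of i] by (auto simp: \<nu>_def)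
  qed (auto simp: \<nu>_def)
  have "bracket n \<nu> m = int (Poly_Mapping.lookup ?e m)" if "1 \<le> m" for m
  proof (cases "m \<le> n")
    case True
    then show ?thesis using that
    proof (induction m rule: inc_induct)
      case base
      then show ?case using zero[of "Suc n"] \<nu>[of n] by (simp add: bracket_rec bracket_beyond)
    next
      case (step m)
      then show ?case using bracket_rec[of m n \<nu>] \<nu>[of m] by simp
    qed
  next
    case False
    then show ?thesis using zero[of m] by (simp add: bracket_beyond)
  qed
  then have B: "bracket_exponent n \<nu> = ?e"
    by (intro poly_mapping_eqI) (use zero in \<open>auto simp: lookup_bracket_exponent\<close>)
  show ?thesis
    by (rule that[OF L B]) (use exp_deg_bracket_exponent[OF L] B top(2) in simp)
qed

subsection \<open>The column polynomials\<close>

definition cls :: "nat \<Rightarrow> bool \<Rightarrow> nat set" where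
  "cls n A = {i. i \<in> {1..n} \<and> odd i = A}"

lemma finite_cls [simp]: "finite (cls n A)"
  by (simp add: cls_def)

definition newt_den :: "nat \<Rightarrow> 'a::field \<Rightarrow> nat \<Rightarrow> 'a poly" where
  "newt_den n r m = (\<Prod>i | i \<in> {m + 1..n} \<and> odd i = odd m. [:- rho n r i, 1:])"

text \<open>The coefficient of \<^term>\<open>newt_den n r m\<close> in the Newton expansion of \<open>P\<close> at the nodes \<open>\<rho>\<^sub>i\<close> with \<open>i \<equiv> m\<close> modulo 2, taken in decreasing order of \<open>i\<close>.\<close>

definition newt :: "nat \<Rightarrow> 'a::field \<Rightarrow> nat \<Rightarrow> 'a poly \<Rightarrow> 'a" where
  "newt n r m P = poly (P div newt_den n r m) (rho n r m)"

lemma newt_add: "newt n r m (P + Q) = newt n r m P + newt n r m Q"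
  by (simp add: newt_def poly_div_add_left)

lemma newt_smult: "newt n r m (smult c P) = c * newt n r m P"
  by (simp add: newt_def div_smult_left)

lemma newt_zero [simp]: "newt n r m 0 = 0"
  by (simp add: newt_def)

lemma newt_sum: "newt n r m (\<Sum>x\<in>S. f x) = (\<Sum>x\<in>S. newt n r m (f x))"
  by (induction S rule: infinite_finite_induct) (simp_all add: newt_add)

lemma newt_den_monic:
  "degree (newt_den n r m) = card {i. i \<in> {m + 1..n} \<and> odd i = odd m}" "lead_coeff (newt_den n r m) = 1"
proof -
  show "degree (newt_den n r m) = card {i. i \<in> {m + 1..n} \<and> odd i = odd m}"
    unfolding newt_den_def by (subst degree_prod_sum_eq) auto
  show "lead_coeff (newt_den n r m) = 1"
    unfolding newt_den_def lead_coeff_prod by (rule prod.neutral) simp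
qed

lemma newt_small: "degree P < degree (newt_den n r m) \<Longrightarrow> newt n r m P = 0"
  by (simp add: newt_def div_poly_less)

lemma newt_same:
  assumes "lead_coeff P = 1" "degree P = degree (newt_den n r m)"
  shows "newt n r m P = 1"
  using div_monic_same[OF newt_den_monic(2) assms(1) assms(2)[symmetric], of 1] by (simp add: newt_def)

lemma newt_multiple: "newt n r m (Q * newt_den n r m) = poly Q (rho n r m)"
proof -
  have "newt_den n r m \<noteq> 0" using newt_den_monic(2)[of n r m] by auto
  then show ?thesis by (simp add: newt_def)
qed

lemma card_parity_le: "card {i. i \<in> {1..m} \<and> odd i = odd m} = (m + 1) div 2"
proof (induction m rule: less_induct)
  case (less m)
  consider "m = 0" | "m = 1" | "2 \<le> m" by linarith
  then show ?case
  proof cases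
    case 2
    have "{i. i \<in> {1..1} \<and> odd i = odd (1::nat)} = {1::nat}" by auto
    then show ?thesis using 2 by simp
  next
    case 3
    have "{i. i \<in> {1..m} \<and> odd i = odd m} = insert m {i. i \<in> {1..m - 2} \<and> odd i = odd (m - 2)}"
    proof (intro set_eqI iffI)
      fix i assume i: "i \<in> {i. i \<in> {1..m} \<and> odd i = odd m}"
      then have "i = m \<or> i \<le> m - 2"
      proof -
        have "i \<noteq> m - 1" using i 3 by auto
        then show ?thesis using i by auto
      qed
      then show "i \<in> insert m {i. i \<in> {1..m - 2} \<and> odd i = odd (m - 2)}" using i 3 by auto
    qed (use 3 in auto)
    moreover have "m \<notin> {i. i \<in> {1..m - 2} \<and> odd i = odd (m - 2)}" using 3 by auto
    ultimately have "card {i. i \<in> {1..m} \<and> odd i = odd m} = Suc (card {i. i \<in> {1..m - 2} \<and> odd i = odd (m - 2)})"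
      by simp
    also have "\<dots> = Suc ((m - 2 + 1) div 2)" using less[of "m - 2"] 3 by simp
    also have "\<dots> = (m + 1) div 2"
    proof -
      obtain j where "m = j + 2" using 3 by (metis add.commute le_Suc_ex)
      then show ?thesis by simp
    qed
    finally show ?thesis .
  qed simp
qed

lemma cls_split:
  assumes "m \<le> n"
  shows "cls n (odd m) = {i. i \<in> {1..m} \<and> odd i = odd m} \<union> {i. i \<in> {m + 1..n} \<and> odd i = odd m}"
    "{i. i \<in> {1..m} \<and> odd i = odd m} \<inter> {i. i \<in> {m + 1..n} \<and> odd i = odd m} = {}"
proof -
  have "i \<in> {1..n} \<longleftrightarrow> i \<in> {1..m} \<or> i \<in> {m + 1..n}" for i using assms by auto
  then show "cls n (odd m) = {i. i \<in> {1..m} \<and> odd i = odd m} \<union> {i. i \<in> {m + 1..n} \<and> odd i = odd m}"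
    unfolding cls_def by blast
  show "{i. i \<in> {1..m} \<and> odd i = odd m} \<inter> {i. i \<in> {m + 1..n} \<and> odd i = odd m} = {}"
    by (rule Int_emptyI) simp
qed

lemma card_cls:
  assumes "m \<le> n"
  shows "card (cls n (odd m)) = (m + 1) div 2 + degree (newt_den n (r :: 'a::field) m)"
proof -
  have "card (cls n (odd m)) = card {i. i \<in> {1..m} \<and> odd i = odd m} + card {i. i \<in> {m + 1..n} \<and> odd i = odd m}"
    unfolding cls_split(1)[OF assms] by (rule card_Un_disjoint) (use cls_split(2)[OF assms] in auto)
  then show ?thesis by (simp only: card_parity_le newt_den_monic)
qed

definition ind_exp :: "nat set \<Rightarrow> nat \<Rightarrow>\<^sub>0 nat" where
  "ind_exp S = (\<Sum>i\<in>S. Poly_Mapping.single i 1)"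

lemma lookup_ind_exp:
  assumes "finite S"
  shows "Poly_Mapping.lookup (ind_exp S) j = (if j \<in> S then 1 else 0)"
proof -
  have "Poly_Mapping.lookup (ind_exp S) j = (\<Sum>i\<in>S. if i = j then 1 else 0)"
    unfolding ind_exp_def lookup_sum by (rule sum.cong[OF refl]) (simp add: lookup_single when_def)
  then show ?thesis using assms by simp
qed

lemma keys_ind_exp: "finite S \<Longrightarrow> Poly_Mapping.keys (ind_exp S) = S"
  by (auto simp: in_keys_iff lookup_ind_exp split: if_splits)

lemma exp_deg_ind_exp: "finite S \<Longrightarrow> exp_deg (ind_exp S) = card S"
  by (simp add: exp_deg_def keys_ind_exp lookup_ind_exp)

lemma mon_ind_exp: "finite S \<Longrightarrow> mon f (ind_exp S) = (\<Prod>i\<in>S. f i)"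
  by (simp add: mon_def keys_ind_exp lookup_ind_exp)

lemma ind_exp_inject: "finite S \<Longrightarrow> finite T \<Longrightarrow> ind_exp S = ind_exp T \<longleftrightarrow> S = T"
  using keys_ind_exp by metis

definition npol_coeff :: "nat \<Rightarrow> 'a::field \<Rightarrow> nat \<Rightarrow> nat set \<Rightarrow> 'a" where
  "npol_coeff n r m S = (- 1) ^ card S * newt n r m (monom 1 (card (cls n (odd m)) - card S))"

text \<open>The functional \<open>newt\<close> applied to the product of T - z_i over the parity
  class of m, with z kept variable: the product is expanded over subsets and \<open>newt\<close>
  acts on each power of T.\<close>

definition npol :: "nat \<Rightarrow> 'a::field \<Rightarrow> nat \<Rightarrow> 'a mpol" where
  "npol n r m = (\<Sum>S\<in>Pow (cls n (odd m)). Poly_Mapping.single (ind_exp S) (npol_coeff n r m S))"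

lemma prod_linear_expand:
  fixes z :: "nat \<Rightarrow> 'a::comm_ring_1"
  assumes "finite T"
  shows "(\<Prod>i\<in>T. [:- z i, 1:]) = (\<Sum>S\<in>Pow T. smult ((- 1) ^ card S * (\<Prod>i\<in>S. z i)) (monom 1 (card T - card S)))"
proof -
  have "(\<Prod>i\<in>T. [:- z i, 1:]) = (\<Prod>i\<in>T. [:- z i:] + [:0, 1:])" by simp
  also have "\<dots> = (\<Sum>S\<in>Pow T. (\<Prod>i\<in>S. [:- z i:]) * (\<Prod>i\<in>T - S. [:0, 1:]))" by (rule prod_add[OF assms])
  also have "\<dots> = (\<Sum>S\<in>Pow T. smult ((- 1) ^ card S * (\<Prod>i\<in>S. z i)) (monom 1 (card T - card S)))"
  proof (rule sum.cong[OF refl])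
    fix S assume "S \<in> Pow T"
    then have S: "S \<subseteq> T" "finite S" using assms finite_subset by auto
    have "(\<Prod>i\<in>S. [:- z i:]) = [:(- 1) ^ card S * (\<Prod>i\<in>S. z i):]"
      unfolding prod_to_poly prod_uminus ..
    moreover have "(\<Prod>i\<in>T - S. [:0, 1 :: 'a:]) = monom 1 (card T - card S)"
      using card_Diff_subset[OF S(2,1)] by (simp add: monom_altdef)
    ultimately show "(\<Prod>i\<in>S. [:- z i:]) * (\<Prod>i\<in>T - S. [:0, 1:]) = smult ((- 1) ^ card S * (\<Prod>i\<in>S. z i)) (monom 1 (card T - card S))"
      by simp
  qed
  finally show ?thesis .
qed

lemma eval_npol: "eval_pol (npol n r m) z = newt n r m (\<Prod>i\<in>cls n (odd m). [:- z i, 1:])"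
proof -
  have "eval_pol (npol n r m) z = (\<Sum>S\<in>Pow (cls n (odd m)). npol_coeff n r m S * (\<Prod>i\<in>S. z i))"
    unfolding npol_def eval_pol_simps
    by (rule sum.cong[OF refl]) (auto simp: mon_ind_exp finite_subset[OF _ finite_cls])
  also have "\<dots> = newt n r m (\<Prod>i\<in>cls n (odd m). [:- z i, 1:])"
    unfolding prod_linear_expand[OF finite_cls] newt_sum newt_smult npol_coeff_def
    by (simp only: mult_ac)
  finally show ?thesis .
qed

lemma semisymmetric_npol: "semisymmetric n (npol n r m)"
  unfolding semisymmetric_def
proof (intro conjI ballI)
  have fin: "finite S" if "S \<in> Pow (cls n (odd m))" for S using that finite_subset[OF _ finite_cls] by auto
  show "in_vars {1..n} (npol n r m)"
    unfolding in_vars_def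
  proof
    fix e assume "e \<in> Poly_Mapping.keys (npol n r m)"
    then have "e \<in> (\<Union>S\<in>Pow (cls n (odd m)). Poly_Mapping.keys (Poly_Mapping.single (ind_exp S) (npol_coeff n r m S)))"
      unfolding npol_def by (rule subsetD[OF keys_sum])
    then obtain S where S: "S \<in> Pow (cls n (odd m))" "e \<in> Poly_Mapping.keys (Poly_Mapping.single (ind_exp S) (npol_coeff n r m S))"
      by (rule UN_E)
    then have "e = ind_exp S" by (auto split: if_splits)
    then show "Poly_Mapping.keys e \<subseteq> {1..n}" using S(1) fin[OF S(1)] by (auto simp: keys_ind_exp cls_def)
  qed
  fix \<pi> assume \<pi>: "\<pi> \<in> W_group n"
  then have p: "\<pi> permutes {1..n}" "\<And>i. i \<in> {1..n} \<Longrightarrow> odd (\<pi> i) = odd i"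
    unfolding W_group_def by (auto simp: odd_iff_mod_2_eq_one)
  have inj: "inj \<pi>" using p(1) permutes_inj by blast
  have sub: "\<pi> ` cls n (odd m) \<subseteq> cls n (odd m)"
    using p permutes_in_image[OF p(1)] by (auto simp: cls_def)
  have img: "\<pi> ` cls n (odd m) = cls n (odd m)"
    by (rule card_subset_eq[OF finite_cls sub]) (simp add: card_image inj_on_subset[OF inj])
  have trm: "permute_vars \<pi> (Poly_Mapping.single (ind_exp S) c) = Poly_Mapping.single (ind_exp (\<pi> ` S)) c"
    if S: "S \<in> Pow (cls n (odd m))" for S and c :: 'a
  proof -
    have pr: "(\<Prod>i\<in>S. Poly_Mapping.single (f i) (1 :: 'a)) = Poly_Mapping.single (\<Sum>i\<in>S. f i) 1" for f :: "nat \<Rightarrow> nat \<Rightarrow>\<^sub>0 nat"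
      using fin[OF S] by (induction S rule: finite_induct) (simp_all add: mult_single)
    have "mon (\<lambda>i. var_pol (\<pi> i)) (ind_exp S) = (Poly_Mapping.single (ind_exp (\<pi> ` S)) 1 :: 'a mpol)"
      unfolding mon_ind_exp[OF fin[OF S]] var_pol_def pr unfolding ind_exp_def
      by (simp add: sum.reindex[OF inj_on_subset[OF inj subset_UNIV]] comp_def)
    then show ?thesis by (simp add: permute_vars_simps const_pol_def mult_single)
  qed
  have cf: "npol_coeff n r m (\<pi> ` S) = npol_coeff n r m S" for S
    unfolding npol_coeff_def by (simp add: card_image inj_on_subset[OF inj])
  have "permute_vars \<pi> (npol n r m) = (\<Sum>S\<in>Pow (cls n (odd m)). Poly_Mapping.single (ind_exp (\<pi> ` S)) (npol_coeff n r m (\<pi> ` S)))"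
    unfolding npol_def permute_vars_simps(6) cf by (rule sum.cong[OF refl trm])
  also have "\<dots> = (\<Sum>S\<in>(\<lambda>S. \<pi> ` S) ` Pow (cls n (odd m)). Poly_Mapping.single (ind_exp S) (npol_coeff n r m S))"
    by (subst sum.reindex) (auto simp: inj_on_def inj_image_eq_iff[OF inj])
  also have "(\<lambda>S. \<pi> ` S) ` Pow (cls n (odd m)) = Pow (cls n (odd m))"
    using image_Pow_surj[OF img] .
  finally show "permute_vars \<pi> (npol n r m) = npol n r m" unfolding npol_def .
qed

lemma lookup_npol:
  "Poly_Mapping.lookup (npol n r m) e = (\<Sum>S | S \<in> Pow (cls n (odd m)) \<and> ind_exp S = e. npol_coeff n r m S)"
proof -
  have "Poly_Mapping.lookup (npol n r m) e = (\<Sum>S\<in>Pow (cls n (odd m)). if ind_exp S = e then npol_coeff n r m S else 0)"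
    unfolding npol_def lookup_sum by (rule sum.cong[OF refl]) (simp add: lookup_single when_def)
  also have "\<dots> = (\<Sum>S | S \<in> Pow (cls n (odd m)) \<and> ind_exp S = e. npol_coeff n r m S)"
    by (rule sum.inter_filter[symmetric]) simp
  finally show ?thesis .
qed

lemma lookup_npol_ind:
  assumes "S \<subseteq> cls n (odd m)"
  shows "Poly_Mapping.lookup (npol n r m) (ind_exp S) = npol_coeff n r m S"
proof -
  have "{T. T \<in> Pow (cls n (odd m)) \<and> ind_exp T = ind_exp S} = {S}"
  proof (rule set_eqI, rule iffI)
    fix T assume "T \<in> {T. T \<in> Pow (cls n (odd m)) \<and> ind_exp T = ind_exp S}"
    then have T: "T \<subseteq> cls n (odd m)" "ind_exp T = ind_exp S" by simp_all
    then show "T \<in> {S}"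
      using ind_exp_inject[of T S] finite_subset[OF T(1) finite_cls] finite_subset[OF assms finite_cls] by simp
  qed (use assms in simp)
  then show ?thesis unfolding lookup_npol by simp
qed

text \<open>A large \<open>S\<close> leaves a small power of T, and \<open>newt\<close> kills
  degrees below that of its divisor. This bounds the degree of \<open>npol\<close>.\<close>

lemma npol_coeff_zero:
  assumes "m \<le> n" "(m + 1) div 2 < card S" "S \<subseteq> cls n (odd m)"
  shows "npol_coeff n r m S = 0"
proof -
  have "card S \<le> card (cls n (odd m))" using assms(3) by (intro card_mono) auto
  then have "card (cls n (odd m)) - card S < degree (newt_den n r m)" using assms(2) card_cls[OF assms(1), of r] by simp
  then have "newt n r m (monom 1 (card (cls n (odd m)) - card S)) = 0" by (intro newt_small) (simp add: degree_monom_eq)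
  then show ?thesis by (simp add: npol_coeff_def)
qed

lemma npol_coeff_top:
  assumes "m \<le> n" "card S = (m + 1) div 2"
  shows "npol_coeff n r m S = (- 1) ^ ((m + 1) div 2)"
proof -
  have "newt n r m (monom 1 (card (cls n (odd m)) - card S)) = 1"
    using card_cls[OF assms(1), of r] assms(2) by (intro newt_same) (simp_all add: degree_monom_eq)
  then show ?thesis using assms(2) by (simp add: npol_coeff_def)
qed

lemma keys_npol:
  assumes "m \<le> n" "e \<in> Poly_Mapping.keys (npol n r m)"
  obtains S where "S \<subseteq> cls n (odd m)" "e = ind_exp S" "card S \<le> (m + 1) div 2"
proof -
  have "Poly_Mapping.lookup (npol n r m) e \<noteq> 0" using assms(2) by (simp add: in_keys_iff)
  then obtain S where "S \<in> {S. S \<in> Pow (cls n (odd m)) \<and> ind_exp S = e}" and S: "npol_coeff n r m S \<noteq> 0"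
    unfolding lookup_npol by (rule sum.not_neutral_contains_not_neutral)
  then have S: "S \<in> Pow (cls n (odd m))" "ind_exp S = e" "npol_coeff n r m S \<noteq> 0" by simp_all
  then have "\<not> (m + 1) div 2 < card S" using npol_coeff_zero[OF assms(1)] by blast
  then show ?thesis using S that[of S] by auto
qed

text \<open>For odd m the operator of \<open>P_odd\<close> also meets sets of m + 1 indices with
  excess 0. The subtracted term comes from the operator of \<open>P_even\<close> and cancels their
  coefficient, see \<open>col_coeff_large\<close>; for m = n there are no such sets. The sign makes
  the leading coefficient 1.\<close>

definition col :: "nat \<Rightarrow> 'a::field \<Rightarrow> nat \<Rightarrow> 'a mpol" where
  "col n r m = const_pol ((- 1) ^ ((m + 1) div 2)) *
     (npol n r m - (if odd m \<and> m < n then npol n r (m + 1) else 0))"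

lemma eval_col: "eval_pol (col n r m) z = (- 1) ^ ((m + 1) div 2) *
    (newt n r m (\<Prod>i\<in>cls n (odd m). [:- z i, 1:]) -
     (if odd m \<and> m < n then newt n r (m + 1) (\<Prod>i\<in>cls n False. [:- z i, 1:]) else 0))"
  unfolding col_def by (simp add: eval_pol_simps eval_pol_diff eval_npol)

lemma semisymmetric_col: "semisymmetric n (col n r m)"
  unfolding col_def by (intro semisymmetric_simps semisymmetric_diff semisymmetric_npol) (simp add: semisymmetric_npol semisymmetric_simps)

section \<open>Leading terms for the degree-lexicographic order\<close>

definition leads :: "nat \<Rightarrow> (nat \<Rightarrow>\<^sub>0 nat) \<Rightarrow> 'a::comm_ring_1 mpol \<Rightarrow> bool" where
  "leads d a p \<longleftrightarrow> exp_deg a = d \<and> Poly_Mapping.lookup p a = 1 \<and>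
     (\<forall>e\<in>Poly_Mapping.keys p. exp_deg e < d \<or> exp_deg e = d \<and> e \<le> a)"

lemma leads_deg_le: "leads d a p \<Longrightarrow> deg_le d p"
  unfolding leads_def deg_le_def by fastforce

lemma leads_total_degree:
  assumes "leads d a p"
  shows "total_degree p = d"
proof -
  have "a \<in> Poly_Mapping.keys p" using assms by (simp add: leads_def in_keys_iff)
  then have "d \<le> total_degree p" using deg_le_total_degree[of p] assms by (auto simp: leads_def deg_le_def)
  moreover have "total_degree p \<le> d" using leads_deg_le[OF assms] total_degree_le_iff by blast
  ultimately show ?thesis by simp
qed

lemma lookup_mult_sum:
  fixes p q :: "'a::comm_ring_1 mpol"
  shows "Poly_Mapping.lookup (p * q) x = (\<Sum>(d, e)\<in>Poly_Mapping.keys p \<times> Poly_Mapping.keys q.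
    if d + e = x then Poly_Mapping.lookup p d * Poly_Mapping.lookup q e else 0)"
proof -
  have "p * q = (\<Sum>d\<in>Poly_Mapping.keys p. Poly_Mapping.single d (Poly_Mapping.lookup p d)) *
      (\<Sum>e\<in>Poly_Mapping.keys q. Poly_Mapping.single e (Poly_Mapping.lookup q e))"
    by (simp only: mpol_decompose[symmetric])
  also have "\<dots> = (\<Sum>(d, e)\<in>Poly_Mapping.keys p \<times> Poly_Mapping.keys q.
      Poly_Mapping.single (d + e) (Poly_Mapping.lookup p d * Poly_Mapping.lookup q e))"
    by (simp add: sum_product sum.cartesian_product mult_single)
  finally have pq: "p * q = (\<Sum>(d, e)\<in>Poly_Mapping.keys p \<times> Poly_Mapping.keys q.
      Poly_Mapping.single (d + e) (Poly_Mapping.lookup p d * Poly_Mapping.lookup q e))" .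
  show ?thesis unfolding pq lookup_sum
    by (rule sum.cong[OF refl]) (auto simp: lookup_single when_def)
qed

text \<open>Addition of exponents is strictly monotone in both arguments, so \<open>a + b\<close>
  arises only from \<open>a\<close> and \<open>b\<close>.\<close>

lemma leads_mult:
  fixes p q :: "'a::comm_ring_1 mpol"
  assumes p: "leads d a p" and q: "leads d' b q"
  shows "leads (d + d') (a + b) (p * q)"
  unfolding leads_def
proof (intro conjI ballI)
  have P: "\<And>e. e \<in> Poly_Mapping.keys p \<Longrightarrow> exp_deg e < d \<or> exp_deg e = d \<and> e \<le> a" and da: "exp_deg a = d" "Poly_Mapping.lookup p a = 1"
    using p by (auto simp: leads_def)
  have Q: "\<And>e. e \<in> Poly_Mapping.keys q \<Longrightarrow> exp_deg e < d' \<or> exp_deg e = d' \<and> e \<le> b" and db: "exp_deg b = d'" "Poly_Mapping.lookup q b = 1"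
    using q by (auto simp: leads_def)
  show "exp_deg (a + b) = d + d'" using da db by (simp add: exp_deg_add)
  show "exp_deg x < d + d' \<or> exp_deg x = d + d' \<and> x \<le> a + b" if x: "x \<in> Poly_Mapping.keys (p * q)" for x
  proof -
    obtain e f where ef: "x = e + f" "e \<in> Poly_Mapping.keys p" "f \<in> Poly_Mapping.keys q"
      using keys_mult[of p q] x by blast
    show ?thesis using P[OF ef(2)] Q[OF ef(3)] unfolding ef(1) exp_deg_add by (auto intro: add_mono)
  qed
  have uniq: "e = a \<and> f = b" if "e \<in> Poly_Mapping.keys p" "f \<in> Poly_Mapping.keys q" "e + f = a + b" for e f
  proof -
    have "exp_deg e + exp_deg f = d + d'" using that(3) da db by (metis exp_deg_add)
    then have le: "e \<le> a" "f \<le> b" using P[OF that(1)] Q[OF that(2)] by auto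
    have "\<not> e < a" using add_less_le_mono[of e a f b] le(2) that(3) by auto
    moreover have "\<not> f < b" using add_le_less_mono[of e a f b] le(1) that(3) by auto
    ultimately show ?thesis using le by auto
  qed
  have ab: "(a, b) \<in> Poly_Mapping.keys p \<times> Poly_Mapping.keys q" using da db by (simp add: in_keys_iff)
  have "Poly_Mapping.lookup (p * q) (a + b) =
      (\<Sum>x\<in>Poly_Mapping.keys p \<times> Poly_Mapping.keys q. if x = (a, b) then 1 else 0)"
    unfolding lookup_mult_sum
  proof (rule sum.cong[OF refl])
    fix x assume "x \<in> Poly_Mapping.keys p \<times> Poly_Mapping.keys q"
    then obtain e f where x: "x = (e, f)" "e \<in> Poly_Mapping.keys p" "f \<in> Poly_Mapping.keys q" by blast
    show "(case x of (d, e) \<Rightarrow> if d + e = a + b then Poly_Mapping.lookup p d * Poly_Mapping.lookup q e else 0)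
      = (if x = (a, b) then 1 else 0)"
      using uniq[OF x(2,3)] da(2) db(2) unfolding x(1) by (cases "e + f = a + b") auto
  qed
  then show "Poly_Mapping.lookup (p * q) (a + b) = 1" using ab by simp
qed

lemma leads_diff:
  fixes p q :: "'a::comm_ring_1 mpol"
  assumes p: "leads d a p" and q: "\<And>e. e \<in> Poly_Mapping.keys q \<Longrightarrow> exp_deg e < d \<or> exp_deg e = d \<and> e < a"
  shows "leads d a (p - q)"
  unfolding leads_def
proof (intro conjI ballI)
  show "exp_deg a = d" using p by (simp add: leads_def)
  have "a \<notin> Poly_Mapping.keys q" using q[of a] \<open>exp_deg a = d\<close> by auto
  then show "Poly_Mapping.lookup (p - q) a = 1" using p by (simp add: leads_def lookup_minus in_keys_iff)
  fix e assume "e \<in> Poly_Mapping.keys (p - q)"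
  then have "e \<in> Poly_Mapping.keys p \<union> Poly_Mapping.keys q" by (rule subsetD[OF keys_diff])
  then show "exp_deg e < d \<or> exp_deg e = d \<and> e \<le> a"
  proof
    assume "e \<in> Poly_Mapping.keys p" then show ?thesis using p by (simp add: leads_def)
  next
    assume "e \<in> Poly_Mapping.keys q" then show ?thesis using q[of e] by (meson less_imp_le)
  qed
qed

lemma one_col_eq: "one_col m = add_indicator (\<lambda>_. 0) {1..m}"
  by (auto simp: one_col_def add_indicator_def)

lemma zero_Lam: "(\<lambda>_. 0) \<in> Lam n"
  by (auto simp: Lam_def)

lemma one_col_Lam: "m \<le> n \<Longrightarrow> one_col m \<in> Lam n"
  by (auto simp: Lam_def one_col_def)

lemma bracket_one_col:
  assumes "m \<le> n" "1 \<le> j"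
  shows "bracket n (one_col m) j = (if j \<le> m \<and> odd j = odd m then 1 else 0)"
proof (cases "j \<le> n")
  case True
  then show ?thesis using assms(2)
  proof (induction j rule: inc_induct)
    case base
    then show ?case using assms(1) by (auto simp: bracket_rec bracket_beyond one_col_def)
  next
    case (step j)
    have "one_col m j = (if j \<le> m then 1 else 0)" using step by (simp add: one_col_def)
    then show ?case using bracket_rec[of j n "one_col m"] step
      by (cases "j = m") auto
  qed
next
  case False
  then show ?thesis using assms by (simp add: bracket_beyond)
qed

lemma bracket_exponent_one_col:
  assumes "m \<le> n"
  shows "bracket_exponent n (one_col m) = ind_exp {i. i \<in> {1..m} \<and> odd i = odd m}"
proof (rule poly_mapping_eqI)
  fix j
  have f: "finite {i. i \<in> {1..m} \<and> odd i = odd m}" by simp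
  show "Poly_Mapping.lookup (bracket_exponent n (one_col m)) j = Poly_Mapping.lookup (ind_exp {i. i \<in> {1..m} \<and> odd i = odd m}) j"
    unfolding lookup_bracket_exponent lookup_ind_exp[OF f] using bracket_one_col[OF assms, of j] assms by auto
qed

lemma ind_exp_less:
  assumes fin: "finite S" "finite T" and i: "i \<in> T" "i \<notin> S" and low: "\<And>j. j < i \<Longrightarrow> j \<in> S \<longleftrightarrow> j \<in> T"
  shows "ind_exp S < ind_exp T"
proof -
  have "less_fun (Poly_Mapping.lookup (ind_exp S)) (Poly_Mapping.lookup (ind_exp T))"
    unfolding less_fun_def lookup_ind_exp[OF fin(1)] lookup_ind_exp[OF fin(2)]
    using i low by (intro exI[of _ i]) auto
  then show ?thesis by (simp add: less_poly_mapping.rep_eq)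
qed

text \<open>No monomial has more than (m + 1) div 2 variables, and among subsets of this size of the
  parity class the one inside {1..m} consists of the smallest indices, hence is lexicographically
  largest.\<close>

lemma leads_npol:
  assumes m: "m \<le> n"
  shows "leads ((m + 1) div 2) (bracket_exponent n (one_col m)) (const_pol ((- 1) ^ ((m + 1) div 2)) * npol n r m)"
proof -
  let ?k = "(m + 1) div 2" and ?T = "{i. i \<in> {1..m} \<and> odd i = odd m}"
  have T: "finite ?T" "card ?T = ?k" "?T \<subseteq> cls n (odd m)" using m card_parity_le[of m] by (auto simp: cls_def)
  show ?thesis
    unfolding leads_def bracket_exponent_one_col[OF m]
  proof (intro conjI ballI)
    show "exp_deg (ind_exp ?T) = ?k" unfolding exp_deg_ind_exp[OF T(1)] T(2) ..
    show "Poly_Mapping.lookup (const_pol ((- 1) ^ ?k) * npol n r m) (ind_exp ?T) = 1"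
      unfolding lookup_const_mult lookup_npol_ind[OF T(3)] npol_coeff_top[OF m T(2)] by (simp flip: power_mult_distrib)
    fix e assume "e \<in> Poly_Mapping.keys (const_pol ((- 1) ^ ?k) * npol n r m)"
    then have "e \<in> Poly_Mapping.keys (npol n r m)" by (simp add: in_keys_iff lookup_const_mult)
    then obtain S where S: "S \<subseteq> cls n (odd m)" "e = ind_exp S" "card S \<le> ?k" by (rule keys_npol[OF m])
    have fS: "finite S" using S(1) finite_subset[OF _ finite_cls] by blast
    have "ind_exp S \<le> ind_exp ?T" if "card S = ?k"
    proof (cases "?T \<subseteq> S")
      case True
      then have "?T = S" using card_subset_eq[OF fS] that T(2) by metis
      then show ?thesis by simp
    next
      case False
      define i where "i = (LEAST i. i \<in> ?T \<and> i \<notin> S)"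
      have i: "i \<in> ?T \<and> i \<notin> S" unfolding i_def by (rule LeastI_ex) (use False in blast)
      have "j \<in> S \<longleftrightarrow> j \<in> ?T" if "j < i" for j
      proof
        assume "j \<in> S" then show "j \<in> ?T" using S(1) that i by (auto simp: cls_def)
      next
        assume "j \<in> ?T" then show "j \<in> S" using not_less_Least[of j "\<lambda>i. i \<in> ?T \<and> i \<notin> S"] that unfolding i_def by blast
      qed
      then have "ind_exp S < ind_exp ?T" using i by (intro ind_exp_less[OF fS T(1)]) auto
      then show ?thesis by simp
    qed
    then show "exp_deg e < ?k \<or> exp_deg e = ?k \<and> e \<le> ind_exp ?T"
      using S exp_deg_ind_exp[OF fS] by auto
  qed
qed

text \<open>For odd m the correction has no larger degree and contains even variables only, whereas
  variable 1 occurs in the leading exponent; so it is lexicographically smaller.\<close>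

lemma leads_col:
  assumes m: "m \<le> n"
  shows "leads ((m + 1) div 2) (bracket_exponent n (one_col m)) (col n r m)"
proof (cases "odd m \<and> m < n")
  case True
  let ?k = "(m + 1) div 2" and ?T = "{i. i \<in> {1..m} \<and> odd i = odd m}"
  have k: "(m + 1 + 1) div 2 = ?k" using True by (auto elim: oddE)
  have "leads ?k (bracket_exponent n (one_col m))
      (const_pol ((- 1) ^ ?k) * npol n r m - const_pol ((- 1) ^ ?k) * npol n r (m + 1))"
  proof (rule leads_diff[OF leads_npol[OF m]])
    fix e assume "e \<in> Poly_Mapping.keys (const_pol ((- 1) ^ ?k) * npol n r (m + 1))"
    then have e: "e \<in> Poly_Mapping.keys (npol n r (m + 1))" by (simp add: in_keys_iff lookup_const_mult)
    have "m + 1 \<le> n" using True by simp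
    then obtain S where S: "S \<subseteq> cls n (odd (m + 1))" "e = ind_exp S" "card S \<le> ?k"
      using keys_npol[OF _ e] unfolding k by metis
    have fS: "finite S" using S(1) finite_subset[OF _ finite_cls] by blast
    have "ind_exp S < ind_exp ?T"
      by (rule ind_exp_less[of _ _ 1]) (use fS True S(1) in \<open>auto simp: cls_def elim: oddE\<close>)
    then show "exp_deg e < ?k \<or> exp_deg e = ?k \<and> e < bracket_exponent n (one_col m)"
      unfolding bracket_exponent_one_col[OF m] using S exp_deg_ind_exp[OF fS] by auto
  qed
  then show ?thesis unfolding col_def using True by (simp add: right_diff_distrib)
next
  case False
  then have "col n r m = const_pol ((- 1) ^ ((m + 1) div 2)) * npol n r m" unfolding col_def by auto
  then show ?thesis using leads_npol[OF m, of r] by simp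
qed

section \<open>Newton coefficients of the eigenvalue equation\<close>

definition restr_poly :: "nat \<Rightarrow> bool \<Rightarrow> nat set \<Rightarrow> (nat \<Rightarrow> 'a::field) \<Rightarrow> 'a poly" where
  "restr_poly n A I z = (\<Prod>i\<in>cls n A - I. [:- z i, 1:])"

text \<open>The coefficient of \<open>I\<close> after passing to Newton coefficients. By
  \<open>eval_compl_col\<close> it is the smaller column polynomial evaluated at the coordinates
  outside \<open>I\<close>.\<close>

definition col_coeff :: "nat \<Rightarrow> 'a::field \<Rightarrow> nat \<Rightarrow> nat set \<Rightarrow> (nat \<Rightarrow> 'a) \<Rightarrow> 'a" where
  "col_coeff n r m I z = (- 1) ^ ((m + 1) div 2) * odd_sign I *
     (newt n r m (restr_poly n (odd m) I z) -
      (if odd m \<and> m < n \<and> excess I = 0 then newt n r (m + 1) (restr_poly n False I z) else 0))"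

lemma restr_poly_monic:
  "degree (restr_poly n A I z) = card (cls n A - I)" "lead_coeff (restr_poly n A I z) = 1"
proof -
  show "degree (restr_poly n A I z) = card (cls n A - I)"
    unfolding restr_poly_def by (subst degree_prod_sum_eq) auto
  show "lead_coeff (restr_poly n A I z) = 1"
    unfolding restr_poly_def lead_coeff_prod by (rule prod.neutral) simp
qed

lemma poly_restr_poly: "poly (restr_poly n A I z) t = wt A ({1..n} - I) t z"
  unfolding restr_poly_def wt_def poly_prod by (rule prod.cong) (auto simp: cls_def)

lemma class_poly_restr: "class_poly n r A \<mu> = (\<Prod>i\<in>cls n A. [:- rho_plus n r \<mu> i, 1:])"
  unfolding class_poly_def cls_def ..

text \<open>The eigenvalue equation holds for all u in an infinite field, hence as an identity of
  polynomials, and \<open>newt\<close> is linear.\<close>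

lemma pieri_op_newt:
  fixes r :: "'a::field_char_0"
  assumes "\<And>u. pieri_op n r A u \<chi> \<mu> = poly (class_poly n r A \<nu>) u * \<chi> \<mu>"
  shows "(\<Sum>I\<in>pieri_sets n A \<mu>. odd_sign I * psi_even n I \<mu> r * newt n r m (restr_poly n A I (rho_plus n r \<mu>)) *
      \<chi> (add_indicator \<mu> I)) = newt n r m (class_poly n r A \<nu>) * \<chi> \<mu>"
proof -
  let ?z = "rho_plus n r \<mu>"
  have "(\<Sum>I\<in>pieri_sets n A \<mu>. smult (odd_sign I * psi_even n I \<mu> r * \<chi> (add_indicator \<mu> I)) (restr_poly n A I ?z))
    = smult (\<chi> \<mu>) (class_poly n r A \<nu>)"
  proof (rule poly_ext)
    fix u
    show "poly (\<Sum>I\<in>pieri_sets n A \<mu>. smult (odd_sign I * psi_even n I \<mu> r * \<chi> (add_indicator \<mu> I)) (restr_poly n A I ?z)) u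
      = poly (smult (\<chi> \<mu>) (class_poly n r A \<nu>)) u"
      using assms[of u] unfolding pieri_op_def coef_at_def poly_sum poly_smult poly_restr_poly
      by (simp only: mult_ac)
  qed
  then have "newt n r m (\<Sum>I\<in>pieri_sets n A \<mu>. smult (odd_sign I * psi_even n I \<mu> r * \<chi> (add_indicator \<mu> I)) (restr_poly n A I ?z))
    = newt n r m (smult (\<chi> \<mu>) (class_poly n r A \<nu>))" by simp
  then show ?thesis unfolding newt_sum newt_smult by (simp only: mult_ac)
qed

text \<open>For odd m, the even operator is the part of the odd one with excess 0, up to the choice
  of weights. Subtracting its Newton coefficient for m + 1 produces the correction in
  \<open>col\<close> and in \<open>col_coeff\<close>.\<close>

lemma col_pieri:
  fixes r :: "'a::field_char_0"
  assumes eig: "\<And>A u. pieri_op n r A u \<chi> \<mu> = poly (class_poly n r A \<nu>) u * \<chi> \<mu>"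
  shows "(\<Sum>I\<in>pieri_sets n (odd m) \<mu>. col_coeff n r m I (rho_plus n r \<mu>) * psi_even n I \<mu> r * \<chi> (add_indicator \<mu> I))
    = eval_pol (col n r m) (rho_plus n r \<nu>) * \<chi> \<mu>"
proof -
  let ?z = "rho_plus n r \<mu>" and ?k = "(m + 1) div 2"
  let ?f = "\<lambda>j A I. odd_sign I * psi_even n I \<mu> r * newt n r j (restr_poly n A I ?z) * \<chi> (add_indicator \<mu> I)"
  let ?c = "odd m \<and> m < n"
  have 1: "(\<Sum>I\<in>pieri_sets n (odd m) \<mu>. ?f m (odd m) I) = newt n r m (class_poly n r (odd m) \<nu>) * \<chi> \<mu>"
    by (rule pieri_op_newt[OF eig])
  have 2: "(\<Sum>I\<in>pieri_sets n (odd m) \<mu>. if ?c \<and> excess I = 0 then ?f (m + 1) False I else 0) =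
    (if ?c then newt n r (m + 1) (class_poly n r False \<nu>) * \<chi> \<mu> else 0)"
  proof (cases ?c)
    case True
    have "(\<Sum>I\<in>pieri_sets n (odd m) \<mu>. if ?c \<and> excess I = 0 then ?f (m + 1) False I else 0)
      = (\<Sum>I\<in>pieri_sets n False \<mu>. ?f (m + 1) False I)"
      using True by (intro sum.mono_neutral_cong_right) (auto simp: pieri_sets_def family_def admissible_def)
    then show ?thesis using True pieri_op_newt[OF eig] by simp
  next
    case False
    then show ?thesis by (intro trans[OF sum.neutral]) auto
  qed
  have "(\<Sum>I\<in>pieri_sets n (odd m) \<mu>. col_coeff n r m I ?z * psi_even n I \<mu> r * \<chi> (add_indicator \<mu> I))
    = (\<Sum>I\<in>pieri_sets n (odd m) \<mu>. (- 1) ^ ?k * (?f m (odd m) I - (if ?c \<and> excess I = 0 then ?f (m + 1) False I else 0)))"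
    by (rule sum.cong[OF refl]) (simp add: col_coeff_def algebra_simps)
  also have "\<dots> = (- 1) ^ ?k * (newt n r m (class_poly n r (odd m) \<nu>) * \<chi> \<mu> -
      (if ?c then newt n r (m + 1) (class_poly n r False \<nu>) * \<chi> \<mu> else 0))"
    unfolding sum_distrib_left[symmetric] sum_subtractf 1 2 ..
  also have "\<dots> = eval_pol (col n r m) (rho_plus n r \<nu>) * \<chi> \<mu>"
    unfolding eval_col class_poly_restr by (simp add: algebra_simps)
  finally show ?thesis .
qed

lemma card_cls_diff:
  assumes "I \<subseteq> {1..n}"
  shows "card (cls n A - I) = card (cls n A) - card {i\<in>I. odd i = A}"
proof -
  have "cls n A - I = cls n A - {i\<in>I. odd i = A}" by (auto simp: cls_def)
  moreover have "{i\<in>I. odd i = A} \<subseteq> cls n A" using assms by (auto simp: cls_def)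
  ultimately show ?thesis by (metis card_Diff_subset finite_cls finite_subset)
qed

lemma family_cards:
  assumes "I \<in> family n A"
  shows "card {i\<in>I. odd i} = (card I + 1) div 2" "card {i\<in>I. even i} = card I div 2" "excess I = 0 \<longleftrightarrow> even (card I)"
    "\<not> A \<Longrightarrow> even (card I)"
proof -
  have fin: "finite I" using family_card(1)[OF assms] finite_subset by blast
  have "card I = card ({i\<in>I. odd i} \<union> {i\<in>I. even i})" by (rule arg_cong[of _ _ card]) auto
  also have "\<dots> = card {i\<in>I. odd i} + card {i\<in>I. even i}" using fin by (intro card_Un_disjoint) auto
  finally have c: "card I = card {i\<in>I. odd i} + card {i\<in>I. even i}" .
  have e: "excess I = int (card {i\<in>I. odd i}) - int (card {i\<in>I. even i})" using excess_card[OF fin] .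
  consider "card {i\<in>I. odd i} = card {i\<in>I. even i}" | "A" "card {i\<in>I. odd i} = card {i\<in>I. even i} + 1"
    using assms e unfolding family_def admissible_def by auto
  then show "card {i\<in>I. odd i} = (card I + 1) div 2" "card {i\<in>I. even i} = card I div 2" "excess I = 0 \<longleftrightarrow> even (card I)"
    "\<not> A \<Longrightarrow> even (card I)"
    using c e by (cases; simp)+
qed

text \<open>Removing many indices leaves a degree below that of the divisor of \<open>newt\<close>.
  The exceptional case is odd m and \<open>card I = m + 1\<close>, where both Newton coefficients
  are 1 and cancel.\<close>

lemma col_coeff_large:
  fixes r :: "'a::field_char_0"
  assumes I: "I \<in> family n (odd m)" and m: "m \<le> n" "m < card I"
  shows "col_coeff n r m I z = 0"
proof -
  have IN: "I \<subseteq> {1..n}" using family_card(1)[OF I] .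
  note fc = family_cards[OF I]
  have "card I \<le> n" using card_mono[OF _ IN] by simp
  have small: "newt n r j (restr_poly n (odd j) I z) = 0" if "j \<le> n" "(j + 1) div 2 < card {i\<in>I. odd i = odd j}" for j
  proof (rule newt_small)
    have "{i\<in>I. odd i = odd j} \<subseteq> cls n (odd j)" using IN by (auto simp: cls_def)
    then have "card {i\<in>I. odd i = odd j} \<le> card (cls n (odd j))" by (rule card_mono[OF finite_cls])
    then show "degree (restr_poly n (odd j) I z) < degree (newt_den n r j)"
      unfolding restr_poly_monic card_cls_diff[OF IN] using card_cls[OF that(1), of r] that(2) by linarith
  qed
  have same: "newt n r j (restr_poly n (odd j) I z) = 1" if "j \<le> n" "(j + 1) div 2 = card {i\<in>I. odd i = odd j}" for j
    by (rule newt_same[OF restr_poly_monic(2)])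
      (use card_cls[OF that(1), of r] that(2) in \<open>simp add: restr_poly_monic card_cls_diff[OF IN]\<close>)
  show ?thesis
  proof (cases "odd m")
    case False
    then have "even (card I)" using fc(4) by simp
    then have "(m + 1) div 2 < card {i\<in>I. odd i = odd m}" using fc(2) m(2) False by (auto elim!: evenE)
    then show ?thesis using small[OF m(1)] False unfolding col_coeff_def by simp
  next
    case True
    have o: "{i\<in>I. odd i = odd m} = {i\<in>I. odd i}" "{i\<in>I. odd i = odd (m + 1)} = {i\<in>I. even i}" using True by auto
    show ?thesis
    proof (cases "card I = m + 1")
      case eq: True
      have "m + 1 \<le> n" using eq \<open>card I \<le> n\<close> by simp
      moreover have "(m + 1) div 2 = card {i\<in>I. odd i}" "(m + 1 + 1) div 2 = card {i\<in>I. even i}"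
        unfolding fc(1,2) eq using True by (auto elim!: oddE)
      moreover have "excess I = 0" using fc(3) eq True by simp
      ultimately show ?thesis
        using same[of m] same[of "m + 1"] m(1) True unfolding col_coeff_def o by simp
    next
      case False
      then have gt: "m + 1 < card I" using m(2) by simp
      have "(m + 1) div 2 < card {i\<in>I. odd i}" unfolding fc(1) using gt True by (auto elim!: oddE)
      moreover have "(m + 1 + 1) div 2 < card {i\<in>I. even i}" if "excess I = 0"
      proof -
        have "even (card I)" using fc(3) that by simp
        then show ?thesis unfolding fc(2) using gt True by (auto elim!: oddE evenE)
      qed
      ultimately show ?thesis
        using small[of m] small[of "m + 1"] m(1) True unfolding col_coeff_def o by auto
    qed
  qed
qed

section \<open>Reduction to the variables outside I\<close>

lemma newt_den_shift:
  assumes "s \<le> m" "m \<le> n"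
  shows "newt_den (n - s) r (m - s) = newt_den n r m"
  unfolding newt_den_def
proof (rule prod.reindex_bij_witness[where i = "\<lambda>i. i - s" and j = "\<lambda>p. p + s"])
  fix p assume p: "p \<in> {i. i \<in> {m - s + 1..n - s} \<and> odd i = odd (m - s)}"
  have "odd (p + s) = odd (m - s + s)" using p unfolding odd_add by simp
  then show "p + s \<in> {i. i \<in> {m + 1..n} \<and> odd i = odd m}" using p assms by auto
  show "[:- rho n r (p + s), 1:] = [:- rho (n - s) r p, 1:]" by (simp add: rho_def add.commute)
next
  fix i assume i: "i \<in> {i. i \<in> {m + 1..n} \<and> odd i = odd m}"
  have "odd (i - s) = odd (m - s)" using i assms by (simp add: even_diff_nat)
  then show "i - s \<in> {i. i \<in> {m - s + 1..n - s} \<and> odd i = odd (m - s)}" using i assms by auto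
qed (use assms in auto)

text \<open>The vector rho for n - s variables is the one for n variables with its first s entries
  removed, so nodes and divisor are the same.\<close>

lemma newt_shift:
  assumes "s \<le> m" "m \<le> n"
  shows "newt (n - s) r (m - s) = newt n r m"
  using assms unfolding newt_def newt_den_shift[OF assms] by (simp add: rho_def)

lemma card_initial: "card {i. i \<in> {1..s} \<and> odd i} = (s + 1) div 2" "card {i. i \<in> {1..s} \<and> even i} = s div 2"
proof -
  have "card {i. i \<in> {1..s} \<and> odd i} = (s + 1) div 2 \<and> card {i. i \<in> {1..s} \<and> even i} = s div 2"
  proof (induction s)
    case (Suc s)
    have *: "{i. i \<in> {1..Suc s} \<and> odd i} = (if odd (Suc s) then insert (Suc s) {i. i \<in> {1..s} \<and> odd i} else {i. i \<in> {1..s} \<and> odd i})"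
      "{i. i \<in> {1..Suc s} \<and> even i} = (if even (Suc s) then insert (Suc s) {i. i \<in> {1..s} \<and> even i} else {i. i \<in> {1..s} \<and> even i})"
      by (auto simp: le_Suc_eq)
    show ?case unfolding * using Suc.IH by (cases "even s") (auto elim!: evenE oddE)
  qed simp
  then show "card {i. i \<in> {1..s} \<and> odd i} = (s + 1) div 2" "card {i. i \<in> {1..s} \<and> even i} = s div 2" by auto
qed

lemma card_complement:
  assumes "I \<subseteq> {1..n :: nat}"
  shows "card {i. i \<in> {1..n} - I \<and> P i} = card {i. i \<in> {1..n} \<and> P i} - card {i\<in>I. P i}"
proof -
  have "{i. i \<in> {1..n} - I \<and> P i} = {i. i \<in> {1..n} \<and> P i} - {i\<in>I. P i}" by auto
  then show ?thesis using assms by (simp add: card_Diff_subset finite_subset[OF assms] subset_iff)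
qed

text \<open>A member of the family with s elements has as many odd and as many even elements as
  {1..s}. So the complements of both can be matched parity by parity.\<close>

lemma compl_enum_bij:
  assumes "I \<in> family n A"
  shows "bij_betw (compl_enum n I) {card I + 1..n} ({1..n} - I)"
    "\<And>i. i \<in> {card I + 1..n} \<Longrightarrow> odd (compl_enum n I i) = odd i"
proof -
  let ?s = "card I"
  have IN: "I \<subseteq> {1..n}" using family_card(1)[OF assms] .
  have "?s \<le> n" using card_mono[OF _ IN] by simp
  then have S: "{1..?s} \<subseteq> {1..n}" "{?s + 1..n} = {1..n} - {1..?s}" by auto
  have e: "\<exists>f. bij_betw f {i. i \<in> {?s + 1..n} \<and> P i} {i. i \<in> {1..n} - I \<and> P i}"
    if "card {i\<in>I. P i} = card {i\<in>{1..?s}. P i}" for P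
    by (rule finite_same_card_bij) (simp_all only: S(2) card_complement[OF IN] card_complement[OF S(1)] that, simp_all)
  obtain f where f: "bij_betw f {i. i \<in> {?s + 1..n} \<and> odd i} {i. i \<in> {1..n} - I \<and> odd i}"
    using e[of odd] family_cards(1)[OF assms] card_initial(1)[of ?s] by auto
  obtain g where g: "bij_betw g {i. i \<in> {?s + 1..n} \<and> even i} {i. i \<in> {1..n} - I \<and> even i}"
    using e[of even] family_cards(2)[OF assms] card_initial(2)[of ?s] by auto
  let ?h = "\<lambda>i. if odd i then f i else g i"
  have "bij_betw ?h {i. i \<in> {?s + 1..n} \<and> odd i} {i. i \<in> {1..n} - I \<and> odd i}"
    using f by (subst bij_betw_cong[where g = f]) auto
  moreover have "bij_betw ?h {i. i \<in> {?s + 1..n} \<and> even i} {i. i \<in> {1..n} - I \<and> even i}"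
    using g by (subst bij_betw_cong[where g = g]) auto
  ultimately have "bij_betw ?h ({i. i \<in> {?s + 1..n} \<and> odd i} \<union> {i. i \<in> {?s + 1..n} \<and> even i})
      ({i. i \<in> {1..n} - I \<and> odd i} \<union> {i. i \<in> {1..n} - I \<and> even i})"
    by (rule bij_betw_combine) auto
  moreover have "{i. i \<in> {?s + 1..n} \<and> odd i} \<union> {i. i \<in> {?s + 1..n} \<and> even i} = {?s + 1..n}"
    "{i. i \<in> {1..n} - I \<and> odd i} \<union> {i. i \<in> {1..n} - I \<and> even i} = {1..n} - I" by blast+
  ultimately have h: "bij_betw ?h {?s + 1..n} ({1..n} - I)" by simp
  have "\<forall>i\<in>{?s + 1..n}. ?h i mod 2 = i mod 2"
  proof
    fix i assume "i \<in> {?s + 1..n}"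
    then have "odd (?h i) = odd i"
      using bij_betwE[OF f] bij_betwE[OF g] by (cases "odd i") auto
    then show "?h i mod 2 = i mod 2" unfolding mod2_eq_if by argo
  qed
  with h have "\<exists>k. bij_betw k {?s + 1..n} ({1..n} - I) \<and> (\<forall>i\<in>{?s + 1..n}. k i mod 2 = i mod 2)"
    by (intro exI[of _ ?h] conjI)
  from someI_ex[OF this] have k: "bij_betw (compl_enum n I) {?s + 1..n} ({1..n} - I)"
    "\<forall>i\<in>{?s + 1..n}. compl_enum n I i mod 2 = i mod 2"
    unfolding compl_enum_def by blast+
  show "bij_betw (compl_enum n I) {?s + 1..n} ({1..n} - I)" by (rule k(1))
  fix i assume "i \<in> {?s + 1..n}"
  then have "compl_enum n I i mod 2 = i mod 2" using k(2) by blast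
  then show "odd (compl_enum n I i) = odd i" by (simp only: odd_iff_mod_2_eq_one)
qed

lemma restr_poly_compl:
  assumes I: "I \<in> family n A" and B: "\<And>p. (odd p = B) = (odd (card I + p) = C)"
  shows "(\<Prod>p\<in>cls (n - card I) B. [:- z (compl_enum n I (card I + p)), 1:]) = restr_poly n C I z"
proof -
  let ?s = "card I" and ?k = "compl_enum n I"
  have "?s \<le> n" using card_mono[OF _ family_card(1)[OF I]] by simp
  note k = compl_enum_bij[OF I]
  have 1: "bij_betw (\<lambda>p. ?s + p) {1..n - ?s} {?s + 1..n}"
    using \<open>?s \<le> n\<close> by (intro bij_betw_byWitness[where f' = "\<lambda>i. i - ?s"]) auto
  have b: "bij_betw (\<lambda>p. ?k (?s + p)) {1..n - ?s} ({1..n} - I)"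
    using bij_betw_trans[OF 1 k(1)] by (simp add: comp_def)
  have par: "odd (?k (?s + p)) = odd (?s + p)" if "p \<in> {1..n - ?s}" for p
    by (rule k(2)) (use bij_betwE[OF 1] that in blast)
  have "bij_betw (\<lambda>p. ?k (?s + p)) (cls (n - ?s) B) (cls n C - I)"
  proof (rule bij_betw_subset[OF b])
    show "cls (n - ?s) B \<subseteq> {1..n - ?s}" by (auto simp: cls_def)
    have "cls n C - I = {i \<in> {1..n} - I. odd i = C}" by (auto simp: cls_def)
    also have "\<dots> = {i \<in> (\<lambda>p. ?k (?s + p)) ` {1..n - ?s}. odd i = C}" using b by (simp add: bij_betw_def)
    also have "\<dots> = (\<lambda>p. ?k (?s + p)) ` {p \<in> {1..n - ?s}. odd (?k (?s + p)) = C}" by blast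
    also have "{p \<in> {1..n - ?s}. odd (?k (?s + p)) = C} = cls (n - ?s) B"
      unfolding cls_def by (rule Collect_cong) (simp add: par B cong: conj_cong)
    finally show "(\<lambda>p. ?k (?s + p)) ` cls (n - ?s) B = cls n C - I" ..
  qed
  from prod.reindex_bij_betw[OF this, of "\<lambda>i. [:- z i, 1:]"] show ?thesis
    unfolding restr_poly_def .
qed

text \<open>Removing \<open>I\<close> lowers n and m by s = \<open>card I\<close>. For even s the
  parities are preserved. For odd s they are exchanged; then m is odd, m - s is even and
  \<open>I\<close> has nonzero excess, so no correction appears on either side.\<close>

lemma eval_compl_col:
  fixes r :: "'a::field_char_0"
  assumes I: "I \<in> family n (odd m)" and s: "card I \<le> m" and m: "m \<le> n"
  shows "eval_compl n I (col (n - card I) r (m - card I)) z = col_coeff n r m I z"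
proof -
  let ?s = "card I"
  note fc = family_cards[OF I]
  have A: "newt (n - ?s) r (m - ?s) (\<Prod>p\<in>cls (n - ?s) (odd (m - ?s)). [:- z (compl_enum n I (?s + p)), 1:])
    = newt n r m (restr_poly n (odd m) I z)"
  proof -
    have "(odd p = odd (m - ?s)) = (odd (?s + p) = odd m)" for p using s by (simp add: even_diff_nat) blast
    then show ?thesis unfolding newt_shift[OF s m] by (subst restr_poly_compl[OF I]) auto
  qed
  \<comment> \<open>The rule can fail for odd s and even m. This does not occur, since members of
    \<open>P_even\<close> have even size.\<close>
  have sg: "(- 1) ^ ((m - ?s + 1) div 2) = ((- 1) ^ ((m + 1) div 2) * (- 1) ^ ((?s + 1) div 2) :: 'a)"
    if "even ?s \<or> odd m"
  proof -
    obtain j where j: "m = ?s + j" using s le_Suc_ex by blast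
    have "even ((j + 1) div 2 + (?s + j + 1) div 2 + (?s + 1) div 2)"
      using that unfolding j by presburger
    then have "(- 1) ^ ((j + 1) div 2 + (?s + j + 1) div 2 + (?s + 1) div 2) = (1 :: 'a)" by simp
    then have x: "(- 1) ^ ((j + 1) div 2) * ((- 1) ^ ((?s + j + 1) div 2) * (- 1) ^ ((?s + 1) div 2)) = (1 :: 'a)"
      by (simp only: power_add mult.assoc)
    have sq: "(- 1) ^ q * (- 1) ^ q = (1 :: 'a)" for q :: nat by (simp flip: power_add)
    have "(- 1) ^ ((j + 1) div 2) * ((- 1) ^ ((j + 1) div 2) * ((- 1) ^ ((?s + j + 1) div 2) * (- 1) ^ ((?s + 1) div 2)))
      = ((- 1) ^ ((j + 1) div 2) :: 'a)" unfolding x by simp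
    then have "((- 1) ^ ((?s + j + 1) div 2) * (- 1) ^ ((?s + 1) div 2)) = ((- 1) ^ ((j + 1) div 2) :: 'a)"
      unfolding mult.assoc[symmetric] sq by (simp add: mult.assoc)
    moreover have "m - ?s = j" using j by simp
    ultimately show ?thesis using j by metis
  qed
  have es: "even ?s \<or> odd m" using fc(4) by blast
  have os: "odd_sign I = ((- 1) ^ ((?s + 1) div 2) :: 'a)" unfolding odd_sign_def fc(1) ..
  have Bq: "(if odd (m - ?s) \<and> m - ?s < n - ?s then newt (n - ?s) r (m - ?s + 1)
       (\<Prod>p\<in>cls (n - ?s) False. [:- z (compl_enum n I (?s + p)), 1:]) else 0)
    = (if odd m \<and> m < n \<and> excess I = 0 then newt n r (m + 1) (restr_poly n False I z) else 0)"
  proof (cases "odd m \<and> m < n \<and> excess I = 0")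
    case True
    then have "even ?s" using fc(3) by simp
    then have "odd (m - ?s)" using True s by simp
    have "newt (n - ?s) r (m - ?s + 1) = newt n r (m + 1)"
      using newt_shift[of ?s "m + 1" n r] s True by (simp add: Suc_diff_le)
    moreover have "(\<Prod>p\<in>cls (n - ?s) False. [:- z (compl_enum n I (?s + p)), 1:]) = restr_poly n False I z"
      by (rule restr_poly_compl[OF I]) (use \<open>even ?s\<close> in simp)
    moreover have "m - ?s < n - ?s" using True s by linarith
    ultimately show ?thesis using True \<open>odd (m - ?s)\<close> by simp
  next
    case False
    have "\<not> (odd (m - ?s) \<and> m - ?s < n - ?s)"
    proof
      assume h: "odd (m - ?s) \<and> m - ?s < n - ?s"
      then have "even ?s \<and> odd m" using es s by auto
      moreover have "m < n" using h by linarith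
      ultimately show False using False fc(3) by blast
    qed
    then show ?thesis using False by auto
  qed
  show ?thesis
    unfolding eval_compl_def eval_col A Bq sg[OF es] col_coeff_def os ..
qed

section \<open>Initial columns and the zero tuple\<close>

lemma initial_family:
  assumes "m \<le> n"
  shows "{1..m} \<in> family n (odd m)"
proof -
  have "excess {1..m} = int ((m + 1) div 2) - int (m div 2)"
    using excess_card[of "{1..m}"] card_initial[of m] by simp
  then show ?thesis using assms unfolding family_def admissible_def by (auto elim!: evenE oddE)
qed

lemma psi_even_initial [simp]: "psi_even n {1..m} \<mu> (r :: 'a::field_char_0) = 1"
proof -
  have *: "psi_expr n {1..m} \<mu> x = 1" for x :: "'b::field"
    unfolding psi_expr_pairs by (rule prod.neutral) (auto simp: index_pairs_def)
  have "ratfun_value (1 :: 'a poly fract) 0 = 1"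
    using regular_fract_of(2)[of "1 :: 'a poly" 0] by (simp add: fract_of_simps)
  then show ?thesis unfolding psi_even_def * by simp
qed

text \<open>Removing {1..m} leaves a monic polynomial of exactly the degree of the divisor, so
  \<open>newt\<close> gives 1. There is no correction, because for odd m the set {1..m} has excess
  1. The two signs cancel.\<close>

lemma col_coeff_initial:
  fixes r :: "'a::field_char_0"
  assumes m: "m \<le> n"
  shows "col_coeff n r m {1..m} z = 1"
proof -
  let ?I = "{1..m}"
  note F = initial_family[OF m]
  have IN: "?I \<subseteq> {1..n}" using m by auto
  have "card {i\<in>?I. odd i = odd m} = (m + 1) div 2" using card_parity_le[of m] by simp
  then have "degree (restr_poly n (odd m) ?I z) = degree (newt_den n r m)"
    unfolding restr_poly_monic card_cls_diff[OF IN] using card_cls[OF m, of r] by simp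
  then have 1: "newt n r m (restr_poly n (odd m) ?I z) = 1" by (intro newt_same restr_poly_monic(2))
  have 2: "\<not> (odd m \<and> m < n \<and> excess ?I = 0)" using family_cards(3)[OF F] by simp
  have "odd_sign ?I = ((- 1) ^ ((m + 1) div 2) :: 'a)"
    unfolding odd_sign_def using family_cards(1)[OF F] by simp
  then show ?thesis unfolding col_coeff_def 1 using 2 by (auto simp flip: power_add)
qed

lemma rho_plus_zero [simp]: "rho_plus n r (\<lambda>_. 0) = rho n r"
  by (rule ext) (simp add: rho_plus_def)

text \<open>The nodes of \<open>newt\<close> are the coordinates of rho itself, so at the zero tuple
  the remaining product is a multiple of T - rho_j times the divisor. This is why these nodes are
  used.\<close>

lemma newt_initial:
  assumes "s < j" "j \<le> n"
  shows "newt n r j (restr_poly n (odd j) {1..s} (rho n r)) = 0"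
proof -
  let ?Q = "\<Prod>i | i \<in> {s + 1..j} \<and> odd i = odd j. [:- rho n r i, 1:]"
  have "restr_poly n (odd j) {1..s} (rho n r) = ?Q * newt_den n r j"
    unfolding restr_poly_def newt_den_def
  proof (subst prod.union_disjoint[symmetric])
    have "i \<in> {1..n} \<and> i \<notin> {1..s} \<longleftrightarrow> i \<in> {s + 1..j} \<or> i \<in> {j + 1..n}" for i using assms by auto
    then have "cls n (odd j) - {1..s} = {i. i \<in> {s + 1..j} \<and> odd i = odd j} \<union> {i. i \<in> {j + 1..n} \<and> odd i = odd j}"
      unfolding cls_def by blast
    then show "(\<Prod>i\<in>cls n (odd j) - {1..s}. [:- rho n r i, 1:]) =
      (\<Prod>i\<in>{i. i \<in> {s + 1..j} \<and> odd i = odd j} \<union> {i. i \<in> {j + 1..n} \<and> odd i = odd j}. [:- rho n r i, 1:])" by simp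
  qed (simp, simp, rule Int_emptyI, simp)
  moreover have "poly ?Q (rho n r j) = 0"
    unfolding poly_prod by (rule prod_zero) (use assms in \<open>auto intro!: exI[of _ j]\<close>)
  ultimately show ?thesis by (simp add: newt_multiple)
qed

lemma add_indicator_zero_Lam:
  assumes "I \<subseteq> {1..n}" "add_indicator (\<lambda>_. 0) I \<in> Lam n"
  shows "I = {1..card I}"
proof -
  have "finite I" using assms(1) finite_subset by blast
  have down: "i \<in> I" if "j \<in> I" "1 \<le> i" "i \<le> j" for i j
  proof -
    have "j \<le> n" using that assms(1) by auto
    then have "add_indicator (\<lambda>_. 0) I j \<le> add_indicator (\<lambda>_. 0) I i" using LamD[OF assms(2), of i j] that by simp
    then show ?thesis using that(1) by (auto simp: add_indicator_def split: if_splits)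
  qed
  show ?thesis
  proof (cases "I = {}")
    case False
    have "I = {1..Max I}"
      using down[OF Max_in[OF \<open>finite I\<close> False]] Max_ge[OF \<open>finite I\<close>] assms(1) by auto
    then show ?thesis by (metis card_atLeastAtMost diff_Suc_1)
  qed simp
qed

text \<open>Starting from 0, only sets {1..s} lead into \<Lambda>. The case s > m is excluded by
  degree, s < m by the choice of the nodes.\<close>

lemma col_coeff_zero_tuple:
  fixes r :: "'a::field_char_0"
  assumes m: "m \<le> n" and I: "I \<in> pieri_sets n (odd m) (\<lambda>_. 0)" "I \<noteq> {1..m}"
  shows "col_coeff n r m I (rho n r) = 0"
proof -
  have F: "I \<in> family n (odd m)" and L: "add_indicator (\<lambda>_. 0) I \<in> Lam n" using I by (auto simp: pieri_sets_def)
  have Is: "I = {1..card I}" by (rule add_indicator_zero_Lam[OF family_card(1)[OF F] L])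
  show ?thesis
  proof (cases "m < card I")
    case True
    then show ?thesis by (rule col_coeff_large[OF F m])
  next
    case False
    moreover have "card I \<noteq> m" using Is I(2) by metis
    ultimately have lt: "card I < m" by simp
    have 1: "newt n r m (restr_poly n (odd m) I (rho n r)) = 0"
      by (subst Is) (rule newt_initial[OF lt m])
    have 2: "newt n r (m + 1) (restr_poly n False I (rho n r)) = 0" if "odd m" "m < n"
    proof -
      have "odd (m + 1) = False" using that(1) by simp
      then show ?thesis using newt_initial[of "card I" "m + 1" n r] lt that Is by simp
    qed
    show ?thesis unfolding col_coeff_def using 1 2 by auto
  qed
qed

subsection \<open>The polynomials represented by the eigenfunctionals\<close>

definition prec :: "nat \<Rightarrow> (nat \<Rightarrow> int) \<Rightarrow> (nat \<Rightarrow> int) \<Rightarrow> bool" where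
  "prec n \<nu> \<mu> \<longleftrightarrow> odd_size n \<nu> < odd_size n \<mu> \<or>
     odd_size n \<nu> = odd_size n \<mu> \<and> bracket_exponent n \<nu> < bracket_exponent n \<mu>"

text \<open>Only finitely many tuples precede a given one, because \<open>odd_size\<close> bounds
  every part.\<close>

lemma Lam_prec_induct [consumes 1, case_names step]:
  assumes "\<mu> \<in> Lam n" and step: "\<And>\<mu>. \<mu> \<in> Lam n \<Longrightarrow> (\<And>\<nu>. \<nu> \<in> Lam n \<Longrightarrow> prec n \<nu> \<mu> \<Longrightarrow> P \<nu>) \<Longrightarrow> P \<mu>"
  shows "P \<mu>"
  using assms(1)
proof (induction "card {\<nu> \<in> Lam n. prec n \<nu> \<mu>}" arbitrary: \<mu> rule: less_induct)
  case less
  show ?case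
  proof (rule step[OF less.prems])
    fix \<nu> assume \<nu>: "\<nu> \<in> Lam n" "prec n \<nu> \<mu>"
    have "{\<kappa> \<in> Lam n. prec n \<kappa> \<nu>} \<subset> {\<kappa> \<in> Lam n. prec n \<kappa> \<mu>}"
      using \<nu> by (auto simp: prec_def)
    moreover have "finite {\<kappa> \<in> Lam n. prec n \<kappa> \<mu>}"
      by (rule finite_subset[OF _ finite_Lam_bounded[of n "odd_size n \<mu>"]]) (auto simp: prec_def)
    ultimately have "card {\<kappa> \<in> Lam n. prec n \<kappa> \<nu>} < card {\<kappa> \<in> Lam n. prec n \<kappa> \<mu>}"
      by (intro psubset_card_mono)
    then show "P \<nu>" using less.hyps \<nu>(1) by blast
  qed
qed

definition leads_tuple :: "nat \<Rightarrow> (nat \<Rightarrow> int) \<Rightarrow> 'a::comm_ring_1 mpol \<Rightarrow> bool" where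
  "leads_tuple n \<mu> f \<longleftrightarrow> leads (nat (odd_size n \<mu>)) (bracket_exponent n \<mu>) f"

text \<open>The height m of the column is the number of positive parts.\<close>

lemma remove_column:
  assumes \<mu>: "\<mu> \<in> Lam n" "\<mu> \<noteq> (\<lambda>_. 0)"
  obtains m \<kappa> where "1 \<le> m" "m \<le> n" "\<kappa> \<in> Lam n" "\<mu> = add_indicator \<kappa> {1..m}"
proof -
  let ?S = "{i \<in> {1..n}. 0 < \<mu> i}"
  have fS: "finite ?S" by simp
  have ne: "?S \<noteq> {}"
  proof
    assume "?S = {}"
    then have "\<mu> i = 0" for i using \<mu>(1) Lam_nonneg[OF \<mu>(1), of i] unfolding Lam_def by (cases "i \<in> {1..n}") force+
    then show False using \<mu>(2) by auto
  qed
  obtain m where mS: "m \<in> ?S" and ge: "\<And>i. i \<in> ?S \<Longrightarrow> i \<le> m"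
    by (rule that[OF Max_in[OF fS ne] Max_ge[OF fS]])
  let ?k = "\<lambda>i. \<mu> i - (if i \<in> {1..m} then 1 else 0)"
  have pos: "1 \<le> \<mu> i" if "i \<in> {1..m}" for i
    using LamD[OF \<mu>(1), of i m] mS that by auto
  have zero: "\<mu> i = 0" if "i \<notin> {1..m}" for i
  proof (cases "i \<in> {1..n}")
    case True
    have "\<not> i \<le> m" using True that by simp
    then have "i \<notin> ?S" using ge by blast
    then have "\<not> 0 < \<mu> i" using True by simp
    then show ?thesis using Lam_nonneg[OF \<mu>(1), of i] by simp
  qed (use \<mu>(1) in \<open>auto simp: Lam_def\<close>)
  have "?k \<in> Lam n"
    unfolding Lam_def
  proof (intro CollectI conjI ballI allI impI)
    show "0 \<le> ?k i" for i using pos[of i] zero[of i] by (cases "i \<in> {1..m}") auto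
    show "?k i = 0" if "i \<notin> {1..n}" for i using that zero[of i] mS by auto
    show "?k (Suc i) \<le> ?k i" if i: "i \<in> {1..<n}" for i
    proof -
      have "\<mu> (Suc i) \<le> \<mu> i" using \<mu>(1) i by (auto simp: Lam_def)
      then show ?thesis using zero[of "Suc i"] pos[of i] i by (cases "Suc i \<in> {1..m}"; cases "i \<in> {1..m}") auto
    qed
  qed
  moreover have "\<mu> = add_indicator ?k {1..m}" by (auto simp: add_indicator_def)
  ultimately show ?thesis using that[of m ?k] mS by auto
qed

lemma bracket_exponent_add_column:
  assumes "\<kappa> \<in> Lam n" "m \<le> n"
  shows "bracket_exponent n (add_indicator \<kappa> {1..m}) = bracket_exponent n (one_col m) + bracket_exponent n \<kappa>"
proof (rule poly_mapping_eqI)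
  fix j
  have "bracket n (add_indicator \<kappa> {1..m}) j = bracket n \<kappa> j + bracket n (one_col m) j"
    unfolding bracket_add_indicator[of n \<kappa>] one_col_eq ..
  then show "Poly_Mapping.lookup (bracket_exponent n (add_indicator \<kappa> {1..m})) j =
    Poly_Mapping.lookup (bracket_exponent n (one_col m) + bracket_exponent n \<kappa>) j"
    unfolding lookup_add lookup_bracket_exponent
    using bracket_bounds[OF assms(1), of j] bracket_bounds[OF one_col_Lam[OF assms(2)], of j] by auto
qed

lemma odd_size_add_column:
  "m \<le> n \<Longrightarrow> odd_size n (add_indicator \<kappa> {1..m}) = odd_size n \<kappa> + int ((m + 1) div 2)"
  using odd_size_add_indicator[of "{1..m}" n \<kappa>] card_initial(1)[of m] by simp

text \<open>Smaller sets add fewer odd indices, hence give smaller \<open>odd_size\<close>; sets of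
  size m are compared by \<open>lex_less_column\<close>. So {1..m} gives the leading term of the
  recursion.\<close>

lemma prec_column:
  assumes I: "I \<in> pieri_sets n (odd m) \<kappa>" "I \<noteq> {1..m}" "card I \<le> m" and m: "m \<le> n"
    and L: "add_indicator \<kappa> {1..m} \<in> Lam n"
  shows "prec n (add_indicator \<kappa> I) (add_indicator \<kappa> {1..m})"
proof -
  have F: "I \<in> family n (odd m)" and LI: "add_indicator \<kappa> I \<in> Lam n" using I(1) by (auto simp: pieri_sets_def)
  note IN = family_card(1)[OF F] and fc = family_cards[OF F]
  have s: "odd_size n (add_indicator \<kappa> I) = odd_size n \<kappa> + int ((card I + 1) div 2)"
    using odd_size_add_indicator[OF IN] fc(1) by simp
  show ?thesis
  proof (cases "card I = m")
    case True
    have fin: "finite I" using IN finite_subset by blast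
    have "excess I = excess {1..m}"
      unfolding excess_card[OF fin] excess_card[OF finite_atLeastAtMost] fc(1,2)
      using card_initial[of m] True by simp
    then show ?thesis
      using lex_less_column[OF LI L m IN I(2) True] s odd_size_add_column[OF m, of \<kappa>] True by (simp add: prec_def)
  next
    case False
    then have "(card I + 1) div 2 < (m + 1) div 2"
      using fc(4) I(3) by (cases "even m") presburger+
    then show ?thesis using s odd_size_add_column[OF m, of \<kappa>] by (simp add: prec_def)
  qed
qed

locale eigenfunctionals =
  fixes n :: nat and r :: "'a::field_char_0" and \<chi> :: "(nat \<Rightarrow> int) \<Rightarrow> (nat \<Rightarrow> int) \<Rightarrow> 'a"
  assumes \<chi>_self: "\<nu> \<in> Lam n \<Longrightarrow> \<chi> \<nu> \<nu> = 1"
    and \<chi>_vanish: "\<nu> \<in> Lam n \<Longrightarrow> \<mu> \<in> Lam n \<Longrightarrow> odd_size n \<nu> \<le> odd_size n \<mu> \<Longrightarrow> \<mu> \<noteq> \<nu> \<Longrightarrow> \<chi> \<nu> \<mu> = 0"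
    and \<chi>_eigen: "\<nu> \<in> Lam n \<Longrightarrow> \<mu> \<in> Lam n \<Longrightarrow> pieri_op n r A u (\<chi> \<nu>) \<mu> = poly (class_poly n r A \<nu>) u * \<chi> \<nu> \<mu>"
begin

lemma pieri_recursion:
  assumes "\<nu> \<in> Lam n" "\<kappa> \<in> Lam n"
  shows "(\<Sum>I\<in>pieri_sets n (odd m) \<kappa>. col_coeff n r m I (rho_plus n r \<kappa>) * psi_even n I \<kappa> r * \<chi> \<nu> (add_indicator \<kappa> I))
    = eval_pol (col n r m) (rho_plus n r \<nu>) * \<chi> \<nu> \<kappa>"
  by (rule col_pieri[OF \<chi>_eigen[OF assms]])

text \<open>The value at the zero tuple is a common normalization. It proves nonzero in
  \<open>\<chi>_zero_tuple\<close>, because the value at \<nu> is 1.\<close>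

definition represents :: "(nat \<Rightarrow> int) \<Rightarrow> 'a mpol \<Rightarrow> bool" where
  "represents \<mu> f \<longleftrightarrow> semisymmetric n f \<and> leads_tuple n \<mu> f \<and>
     (\<forall>\<nu>\<in>Lam n. \<chi> \<nu> \<mu> = eval_pol f (rho_plus n r \<nu>) * \<chi> \<nu> (\<lambda>_. 0))"

text \<open>The recursion at \<kappa> is solved for its term with the set {1..m}, whose coefficient
  is 1. Every other term has more than m indices and coefficient 0, or leads to a tuple preceding
  \<kappa> plus the column.\<close>

lemma represents_step:
  assumes m: "m \<le> n" and \<kappa>: "\<kappa> \<in> Lam n" and L: "add_indicator \<kappa> {1..m} \<in> Lam n"
    and f: "\<And>\<theta>. \<theta> \<in> Lam n \<Longrightarrow> prec n \<theta> (add_indicator \<kappa> {1..m}) \<Longrightarrow> represents \<theta> (f \<theta>)"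
    and fk: "represents \<kappa> (f \<kappa>)"
  shows "\<exists>g. represents (add_indicator \<kappa> {1..m}) g"
proof -
  let ?\<mu> = "add_indicator \<kappa> {1..m}"
  let ?c = "\<lambda>I. col_coeff n r m I (rho_plus n r \<kappa>) * psi_even n I \<kappa> r"
  let ?J = "{I \<in> pieri_sets n (odd m) \<kappa>. I \<noteq> {1..m} \<and> card I \<le> m}"
  let ?q = "\<Sum>I\<in>?J. const_pol (?c I) * f (add_indicator \<kappa> I)"
  let ?g = "col n r m * f \<kappa> - ?q"
  have fJ: "represents (add_indicator \<kappa> I) (f (add_indicator \<kappa> I))" "prec n (add_indicator \<kappa> I) ?\<mu>" if "I \<in> ?J" for I
  proof -
    show p: "prec n (add_indicator \<kappa> I) ?\<mu>" using that by (intro prec_column[OF _ _ _ m L]) auto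
    show "represents (add_indicator \<kappa> I) (f (add_indicator \<kappa> I))"
      using that by (intro f[OF _ p]) (simp add: pieri_sets_def)
  qed
  have "semisymmetric n ?g"
    using fJ(1) fk unfolding represents_def
    by (intro semisymmetric_diff semisymmetric_simps semisymmetric_col semisymmetric_sum) auto
  moreover have "leads_tuple n ?\<mu> ?g"
  proof -
    have d: "nat (odd_size n ?\<mu>) = (m + 1) div 2 + nat (odd_size n \<kappa>)"
      using odd_size_add_column[OF m, of \<kappa>] odd_size_nonneg[OF \<kappa>] by simp
    have "leads ((m + 1) div 2 + nat (odd_size n \<kappa>)) (bracket_exponent n (one_col m) + bracket_exponent n \<kappa>) (col n r m * f \<kappa>)"
      using fk by (intro leads_mult leads_col[OF m]) (simp add: represents_def leads_tuple_def)
    then have "leads (nat (odd_size n ?\<mu>)) (bracket_exponent n ?\<mu>) (col n r m * f \<kappa>)"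
      unfolding d bracket_exponent_add_column[OF \<kappa> m] .
    moreover have "exp_deg e < nat (odd_size n ?\<mu>) \<or> exp_deg e = nat (odd_size n ?\<mu>) \<and> e < bracket_exponent n ?\<mu>"
      if "e \<in> Poly_Mapping.keys ?q" for e
    proof -
      have "e \<in> (\<Union>I\<in>?J. Poly_Mapping.keys (const_pol (?c I) * f (add_indicator \<kappa> I)))"
        by (rule subsetD[OF keys_sum that])
      then obtain I where I: "I \<in> ?J" "e \<in> Poly_Mapping.keys (const_pol (?c I) * f (add_indicator \<kappa> I))" by blast
      then have "e \<in> Poly_Mapping.keys (f (add_indicator \<kappa> I))" by (auto simp: in_keys_iff lookup_const_mult)
      then have "exp_deg e < nat (odd_size n (add_indicator \<kappa> I)) \<or> exp_deg e = nat (odd_size n (add_indicator \<kappa> I)) \<and>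
          e \<le> bracket_exponent n (add_indicator \<kappa> I)"
        using fJ(1)[OF I(1)] unfolding represents_def leads_tuple_def leads_def by blast
      moreover have "0 \<le> odd_size n (add_indicator \<kappa> I)" using I(1) by (intro odd_size_nonneg) (simp add: pieri_sets_def)
      ultimately show ?thesis using fJ(2)[OF I(1)] unfolding prec_def by auto
    qed
    ultimately show ?thesis unfolding leads_tuple_def by (rule leads_diff)
  qed
  moreover have "\<chi> \<nu> ?\<mu> = eval_pol ?g (rho_plus n r \<nu>) * \<chi> \<nu> (\<lambda>_. 0)" if \<nu>: "\<nu> \<in> Lam n" for \<nu>
  proof -
    let ?t = "\<lambda>I. ?c I * \<chi> \<nu> (add_indicator \<kappa> I)"
    have init: "{1..m} \<in> pieri_sets n (odd m) \<kappa>" using initial_family[OF m] L by (simp add: pieri_sets_def)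
    have "eval_pol (col n r m) (rho_plus n r \<nu>) * \<chi> \<nu> \<kappa> = (\<Sum>I\<in>pieri_sets n (odd m) \<kappa>. ?t I)"
      by (rule pieri_recursion[OF \<nu> \<kappa>, symmetric])
    also have "\<dots> = (\<Sum>I\<in>insert {1..m} ?J. ?t I)"
    proof (rule sum.mono_neutral_right)
      show "insert {1..m} ?J \<subseteq> pieri_sets n (odd m) \<kappa>" using init by auto
      show "\<forall>I\<in>pieri_sets n (odd m) \<kappa> - insert {1..m} ?J. ?t I = 0"
      proof
        fix I assume "I \<in> pieri_sets n (odd m) \<kappa> - insert {1..m} ?J"
        then have "I \<in> family n (odd m)" "m < card I" by (auto simp: pieri_sets_def)
        then have "col_coeff n r m I (rho_plus n r \<kappa>) = 0" by (intro col_coeff_large[OF _ m])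
        then show "?t I = 0" by simp
      qed
    qed simp
    also have "\<dots> = ?t {1..m} + (\<Sum>I\<in>?J. ?t I)" by (rule sum.insert) auto
    also have "?t {1..m} = \<chi> \<nu> ?\<mu>" unfolding col_coeff_initial[OF m] psi_even_initial by simp
    also have "(\<Sum>I\<in>?J. ?t I) = (\<Sum>I\<in>?J. ?c I * eval_pol (f (add_indicator \<kappa> I)) (rho_plus n r \<nu>)) * \<chi> \<nu> (\<lambda>_. 0)"
      unfolding sum_distrib_right
    proof (rule sum.cong[OF refl])
      fix I assume "I \<in> ?J"
      then have "\<chi> \<nu> (add_indicator \<kappa> I) = eval_pol (f (add_indicator \<kappa> I)) (rho_plus n r \<nu>) * \<chi> \<nu> (\<lambda>_. 0)"
        using fJ(1) \<nu> unfolding represents_def by blast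
      then show "?t I = ?c I * eval_pol (f (add_indicator \<kappa> I)) (rho_plus n r \<nu>) * \<chi> \<nu> (\<lambda>_. 0)" by simp
    qed
    finally have e: "eval_pol (col n r m) (rho_plus n r \<nu>) * \<chi> \<nu> \<kappa> = \<chi> \<nu> ?\<mu> +
      (\<Sum>I\<in>?J. ?c I * eval_pol (f (add_indicator \<kappa> I)) (rho_plus n r \<nu>)) * \<chi> \<nu> (\<lambda>_. 0)" .
    have k: "\<chi> \<nu> \<kappa> = eval_pol (f \<kappa>) (rho_plus n r \<nu>) * \<chi> \<nu> (\<lambda>_. 0)" using fk \<nu> by (simp add: represents_def)
    have "\<chi> \<nu> ?\<mu> = eval_pol (col n r m) (rho_plus n r \<nu>) * \<chi> \<nu> \<kappa> -
      (\<Sum>I\<in>?J. ?c I * eval_pol (f (add_indicator \<kappa> I)) (rho_plus n r \<nu>)) * \<chi> \<nu> (\<lambda>_. 0)" unfolding e by simp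
    also have "\<dots> = eval_pol ?g (rho_plus n r \<nu>) * \<chi> \<nu> (\<lambda>_. 0)"
      unfolding k eval_pol_diff eval_pol_simps by (simp only: left_diff_distrib mult.assoc)
    finally show ?thesis .
  qed
  ultimately show ?thesis unfolding represents_def by blast
qed

lemma ex_represents:
  assumes "\<mu> \<in> Lam n"
  shows "\<exists>f. represents \<mu> f"
  using assms
proof (induction \<mu> rule: Lam_prec_induct)
  case (step \<mu>)
  show ?case
  proof (cases "\<mu> = (\<lambda>_. 0)")
    case True
    have b: "bracket_exponent n (\<lambda>_. 0) = 0"
      by (rule poly_mapping_eqI) (simp add: lookup_bracket_exponent bracket_def)
    have o: "odd_size n (\<lambda>_. 0) = 0" by (simp add: odd_size_def)
    have "represents \<mu> 1"
      unfolding represents_def leads_tuple_def leads_def True b o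
      using semisymmetric_simps(2)[of n "1 :: 'a"] eval_pol_simps(3)[of "1 :: 'a"]
      by (auto simp: const_pol_simps exp_deg_def lookup_one)
    then show ?thesis by blast
  next
    case False
    then obtain m \<kappa> where mk: "1 \<le> m" "m \<le> n" "\<kappa> \<in> Lam n" "\<mu> = add_indicator \<kappa> {1..m}"
      using remove_column[OF step.hyps] by metis
    have "(1 :: nat) \<le> (m + 1) div 2" using mk(1) by simp
    then have "prec n \<kappa> \<mu>" using odd_size_add_column[OF mk(2), of \<kappa>] unfolding prec_def mk(4) by simp
    have "\<forall>\<nu>. \<exists>f. \<nu> \<in> Lam n \<longrightarrow> prec n \<nu> \<mu> \<longrightarrow> represents \<nu> f" using step.IH by blast
    then obtain f where f: "\<And>\<nu>. \<nu> \<in> Lam n \<Longrightarrow> prec n \<nu> \<mu> \<Longrightarrow> represents \<nu> (f \<nu>)" by metis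
    show ?thesis
      unfolding mk(4)
      using represents_step[OF mk(2,3), of f] step.hyps f f[OF mk(3) \<open>prec n \<kappa> \<mu>\<close>] unfolding mk(4) by blast
  qed
qed

end

section \<open>The interpolation basis of semisymmetric polynomials\<close>

context eigenfunctionals
begin

definition rep :: "(nat \<Rightarrow> int) \<Rightarrow> 'a mpol" where
  "rep \<mu> = (SOME f. represents \<mu> f)"

lemma represents_rep: "\<mu> \<in> Lam n \<Longrightarrow> represents \<mu> (rep \<mu>)"
  unfolding rep_def by (rule someI_ex[OF ex_represents])

lemma rep_props:
  assumes "\<mu> \<in> Lam n"
  shows "semisymmetric n (rep \<mu>)" "leads (nat (odd_size n \<mu>)) (bracket_exponent n \<mu>) (rep \<mu>)"
    "\<nu> \<in> Lam n \<Longrightarrow> \<chi> \<nu> \<mu> = eval_pol (rep \<mu>) (rho_plus n r \<nu>) * \<chi> \<nu> (\<lambda>_. 0)"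
  using represents_rep[OF assms] unfolding represents_def leads_tuple_def by blast+

lemma \<chi>_zero_tuple:
  assumes "\<nu> \<in> Lam n"
  shows "\<chi> \<nu> (\<lambda>_. 0) \<noteq> 0"
  using rep_props(3)[OF assms assms] \<chi>_self[OF assms] by auto

lemma eval_rep_self: "\<nu> \<in> Lam n \<Longrightarrow> eval_pol (rep \<nu>) (rho_plus n r \<nu>) \<noteq> 0"
  using rep_props(3)[of \<nu> \<nu>] \<chi>_self[of \<nu>] by auto

lemma eval_rep_vanish:
  assumes "\<mu> \<in> Lam n" "\<nu> \<in> Lam n" "odd_size n \<nu> \<le> odd_size n \<mu>" "\<nu> \<noteq> \<mu>"
  shows "eval_pol (rep \<mu>) (rho_plus n r \<nu>) = 0"
proof -
  have "\<chi> \<nu> \<mu> = 0" using assms by (intro \<chi>_vanish) auto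
  then show ?thesis using rep_props(3)[OF assms(1,2)] \<chi>_zero_tuple[OF assms(2)] by simp
qed

text \<open>Elimination of leading terms: subtracting a multiple of \<open>rep \<mu>\<close> removes
  the exponent [mu], and by \<open>top_exp_bracket\<close> the next leading exponent is again a
  bracket. The fixed bound \<open>D\<close> keeps all sums over the same index set.\<close>

lemma span_leading:
  assumes "\<mu> \<in> Lam n" "odd_size n \<mu> \<le> D" "semisymmetric n p"
    "\<And>e. e \<in> Poly_Mapping.keys p \<Longrightarrow> exp_deg e < nat (odd_size n \<mu>) \<or> exp_deg e = nat (odd_size n \<mu>) \<and> e \<le> bracket_exponent n \<mu>"
  shows "\<exists>c. p = (\<Sum>\<nu> | \<nu> \<in> Lam n \<and> odd_size n \<nu> \<le> D. const_pol (c \<nu>) * rep \<nu>)"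
  using assms
proof (induction \<mu> arbitrary: p rule: Lam_prec_induct)
  case (step \<mu>)
  let ?L = "{\<nu>. \<nu> \<in> Lam n \<and> odd_size n \<nu> \<le> D}" and ?b = "bracket_exponent n \<mu>"
  let ?a = "Poly_Mapping.lookup p ?b"
  let ?q = "p - const_pol ?a * rep \<mu>"
  note rep = rep_props(1,2)[OF step.hyps]
  have q: "semisymmetric n ?q" by (intro semisymmetric_diff semisymmetric_simps step.prems(2) rep(1))
  have "\<exists>c. ?q = (\<Sum>\<nu>\<in>?L. const_pol (c \<nu>) * rep \<nu>)"
  proof (cases "?q = 0")
    case True
    then show ?thesis by (intro exI[of _ "\<lambda>_. 0"]) (simp add: const_pol_simps)
  next
    case False
    then obtain \<nu> where \<nu>: "\<nu> \<in> Lam n" "bracket_exponent n \<nu> = top_exp ?q" "odd_size n \<nu> = int (total_degree ?q)"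
      by (rule top_exp_bracket[OF q])
    let ?t = "top_exp ?q"
    have t: "?t \<in> Poly_Mapping.keys ?q" "exp_deg ?t = total_degree ?q" by (rule top_exp[OF False])+
    have "?t \<in> Poly_Mapping.keys p \<or> ?t \<in> Poly_Mapping.keys (rep \<mu>)"
      using t(1) by (auto simp: in_keys_iff lookup_minus lookup_const_mult)
    then have bd: "exp_deg ?t < nat (odd_size n \<mu>) \<or> exp_deg ?t = nat (odd_size n \<mu>) \<and> ?t \<le> ?b"
      using step.prems(3) rep(2) unfolding leads_def by blast
    have "Poly_Mapping.lookup ?q ?b = 0"
      using rep(2) unfolding leads_def by (simp add: lookup_minus lookup_const_mult)
    then have "?t \<noteq> ?b" using t(1) by (auto simp: in_keys_iff)
    then have "prec n \<nu> \<mu>"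
      using bd odd_size_nonneg[OF step.hyps] unfolding prec_def \<nu>(2,3) t(2) by auto
    moreover have "odd_size n \<nu> \<le> D" using \<open>prec n \<nu> \<mu>\<close> step.prems(1) by (auto simp: prec_def)
    moreover have "exp_deg e < nat (odd_size n \<nu>) \<or> exp_deg e = nat (odd_size n \<nu>) \<and> e \<le> bracket_exponent n \<nu>"
      if "e \<in> Poly_Mapping.keys ?q" for e
    proof -
      have "exp_deg e \<le> total_degree ?q" using deg_le_total_degree[of ?q] that unfolding deg_le_def by blast
      then show ?thesis using top_exp(3)[OF False that] unfolding \<nu>(2,3) by auto
    qed
    ultimately show ?thesis using step.IH[OF \<nu>(1)] q by blast
  qed
  then obtain c where c: "?q = (\<Sum>\<nu>\<in>?L. const_pol (c \<nu>) * rep \<nu>)" by blast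
  have fin: "finite ?L" by (rule finite_Lam_bounded)
  have mL: "\<mu> \<in> ?L" using step.hyps step.prems(1) by simp
  have "const_pol ?a * rep \<mu> = (\<Sum>\<nu>\<in>?L. const_pol (if \<nu> = \<mu> then ?a else 0) * rep \<nu>)"
  proof -
    have "(\<Sum>\<nu>\<in>?L. const_pol (if \<nu> = \<mu> then ?a else 0) * rep \<nu>) = (\<Sum>\<nu>\<in>?L. if \<nu> = \<mu> then const_pol ?a * rep \<mu> else 0)"
      by (rule sum.cong[OF refl]) (simp add: const_pol_simps)
    then show ?thesis using mL by (simp add: sum.delta[OF fin])
  qed
  then have "p = (\<Sum>\<nu>\<in>?L. const_pol (c \<nu>) * rep \<nu>) + (\<Sum>\<nu>\<in>?L. const_pol (if \<nu> = \<mu> then ?a else 0) * rep \<nu>)"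
    using c by (metis diff_add_cancel)
  then have "p = (\<Sum>\<nu>\<in>?L. const_pol (c \<nu> + (if \<nu> = \<mu> then ?a else 0)) * rep \<nu>)"
    unfolding sum.distrib[symmetric] distrib_right[symmetric] const_pol_simps(3)[symmetric] .
  then show ?case by (rule exI[of _ "\<lambda>\<nu>. c \<nu> + (if \<nu> = \<mu> then ?a else 0)"])
qed

lemma span_semisymmetric:
  assumes p: "semisymmetric n p" "int (total_degree p) \<le> D"
  obtains c where "p = (\<Sum>\<nu> | \<nu> \<in> Lam n \<and> odd_size n \<nu> \<le> D. const_pol (c \<nu>) * rep \<nu>)"
proof (cases "p = 0")
  case True
  then show ?thesis using that[of "\<lambda>_. 0"] by (simp add: const_pol_simps)
next
  case False
  then obtain \<nu> where \<nu>: "\<nu> \<in> Lam n" "bracket_exponent n \<nu> = top_exp p" "odd_size n \<nu> = int (total_degree p)"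
    by (rule top_exp_bracket[OF p(1)])
  have "exp_deg e < nat (odd_size n \<nu>) \<or> exp_deg e = nat (odd_size n \<nu>) \<and> e \<le> bracket_exponent n \<nu>"
    if "e \<in> Poly_Mapping.keys p" for e
  proof -
    have "exp_deg e \<le> total_degree p" using deg_le_total_degree[of p] that unfolding deg_le_def by blast
    then show ?thesis using top_exp(3)[OF False that] unfolding \<nu>(2,3) by auto
  qed
  then show ?thesis using span_leading[OF \<nu>(1) _ p(1), of D] p(2) \<nu>(3) that by auto
qed

text \<open>Evaluation at rho + nu is triangular: basis elements of at least the size of \<nu>,
  other than \<open>rep \<nu>\<close>, vanish there, and smaller ones have coefficient 0 by
  induction. The exempted set \<open>X\<close> lies on the top level, so it does not affect the
  induction at lower levels.\<close>

lemma coefficients_vanish: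
  assumes p: "p = (\<Sum>\<nu> | \<nu> \<in> Lam n \<and> odd_size n \<nu> \<le> D. const_pol (c \<nu>) * rep \<nu>)"
    and z: "\<And>\<nu>. \<nu> \<in> Lam n \<Longrightarrow> odd_size n \<nu> \<le> D \<Longrightarrow> \<nu> \<notin> X \<Longrightarrow> eval_pol p (rho_plus n r \<nu>) = 0"
    and X: "\<And>\<nu>. \<nu> \<in> X \<Longrightarrow> odd_size n \<nu> = D"
    and \<nu>: "\<nu> \<in> Lam n" "odd_size n \<nu> \<le> D" "\<nu> \<notin> X"
  shows "c \<nu> = 0"
  using \<nu>
proof (induction "nat (odd_size n \<nu>)" arbitrary: \<nu> rule: less_induct)
  case less
  let ?L = "{\<nu>. \<nu> \<in> Lam n \<and> odd_size n \<nu> \<le> D}"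
  have "0 = (\<Sum>\<kappa>\<in>?L. c \<kappa> * eval_pol (rep \<kappa>) (rho_plus n r \<nu>))"
    using z[OF less.prems] unfolding p eval_pol_simps by simp
  also have "\<dots> = (\<Sum>\<kappa>\<in>{\<nu>}. c \<kappa> * eval_pol (rep \<kappa>) (rho_plus n r \<nu>))"
  proof (rule sum.mono_neutral_right)
    show "finite ?L" by (rule finite_Lam_bounded)
    show "\<forall>\<kappa>\<in>?L - {\<nu>}. c \<kappa> * eval_pol (rep \<kappa>) (rho_plus n r \<nu>) = 0"
    proof
      fix \<kappa> assume \<kappa>: "\<kappa> \<in> ?L - {\<nu>}"
      show "c \<kappa> * eval_pol (rep \<kappa>) (rho_plus n r \<nu>) = 0"
      proof (cases "odd_size n \<nu> \<le> odd_size n \<kappa>")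
        case True
        then show ?thesis using \<kappa> eval_rep_vanish[of \<kappa> \<nu>] less.prems(1) by auto
      next
        case False
        then have "\<kappa> \<notin> X" using X[of \<kappa>] less.prems(2) by auto
        moreover have "nat (odd_size n \<kappa>) < nat (odd_size n \<nu>)" using False odd_size_nonneg[of \<kappa> n] \<kappa> by auto
        ultimately show ?thesis using less.hyps[of \<kappa>] \<kappa> by simp
      qed
    qed
  qed (use less.prems in auto)
  finally show ?case using eval_rep_self[OF less.prems(1)] by simp
qed

text \<open>The points rho + nu determine a semisymmetric polynomial; this turns identities between
  values of \<chi> into identities of polynomials.\<close>

lemma semisymmetric_zeroI:
  assumes p: "semisymmetric n p" and z: "\<And>\<nu>. \<nu> \<in> Lam n \<Longrightarrow> eval_pol p (rho_plus n r \<nu>) = 0"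
  shows "p = 0"
proof -
  obtain c where c: "p = (\<Sum>\<nu> | \<nu> \<in> Lam n \<and> odd_size n \<nu> \<le> int (total_degree p). const_pol (c \<nu>) * rep \<nu>)"
    by (rule span_semisymmetric[OF p order_refl])
  have "const_pol (c \<nu>) * rep \<nu> = 0" if "\<nu> \<in> {\<nu>. \<nu> \<in> Lam n \<and> odd_size n \<nu> \<le> int (total_degree p)}" for \<nu>
    using coefficients_vanish[OF c, of "{}" \<nu>] z that by (simp add: const_pol_simps)
  then show ?thesis by (subst c) (rule sum.neutral, blast)
qed

lemma semisymmetric_eqI:
  assumes "semisymmetric n p" "semisymmetric n q" "\<And>\<nu>. \<nu> \<in> Lam n \<Longrightarrow> eval_pol p (rho_plus n r \<nu>) = eval_pol q (rho_plus n r \<nu>)"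
  shows "p = q"
  using semisymmetric_zeroI[OF semisymmetric_diff[OF assms(1,2)]] assms(3) by (simp add: eval_pol_diff)

text \<open>Two candidates differ by a polynomial of degree at most \<open>odd_size n \<mu>\<close>
  that vanishes at all points up to this size except possibly rho + mu, hence by a multiple of
  \<open>rep \<mu>\<close>. The normalization at z^[mu] makes the multiple 0.\<close>

lemma R_pol_eq_rep:
  assumes \<mu>: "\<mu> \<in> Lam n"
  shows "R_pol n r \<mu> = rep \<mu>"
  unfolding R_pol_def
proof (rule the_equality)
  note rep = rep_props(1,2)[OF \<mu>]
  show R: "is_R n r \<mu> (rep \<mu>)"
    unfolding is_R_def using rep leads_total_degree[OF rep(2)] odd_size_nonneg[OF \<mu>] eval_rep_vanish[OF \<mu>]
    by (auto simp: leads_def)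
  fix p assume p: "is_R n r \<mu> p"
  let ?q = "p - rep \<mu>" and ?D = "odd_size n \<mu>"
  have q: "semisymmetric n ?q" using p rep(1) by (intro semisymmetric_diff) (auto simp: is_R_def)
  have "deg_le (nat ?D) p" "deg_le (nat ?D) (rep \<mu>)"
    using p R odd_size_nonneg[OF \<mu>] unfolding is_R_def total_degree_le_iff[symmetric] by auto
  then have "deg_le (nat ?D) ?q"
    using deg_le_add[of "nat ?D" p "- rep \<mu>"] deg_le_const_mult[of "nat ?D" "rep \<mu>" "- 1"] by (simp flip: uminus_const)
  then have "int (total_degree ?q) \<le> ?D" using odd_size_nonneg[OF \<mu>] unfolding total_degree_le_iff[symmetric] by simp
  then obtain c where c: "?q = (\<Sum>\<nu> | \<nu> \<in> Lam n \<and> odd_size n \<nu> \<le> ?D. const_pol (c \<nu>) * rep \<nu>)"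
    by (rule span_semisymmetric[OF q])
  have z: "c \<nu> = 0" if "\<nu> \<in> Lam n" "odd_size n \<nu> \<le> ?D" "\<nu> \<noteq> \<mu>" for \<nu>
    by (rule coefficients_vanish[OF c, of "{\<mu>}"]) (use p R that in \<open>auto simp: is_R_def eval_pol_diff\<close>)
  have "?q = (\<Sum>\<nu>\<in>{\<mu>}. const_pol (c \<nu>) * rep \<nu>)"
    unfolding c by (rule sum.mono_neutral_right[OF finite_Lam_bounded]) (use \<mu> z in \<open>auto simp: const_pol_simps\<close>)
  then have e: "?q = const_pol (c \<mu>) * rep \<mu>" by simp
  have "0 = Poly_Mapping.lookup ?q (bracket_exponent n \<mu>)"
    using p R by (simp add: is_R_def lookup_minus)
  also have "\<dots> = c \<mu>" unfolding e lookup_const_mult using R by (simp add: is_R_def)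
  finally show "p = rep \<mu>" using e by (simp add: const_pol_simps)
qed

text \<open>At the zero tuple the recursion has the single nonzero term of {1..m}, so it expresses
  the value of \<chi> at the column through \<open>col\<close>.\<close>

lemma R_pol_one_col:
  assumes m: "m \<le> n"
  shows "R_pol n r (one_col m) = col n r m"
  unfolding R_pol_eq_rep[OF one_col_Lam[OF m]]
proof (rule semisymmetric_eqI[OF rep_props(1)[OF one_col_Lam[OF m]] semisymmetric_col])
  fix \<nu> assume \<nu>: "\<nu> \<in> Lam n"
  let ?t = "\<lambda>I. col_coeff n r m I (rho_plus n r (\<lambda>_. 0)) * psi_even n I (\<lambda>_. 0) r * \<chi> \<nu> (add_indicator (\<lambda>_. 0) I)"
  have "eval_pol (col n r m) (rho_plus n r \<nu>) * \<chi> \<nu> (\<lambda>_. 0) = (\<Sum>I\<in>pieri_sets n (odd m) (\<lambda>_. 0). ?t I)"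
    by (rule pieri_recursion[OF \<nu> zero_Lam, symmetric])
  also have "\<dots> = (\<Sum>I\<in>{{1..m}}. ?t I)"
  proof (rule sum.mono_neutral_right)
    show "{{1..m}} \<subseteq> pieri_sets n (odd m) (\<lambda>_. 0)"
      using initial_family[OF m] one_col_Lam[OF m] by (simp add: pieri_sets_def one_col_eq)
    show "\<forall>I\<in>pieri_sets n (odd m) (\<lambda>_. 0) - {{1..m}}. ?t I = 0"
      by (intro ballI) (simp add: col_coeff_zero_tuple[OF m, simplified])
  qed simp
  also have "\<dots> = ?t {1..m}" by simp
  also have "\<dots> = \<chi> \<nu> (one_col m)" unfolding col_coeff_initial[OF m] psi_even_initial one_col_eq by simp
  also have "\<dots> = eval_pol (rep (one_col m)) (rho_plus n r \<nu>) * \<chi> \<nu> (\<lambda>_. 0)"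
    by (rule rep_props(3)[OF one_col_Lam[OF m] \<nu>])
  finally show "eval_pol (rep (one_col m)) (rho_plus n r \<nu>) = eval_pol (col n r m) (rho_plus n r \<nu>)"
    using \<chi>_zero_tuple[OF \<nu>] by simp
qed

text \<open>Divided by the nonzero value of \<chi> at the zero tuple, the recursion at \<mu> is the
  claimed identity evaluated at rho + nu.\<close>

lemma pieri_formula:
  assumes m: "m \<le> n" and \<mu>: "\<mu> \<in> Lam n"
  shows "R_pol n r (one_col m) * R_pol n r \<mu> = (\<Sum>I\<in>pieri_sets n (odd m) \<mu>.
    const_pol (col_coeff n r m I (rho_plus n r \<mu>) * psi_even n I \<mu> r) * R_pol n r (add_indicator \<mu> I))"
proof -
  let ?c = "\<lambda>I. col_coeff n r m I (rho_plus n r \<mu>) * psi_even n I \<mu> r"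
  have L: "add_indicator \<mu> I \<in> Lam n" if "I \<in> pieri_sets n (odd m) \<mu>" for I using that by (simp add: pieri_sets_def)
  have "col n r m * rep \<mu> = (\<Sum>I\<in>pieri_sets n (odd m) \<mu>. const_pol (?c I) * rep (add_indicator \<mu> I))"
  proof (rule semisymmetric_eqI)
    show "semisymmetric n (col n r m * rep \<mu>)" by (intro semisymmetric_simps semisymmetric_col rep_props(1)[OF \<mu>])
    show "semisymmetric n (\<Sum>I\<in>pieri_sets n (odd m) \<mu>. const_pol (?c I) * rep (add_indicator \<mu> I))"
      by (intro semisymmetric_sum semisymmetric_simps rep_props(1) L)
    fix \<nu> assume \<nu>: "\<nu> \<in> Lam n"
    have "(eval_pol (col n r m * rep \<mu>) (rho_plus n r \<nu>)) * \<chi> \<nu> (\<lambda>_. 0) = eval_pol (col n r m) (rho_plus n r \<nu>) * \<chi> \<nu> \<mu>"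
      unfolding rep_props(3)[OF \<mu> \<nu>] eval_pol_simps by (rule mult.assoc)
    also have "\<dots> = (\<Sum>I\<in>pieri_sets n (odd m) \<mu>. ?c I * \<chi> \<nu> (add_indicator \<mu> I))"
      by (rule pieri_recursion[OF \<nu> \<mu>, symmetric])
    also have "\<dots> = (\<Sum>I\<in>pieri_sets n (odd m) \<mu>. ?c I * eval_pol (rep (add_indicator \<mu> I)) (rho_plus n r \<nu>)) * \<chi> \<nu> (\<lambda>_. 0)"
      unfolding sum_distrib_right by (rule sum.cong[OF refl]) (simp add: rep_props(3)[OF L \<nu>])
    finally show "eval_pol (col n r m * rep \<mu>) (rho_plus n r \<nu>) =
      eval_pol (\<Sum>I\<in>pieri_sets n (odd m) \<mu>. const_pol (?c I) * rep (add_indicator \<mu> I)) (rho_plus n r \<nu>)"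
      using \<chi>_zero_tuple[OF \<nu>] unfolding eval_pol_simps by simp
  qed
  then show ?thesis
    unfolding R_pol_one_col[OF m] R_pol_eq_rep[OF \<mu>] by (simp add: R_pol_eq_rep[OF L])
qed

end

section \<open>Assembling the Pieri formula\<close>

lemma ex_eigenfunctionals:
  fixes r :: "'a::field_char_0"
  assumes r: "\<not> (\<exists>q::rat. q < 0 \<and> r = of_rat q)"
  obtains \<chi> where "eigenfunctionals n r \<chi>"
proof -
  have "\<forall>\<nu>. \<exists>g. \<nu> \<in> Lam n \<longrightarrow> g \<nu> = 1 \<and> (\<forall>\<mu>. \<mu> \<in> Lam n \<longrightarrow> odd_size n \<nu> \<le> odd_size n \<mu> \<longrightarrow> \<mu> \<noteq> \<nu> \<longrightarrow> g \<mu> = 0) \<and>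
      (\<forall>\<mu> A u. \<mu> \<in> Lam n \<longrightarrow> pieri_op n r A u g \<mu> = poly (class_poly n r A \<nu>) u * g \<mu>)"
  proof
    fix \<nu>
    show "\<exists>g. \<nu> \<in> Lam n \<longrightarrow> g \<nu> = 1 \<and> (\<forall>\<mu>. \<mu> \<in> Lam n \<longrightarrow> odd_size n \<nu> \<le> odd_size n \<mu> \<longrightarrow> \<mu> \<noteq> \<nu> \<longrightarrow> g \<mu> = 0) \<and>
      (\<forall>\<mu> A u. \<mu> \<in> Lam n \<longrightarrow> pieri_op n r A u g \<mu> = poly (class_poly n r A \<nu>) u * g \<mu>)"
    proof (cases "\<nu> \<in> Lam n")
      case True
      then obtain g where "g \<nu> = 1" "\<And>\<mu>. \<mu> \<in> Lam n \<Longrightarrow> odd_size n \<nu> \<le> odd_size n \<mu> \<Longrightarrow> \<mu> \<noteq> \<nu> \<Longrightarrow> g \<mu> = 0"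
        "\<And>\<mu> A u. \<mu> \<in> Lam n \<Longrightarrow> pieri_op n r A u g \<mu> = poly (class_poly n r A \<nu>) u * g \<mu>"
        using ex_eigenfunctional[OF r True] by metis
      then show ?thesis by blast
    qed simp
  qed
  from choice[OF this] obtain \<chi> where "\<forall>\<nu>. \<nu> \<in> Lam n \<longrightarrow> \<chi> \<nu> \<nu> = 1 \<and>
      (\<forall>\<mu>. \<mu> \<in> Lam n \<longrightarrow> odd_size n \<nu> \<le> odd_size n \<mu> \<longrightarrow> \<mu> \<noteq> \<nu> \<longrightarrow> \<chi> \<nu> \<mu> = 0) \<and>
      (\<forall>\<mu> A u. \<mu> \<in> Lam n \<longrightarrow> pieri_op n r A u (\<chi> \<nu>) \<mu> = poly (class_poly n r A \<nu>) u * \<chi> \<nu> \<mu>)" by blast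
  then have "eigenfunctionals n r \<chi>" unfolding eigenfunctionals_def by blast
  then show ?thesis by (rule that)
qed

theorem theorem9p3:
  fixes r :: "'a::field_char_0" and n m :: nat and \<mu> :: "nat \<Rightarrow> int"
  assumes r: "\<not> (\<exists>q::rat. q < 0 \<and> r = of_rat q)"
    and n: "1 \<le> n" and m: "m \<le> n" and mu: "\<mu> \<in> Lam n"
  shows "R_pol n r (one_col m) * R_pol n r \<mu> =
    (\<Sum>s=0..m. \<Sum>I | I \<in> (if odd m then P_odd n else P_even n) \<and> card I = s
                      \<and> add_indicator \<mu> I \<in> Lam n.
        const_pol (eval_compl n I (R_pol (n - s) r (one_col (m - s))) (rho_plus n r \<mu>) *
                   psi_even n I \<mu> r) *
        R_pol n r (add_indicator \<mu> I))"
proof -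
  let ?S = "{I \<in> pieri_sets n (odd m) \<mu>. card I \<le> m}"
  let ?t = "\<lambda>s I. const_pol (eval_compl n I (R_pol (n - s) r (one_col (m - s))) (rho_plus n r \<mu>) * psi_even n I \<mu> r) *
    R_pol n r (add_indicator \<mu> I)"
  let ?u = "\<lambda>I. const_pol (col_coeff n r m I (rho_plus n r \<mu>) * psi_even n I \<mu> r) * R_pol n r (add_indicator \<mu> I)"
  obtain \<chi> where "eigenfunctionals n r \<chi>" by (rule ex_eigenfunctionals[OF r])
  then interpret eigenfunctionals n r \<chi> .
  have "R_pol n r (one_col m) * R_pol n r \<mu> = (\<Sum>I\<in>pieri_sets n (odd m) \<mu>. ?u I)" by (rule pieri_formula[OF m mu])
  also have "\<dots> = (\<Sum>I\<in>?S. ?u I)"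
    by (rule sum.mono_neutral_right) (auto simp: pieri_sets_def col_coeff_large[OF _ m] const_pol_simps not_le)
  also have "\<dots> = (\<Sum>I\<in>?S. ?t (card I) I)"
  proof (rule sum.cong[OF refl])
    fix I assume I: "I \<in> ?S"
    \<comment> \<open>A second system of eigenfunctionals, in n - |I| variables, identifies the
      smaller column polynomial. The number of variables may be 0 here.\<close>
    obtain \<chi>' where "eigenfunctionals (n - card I) r \<chi>'" by (rule ex_eigenfunctionals[OF r])
    then have "R_pol (n - card I) r (one_col (m - card I)) = col (n - card I) r (m - card I)"
      using m by (intro eigenfunctionals.R_pol_one_col) auto
    moreover have "eval_compl n I (col (n - card I) r (m - card I)) (rho_plus n r \<mu>) = col_coeff n r m I (rho_plus n r \<mu>)"
      using I by (intro eval_compl_col m) (auto simp: pieri_sets_def)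
    ultimately show "?u I = ?t (card I) I" by simp
  qed
  also have "\<dots> = (\<Sum>s\<in>{0..m}. \<Sum>I | I \<in> ?S \<and> card I = s. ?t (card I) I)"
    by (rule sum.group[symmetric]) auto
  also have "\<dots> = (\<Sum>s=0..m. \<Sum>I | I \<in> (if odd m then P_odd n else P_even n) \<and> card I = s \<and> add_indicator \<mu> I \<in> Lam n. ?t s I)"
  proof (rule sum.cong[OF refl], rule sum.cong)
    fix s assume s: "s \<in> {0..m}"
    show "{I. I \<in> ?S \<and> card I = s} = {I. I \<in> (if odd m then P_odd n else P_even n) \<and> card I = s \<and> add_indicator \<mu> I \<in> Lam n}"
      unfolding family_eq[symmetric] pieri_sets_def using s by (intro Collect_cong) auto
    fix I assume "I \<in> {I. I \<in> (if odd m then P_odd n else P_even n) \<and> card I = s \<and> add_indicator \<mu> I \<in> Lam n}"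
    then show "?t (card I) I = ?t s I" by simp
  qed
  finally show ?thesis .
qed

end
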